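(* Let $\alpha:\mathbb{R}\to\mathbb{R}$ be a non-negative continuous function such that $\alpha(t)=0$ for $t\le0$. Suppose that $\mu_\hbar\to\mu>0$ as $\hbar\to0$, and that a family of real-valued functions $V_\hbar$ on $\mathbb{R}^3$, $\hbar\in(0,1]$, satisfies $$\sup_{\hbar\in(0,1]}\|V_\hbar\|_{C^{0,\frac15}(\mathbb{R}^3)}<\infty.$$ Then $$\lim_{\hbar\to0}\Big\|\mathrm{Op}^T_\hbar\Big[\alpha\big(-\mu_\hbar-(\tfrac{|p|^2}{2}+V_\hbar(q))\big)\Big]-\alpha\big(-\mu_\hbar-(-\tfrac{\hbar^2}{2}\Delta+V_\hbar)\big)\Big\|=0,$$ where $\|\cdot\|$ is the operator norm on $L^2(\mathbb{R}^3)$.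
   Context: The T\"oplitz quantization of a function $f$ on $\mathbb{R}^6=\mathbb{R}^3_q\times\mathbb{R}^3_p$ is the operator on $L^2(\mathbb{R}^3)$ given by $\mathrm{Op}^T_\hbar[f]=\frac{1}{(2\pi\hbar)^3}\int_{\mathbb{R}^6}|\varphi^\hbar_{(q,p)}\rangle\langle\varphi^\hbar_{(q,p)}|f(q,p)\,dq\,dp$ with $\varphi^\hbar_{(q,p)}(x)=\frac{1}{(\pi\hbar)^{3/4}}e^{-\frac{|x-q|^2}{2\hbar}}e^{\frac{ip\cdot x}{\hbar}}$. The operator $\alpha(-\mu_\hbar-(-\frac{\hbar^2}{2}\Delta+V_\hbar))$ is defined by the functional calculus. The $C^{0,\frac15}(\mathbb{R}^3)$ norm is the sup norm plus the H\"older seminorm of exponent $\frac15$. *)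

theory Defs
  imports "HOL-Analysis.Analysis"
begin

section \<open>The Hilbert space $L^2(\mathbb{R}^3)$\<close>

definition square_integrable :: "(real^3 \<Rightarrow> complex) \<Rightarrow> bool" where
  "square_integrable f \<longleftrightarrow>
     f \<in> borel_measurable lborel \<and> integrable lborel (\<lambda>x. (norm (f x))\<^sup>2)"

lemma square_integrable_zero: "square_integrable (\<lambda>x. 0)"
  by (simp add: square_integrable_def)

lemma square_integrable_add:
  assumes "square_integrable f" "square_integrable g"
  shows "square_integrable (\<lambda>x. f x + g x)"
proof -
  have m [measurable]: "f \<in> borel_measurable lborel" "g \<in> borel_measurable lborel"
    using assms by (auto simp: square_integrable_def)
  have *: "(norm (f x + g x))\<^sup>2 \<le> 2 * (norm (f x))\<^sup>2 + 2 * (norm (g x))\<^sup>2" for x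
  proof -
    have "(norm (f x + g x))\<^sup>2 \<le> (norm (f x) + norm (g x))\<^sup>2"
      by (intro power_mono norm_triangle_ineq) auto
    also have "\<dots> \<le> 2 * (norm (f x))\<^sup>2 + 2 * (norm (g x))\<^sup>2"
      using zero_le_power2 [of "norm (f x) - norm (g x)"] by (simp add: power2_eq_square algebra_simps)
    finally show ?thesis .
  qed
  have "integrable lborel (\<lambda>x. (norm (f x + g x))\<^sup>2)"
    by (rule Bochner_Integration.integrable_bound
          [where f = "\<lambda>x. 2 * (norm (f x))\<^sup>2 + 2 * (norm (g x))\<^sup>2"])
       (use assms * in \<open>auto simp: square_integrable_def\<close>)
  then show ?thesis by (simp add: square_integrable_def)
qed

lemma square_integrable_scale:
  assumes "square_integrable f"
  shows "square_integrable (\<lambda>x. c * f x)"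
  using assms by (auto simp: square_integrable_def norm_mult power_mult_distrib)

lemma square_integrable_mult_integrable:
  assumes "square_integrable f" "square_integrable g"
  shows "integrable lborel (\<lambda>x. cnj (f x) * g x)"
proof -
  have m [measurable]: "f \<in> borel_measurable lborel" "g \<in> borel_measurable lborel"
    using assms by (auto simp: square_integrable_def)
  have mc [measurable]: "(\<lambda>x. cnj (f x)) \<in> borel_measurable lborel"
    by (rule borel_measurable_continuous_on [OF _ m(1)]) (intro continuous_intros)
  have bound: "norm (cnj (f x) * g x) \<le> norm ((norm (f x))\<^sup>2 + (norm (g x))\<^sup>2)" for x
  proof -
    have "2 * (norm (f x) * norm (g x)) \<le> (norm (f x))\<^sup>2 + (norm (g x))\<^sup>2"
      using zero_le_power2 [of "norm (f x) - norm (g x)"] by (simp add: power2_diff)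
    moreover have "0 \<le> norm (f x) * norm (g x)" by simp
    ultimately have "norm (f x) * norm (g x) \<le> (norm (f x))\<^sup>2 + (norm (g x))\<^sup>2" by linarith
    then show ?thesis by (simp add: norm_mult)
  qed
  have "integrable lborel (\<lambda>x. (norm (f x))\<^sup>2 + (norm (g x))\<^sup>2)"
    using assms by (intro Bochner_Integration.integrable_add) (simp_all add: square_integrable_def)
  moreover have "(\<lambda>x. cnj (f x) * g x) \<in> borel_measurable lborel"
    by (intro borel_measurable_times mc m)
  ultimately show ?thesis
    by (rule Bochner_Integration.integrable_bound) (intro AE_I2 bound)
qed

quotient_type L2 = "real^3 \<Rightarrow> complex" / partial:
  "\<lambda>f g. square_integrable f \<and> square_integrable g \<and> (AE x in lborel. f x = g x)"
proof (rule part_equivpI)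
  show "\<exists>f. square_integrable f \<and> square_integrable f \<and> (AE x in lborel. f x = f x)"
    using square_integrable_zero by blast
  show "symp (\<lambda>f g. square_integrable f \<and> square_integrable g \<and> (AE x in lborel. f x = g x))"
    by (rule sympI) (auto elim: eventually_mono)
  show "transp (\<lambda>f g. square_integrable f \<and> square_integrable g \<and> (AE x in lborel. f x = g x))"
    by (rule transpI) (auto elim: eventually_mono)
qed

lift_definition scaleC :: "complex \<Rightarrow> L2 \<Rightarrow> L2" is "\<lambda>c f x. c * f x"
  by (auto intro: square_integrable_scale elim: eventually_mono)

lift_definition cinner :: "L2 \<Rightarrow> L2 \<Rightarrow> complex" is
  "\<lambda>f g. \<integral>x. cnj (f x) * g x \<partial>lborel"
proof -
  fix f f' g g' :: "real^3 \<Rightarrow> complex"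
  assume 1: "square_integrable f \<and> square_integrable f' \<and> (AE x in lborel. f x = f' x)"
    and 2: "square_integrable g \<and> square_integrable g' \<and> (AE x in lborel. g x = g' x)"
  show "(\<integral>x. cnj (f x) * g x \<partial>lborel) = (\<integral>x. cnj (f' x) * g' x \<partial>lborel)"
  proof (rule integral_cong_AE)
    show "AE x in lborel. cnj (f x) * g x = cnj (f' x) * g' x"
      using conjunct2 [OF conjunct2 [OF 1]] conjunct2 [OF conjunct2 [OF 2]]
      by eventually_elim simp
  qed (use 1 2 in \<open>blast intro: borel_measurable_integrable square_integrable_mult_integrable\<close>)+
qed

instantiation L2 :: real_vector
begin

lift_definition zero_L2 :: L2 is "\<lambda>x. 0"
  by (simp add: square_integrable_zero)

lift_definition plus_L2 :: "L2 \<Rightarrow> L2 \<Rightarrow> L2" is "\<lambda>f g x. f x + g x"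
  by (auto intro: square_integrable_add)

lift_definition uminus_L2 :: "L2 \<Rightarrow> L2" is "\<lambda>f x. - f x"
  by (auto simp: square_integrable_def)

definition minus_L2 :: "L2 \<Rightarrow> L2 \<Rightarrow> L2" where
  "minus_L2 u v = u + - v"

lift_definition scaleR_L2 :: "real \<Rightarrow> L2 \<Rightarrow> L2" is "\<lambda>r f x. of_real r * f x"
  by (auto intro: square_integrable_scale elim: eventually_mono)

instance
proof
  fix a b c :: L2 and r s :: real
  show "a + b + c = a + (b + c)"
    by transfer (auto intro!: square_integrable_add simp: add.assoc)
  show "a + b = b + a"
    by transfer (auto intro!: square_integrable_add simp: add.commute)
  show "0 + a = a" by transfer auto
  show "- a + a = 0" by transfer (auto simp: square_integrable_zero)
  show "a - b = a + - b" by (rule minus_L2_def)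
  show "r *\<^sub>R (a + b) = r *\<^sub>R a + r *\<^sub>R b"
    by transfer (auto intro!: square_integrable_add square_integrable_scale simp: distrib_left)
  show "(r + s) *\<^sub>R a = r *\<^sub>R a + s *\<^sub>R a"
    by transfer (auto intro!: square_integrable_add square_integrable_scale simp: distrib_right)
  show "r *\<^sub>R s *\<^sub>R a = (r * s) *\<^sub>R a"
    by transfer (auto intro!: square_integrable_scale simp: mult.assoc)
  show "1 *\<^sub>R a = a" by transfer auto
qed

end

lemma cinner_commute: "cinner u v = cnj (cinner v u)"
  by transfer (simp flip: Bochner_Integration.integral_cnj add: mult.commute)

lemma cinner_add_left: "cinner (u + v) w = cinner u w + cinner v w"
  by transfer (simp add: distrib_right square_integrable_mult_integrable)

lemma cinner_scaleR_left: "cinner (r *\<^sub>R u) w = of_real r * cinner u w"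
  by transfer (simp add: mult.assoc)

lemma integral_self:
  "(\<integral>x. cnj (f x) * f x \<partial>lborel) = of_real (\<integral>x. (norm (f x))\<^sup>2 \<partial>lborel)"
proof -
  have "cnj (f x) * f x = of_real ((norm (f x))\<^sup>2)" for x
    by (simp only: complex_norm_square mult.commute)
  then show ?thesis by (simp only: integral_complex_of_real)
qed

lemma cinner_self_nonneg: "0 \<le> Re (cinner u u)"
  by transfer (simp add: integral_self del: of_real_power)

lemma integral_self_eq_0:
  assumes sq: "square_integrable f"
  shows "Re (\<integral>x. cnj (f x) * f x \<partial>lborel) = 0 \<longleftrightarrow> (AE x in lborel. f x = 0)"
proof -
  have "(\<integral>x. (norm (f x))\<^sup>2 \<partial>lborel) = 0 \<longleftrightarrow> (AE x in lborel. (norm (f x))\<^sup>2 = 0)"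
    using sq by (intro integral_nonneg_eq_0_iff_AE) (auto simp: square_integrable_def)
  then show ?thesis by (simp add: integral_self)
qed

lemma cinner_self_eq_0: "Re (cinner u u) = 0 \<longleftrightarrow> u = 0"
  by transfer (auto simp: integral_self_eq_0 square_integrable_zero)

instantiation L2 :: real_inner
begin

definition inner_L2 :: "L2 \<Rightarrow> L2 \<Rightarrow> real" where
  "inner_L2 u v = Re (cinner u v)"

definition norm_L2 :: "L2 \<Rightarrow> real" where
  "norm_L2 u = sqrt (Re (cinner u u))"

definition sgn_L2 :: "L2 \<Rightarrow> L2" where
  "sgn_L2 u = inverse (norm u) *\<^sub>R u"

definition dist_L2 :: "L2 \<Rightarrow> L2 \<Rightarrow> real" where
  "dist_L2 u v = norm (u - v)"

definition uniformity_L2 :: "(L2 \<times> L2) filter" where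
  "uniformity_L2 = (INF e\<in>{0 <..}. principal {(x, y). dist x y < e})"

definition open_L2 :: "L2 set \<Rightarrow> bool" where
  "open_L2 S = (\<forall>x\<in>S. \<forall>\<^sub>F (x', y) in uniformity. x' = x \<longrightarrow> y \<in> S)"

instance
proof
  fix u v w :: L2 and r :: real
  show "inner u v = inner v u"
    by (subst (2) inner_L2_def, subst cinner_commute) (simp add: inner_L2_def)
  show "inner (u + v) w = inner u w + inner v w"
    by (simp add: inner_L2_def cinner_add_left)
  show "inner (r *\<^sub>R u) v = r * inner u v"
    by (simp add: inner_L2_def cinner_scaleR_left)
  show "0 \<le> inner u u"
    using cinner_self_nonneg by (simp add: inner_L2_def)
  show "inner u u = 0 \<longleftrightarrow> u = 0"
    by (simp add: inner_L2_def cinner_self_eq_0)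
  show "norm u = sqrt (inner u u)"
    by (simp add: inner_L2_def norm_L2_def)
qed (simp_all add: sgn_L2_def dist_L2_def uniformity_L2_def open_L2_def)

end


section \<open>The Schroedinger operator\<close>

definition partial_deriv :: "3 \<Rightarrow> (real^3 \<Rightarrow> real) \<Rightarrow> real^3 \<Rightarrow> real" where
  "partial_deriv i f x = frechet_derivative f (at x) (axis i 1)"

definition laplacian :: "(real^3 \<Rightarrow> real) \<Rightarrow> real^3 \<Rightarrow> real" where
  "laplacian f x = (\<Sum>i\<in>UNIV. partial_deriv i (partial_deriv i f) x)"

text \<open>Smoothness: the iterated partial derivatives of all orders are differentiable (hence
  continuous).  Real-valued test functions suffice for testing complex distributions.\<close>

definition test_function :: "(real^3 \<Rightarrow> real) \<Rightarrow> bool" where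
  "test_function \<phi> \<longleftrightarrow>
     (\<forall>is. foldr partial_deriv is \<phi> differentiable_on UNIV) \<and>
     (\<exists>K. compact K \<and> (\<forall>x. x \<notin> K \<longrightarrow> \<phi> x = 0))"

definition has_weak_laplacian :: "L2 \<Rightarrow> L2 \<Rightarrow> bool" where
  "has_weak_laplacian u l \<longleftrightarrow>
     (\<forall>\<phi>. test_function \<phi> \<longrightarrow>
        (\<integral>x. of_real (laplacian \<phi> x) * rep_L2 u x \<partial>lborel) =
        (\<integral>x. of_real (\<phi> x) * rep_L2 l x \<partial>lborel))"

text \<open>Unbounded operators are represented by their graphs.  For bounded \<open>V\<close> the domain below is
  the set of \<open>u\<close> in $L^2$ whose distributional Laplacian is in $L^2$, that is, $H^2(\mathbb{R}^3)$;
  this is the usual self-adjoint realisation of $-\frac{\hbar^2}{2}\Delta + V$.\<close>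

definition schroedinger :: "real \<Rightarrow> (real^3 \<Rightarrow> real) \<Rightarrow> (L2 \<times> L2) set" where
  "schroedinger h V = {(u, v). \<exists>l. has_weak_laplacian u l \<and>
     (AE x in lborel. rep_L2 v x = - of_real (h\<^sup>2 / 2) * rep_L2 l x + of_real (V x) * rep_L2 u x)}"


section \<open>Functional calculus\<close>

text \<open>An everywhere defined map that is idempotent and symmetric is automatically
  complex-linear, so no linearity clause is needed.\<close>

definition orthogonal_projection :: "(L2 \<Rightarrow> L2) \<Rightarrow> bool" where
  "orthogonal_projection P \<longleftrightarrow>
     (\<forall>u. P (P u) = P u) \<and> (\<forall>u v. cinner (P u) v = cinner u (P v))"

definition resolution_of_identity :: "(real \<Rightarrow> L2 \<Rightarrow> L2) \<Rightarrow> bool" where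
  "resolution_of_identity E \<longleftrightarrow>
     (\<forall>t. orthogonal_projection (E t)) \<and>
     (\<forall>s t u. s \<le> t \<longrightarrow> E s (E t u) = E s u) \<and>
     (\<forall>t u. ((\<lambda>s. E s u) \<longlongrightarrow> E t u) (at_right t)) \<and>
     (\<forall>u. ((\<lambda>t. E t u) \<longlongrightarrow> 0) at_bot) \<and>
     (\<forall>u. ((\<lambda>t. E t u) \<longlongrightarrow> u) at_top)"

definition spectral_measure :: "(real \<Rightarrow> L2 \<Rightarrow> L2) \<Rightarrow> L2 \<Rightarrow> real measure" where
  "spectral_measure E u = interval_measure (\<lambda>t. (norm (E t u))\<^sup>2)"

definition spectral_domain :: "(real \<Rightarrow> L2 \<Rightarrow> L2) \<Rightarrow> (real \<Rightarrow> real) \<Rightarrow> L2 set" where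
  "spectral_domain E g = {u. integrable (spectral_measure E u) (\<lambda>t. (g t)\<^sup>2)}"

text \<open>The graph of $\int g\,dE$.  The complex measure $d\langle w, E_t u\rangle$ is expressed
  through the positive measures $d\|E_t(u + i^k w)\|^2$ by polarisation; \<open>cinner\<close> is antilinear in
  its first argument.  Since the domain is dense, testing against \<open>w\<close> in the domain determines
  \<open>v\<close>.\<close>

definition spectral_integral :: "(real \<Rightarrow> L2 \<Rightarrow> L2) \<Rightarrow> (real \<Rightarrow> real) \<Rightarrow> (L2 \<times> L2) set" where
  "spectral_integral E g = {(u, v). u \<in> spectral_domain E g \<and>
     (\<forall>w\<in>spectral_domain E g. cinner w v =
        (1 / 4) * (\<Sum>k<4. \<i> ^ k *
           of_real (\<integral>t. g t \<partial>spectral_measure E (u + scaleC (\<i> ^ k) w))))}"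

text \<open>The resolution of the identity of a self-adjoint operator exists and is unique by the
  spectral theorem, so that the choice below is canonical.\<close>

definition functional_calculus :: "(real \<Rightarrow> real) \<Rightarrow> (L2 \<times> L2) set \<Rightarrow> (L2 \<times> L2) set" where
  "functional_calculus g A =
     spectral_integral (SOME E. resolution_of_identity E \<and> spectral_integral E (\<lambda>t. t) = A) g"

definition op_apply :: "(L2 \<times> L2) set \<Rightarrow> L2 \<Rightarrow> L2" where
  "op_apply A u = (THE v. (u, v) \<in> A)"


section \<open>Toeplitz quantization\<close>

definition coherent_state :: "real \<Rightarrow> real^3 \<Rightarrow> real^3 \<Rightarrow> real^3 \<Rightarrow> complex" where
  "coherent_state h q p x =
     of_real ((pi * h) powr (- 3 / 4) * exp (- (norm (x - q))\<^sup>2 / (2 * h)))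
       * exp (\<i> * of_real (p \<bullet> x / h))"

text \<open>The operator-valued integral is understood weakly.\<close>

definition toeplitz :: "real \<Rightarrow> ((real^3) \<times> (real^3) \<Rightarrow> real) \<Rightarrow> L2 \<Rightarrow> L2" where
  "toeplitz h f u = (THE v. \<forall>w.
     (let F = (\<lambda>(q, p). of_real (f (q, p))
                 * cinner w (abs_L2 (coherent_state h q p))
                 * cinner (abs_L2 (coherent_state h q p)) u)
      in integrable lborel F \<and>
         cinner w v = of_real (1 / (2 * pi * h) ^ 3) * (\<integral>z. F z \<partial>lborel)))"


section \<open>Hoelder norms\<close>

definition hoelder_norm :: "real \<Rightarrow> (real^3 \<Rightarrow> real) \<Rightarrow> ennreal" where
  "hoelder_norm \<gamma> V = (SUP x. ennreal \<bar>V x\<bar>) +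
     (SUP (x, y)\<in>{(x, y). x \<noteq> y}. ennreal (\<bar>V x - V y\<bar> / dist x y powr \<gamma>))"

end

theory Submission imports Defs "HOL-Probability.Probability" begin

text \<open>Both operators are symmetric, so it suffices to compare their quadratic forms. In the coherent
  state representation the equation \<open>(\<lambda> + H) u = y\<close>, where \<open>H\<close> is the Schroedinger operator, becomes
  multiplication of the transform of \<open>u\<close> by \<open>\<lambda> + |p|\<^sup>2 / 2 + V q\<close>, up to Gaussian moments of order
  \<open>h\<^sup>1\<^sup>/\<^sup>2\<close> and the oscillation of \<open>V\<close> at distance \<open>h\<^sup>1\<^sup>/\<^sup>2\<close>, which is of order \<open>h\<^sup>1\<^sup>/\<^sup>1\<^sup>0\<close> by Hoelder
  continuity. After division by this symbol, which dominates \<open>|p|\<close>, the claim follows for the functions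
  \<open>1 / (c - t)\<close> with all large \<open>c\<close>. Both forms are linear in \<open>\<alpha>\<close> and are controlled by its supremum on
  a half-line \<open>{..s}\<close>, independent of \<open>h\<close>, which contains the symbol and the spectrum; there, by the
  resolvent identity and Bernstein's theorem, these functions span a dense set.

  The spectral resolution of the operator is constructed from its resolvent \<open>R = (c - B)\<^sup>-\<^sup>1\<close>: \<open>E t\<close> projects
  onto the vectors whose iterates \<open>R\<^sup>n u\<close> grow at most like \<open>(c - t)\<^sup>-\<^sup>n\<close>. Self-adjointness reduces to the
  nonpositivity of the weak Laplacian, which is read off coherent states of large width.\<close>

section \<open>Hilbert spaces\<close>

text \<open>\<open>functional_calculus\<close> picks its spectral family by \<open>SOME\<close>. So
  a resolution of the identity with the prescribed graph has to be exhibited before anything can be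
  said about \<alpha> of the operator, and afterwards the chosen family is known only through the
  graph of its integral of \<open>t\<close>. Upper bounds of the spectrum and the form of the
  resolvent are therefore read off that graph. Spectral integrals are defined by polarisation, so
  each such step is a linear relation between finitely many finite measures, checked on the
  half-lines \<open>{..t}\<close>. On the Toeplitz side everything rests on the coherent transform
  being a multiple of an isometry. A Gaussian damping of the Fourier transform gives an inequality
  for every vector and equality for indicators of boxes, and a density argument does the rest.
  Errors are measured against the weight \<open>1 + (norm (x - q))\<^sup>2 / h\<close>, whose moment
  against the Gaussian window does not depend on \<open>h\<close>. The exponent
  \<open>1 / 10\<close> is the product of \<open>1 / 2\<close>, from the width of the window, and
  the Hoelder exponent \<open>1 / 5\<close>.\<close>

lemma real_quadratic_min_imp_zero:
  fixes a b :: real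
  assumes "\<And>t. 0 \<le> t\<^sup>2 * a - 2 * t * b"
  shows "b = 0"
proof (cases "a \<le> 0")
  case True
  have "0 \<le> a - 2 * b" "0 \<le> a + 2 * b" using assms[of 1] assms[of "-1"] by auto
  then show ?thesis using True by linarith
next
  case False
  \<comment> \<open>\<open>b / a\<close> is the minimiser of the quadratic when
    \<open>a > 0\<close>.\<close>
  have "0 \<le> (b / a)\<^sup>2 * a - 2 * (b / a) * b" by (rule assms)
  also have "\<dots> = - (b\<^sup>2 / a)" using False by (simp add: power2_eq_square field_simps)
  finally have "b\<^sup>2 / a \<le> 0" by simp
  then show ?thesis using False by (simp add: divide_le_0_iff)
qed

text \<open>A minimising sequence for the distance to \<open>S\<close> is Cauchy by the
  parallelogram law, completeness gives a nearest point, and the first variation of the distance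
  there is the orthogonality.\<close>

lemma projection_exists:
  fixes S :: "'a :: {real_inner, complete_space} set"
  assumes S: "subspace S" "closed S"
  shows "\<exists>p\<in>S. \<forall>v\<in>S. inner (x - p) v = 0"
proof -
  define d where "d = infdist x S"
  have ne: "S \<noteq> {}" using S(1) by (auto simp: subspace_def)
  have d0: "0 \<le> d" by (simp add: d_def infdist_nonneg)
  have dle: "d \<le> norm (x - p)" if "p \<in> S" for p
    using infdist_le[OF that, of x] by (simp add: d_def dist_norm)
  have "\<exists>p\<in>S. (norm (x - p))\<^sup>2 < d\<^sup>2 + 1 / real (Suc n)" for n
  proof -
    have "d < sqrt (d\<^sup>2 + 1 / real (Suc n))"
      by (rule real_less_rsqrt) simp
    then have "(INF a\<in>S. dist x a) < sqrt (d\<^sup>2 + 1 / real (Suc n))"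
      using ne by (simp add: d_def infdist_def)
    then obtain p where p: "p \<in> S" "dist x p < sqrt (d\<^sup>2 + 1 / real (Suc n))"
      using ne by (subst (asm) cInf_less_iff) auto
    have "(norm (x - p))\<^sup>2 < (sqrt (d\<^sup>2 + 1 / real (Suc n)))\<^sup>2"
      using p(2) by (intro power_strict_mono) (auto simp: dist_norm)
    then show ?thesis using p(1) by (auto intro!: bexI[of _ p])
  qed
  then obtain p where p: "\<And>n. p n \<in> S" "\<And>n. (norm (x - p n))\<^sup>2 < d\<^sup>2 + 1 / real (Suc n)"
    by metis
  have par: "(norm (p n - p m))\<^sup>2 \<le> 2 / real (Suc n) + 2 / real (Suc m)" for n m
  proof -
    \<comment> \<open>The midpoint stays in \<open>S\<close>, so it is at distance at least
      \<open>d\<close> from \<open>x\<close>; in the parallelogram identity this leaves only the two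
      excesses \<open>1 / Suc n\<close> and \<open>1 / Suc m\<close>.\<close>
    have "(1/2) *\<^sub>R (p n + p m) \<in> S"
      using p(1) S(1) by (simp add: subspace_def)
    then have "d\<^sup>2 \<le> (norm (x - (1/2) *\<^sub>R (p n + p m)))\<^sup>2"
      using dle d0 by (intro power_mono) auto
    moreover have "(norm (p n - p m))\<^sup>2 = 2 * (norm (x - p n))\<^sup>2 + 2 * (norm (x - p m))\<^sup>2
        - 4 * (norm (x - (1/2) *\<^sub>R (p n + p m)))\<^sup>2"
      by (simp add: power2_norm_eq_inner inner_diff inner_add algebra_simps inner_commute)
    ultimately show ?thesis using p(2)[of n] p(2)[of m] by simp
  qed
  have "Cauchy p"
  proof (rule CauchyI)
    fix e :: real assume e: "0 < e"
    obtain N where N: "4 / e\<^sup>2 < real N" using reals_Archimedean2 by blast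
    show "\<exists>M. \<forall>m\<ge>M. \<forall>n\<ge>M. norm (p m - p n) < e"
    proof (intro exI allI impI)
      fix m n assume mn: "N \<le> m" "N \<le> n"
      have N0: "0 < real N" using N e by (meson divide_pos_pos less_trans zero_less_numeral zero_less_power)
      have "2 / real (Suc m) + 2 / real (Suc n) \<le> 2 / real N + 2 / real N"
        using mn N0 by (intro add_mono divide_left_mono) auto
      also have "\<dots> < e\<^sup>2" using N e N0 by (simp add: field_simps)
      finally have "(norm (p m - p n))\<^sup>2 < e\<^sup>2" using par[of m n] by linarith
      then show "norm (p m - p n) < e" using e by (simp add: power2_less_imp_less)
    qed
  qed
  then obtain q where q: "p \<longlonglongrightarrow> q" using Cauchy_convergent convergent_def by blast
  have qS: "q \<in> S" using closed_sequentially[OF S(2)] p(1) q by blast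
  have "(\<lambda>n. d\<^sup>2 + 1 / real (Suc n)) \<longlonglongrightarrow> d\<^sup>2 + 0"
    by (intro tendsto_intros LIMSEQ_inverse_real_of_nat[unfolded inverse_eq_divide])
  moreover have "(\<lambda>n. (norm (x - p n))\<^sup>2) \<longlonglongrightarrow> (norm (x - q))\<^sup>2"
    by (intro tendsto_intros q)
  ultimately have qd: "(norm (x - q))\<^sup>2 \<le> d\<^sup>2"
    using p(2) by (intro LIMSEQ_le) (auto intro: less_imp_le)
  have "inner (x - q) v = 0" if v: "v \<in> S" for v
  proof (rule real_quadratic_min_imp_zero[of "(norm v)\<^sup>2"])
    fix t :: real
    have "q + t *\<^sub>R v \<in> S" using qS v S(1) by (simp add: subspace_def)
    then have "d\<^sup>2 \<le> (norm (x - (q + t *\<^sub>R v)))\<^sup>2" using dle d0 by (intro power_mono) auto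
    also have "\<dots> = (norm (x - q))\<^sup>2 + t\<^sup>2 * (norm v)\<^sup>2 - 2 * t * inner (x - q) v"
      unfolding power2_norm_eq_inner
      by (simp add: inner_diff inner_add algebra_simps inner_commute power2_eq_square)
    finally show "0 \<le> t\<^sup>2 * (norm v)\<^sup>2 - 2 * t * inner (x - q) v" using qd by linarith
  qed
  then show ?thesis using qS by blast
qed

lemma subspace_closure:
  fixes S :: "'a :: real_normed_vector set"
  assumes "subspace S" shows "subspace (closure S)"
  unfolding subspace_def
proof (intro conjI ballI allI)
  show "0 \<in> closure S" using assms closure_subset by (auto simp: subspace_def)
  fix x assume "x \<in> closure S"
  then obtain f where f: "\<And>n. f n \<in> S" "f \<longlonglongrightarrow> x" by (auto simp: closure_sequential)
  show "c *\<^sub>R x \<in> closure S" for c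
    unfolding closure_sequential using assms f
    by (intro exI[of _ "\<lambda>n. c *\<^sub>R f n"]) (auto simp: subspace_def intro!: tendsto_intros)
  fix y assume "y \<in> closure S"
  then obtain g where g: "\<And>n. g n \<in> S" "g \<longlonglongrightarrow> y" by (auto simp: closure_sequential)
  show "x + y \<in> closure S"
    unfolding closure_sequential using assms f g
    by (intro exI[of _ "\<lambda>n. f n + g n"]) (auto simp: subspace_def intro!: tendsto_intros)
qed

text \<open>The remainder of the projection onto the closure is orthogonal to \<open>S\<close>,
  hence zero.\<close>

lemma dense_if_orthogonal_trivial:
  fixes S :: "'a :: {real_inner, complete_space} set"
  assumes "subspace S" "\<And>v. (\<And>s. s \<in> S \<Longrightarrow> inner v s = 0) \<Longrightarrow> v = 0"
  shows "closure S = UNIV"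
proof -
  have "x \<in> closure S" for x
  proof -
    obtain p where p: "p \<in> closure S" "\<forall>v\<in>closure S. inner (x - p) v = 0"
      using projection_exists[of "closure S" x] subspace_closure[OF assms(1)] by auto
    have "x - p = 0" using p(2) closure_subset[of S] by (intro assms(2)) auto
    then show ?thesis using p(1) by simp
  qed
  then show ?thesis by auto
qed

text \<open>A normal \<open>n\<close> to the kernel represents \<open>f\<close> after scaling,
  because \<open>w - (f w / f n) *\<^sub>R n\<close> lies in the kernel and is orthogonal to
  \<open>n\<close>.\<close>

lemma riesz_representation:
  fixes f :: "'a :: {real_inner, complete_space} \<Rightarrow> real"
  assumes "bounded_linear f"
  shows "\<exists>v. \<forall>w. f w = inner w v"
proof (cases "\<forall>w. f w = 0")
  case True then show ?thesis by (intro exI[of _ 0]) simp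
next
  case False
  then obtain z where z: "f z \<noteq> 0" by blast
  interpret f: bounded_linear f by fact
  define S where "S = {w. f w = 0}"
  have "subspace S" by (auto simp: S_def subspace_def f.add f.scaleR f.zero)
  moreover have "closed S" unfolding S_def
    by (intro closed_Collect_eq continuous_intros linear_continuous_on assms)
  ultimately obtain p where p: "p \<in> S" "\<forall>v\<in>S. inner (z - p) v = 0"
    using projection_exists by blast
  define n where "n = z - p"
  have fn: "f n \<noteq> 0" using z p(1) by (simp add: n_def S_def f.diff)
  then have n0: "n \<noteq> 0" using f.zero by auto
  have "f w = inner w ((f n / (norm n)\<^sup>2) *\<^sub>R n)" for w
  proof -
    have "w - (f w / f n) *\<^sub>R n \<in> S" using fn by (simp add: S_def f.diff f.scaleR)
    then have "inner n (w - (f w / f n) *\<^sub>R n) = 0" using p(2) n_def by blast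
    then have "inner w n = f w / f n * (norm n)\<^sup>2"
      by (simp add: inner_diff inner_commute power2_norm_eq_inner)
    then show ?thesis using fn n0 by (simp add: field_simps)
  qed
  then show ?thesis by blast
qed

section \<open>Orthogonal projection onto a closed subspace as an operator\<close>

text \<open>Junk unless \<open>S\<close> is a closed subspace of a complete space.\<close>
definition proj_on :: "'a :: real_inner set \<Rightarrow> 'a \<Rightarrow> 'a" where
  "proj_on S x = (SOME p. p \<in> S \<and> (\<forall>v\<in>S. inner (x - p) v = 0))"

context
  fixes S :: "'a :: {real_inner, complete_space} set"
  assumes S: "subspace S" "closed S"
begin

lemma proj_on_in: "proj_on S x \<in> S"
  and proj_on_orth: "v \<in> S \<Longrightarrow> inner (x - proj_on S x) v = 0"
proof -
  have "\<exists>p. p \<in> S \<and> (\<forall>v\<in>S. inner (x - p) v = 0)"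
    using projection_exists[OF S] by blast
  from someI_ex[OF this] show "proj_on S x \<in> S" "v \<in> S \<Longrightarrow> inner (x - proj_on S x) v = 0"
    by (auto simp: proj_on_def)
qed

lemma proj_on_unique:
  assumes "p \<in> S" "\<And>v. v \<in> S \<Longrightarrow> inner (x - p) v = 0"
  shows "proj_on S x = p"
proof -
  define d where "d = proj_on S x - p"
  have dS: "d \<in> S" using S(1) proj_on_in assms(1) by (simp add: d_def subspace_diff)
  have "inner d d = inner (x - p) d - inner (x - proj_on S x) d"
    by (simp add: d_def inner_diff)
  also have "\<dots> = 0" using assms(2)[OF dS] proj_on_orth[OF dS] by simp
  finally show ?thesis by (simp add: d_def)
qed

lemma proj_on_id: "x \<in> S \<Longrightarrow> proj_on S x = x"
  by (rule proj_on_unique) auto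

lemma proj_on_symmetric: "inner (proj_on S x) y = inner x (proj_on S y)"
proof -
  have "inner (proj_on S x) (y - proj_on S y) = 0" "inner (x - proj_on S x) (proj_on S y) = 0"
    using proj_on_orth[of "proj_on S x" y] proj_on_orth[of "proj_on S y" x] proj_on_in
    by (auto simp: inner_commute)
  then show ?thesis by (simp add: inner_diff)
qed

text \<open>\<open>C'\<close> is the adjoint of \<open>C\<close>. Invariance of \<open>S\<close>
  under \<open>C'\<close> makes the orthogonal complement invariant under \<open>C\<close>, so
  \<open>C\<close> maps the decomposition of \<open>x\<close> to that of \<open>C x\<close>.\<close>

lemma proj_on_commute:
  assumes "linear C" "\<And>u v. inner (C u) v = inner u (C' v)"
    and "\<And>u. u \<in> S \<Longrightarrow> C u \<in> S" "\<And>u. u \<in> S \<Longrightarrow> C' u \<in> S"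
  shows "proj_on S (C x) = C (proj_on S x)"
proof (rule proj_on_unique)
  show "C (proj_on S x) \<in> S" using assms(3) proj_on_in by blast
  fix v assume "v \<in> S"
  then show "inner (C x - C (proj_on S x)) v = 0"
    by (metis assms linear_diff proj_on_orth)
qed

end

subsection \<open>Splitting a symmetric operator by the sign of its form\<close>

fun sqrt_iter :: "('a :: real_vector \<Rightarrow> 'a) \<Rightarrow> nat \<Rightarrow> 'a \<Rightarrow> 'a" where
  "sqrt_iter X 0 u = 0"
| "sqrt_iter X (Suc n) u = (1/2) *\<^sub>R (X u + sqrt_iter X n (sqrt_iter X n u))"

text \<open>The iteration \<open>Y \<mapsto> (X + Y\<^sup>2) / 2\<close> is dominated by its scalar version at \<open>X = 1\<close>, which
  increases to \<open>1\<close>; the limit satisfies \<open>(1 - Y)\<^sup>2 = 1 - X\<close>.\<close>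
fun sqrt_scalar :: "nat \<Rightarrow> real" where
  "sqrt_scalar 0 = 0"
| "sqrt_scalar (Suc n) = (1 + (sqrt_scalar n)\<^sup>2) / 2"

lemma sqrt_scalar_bounds: "0 \<le> sqrt_scalar n \<and> sqrt_scalar n \<le> 1"
proof (induction n)
  case (Suc n)
  then have "(sqrt_scalar n)\<^sup>2 \<le> 1" by (simp add: power_le_one)
  then show ?case by simp
qed simp

lemma sqrt_scalar_mono: "sqrt_scalar n \<le> sqrt_scalar (Suc n)"
proof -
  have "0 \<le> (1 - sqrt_scalar n)\<^sup>2" by simp
  then show ?thesis by (simp add: power2_eq_square algebra_simps)
qed

text \<open>\<open>Y\<close> stands for \<open>1 - sqrt (1 - X)\<close>, the limit of the iteration
  above. The last clause, commutation with everything that commutes with \<open>X\<close>, is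
  inherited from the iterates; it will let the square root of \<open>A\<^sup>2\<close> commute with
  \<open>A\<close>.\<close>

lemma square_root_complement:
  fixes X :: "'a :: {real_inner, complete_space} \<Rightarrow> 'a"
  assumes X: "bounded_linear X" "\<And>u. norm (X u) \<le> norm u" "\<And>u v. inner (X u) v = inner u (X v)"
  shows "\<exists>Y. bounded_linear Y \<and> (\<forall>u. norm (Y u) \<le> norm u) \<and> (\<forall>u v. inner (Y u) v = inner u (Y v)) \<and>
    (\<forall>u. 2 *\<^sub>R Y u = X u + Y (Y u)) \<and>
    (\<forall>C. bounded_linear C \<longrightarrow> (\<forall>u. C (X u) = X (C u)) \<longrightarrow> (\<forall>u. C (Y u) = Y (C u)))"
proof -
  define Z where "Z = sqrt_iter X"
  have Z0: "Z 0 u = 0" and ZS: "Z (Suc n) u = (1/2) *\<^sub>R (X u + Z n (Z n u))" for n u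
    by (simp_all add: Z_def)
  interpret X: bounded_linear X by (rule X)
  have lin: "bounded_linear (Z n)" for n
  proof (induction n)
    case 0 show ?case by (simp add: Z0[abs_def])
  next
    case (Suc n)
    have "bounded_linear (\<lambda>u. (1/2) *\<^sub>R (X u + Z n (Z n u)))"
      by (intro bounded_linear_const_scaleR bounded_linear_add X(1) bounded_linear_compose[OF Suc Suc])
    then show ?case by (simp add: ZS[abs_def])
  qed
  have bnd: "norm (Z n u) \<le> sqrt_scalar n * norm u" for n u
  proof (induction n arbitrary: u)
    case (Suc n)
    have "norm (Z (Suc n) u) \<le> (norm (X u) + norm (Z n (Z n u))) / 2"
      unfolding ZS using norm_triangle_ineq[of "X u" "Z n (Z n u)"] by simp
    also have "\<dots> \<le> (norm u + sqrt_scalar n * (sqrt_scalar n * norm u)) / 2"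
      using X(2) Suc[of "Z n u"] mult_left_mono[OF Suc[of u], of "sqrt_scalar n"] sqrt_scalar_bounds[of n]
      by (intro divide_right_mono add_mono) (auto intro: order_trans)
    also have "\<dots> = sqrt_scalar (Suc n) * norm u" by (simp add: power2_eq_square field_simps)
    finally show ?case .
  qed (simp add: Z0)
  have sym: "inner (Z n u) v = inner u (Z n v)" for n u v
  proof (induction n arbitrary: u v)
    case (Suc n) show ?case by (simp add: ZS inner_add X(3) Suc)
  qed (simp add: Z0)
  \<comment> \<open>Increments are dominated by those of the scalar iteration: a difference of
    squares is split as \<open>Z' (Z' - Z) + (Z' - Z) Z\<close>, where \<open>Z'\<close> is the
    later iterate, which respects the order of the factors.\<close>
  have diff: "norm (Z (Suc n) u - Z n u) \<le> (sqrt_scalar (Suc n) - sqrt_scalar n) * norm u" for n u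
  proof (induction n arbitrary: u)
    case 0 show ?case using X(2)[of u] by (simp add: ZS Z0)
  next
    case (Suc n)
    let ?a = "sqrt_scalar n" and ?b = "sqrt_scalar (Suc n)"
    interpret Zn: bounded_linear "Z (Suc n)" by (rule lin)
    have "Z (Suc (Suc n)) u - Z (Suc n) u = (1/2) *\<^sub>R (Z (Suc n) (Z (Suc n) u - Z n u)
        + (Z (Suc n) (Z n u) - Z n (Z n u)))"
      unfolding ZS[of "Suc n"] Zn.diff by (subst (3) ZS) (simp add: algebra_simps)
    also have "norm \<dots> \<le> (norm (Z (Suc n) (Z (Suc n) u - Z n u)) + norm (Z (Suc n) (Z n u) - Z n (Z n u))) / 2"
      using norm_triangle_ineq by simp
    also have "\<dots> \<le> (?b * ((?b - ?a) * norm u) + (?b - ?a) * (?a * norm u)) / 2"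
    proof (intro divide_right_mono add_mono)
      show "norm (Z (Suc n) (Z (Suc n) u - Z n u)) \<le> ?b * ((?b - ?a) * norm u)"
        using bnd mult_left_mono[OF Suc[of u], of ?b] sqrt_scalar_bounds[of "Suc n"] by (meson order_trans)
      show "norm (Z (Suc n) (Z n u) - Z n (Z n u)) \<le> (?b - ?a) * (?a * norm u)"
        using Suc[of "Z n u"] mult_left_mono[OF bnd[of n u], of "?b - ?a"] sqrt_scalar_mono[of n]
        by (meson diff_ge_0_iff_ge order_trans)
    qed simp
    also have "\<dots> = (sqrt_scalar (Suc (Suc n)) - ?b) * norm u"
    proof -
      have "sqrt_scalar (Suc (Suc n)) - ?b = (?b\<^sup>2 - ?a\<^sup>2) / 2"
        by (simp add: diff_divide_distrib add_divide_distrib)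
      moreover have "(b * ((b - a) * N) + (b - a) * (a * N)) / 2 = (b\<^sup>2 - a\<^sup>2) / 2 * N" for a b N :: real
        by (simp add: power2_eq_square algebra_simps)
      ultimately show ?thesis by (simp only:)
    qed
    finally show ?case .
  qed
  have diff2: "norm (Z (n + k) u - Z n u) \<le> (sqrt_scalar (n + k) - sqrt_scalar n) * norm u" for n k u
  proof (induction k)
    case (Suc k)
    have "norm (Z (n + Suc k) u - Z n u) \<le> norm (Z (Suc (n + k)) u - Z (n + k) u) + norm (Z (n + k) u - Z n u)"
      using norm_triangle_ineq[of "Z (Suc (n + k)) u - Z (n + k) u" "Z (n + k) u - Z n u"] by simp
    also have "\<dots> \<le> (sqrt_scalar (Suc (n + k)) - sqrt_scalar (n+k)) * norm u + (sqrt_scalar (n + k) - sqrt_scalar n) * norm u"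
      by (intro add_mono diff Suc)
    finally show ?case by (simp add: algebra_simps)
  qed simp
  have "convergent sqrt_scalar"
  proof (rule Bseq_mono_convergent)
    show "Bseq sqrt_scalar" using sqrt_scalar_bounds by (intro BseqI'[of _ 1]) auto
    show "\<forall>m n. m \<le> n \<longrightarrow> sqrt_scalar m \<le> sqrt_scalar n"
      using lift_Suc_mono_le[of sqrt_scalar] sqrt_scalar_mono by blast
  qed
  then have cs: "Cauchy sqrt_scalar" by (rule convergent_Cauchy)
  have "convergent (\<lambda>n. Z n u)" for u
  proof (rule Cauchy_convergent, rule CauchyI)
    fix e :: real assume "0 < e"
    then have "0 < e / (norm u + 1)" by (simp add: add_nonneg_pos)
    then obtain M where M: "\<And>m n. m \<ge> M \<Longrightarrow> n \<ge> M \<Longrightarrow> norm (sqrt_scalar m - sqrt_scalar n) < e / (norm u + 1)"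
      using CauchyD[OF cs] by metis
    have *: "norm (Z m u - Z n u) < e" if "n \<ge> M" "m \<ge> n" for m n
    proof -
      have "norm (Z m u - Z n u) \<le> (sqrt_scalar m - sqrt_scalar n) * norm u"
        using diff2[of n "m - n" u] that by simp
      also have "\<dots> \<le> norm (sqrt_scalar m - sqrt_scalar n) * (norm u + 1)"
        by (intro mult_mono) auto
      also have "\<dots> < e" using M[of m n] that by (simp add: pos_less_divide_eq add_nonneg_pos)
      finally show ?thesis .
    qed
    show "\<exists>M. \<forall>m\<ge>M. \<forall>n\<ge>M. norm (Z m u - Z n u) < e"
      using * by (metis nle_le norm_minus_commute)
  qed
  then have "\<exists>Y. \<forall>u. (\<lambda>n. Z n u) \<longlonglongrightarrow> Y u" unfolding convergent_def by metis
  then obtain Y where Y: "\<And>u. (\<lambda>n. Z n u) \<longlonglongrightarrow> Y u" by blast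
  have Ybnd: "norm (Y u) \<le> norm u" for u
  proof (rule LIMSEQ_le_const2[OF tendsto_norm[OF Y]])
    have "norm (Z n u) \<le> norm u" for n
      using bnd[of n u] mult_right_mono[of "sqrt_scalar n" 1 "norm u"] sqrt_scalar_bounds[of n] by simp
    then show "\<exists>N. \<forall>n\<ge>N. norm (Z n u) \<le> norm u" by blast
  qed
  have Ylin: "bounded_linear Y"
  proof (rule bounded_linear_intro[where K = 1])
    fix x y :: 'a and r :: real
    have "(\<lambda>n. Z n (x + y)) \<longlonglongrightarrow> Y x + Y y"
      using tendsto_add[OF Y[of x] Y[of y]] by (simp add: bounded_linear.axioms(1)[OF lin] linear_add)
    then show "Y (x + y) = Y x + Y y" using LIMSEQ_unique Y by blast
    have "(\<lambda>n. Z n (r *\<^sub>R x)) \<longlonglongrightarrow> r *\<^sub>R Y x"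
      using tendsto_scaleR[OF tendsto_const Y[of x]] by (simp add: bounded_linear.axioms(1)[OF lin] linear_cmul)
    then show "Y (r *\<^sub>R x) = r *\<^sub>R Y x" using LIMSEQ_unique Y by blast
  qed (use Ybnd in simp)
  interpret Y: bounded_linear Y by (rule Ylin)
  have Ysym: "inner (Y u) v = inner u (Y v)" for u v
  proof (rule LIMSEQ_unique)
    show "(\<lambda>n. inner (Z n u) v) \<longlonglongrightarrow> inner (Y u) v" by (intro tendsto_intros Y)
    show "(\<lambda>n. inner (Z n u) v) \<longlonglongrightarrow> inner u (Y v)" unfolding sym by (intro tendsto_intros Y)
  qed
  \<comment> \<open>Pointwise convergence passes to squares because all iterates are
    contractions.\<close>
  have ZZ: "(\<lambda>n. Z n (Z n u)) \<longlonglongrightarrow> Y (Y u)" for u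
  proof -
    have "(\<lambda>n. norm (Z n u - Y u)) \<longlonglongrightarrow> 0" using Y[of u] LIM_zero tendsto_norm_zero by blast
    moreover have "norm (Z n (Z n u - Y u)) \<le> norm (Z n u - Y u)" for n
      using bnd[of n "Z n u - Y u"] mult_right_mono[of "sqrt_scalar n" 1 "norm (Z n u - Y u)"] sqrt_scalar_bounds[of n]
      by simp
    ultimately have "(\<lambda>n. Z n (Z n u - Y u)) \<longlonglongrightarrow> 0"
      by (intro Lim_null_comparison[of "\<lambda>n. Z n (Z n u - Y u)"]) auto
    from tendsto_add[OF this Y[of "Y u"]] show ?thesis
      by (simp add: bounded_linear.axioms(1)[OF lin] linear_diff)
  qed
  have "2 *\<^sub>R Y u = X u + Y (Y u)" for u
  proof (rule LIMSEQ_unique)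
    show "(\<lambda>n. 2 *\<^sub>R Z (Suc n) u) \<longlonglongrightarrow> 2 *\<^sub>R Y u" by (intro tendsto_intros LIMSEQ_Suc Y)
    show "(\<lambda>n. 2 *\<^sub>R Z (Suc n) u) \<longlonglongrightarrow> X u + Y (Y u)"
      unfolding ZS by (simp) (intro tendsto_intros ZZ)
  qed
  moreover have "C (Y u) = Y (C u)" if C: "bounded_linear C" "\<And>u. C (X u) = X (C u)" for C u
  proof -
    interpret C: bounded_linear C by (rule C)
    have com: "C (Z n u) = Z n (C u)" for n u
    proof (induction n arbitrary: u)
      case (Suc n) then show ?case by (simp add: ZS C.add C.scaleR C(2))
    qed (simp add: Z0 C.zero)
    show ?thesis
    proof (rule LIMSEQ_unique)
      show "(\<lambda>n. C (Z n u)) \<longlonglongrightarrow> C (Y u)" by (rule C.tendsto[OF Y])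
      show "(\<lambda>n. C (Z n u)) \<longlonglongrightarrow> Y (C u)" unfolding com by (rule Y)
    qed
  qed
  ultimately show ?thesis using Ylin Ybnd Ysym by blast
qed

text \<open>With \<open>X = 1 - A\<^sup>2\<close> the operator \<open>1 - Y\<close> is the modulus
  |A|, and \<open>K\<close> is the kernel of |A| + A. On \<open>K\<close> the form of
  \<open>A\<close> is minus that of |A|. If \<open>v\<close> is orthogonal to \<open>K\<close>, then
  \<open>z = (|A| - A) v\<close> lies in \<open>K\<close>, since (|A| + A)(|A| - A) = 0; moving |A|
  - A across the inner product, and using that \<open>K\<close> is invariant, gives
  \<open>inner z z = 0\<close>, that is, \<open>A v = |A| v\<close>.\<close>

lemma sign_splitting:
  fixes A :: "'a :: {real_inner, complete_space} \<Rightarrow> 'a"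
  assumes A: "bounded_linear A" "\<And>u. norm (A u) \<le> norm u" "\<And>u v. inner (A u) v = inner u (A v)"
  shows "\<exists>K. subspace K \<and> (\<forall>u\<in>K. A u \<in> K) \<and> (\<forall>u\<in>K. inner (A u) u \<le> 0) \<and>
    (\<forall>v. (\<forall>k\<in>K. inner v k = 0) \<longrightarrow> 0 \<le> inner (A v) v)"
proof -
  define X where "X u = u - A (A u)" for u
  interpret A: bounded_linear A by (rule A)
  have X1: "bounded_linear X" unfolding X_def[abs_def]
    by (intro bounded_linear_sub bounded_linear_ident bounded_linear_compose[OF A(1) A(1)])
  have X2: "norm (X u) \<le> norm u" for u
  proof -
    have "(norm (X u))\<^sup>2 = (norm u)\<^sup>2 - 2 * (norm (A u))\<^sup>2 + (norm (A (A u)))\<^sup>2"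
      by (simp add: X_def power2_norm_eq_inner inner_diff A(3) inner_commute)
    moreover have "(norm (A (A u)))\<^sup>2 \<le> (norm (A u))\<^sup>2" using A(2) by (simp add: power_mono)
    moreover have "0 \<le> (norm (A u))\<^sup>2" by simp
    ultimately have "(norm (X u))\<^sup>2 \<le> (norm u)\<^sup>2" by linarith
    then show ?thesis by (rule power2_le_imp_le) simp
  qed
  have X3: "inner (X u) v = inner u (X v)" for u v by (simp add: X_def inner_diff A(3))
  obtain Y where Y: "bounded_linear Y" "\<And>u. norm (Y u) \<le> norm u" "\<And>u v. inner (Y u) v = inner u (Y v)"
    "\<And>u. 2 *\<^sub>R Y u = X u + Y (Y u)"
    "\<And>C. bounded_linear C \<Longrightarrow> (\<forall>u. C (X u) = X (C u)) \<Longrightarrow> (\<forall>u. C (Y u) = Y (C u))"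
    using square_root_complement[OF X1 X2 X3] by blast
  interpret Y: bounded_linear Y by (rule Y)
  have AY: "A (Y u) = Y (A u)" for u using Y(5)[OF A(1)] by (simp add: X_def A.diff)
  have AA: "A (A u) = u - 2 *\<^sub>R Y u + Y (Y u)" for u
    using Y(4)[of u] by (simp add: X_def algebra_simps)
  define K where "K = {u. u - Y u + A u = 0}"
  have Sp: "0 \<le> inner (u - Y u) u" for u
  proof -
    have "inner (Y u) u \<le> norm (Y u) * norm u" by (rule norm_cauchy_schwarz)
    also have "\<dots> \<le> norm u * norm u" by (intro mult_right_mono Y) simp
    finally show ?thesis by (simp add: inner_diff power2_norm_eq_inner[symmetric] power2_eq_square)
  qed
  have KA: "A u \<in> K" if "u \<in> K" for u
  proof -
    have "A (u - Y u + A u) = 0" using that by (simp add: K_def A.zero)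
    then show ?thesis by (simp add: K_def A.add A.diff AY)
  qed
  have KY: "Y u \<in> K" if "u \<in> K" for u
  proof -
    have "Y (u - Y u + A u) = 0" using that by (simp add: K_def Y.zero)
    then show ?thesis by (simp add: K_def Y.add Y.diff AY)
  qed
  have "inner (A u) u \<le> 0" if "u \<in> K" for u
  proof -
    have "A u = - (u - Y u)" using that by (simp add: K_def add_eq_0_iff2)
    then show ?thesis using Sp[of u] by (metis inner_minus_left neg_le_0_iff_le)
  qed
  moreover have "0 \<le> inner (A v) v" if v: "\<forall>k\<in>K. inner v k = 0" for v
  proof -
    define z where "z = v - Y v - A v"
    have "z - Y z + A z = v - 2 *\<^sub>R Y v + Y (Y v) - A (A v)"
    proof -
      have "Y z = Y v - Y (Y v) - Y (A v)" "A z = A v - Y (A v) - A (A v)"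
        by (simp_all add: z_def Y.diff A.diff AY)
      then show ?thesis by (simp add: z_def scaleR_2)
    qed
    also have "\<dots> = 0" by (simp add: AA)
    finally have zK: "z \<in> K" by (simp add: K_def)
    have "inner z z = inner v (z - Y z - A z)" by (subst z_def) (simp add: inner_diff Y(3) A(3))
    also have "\<dots> = 0" using v KY[OF zK] KA[OF zK] zK by (simp add: inner_diff)
    finally have "A v = v - Y v" by (simp add: z_def)
    then show ?thesis using Sp by simp
  qed
  moreover have "subspace K" unfolding K_def
    by (rule subspaceI) (auto simp: Y.add A.add Y.zero A.zero Y.scaleR A.scaleR algebra_simps
      simp flip: scaleR_diff_right scaleR_add_right)
  ultimately show ?thesis using KA by blast
qed

subsection \<open>Spectral subspaces of a positive contraction by growth of iterates\<close>

locale positive_contraction =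
  fixes R :: "'a :: {real_inner, complete_space} \<Rightarrow> 'a"
  assumes lin: "bounded_linear R"
    and contr: "norm (R u) \<le> norm u"
    and sym: "inner (R u) v = inner u (R v)"
    and pos: "0 \<le> inner (R u) u"
begin

sublocale R: bounded_linear R by (rule lin)

text \<open>Cauchy-Schwarz for the semidefinite form \<open>inner (R u) v\<close>; if it degenerates
  at \<open>v\<close>, nonnegativity along the line \<open>t *\<^sub>R u - v\<close> forces the
  mixed term to vanish.\<close>

lemma form_cauchy_schwarz: "(inner (R u) v)\<^sup>2 \<le> inner (R u) u * inner (R v) v"
proof -
  define a where "a = inner (R v) v"
  define b where "b = inner (R u) v"
  have s: "inner (R v) u = inner (R u) v" using sym inner_commute by metis
  have "0 \<le> inner (R (a *\<^sub>R u - b *\<^sub>R v)) (a *\<^sub>R u - b *\<^sub>R v)" by (rule pos)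
  also have "\<dots> = a * (a * inner (R u) u - b\<^sup>2)"
    by (simp add: R.diff R.scaleR inner_diff s a_def b_def power2_eq_square algebra_simps)
  finally have 1: "0 \<le> a * (a * inner (R u) u - b\<^sup>2)" .
  have a0: "0 \<le> a" using pos by (simp add: a_def)
  show ?thesis
  proof (cases "a = 0")
    case True
    have "b = 0"
    proof (rule real_quadratic_min_imp_zero[of "inner (R u) u"])
      fix t
      have "0 \<le> inner (R (t *\<^sub>R u - v)) (t *\<^sub>R u - v)" by (rule pos)
      also have "\<dots> = t\<^sup>2 * inner (R u) u - 2 * t * b + a"
        by (simp add: R.diff R.scaleR inner_diff s a_def b_def power2_eq_square algebra_simps)
      finally show "0 \<le> t\<^sup>2 * inner (R u) u - 2 * t * b" using True by simp
    qed
    then show ?thesis using pos by (simp add: b_def)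
  next
    case False
    then have "0 \<le> a * inner (R u) u - b\<^sup>2" using 1 a0 by (simp add: zero_le_mult_iff)
    then show ?thesis by (simp add: a_def b_def mult.commute)
  qed
qed

text \<open>For \<open>l > 0\<close> this is the spectral subspace of \<open>R\<close> belonging to
  values at most \<open>l\<close>. The explicit constant \<open>norm u\<close> makes the set visibly
  closed; \<open>growth_spaceI\<close> shows that any other constant yields the same set.\<close>

definition growth_space :: "real \<Rightarrow> 'a set" where
  "growth_space l = {u. \<forall>n. norm ((R ^^ n) u) \<le> l ^ n * norm u}"

lemma bounded_linear_iterate: "bounded_linear (R ^^ n)"
proof (induction n)
  case (Suc n)
  then show ?case using bounded_linear_compose[OF lin Suc] by (simp add: o_def)
qed (simp add: id_def bounded_linear_ident)

lemma iterate_log_convex: "(norm ((R ^^ Suc n) u))\<^sup>2 \<le> norm ((R ^^ n) u) * norm ((R ^^ Suc (Suc n)) u)"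
proof -
  have "(norm ((R ^^ Suc n) u))\<^sup>2 = inner ((R ^^ n) u) ((R ^^ Suc (Suc n)) u)"
    by (simp add: power2_norm_eq_inner sym)
  also have "\<dots> \<le> norm ((R ^^ n) u) * norm ((R ^^ Suc (Suc n)) u)" by (rule norm_cauchy_schwarz)
  finally show ?thesis .
qed

text \<open>The norms of the iterates form a log-convex sequence, so a ratio of consecutive terms
  above \<open>l\<close> would persist from there on and beat every multiple of
  \<open>l ^ n\<close>. Hence all ratios are at most \<open>l\<close>, and the constant
  \<open>C\<close> improves to \<open>norm u\<close>.\<close>

lemma growth_spaceI:
  assumes l: "0 < l" and C: "\<And>n. norm ((R ^^ n) u) \<le> C * l ^ n"
  shows "u \<in> growth_space l"
proof -
  define a where "a n = norm ((R ^^ n) u)" for n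
  have a0: "0 \<le> a n" for n by (simp add: a_def)
  have step: "a (Suc n) \<le> l * a n" for n
  proof (rule ccontr)
    assume "\<not> a (Suc n) \<le> l * a n"
    then have gt: "l * a n < a (Suc n)" by simp
    have an: "0 < a n"
    proof (rule ccontr)
      assume "\<not> 0 < a n"
      then have "(R ^^ n) u = 0" using a0[of n] by (simp add: a_def)
      then have "a (Suc n) = 0" by (simp add: a_def R.zero)
      then show False using gt a0[of n] l by (simp add: mult_less_0_iff not_less)
    qed
    define r where "r = a (Suc n) / a n"
    have r: "l < r" using gt an by (simp add: r_def field_simps)
    have grow: "r * a (n + k) \<le> a (Suc (n + k)) \<and> 0 < a (n + k)" for k
    proof (induction k)
      case 0 show ?case using an by (simp add: r_def)
    next
      case (Suc k)
      then have p: "0 < a (Suc (n + k))" using r l by (smt (verit) mult_pos_pos)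
      have "(a (Suc (n + k)))\<^sup>2 \<le> a (n + k) * a (Suc (Suc (n + k)))"
        unfolding a_def by (rule iterate_log_convex)
      moreover have "r * a (n + k) * a (Suc (n + k)) \<le> (a (Suc (n + k)))\<^sup>2"
        using Suc p by (simp add: power2_eq_square)
      ultimately have "a (n + k) * (r * a (Suc (n + k))) \<le> a (n + k) * a (Suc (Suc (n + k)))"
        by (simp add: mult_ac)
      then show ?case using Suc p by simp
    qed
    have pw: "r ^ k * a n \<le> a (n + k)" for k
    proof (induction k)
      case (Suc k)
      have "r ^ Suc k * a n \<le> r * a (n + k)" using Suc r l by (simp add: mult.assoc)
      also have "\<dots> \<le> a (n + Suc k)" using grow[of k] by simp
      finally show ?case .
    qed simp
    \<comment> \<open>From index \<open>n\<close> on the sequence grows at least like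
      \<open>r ^ k\<close> while the hypothesis allows only \<open>l ^ k\<close>; this
      \<open>k\<close> is large enough for a contradiction.\<close>
    obtain k where k: "C * l ^ n / a n < (r / l) ^ k"
      using real_arch_pow[of "r / l" "C * l ^ n / a n"] r l by auto
    have "r ^ k * a n \<le> C * l ^ n * l ^ k" using pw[of k] C[of "n + k"] by (simp add: a_def power_add mult.assoc)
    then have "(r / l) ^ k \<le> C * l ^ n / a n" using an l by (simp add: power_divide field_simps)
    then show False using k by simp
  qed
  have "a n \<le> l ^ n * a 0" for n
  proof (induction n)
    case (Suc n) then show ?case using step[of n] l
      by (smt (verit) mult.assoc mult_left_mono power_Suc)
  qed simp
  then show ?thesis by (simp add: growth_space_def a_def)
qed

lemma growth_space_subspace: "0 < l \<Longrightarrow> subspace (growth_space l)"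
proof (unfold subspace_def, intro conjI ballI allI)
  assume l: "0 < l"
  have L: "linear (R ^^ n)" for n using bounded_linear_iterate bounded_linear.linear by blast
  show "0 \<in> growth_space l" by (simp add: growth_space_def linear_0[OF L])
  fix x assume x: "x \<in> growth_space l"
  show "c *\<^sub>R x \<in> growth_space l" for c
    using x l by (auto simp: growth_space_def linear_cmul[OF L] intro: mult_left_mono[where c = "\<bar>c\<bar>"] simp: mult.left_commute)
  fix y assume y: "y \<in> growth_space l"
  show "x + y \<in> growth_space l"
  \<comment> \<open>The triangle inequality produces the constant \<open>norm x + norm y\<close>
    rather than \<open>norm (x + y)\<close>, which the criterion tolerates.\<close>
  proof (rule growth_spaceI[OF l])
    fix n
    show "norm ((R ^^ n) (x + y)) \<le> (norm x + norm y) * l ^ n"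
      using x y norm_triangle_ineq[of "(R ^^ n) x" "(R ^^ n) y"]
      by (auto simp: growth_space_def linear_add[OF L] algebra_simps intro: order_trans dest!: spec[of _ n])
  qed
qed

lemma growth_space_closed: "closed (growth_space l)"
  unfolding growth_space_def
  by (intro closed_Collect_all closed_Collect_le continuous_intros linear_continuous_on bounded_linear_iterate)

lemma growth_space_mono: "0 \<le> l \<Longrightarrow> l \<le> l' \<Longrightarrow> growth_space l \<subseteq> growth_space l'"
  unfolding growth_space_def
  by (intro Collect_mono allI impI) (meson mult_right_mono norm_ge_zero order_trans power_mono)

text \<open>An operator commuting with \<open>R\<close> carries iterates to iterates at the cost of
  its norm, a constant that \<open>growth_spaceI\<close> absorbs.\<close>

lemma growth_space_invariant:
  assumes "0 < l" "bounded_linear C" "\<And>u. C (R u) = R (C u)" "u \<in> growth_space l"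
  shows "C u \<in> growth_space l"
proof -
  obtain K where K: "\<And>x. norm (C x) \<le> norm x * K" "0 \<le> K"
    using bounded_linear.nonneg_bounded[OF assms(2)] by blast
  show ?thesis
  proof (rule growth_spaceI[OF assms(1)])
  fix n
  have com: "(R ^^ n) (C u) = C ((R ^^ n) u)" by (induction n) (auto simp: assms(3))
  have "norm (C ((R ^^ n) u)) \<le> norm ((R ^^ n) u) * K" by (rule K)
  also have "\<dots> \<le> (l ^ n * norm u) * K" using assms(4) K(2)
    by (intro mult_right_mono) (auto simp: growth_space_def)
  finally show "norm ((R ^^ n) (C u)) \<le> (norm u * K) * l ^ n" by (simp add: com mult_ac)
  qed
qed

lemma growth_space_form_le:
  assumes "u \<in> growth_space l" shows "inner (R u) u \<le> l * (norm u)\<^sup>2"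
proof -
  have "norm (R u) \<le> l * norm u" using assms by (auto simp: growth_space_def dest: spec[of _ 1])
  then have "norm (R u) * norm u \<le> l * norm u * norm u" by (rule mult_right_mono) simp
  then show ?thesis using norm_cauchy_schwarz[of "R u" u] by (simp add: power2_eq_square)
qed

text \<open>\<open>R - l\<close> is split by the sign of its form. On its nonpositive part
  \<open>K\<close> the form of \<open>R\<close> is at most \<open>l\<close>; this is upgraded to
  \<open>norm (R u) \<le> l * norm u\<close>, and since \<open>K\<close> is invariant under
  \<open>R\<close> it iterates, so \<open>K\<close> lies in the growth space. A vector orthogonal to
  the growth space is then orthogonal to \<open>K\<close>, where the form of \<open>R - l\<close> is
  nonnegative.\<close>

lemma growth_space_orth_form_ge:
  assumes l: "0 < l" "l \<le> 1" and v: "\<And>k. k \<in> growth_space l \<Longrightarrow> inner v k = 0"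
  shows "l * (norm v)\<^sup>2 \<le> inner (R v) v"
proof -
  \<comment> \<open>The factor \<open>1 / 2\<close> makes \<open>A\<close> a contraction for
    \<open>l \<le> 1\<close>, as \<open>sign_splitting\<close> demands.\<close>
  define A where "A u = (1/2) *\<^sub>R (R u - l *\<^sub>R u)" for u
  have A: "bounded_linear A" unfolding A_def[abs_def]
    by (intro bounded_linear_const_scaleR bounded_linear_sub lin bounded_linear_ident)
  have "norm (A u) \<le> norm u" for u
  proof -
    have "norm (R u - l *\<^sub>R u) \<le> norm (R u) + norm (l *\<^sub>R u)" by (rule norm_triangle_ineq4)
    also have "\<dots> \<le> norm u + 1 * norm u" using l contr[of u] by (intro add_mono) (auto intro: mult_right_mono simp: mult_left_le_one_le)
    finally show ?thesis by (simp add: A_def)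
  qed
  moreover have "inner (A u) w = inner u (A w)" for u w by (simp add: A_def inner_diff sym)
  ultimately obtain K where K: "\<forall>u\<in>K. A u \<in> K" "\<forall>u\<in>K. inner (A u) u \<le> 0"
    "\<And>v. (\<forall>k\<in>K. inner v k = 0) \<Longrightarrow> 0 \<le> inner (A v) v" "subspace K"
    using sign_splitting[OF A] by metis
  have KR: "R u \<in> K" if "u \<in> K" for u
  proof -
    have "R u = 2 *\<^sub>R A u + l *\<^sub>R u" by (simp add: A_def)
    then show ?thesis using K(1,4) that by (simp add: subspace_add subspace_scale)
  qed
  have Kle: "inner (R u) u \<le> l * (norm u)\<^sup>2" if "u \<in> K" for u
    using K(2) that by (auto simp: A_def inner_diff power2_norm_eq_inner)
  have Kn: "norm (R u) \<le> l * norm u" if u: "u \<in> K" for u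
  proof -
    \<comment> \<open>Cauchy-Schwarz for the form, applied to \<open>u\<close> and
      \<open>R u\<close>, turns the form bounds at these two vectors of \<open>K\<close> into a norm
      bound.\<close>
    have "((norm (R u))\<^sup>2)\<^sup>2 \<le> inner (R u) u * inner (R (R u)) (R u)"
      using form_cauchy_schwarz[of u "R u"] by (simp add: power2_norm_eq_inner)
    also have "\<dots> \<le> (l * (norm u)\<^sup>2) * (l * (norm (R u))\<^sup>2)"
      using l by (intro mult_mono Kle u KR pos) auto
    finally have "(norm (R u))\<^sup>2 * (norm (R u))\<^sup>2 \<le> (l * norm u)\<^sup>2 * (norm (R u))\<^sup>2"
      by (simp add: power2_eq_square mult_ac)
    then have "(norm (R u))\<^sup>2 \<le> (l * norm u)\<^sup>2 \<or> R u = 0"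
      by (metis mult_right_le_imp_le norm_eq_zero zero_less_power2)
    then show ?thesis using l by (auto intro: power2_le_imp_le)
  qed
  have "norm ((R ^^ n) u) \<le> l ^ n * norm u \<and> (R ^^ n) u \<in> K" if "u \<in> K" for u n
  proof (induction n)
    case (Suc n)
    then have "norm (R ((R ^^ n) u)) \<le> l * (l ^ n * norm u)"
      using Kn[of "(R ^^ n) u"] l by (meson less_imp_le mult_left_mono order_trans)
    then show ?case using Suc KR by (simp add: mult.assoc)
  qed (use that in simp)
  then have "K \<subseteq> growth_space l" by (auto simp: growth_space_def)
  then have "0 \<le> inner (A v) v" using v by (intro K(3)) auto
  then show ?thesis by (simp add: A_def inner_diff power2_norm_eq_inner)
qed
end

section \<open>Completeness and complex structure of $L^2$\<close>

lemma measurable_cnj [measurable]: "cnj \<in> borel_measurable borel"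
  by (intro borel_measurable_continuous_onI continuous_intros)

lemma square_integrable_rep: "square_integrable (rep_L2 u)"
  and rep_abs_L2: "square_integrable f \<Longrightarrow> AE x in lborel. rep_L2 (abs_L2 f) x = f x"
  and abs_rep_L2: "abs_L2 (rep_L2 u) = u"
  using Quotient3_rep_reflp[OF Quotient3_L2, of u] rep_abs_rsp_left[OF Quotient3_L2, of f f]
    Quotient3_abs_rep[OF Quotient3_L2, of u]
  by auto

lemma measurable_rep_L2 [measurable]: "rep_L2 u \<in> borel_measurable borel"
  using square_integrable_rep[of u] by (simp add: square_integrable_def)

lemma integrable_rep_L2_sq: "integrable lborel (\<lambda>x. (norm (rep_L2 u x))\<^sup>2)"
  using square_integrable_rep[of u] by (simp add: square_integrable_def)

lemma L2_eqI: "AE x in lborel. rep_L2 u x = rep_L2 v x \<Longrightarrow> u = v"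
  using Quotient3_rel_rep[OF Quotient3_L2, of u v] square_integrable_rep by blast

lemma rep_plus: "AE x in lborel. rep_L2 (u + v) x = rep_L2 u x + rep_L2 v x"
  by (subst plus_L2_def) (simp add: rep_abs_L2 square_integrable_add square_integrable_rep)

lemma rep_uminus: "AE x in lborel. rep_L2 (- u) x = - rep_L2 u x"
  using square_integrable_scale[OF square_integrable_rep, of "-1" u]
  by (subst uminus_L2_def) (simp add: rep_abs_L2)

lemma rep_scaleC: "AE x in lborel. rep_L2 (scaleC c u) x = c * rep_L2 u x"
  by (subst scaleC_def) (simp add: rep_abs_L2 square_integrable_scale square_integrable_rep)

lemma rep_scaleR: "AE x in lborel. rep_L2 (c *\<^sub>R u) x = of_real c * rep_L2 u x"
  by (subst scaleR_L2_def) (simp add: rep_abs_L2 square_integrable_scale square_integrable_rep)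

lemma rep_zero: "AE x in lborel. rep_L2 0 x = 0"
  by (subst zero_L2_def) (simp add: rep_abs_L2 square_integrable_zero)

lemma rep_minus: "AE x in lborel. rep_L2 (u - v) x = rep_L2 u x - rep_L2 v x"
  using rep_plus[of u "- v"] rep_uminus[of v] by eventually_elim simp

lemma cinner_rep: "cinner u v = (\<integral>x. cnj (rep_L2 u x) * rep_L2 v x \<partial>lborel)"
  by (simp add: cinner.rep_eq)

lemma cinner_abs_left:
  assumes "square_integrable f"
  shows "cinner (abs_L2 f) v = (\<integral>x. cnj (f x) * rep_L2 v x \<partial>lborel)"
  unfolding cinner_rep
  by (rule integral_cong_AE)
     (use assms rep_abs_L2[OF assms] in \<open>auto simp: square_integrable_def elim!: eventually_mono\<close>)

lemma cinner_abs_right: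
  assumes "square_integrable f"
  shows "cinner v (abs_L2 f) = (\<integral>x. cnj (rep_L2 v x) * f x \<partial>lborel)"
  unfolding cinner_rep
  by (rule integral_cong_AE)
     (use assms rep_abs_L2[OF assms] in \<open>auto simp: square_integrable_def elim!: eventually_mono\<close>)

lemma cinner_self: "cinner u u = of_real ((norm u)\<^sup>2)"
proof -
  have "cinner u u = of_real (Re (cinner u u))" by (simp add: cinner_rep integral_self del: of_real_power)
  then show ?thesis using cinner_self_nonneg[of u] by (simp add: norm_L2_def del: of_real_power)
qed

lemma norm_L2_sq: "(norm u)\<^sup>2 = (\<integral>x. (norm (rep_L2 u x))\<^sup>2 \<partial>lborel)"
  using cinner_self[of u] unfolding cinner_rep integral_self of_real_eq_iff by simp

lemma nn_integral_rep_L2: "(\<integral>\<^sup>+x. ennreal ((norm (rep_L2 u x))\<^sup>2) \<partial>lborel) = ennreal ((norm u)\<^sup>2)"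
  unfolding norm_L2_sq by (rule nn_integral_eq_integral) (auto simp: integrable_rep_L2_sq)

lemma nn_integral_norm_minus_L2:
  "(\<integral>\<^sup>+x. ennreal ((norm (rep_L2 u x - rep_L2 v x))\<^sup>2) \<partial>lborel) = ennreal ((norm (u - v))\<^sup>2)"
  unfolding nn_integral_rep_L2[symmetric]
  by (rule nn_integral_cong_AE) (use rep_minus[of u v] in \<open>auto elim: eventually_mono\<close>)

lemma square_integrableI:
  assumes "f \<in> borel_measurable borel" "(\<integral>\<^sup>+x. ennreal ((norm (f x))\<^sup>2) \<partial>lborel) < \<infinity>"
  shows "square_integrable f"
  unfolding square_integrable_def using assms
  by (auto intro!: integrableI_bounded simp: ennreal_power)

text \<open>The inequality \<open>2 * a k \<le> 2 ^ k * (a k)\<^sup>2 + (1/2) ^ k\<close> converts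
  control of weighted squares, which integrate well, into absolute summability at a point.\<close>

lemma summable_if_weighted_squares:
  fixes a :: "nat \<Rightarrow> real"
  assumes "\<And>k. 0 \<le> a k" and "(\<Sum>k. ennreal (2 ^ k * (a k)\<^sup>2)) \<noteq> \<infinity>"
  shows "summable a"
proof -
  have s: "summable (\<lambda>k. 2 ^ k * (a k)\<^sup>2)"
    using assms by (intro summable_suminf_not_top) auto
  have "summable (\<lambda>k. 2 ^ k * (a k)\<^sup>2 + (1/2) ^ k)"
    by (intro summable_add s summable_geometric) simp
  then show ?thesis
  proof (rule summable_comparison_test'[where N = 0])
    fix k :: nat
    define t :: real where "t = sqrt (2 ^ k)"
    have t: "t > 0" "t\<^sup>2 = 2 ^ k" by (auto simp: t_def)
    have "0 \<le> (t * a k - 1 / t)\<^sup>2" by simp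
    also have "\<dots> = t\<^sup>2 * (a k)\<^sup>2 + 1 / t\<^sup>2 - 2 * a k"
      using t(1) by (simp add: power2_diff power_mult_distrib power_divide)
    finally have "2 * a k \<le> 2 ^ k * (a k)\<^sup>2 + (1/2) ^ k" by (simp add: t power_one_over)
    then show "norm (a k) \<le> 2 ^ k * (a k)\<^sup>2 + (1/2) ^ k" using assms(1)[of k] by simp
  qed
qed

text \<open>A subsequence with increments below \<open>1 / 2 ^ k\<close> in norm converges almost
  everywhere, and Fatou's lemma turns the pointwise limit into a limit in norm.\<close>

instance L2 :: complete_space
proof
  fix X :: "nat \<Rightarrow> L2" assume X: "Cauchy X"
  have "\<exists>N. \<forall>m\<ge>N. \<forall>n\<ge>N. norm (X m - X n) < 1 / 2 ^ k" for k :: nat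
    using CauchyD[OF X, of "1 / 2 ^ k"] by simp
  then obtain N where N: "\<And>k m n. m \<ge> N k \<Longrightarrow> n \<ge> N k \<Longrightarrow> norm (X m - X n) < 1 / 2 ^ k"
    by metis
  \<comment> \<open>Summing the thresholds gives an index beyond \<open>N j\<close> for every
    \<open>j \<le> k\<close> at once.\<close>
  define r where "r k = (\<Sum>j\<le>k. N j)" for k
  have rN: "r k \<ge> N j" if "j \<le> k" for j k
    unfolding r_def using that by (intro member_le_sum) auto
  define f where "f k = rep_L2 (X (r k))" for k
  have fm [measurable]: "f k \<in> borel_measurable borel" for k by (simp add: f_def)
  \<comment> \<open>Squared increments are at most \<open>(1/4) ^ k\<close>, so even with the weight
    \<open>2 ^ k\<close> their sum has finite integral.\<close>
  have "(\<integral>\<^sup>+x. (\<Sum>k. ennreal (2 ^ k * (norm (f (Suc k) x - f k x))\<^sup>2)) \<partial>lborel)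
      = (\<Sum>k. \<integral>\<^sup>+x. ennreal (2 ^ k * (norm (f (Suc k) x - f k x))\<^sup>2) \<partial>lborel)"
    by (rule nn_integral_suminf) measurable
  also have "\<dots> = (\<Sum>k. ennreal (2 ^ k * (norm (X (r (Suc k)) - X (r k)))\<^sup>2))"
    by (intro suminf_cong) (simp add: ennreal_mult' nn_integral_cmult nn_integral_norm_minus_L2 f_def)
  also have "\<dots> \<le> (\<Sum>k. ennreal ((1/2) ^ k))"
  proof (intro suminf_le ennreal_leI)
    fix k
    have "norm (X (r (Suc k)) - X (r k)) < 1 / 2 ^ k" by (intro N rN) auto
    then have "(norm (X (r (Suc k)) - X (r k)))\<^sup>2 \<le> (1 / 2 ^ k)\<^sup>2" by (intro power_mono) auto
    then have "2 ^ k * (norm (X (r (Suc k)) - X (r k)))\<^sup>2 \<le> 2 ^ k * (1 / 2 ^ k)\<^sup>2"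
      by (intro mult_left_mono) auto
    also have "\<dots> = (1/2) ^ k" by (simp add: power2_eq_square power_one_over)
    finally show "2 ^ k * (norm (X (r (Suc k)) - X (r k)))\<^sup>2 \<le> (1/2) ^ k" .
  qed auto
  also have "\<dots> = ennreal (\<Sum>k. (1/2) ^ k)" by (intro suminf_ennreal2) auto
  also have "\<dots> < \<infinity>" by simp
  finally have "AE x in lborel. (\<Sum>k. ennreal (2 ^ k * (norm (f (Suc k) x - f k x))\<^sup>2)) \<noteq> \<infinity>"
    by (intro nn_integral_PInf_AE) auto
  then have ae: "AE x in lborel. convergent (\<lambda>k. f k x)"
  proof eventually_elim
    case (elim x)
    then have "summable (\<lambda>k. norm (f (Suc k) x - f k x))"
      by (intro summable_if_weighted_squares) auto
    then have "summable (\<lambda>k. f (Suc k) x - f k x)" by (rule summable_norm_cancel)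
    then have "convergent (\<lambda>n. \<Sum>k<n. f (Suc k) x - f k x)" by (simp add: summable_iff_convergent)
    then have "convergent (\<lambda>n. f n x - f 0 x)" using sum_lessThan_telescope[of "\<lambda>k. f k x"] by simp
    then have "convergent (\<lambda>n. (f n x - f 0 x) + f 0 x)" by (intro convergent_add convergent_const)
    then show ?case by simp
  qed
  define F where "F x = lim (\<lambda>k. f k x)" for x
  have Fm [measurable]: "F \<in> borel_measurable borel" unfolding F_def by measurable
  have conv: "AE x in lborel. (\<lambda>k. f k x) \<longlonglongrightarrow> F x"
    using ae by eventually_elim (simp add: F_def convergent_LIMSEQ_iff)
  have fat: "(\<integral>\<^sup>+x. ennreal ((norm (F x - f k x))\<^sup>2) \<partial>lborel) \<le> ennreal ((1 / 2 ^ k)\<^sup>2)" for k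
  proof -
    have "(\<integral>\<^sup>+x. ennreal ((norm (F x - f k x))\<^sup>2) \<partial>lborel)
       = (\<integral>\<^sup>+x. liminf (\<lambda>m. ennreal ((norm (f m x - f k x))\<^sup>2)) \<partial>lborel)"
    proof (rule nn_integral_cong_AE, use conv in eventually_elim)
      case (elim x)
      have "(\<lambda>m. ennreal ((norm (f m x - f k x))\<^sup>2)) \<longlonglongrightarrow> ennreal ((norm (F x - f k x))\<^sup>2)"
        by (intro tendsto_ennrealI tendsto_intros elim)
      then show ?case using lim_imp_Liminf[OF sequentially_bot] by metis
    qed
    also have "\<dots> \<le> liminf (\<lambda>m. \<integral>\<^sup>+x. ennreal ((norm (f m x - f k x))\<^sup>2) \<partial>lborel)"
      by (rule nn_integral_liminf) measurable
    also have "\<dots> = liminf (\<lambda>m. ennreal ((norm (X (r m) - X (r k)))\<^sup>2))"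
      by (simp add: f_def nn_integral_norm_minus_L2)
    also have "\<dots> \<le> limsup (\<lambda>m. ennreal ((norm (X (r m) - X (r k)))\<^sup>2))"
      by (intro Liminf_le_Limsup) auto
    also have "\<dots> \<le> ennreal ((1 / 2 ^ k)\<^sup>2)"
    proof (rule Limsup_bounded)
      show "\<forall>\<^sub>F m in sequentially. ennreal ((norm (X (r m) - X (r k)))\<^sup>2) \<le> ennreal ((1 / 2 ^ k)\<^sup>2)"
        using eventually_ge_at_top[of k]
      proof eventually_elim
        case (elim m)
        then have "norm (X (r m) - X (r k)) < 1 / 2 ^ k" by (intro N rN) auto
        then show ?case by (intro ennreal_leI power_mono) auto
      qed
    qed
    finally show ?thesis .
  qed
  have sq: "square_integrable F"
  proof -
    have "square_integrable (\<lambda>x. F x - f 0 x)"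
      using le_less_trans[OF fat[of 0]] by (intro square_integrableI) auto
    from square_integrable_add[OF this, of "f 0"] show ?thesis
      by (simp add: f_def square_integrable_rep)
  qed
  have near: "norm (abs_L2 F - X (r k)) \<le> 1 / 2 ^ k" for k
  proof -
    have "ennreal ((norm (abs_L2 F - X (r k)))\<^sup>2) = (\<integral>\<^sup>+x. ennreal ((norm (F x - f k x))\<^sup>2) \<partial>lborel)"
      unfolding nn_integral_norm_minus_L2[symmetric] f_def
      by (rule nn_integral_cong_AE) (use rep_abs_L2[OF sq] in \<open>auto elim: eventually_mono\<close>)
    also have "\<dots> \<le> ennreal ((1 / 2 ^ k)\<^sup>2)" by (rule fat)
    finally have "(norm (abs_L2 F - X (r k)))\<^sup>2 \<le> (1 / 2 ^ k)\<^sup>2" by (simp add: ennreal_le_iff)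
    then show ?thesis by (rule power2_le_imp_le) simp
  qed
  have "X \<longlonglongrightarrow> abs_L2 F"
  proof (rule LIMSEQ_I)
    fix e :: real assume "0 < e"
    then obtain k :: nat where "(1 / 2) ^ k < e / 2"
      using real_arch_pow_inv[of "e / 2" "1 / 2"] by auto
    then have k: "2 * (1 / 2) ^ k < e" by simp
    have "norm (X n - abs_L2 F) < e" if "n \<ge> N k" for n
    proof -
      have "norm (X n - abs_L2 F) \<le> norm (X n - X (r k)) + norm (abs_L2 F - X (r k))"
        using norm_triangle_ineq4[of "X n - X (r k)" "abs_L2 F - X (r k)"] by simp
      also have "\<dots> < 1 / 2 ^ k + 1 / 2 ^ k" using N[OF that rN[of k k]] near[of k] by simp
      also have "\<dots> < e" using k by (simp add: power_one_over)
      finally show ?thesis .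
    qed
    then show "\<exists>no. \<forall>n\<ge>no. norm (X n - abs_L2 F) < e" by blast
  qed
  then show "convergent X" by (auto simp: convergent_def)
qed

section \<open>Complex scalars and the complex inner product\<close>

lemma cinner_add_right: "cinner u (v + w) = cinner u v + cinner u w"
  using cinner_add_left[of v w u] cinner_commute by (metis complex_cnj_add)

lemma cinner_scaleC_right: "cinner u (scaleC c v) = c * cinner u v"
proof -
  have "cinner u (scaleC c v) = (\<integral>x. c * (cnj (rep_L2 u x) * rep_L2 v x) \<partial>lborel)"
    unfolding cinner_rep
    by (rule integral_cong_AE) (use rep_scaleC[of c v] in \<open>auto elim!: eventually_mono\<close>)
  then show ?thesis by (simp add: cinner_rep)
qed

lemma cinner_scaleC_left: "cinner (scaleC c u) v = cnj c * cinner u v"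
  by (metis cinner_commute cinner_scaleC_right complex_cnj_mult)

lemma cinner_scaleR_right: "cinner u (r *\<^sub>R v) = of_real r * cinner u v"
  by (metis cinner_commute cinner_scaleR_left complex_cnj_complex_of_real complex_cnj_mult)

lemma cinner_zero [simp]: "cinner 0 u = 0" "cinner u 0 = 0"
  using cinner_scaleR_left[of 0 u u] cinner_scaleR_right[of u 0 u] by auto

lemma cinner_minus_right: "cinner u (- v) = - cinner u v"
  using cinner_scaleR_right[of u "-1" v] by simp

lemma cinner_minus_left: "cinner (- u) v = - cinner u v"
  using cinner_scaleR_left[of "-1" u v] by simp

lemma cinner_diff_right: "cinner u (v - w) = cinner u v - cinner u w"
  using cinner_add_right[of u v "- w"] by (simp add: cinner_minus_right)

lemma cinner_diff_left: "cinner (u - v) w = cinner u w - cinner v w"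
  using cinner_add_left[of u "- v" w] by (simp add: cinner_minus_left)

lemma cinner_eqI: "(\<And>w. cinner w u = cinner w v) \<Longrightarrow> u = v"
  using cinner_diff_right[of "u - v" u v] cinner_self[of "u - v"] by simp

lemma scaleC_add: "scaleC c (u + v) = scaleC c u + scaleC c v"
  by (rule cinner_eqI) (simp add: cinner_scaleC_right cinner_add_right algebra_simps)

lemma scaleC_scaleC: "scaleC c (scaleC d u) = scaleC (c * d) u"
  by (rule cinner_eqI) (simp add: cinner_scaleC_right)

lemma scaleC_of_real: "scaleC (of_real r) u = r *\<^sub>R u"
  by (rule cinner_eqI) (simp add: cinner_scaleC_right cinner_scaleR_right)

lemma scaleC_diff: "scaleC c (u - v) = scaleC c u - scaleC c v"
  by (rule cinner_eqI) (simp add: cinner_scaleC_right cinner_diff_right algebra_simps)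

lemma scaleC_minus_left: "scaleC (- c) u = - scaleC c u"
  by (rule cinner_eqI) (simp add: cinner_scaleC_right cinner_minus_right)

lemma scaleC_scaleR: "scaleC c (r *\<^sub>R u) = r *\<^sub>R scaleC c u"
  by (rule cinner_eqI) (simp add: cinner_scaleC_right cinner_scaleR_right)

lemma norm_scaleC: "norm (scaleC c u) = norm c * norm u"
proof -
  have "complex_of_real ((norm (scaleC c u))\<^sup>2) = of_real ((norm c * norm u)\<^sup>2)"
    unfolding cinner_self[symmetric] cinner_scaleC_left cinner_scaleC_right
    by (simp add: cinner_self power_mult_distrib mult_ac flip: complex_norm_square)
  then show ?thesis by (simp only: of_real_eq_iff) (simp add: power2_eq_iff_nonneg)
qed

lemma bounded_linear_scaleC: "bounded_linear (scaleC c)"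
  by (rule bounded_linear_intro[where K = "norm c"])
     (auto simp: scaleC_add scaleC_scaleR norm_scaleC mult.commute)

text \<open>The complex product is recovered from the real one and multiplication by the imaginary
  unit. Projections and Riesz representations built in the real Hilbert space are therefore complex
  as soon as they respect \<open>scaleC \<i>\<close>.\<close>

lemma cinner_eq_inner: "cinner u v = Complex (inner u v) (inner (scaleC \<i> u) v)"
  by (simp add: inner_L2_def cinner_scaleC_left complex_eq_iff)

lemma inner_scaleC_i_left: "inner (scaleC \<i> u) v = - inner u (scaleC \<i> v)"
  by (simp add: inner_L2_def cinner_scaleC_left cinner_scaleC_right)

lemma cinner_symmetric_if_inner:
  assumes "\<And>u v. inner (P u) v = inner u (P v)" "\<And>u. P (scaleC \<i> u) = scaleC \<i> (P u)"
  shows "cinner (P u) v = cinner u (P v)"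
  unfolding cinner_eq_inner assms(2)[symmetric] assms(1) by simp

lemma riesz_cinner:
  assumes "bounded_linear S" "\<And>w. S (scaleC \<i> w) = - \<i> * S w"
  shows "\<exists>v. \<forall>w. cinner w v = S w"
proof -
  have "bounded_linear (\<lambda>w. Re (S w))"
    by (rule bounded_linear_compose[OF bounded_linear_Re assms(1)])
  then obtain v where v: "\<And>w. Re (S w) = inner w v" using riesz_representation by blast
  have "cinner w v = S w" for w
    by (simp add: cinner_eq_inner v[symmetric] assms(2) complex_eq_iff)
  then show ?thesis by blast
qed

section \<open>Gaussians and the Fourier transform\<close>

lemma measurable_cis [measurable]: "cis \<in> borel_measurable borel"
  by (intro borel_measurable_continuous_onI continuous_intros)

lemma lborel_integral_affine:
  fixes f :: "'a::euclidean_space \<Rightarrow> 'b::{banach, second_countable_topology}"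
  assumes [measurable]: "f \<in> borel_measurable borel" and c: "0 < c"
  shows "(\<integral>x. f x \<partial>lborel) = c ^ DIM('a) *\<^sub>R (\<integral>x. f (t + c *\<^sub>R x) \<partial>lborel)"
  by (subst lborel_affine[of c t]) (use c in \<open>simp_all add: integral_density integral_distr\<close>)

lemma lborel_nn_integral_affine:
  fixes f :: "'a::euclidean_space \<Rightarrow> ennreal"
  assumes [measurable]: "f \<in> borel_measurable borel" and c: "0 < c"
  shows "(\<integral>\<^sup>+x. f x \<partial>lborel) = ennreal (c ^ DIM('a)) * (\<integral>\<^sup>+x. f (t + c *\<^sub>R x) \<partial>lborel)"
  by (subst lborel_affine[of c t])
     (use c in \<open>simp_all add: nn_integral_density nn_integral_distr nn_integral_cmult\<close>)

lemma lborel_nn_integral_reflect: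
  fixes f :: "'a::euclidean_space \<Rightarrow> ennreal"
  assumes [measurable]: "f \<in> borel_measurable borel"
  shows "(\<integral>\<^sup>+x. f (t - x) \<partial>lborel) = (\<integral>\<^sup>+x. f x \<partial>lborel)"
  by (subst (2) lborel_affine[of "-1" t]) (simp_all add: nn_integral_density nn_integral_distr)

lemma
  fixes f :: "'a::euclidean_space \<Rightarrow> real \<Rightarrow> complex"
  assumes f: "\<And>b. b \<in> Basis \<Longrightarrow> integrable lborel (f b)"
  shows integral_lborel_prod: "(\<integral>x. (\<Prod>b\<in>Basis. f b (x \<bullet> b)) \<partial>lborel) = (\<Prod>b\<in>Basis. (\<integral>t. f b t \<partial>lborel))"
    and integrable_lborel_prod: "integrable lborel (\<lambda>x. \<Prod>b\<in>Basis. f b (x \<bullet> b))"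
proof -
  interpret product_sigma_finite "\<lambda>_::'a. lborel :: real measure" ..
  have [measurable]: "f b \<in> borel_measurable borel" if "b \<in> Basis" for b using f[OF that] by auto
  have *: "(\<Prod>b\<in>Basis. f b ((\<Sum>c\<in>Basis. y c *\<^sub>R c) \<bullet> b)) = (\<Prod>b\<in>Basis. f b (y b))" for y
    by (intro prod.cong refl) simp
  have m: "(\<lambda>x::'a. \<Prod>b\<in>Basis. f b (x \<bullet> b)) \<in> borel_measurable borel" by measurable
  have m2: "(\<lambda>y. \<Sum>c\<in>Basis. y c *\<^sub>R c) \<in> (\<Pi>\<^sub>M b\<in>(Basis::'a set). lborel :: real measure) \<rightarrow>\<^sub>M borel"
    by measurable
  show "(\<integral>x. (\<Prod>b\<in>Basis. f b (x \<bullet> b)) \<partial>lborel) = (\<Prod>b\<in>Basis. (\<integral>t. f b t \<partial>lborel))"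
    by (subst lborel_eq, subst integral_distr[OF m2 m], subst *, rule product_integral_prod) (auto simp: f)
  show "integrable lborel (\<lambda>x::'a. \<Prod>b\<in>Basis. f b (x \<bullet> b))"
    by (subst lborel_eq, subst integrable_distr_eq[OF m2 m], subst *, rule product_integrable_prod) (auto simp: f)
qed

text \<open>A rescaling by \<open>sqrt e\<close> of the characteristic function of the standard
  normal distribution.\<close>

lemma
  fixes e a :: real assumes e: "0 < e"
  shows integrable_gauss_cis_1: "integrable lborel (\<lambda>t. of_real (exp (- (e * t\<^sup>2) / 2)) * cis (a * t))"
    and integral_gauss_cis_1: "(\<integral>t. of_real (exp (- (e * t\<^sup>2) / 2)) * cis (a * t) \<partial>lborel)
      = of_real (sqrt (2 * pi / e) * exp (- a\<^sup>2 / (2 * e)))"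
proof -
  have 1: "of_real (exp (- (t\<^sup>2) / 2)) * cis (b * t) = of_real (sqrt (2 * pi)) * (std_normal_density t *\<^sub>R iexp (b * t))" for b t
    by (simp add: std_normal_density_def cis_conv_exp scaleR_conv_of_real)
  have i0: "integrable lborel (\<lambda>t. std_normal_density t *\<^sub>R iexp (b * t))" for b
    by (rule Bochner_Integration.integrable_bound[OF integrable_normal_density[of 1 0]]) (auto simp: normal_density_nonneg)
  have I0: "(\<integral>t. std_normal_density t *\<^sub>R iexp (b * t) \<partial>lborel) = of_real (exp (- (b\<^sup>2) / 2))" for b
    using fun_cong[OF char_std_normal_distribution, of b]
    by (simp add: char_def integral_density)
  have 2: "of_real (exp (- (e * t\<^sup>2) / 2)) * cis (a * t)
     = (\<lambda>t. of_real (exp (- (t\<^sup>2) / 2)) * cis (a / sqrt e * t)) (0 + sqrt e * t)" for t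
    using e by (simp add: power_mult_distrib)
  have s: "sqrt e \<noteq> 0" "sqrt e > 0" using e by auto
  have i1: "integrable lborel (\<lambda>t. of_real (exp (- (t\<^sup>2) / 2)) * cis (b * t))" for b
    unfolding 1 by (intro integrable_mult_right i0)
  show "integrable lborel (\<lambda>t. of_real (exp (- (e * t\<^sup>2) / 2)) * cis (a * t))"
    unfolding 2 by (rule lborel_integrable_real_affine[OF i1 s(1)])
  have "(\<integral>t. of_real (exp (- (t\<^sup>2) / 2)) * cis (a / sqrt e * t) \<partial>lborel)
     = of_real (sqrt (2 * pi)) * of_real (exp (- ((a / sqrt e)\<^sup>2) / 2))"
    unfolding 1 by (simp only: integral_mult_right_zero I0)
  then have "sqrt e *\<^sub>R (\<integral>t. of_real (exp (- (e * t\<^sup>2) / 2)) * cis (a * t) \<partial>lborel)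
     = of_real (sqrt (2 * pi)) * of_real (exp (- ((a / sqrt e)\<^sup>2) / 2))"
    unfolding 2 using s by (subst (asm) lborel_integral_real_affine[OF s(1), of _ 0]) simp
  then have "(\<integral>t. of_real (exp (- (e * t\<^sup>2) / 2)) * cis (a * t) \<partial>lborel)
     = (1 / sqrt e) *\<^sub>R (of_real (sqrt (2 * pi)) * of_real (exp (- ((a / sqrt e)\<^sup>2) / 2)))"
    using s by (metis (no_types, lifting) divide_inverse mult_1 scaleR_left_imp_eq scaleR_one scaleR_scaleR right_inverse mult.commute)
  also have "\<dots> = of_real (1 / sqrt e * (sqrt (2 * pi) * exp (- ((a / sqrt e)\<^sup>2) / 2)))"
    by (simp add: scaleR_conv_of_real del: of_real_exp)
  also have "1 / sqrt e * (sqrt (2 * pi) * exp (- ((a / sqrt e)\<^sup>2) / 2)) = sqrt (2 * pi / e) * exp (- a\<^sup>2 / (2 * e))"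
    using e by (simp add: real_sqrt_divide power_divide field_simps)
  finally show "(\<integral>t. of_real (exp (- (e * t\<^sup>2) / 2)) * cis (a * t) \<partial>lborel)
      = of_real (sqrt (2 * pi / e) * exp (- a\<^sup>2 / (2 * e)))" .
qed

lemma cis_sum: "finite A \<Longrightarrow> cis (\<Sum>b\<in>A. f b) = (\<Prod>b\<in>A. cis (f b))"
  by (induction A rule: finite_induct) (auto simp: cis_mult[symmetric])

lemma
  fixes z :: "'a::euclidean_space" and e :: real assumes e: "0 < e"
  shows integrable_gauss_cis: "integrable lborel (\<lambda>p::'a. of_real (exp (- (e * (norm p)\<^sup>2) / 2)) * cis (p \<bullet> z))"
    and integral_gauss_cis: "(\<integral>p. of_real (exp (- (e * (norm (p::'a))\<^sup>2) / 2)) * cis (p \<bullet> z) \<partial>lborel)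
      = of_real (sqrt (2 * pi / e) ^ DIM('a) * exp (- (norm z)\<^sup>2 / (2 * e)))"
proof -
  have n: "(norm x)\<^sup>2 = (\<Sum>b\<in>Basis. (x \<bullet> b)\<^sup>2)" for x :: 'a
    unfolding power2_norm_eq_inner by (subst euclidean_inner) (simp add: power2_eq_square)
  have *: "of_real (exp (- (e * (norm p)\<^sup>2) / 2)) * cis (p \<bullet> z)
     = (\<Prod>b\<in>Basis. of_real (exp (- (e * (p \<bullet> b)\<^sup>2) / 2)) * cis ((z \<bullet> b) * (p \<bullet> b)))" for p :: 'a
  proof -
    have "exp (- (e * (norm p)\<^sup>2) / 2) = (\<Prod>b\<in>(Basis::'a set). exp (- (e * (p \<bullet> b)\<^sup>2) / 2))"
      by (simp add: n exp_sum[symmetric] sum_distrib_left sum_divide_distrib sum_negf)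
    moreover have "cis (p \<bullet> z) = (\<Prod>b\<in>Basis. cis ((z \<bullet> b) * (p \<bullet> b)))"
      by (simp add: euclidean_inner[of p z] cis_sum mult.commute)
    ultimately show ?thesis by (simp add: prod.distrib)
  qed
  show "integrable lborel (\<lambda>p::'a. of_real (exp (- (e * (norm p)\<^sup>2) / 2)) * cis (p \<bullet> z))"
    unfolding * by (rule integrable_lborel_prod) (rule integrable_gauss_cis_1[OF e])
  have "(\<integral>p. of_real (exp (- (e * (norm (p::'a))\<^sup>2) / 2)) * cis (p \<bullet> z) \<partial>lborel)
     = (\<Prod>b\<in>(Basis::'a set). of_real (sqrt (2 * pi / e) * exp (- (z \<bullet> b)\<^sup>2 / (2 * e))))"
    unfolding * by (subst integral_lborel_prod) (simp_all only: integrable_gauss_cis_1[OF e] integral_gauss_cis_1[OF e])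
  also have "\<dots> = of_real (\<Prod>b\<in>(Basis::'a set). sqrt (2 * pi / e) * exp (- (z \<bullet> b)\<^sup>2 / (2 * e)))" by simp
  also have "(\<Prod>b\<in>(Basis::'a set). sqrt (2 * pi / e) * exp (- (z \<bullet> b)\<^sup>2 / (2 * e))) = sqrt (2 * pi / e) ^ DIM('a) * exp (- (norm z)\<^sup>2 / (2 * e))"
    by (simp add: prod.distrib n exp_sum[symmetric] sum_divide_distrib sum_negf)
  finally show "(\<integral>p. of_real (exp (- (e * (norm (p::'a))\<^sup>2) / 2)) * cis (p \<bullet> z) \<partial>lborel)
      = of_real (sqrt (2 * pi / e) ^ DIM('a) * exp (- (norm z)\<^sup>2 / (2 * e)))" .
qed

lemma
  fixes e :: real assumes e: "0 < e"
  shows integrable_gauss: "integrable lborel (\<lambda>p::'a::euclidean_space. exp (- (e * (norm p)\<^sup>2) / 2))"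
    and integral_gauss: "(\<integral>p. exp (- (e * (norm (p::'a))\<^sup>2) / 2) \<partial>lborel) = sqrt (2 * pi / e) ^ DIM('a)"
proof -
  have 1: "integrable lborel (\<lambda>p::'a. complex_of_real (exp (- (e * (norm p)\<^sup>2) / 2)))"
    using integrable_gauss_cis[OF e, where z = "0::'a"] by simp
  have 2: "(\<integral>p. complex_of_real (exp (- (e * (norm (p::'a))\<^sup>2) / 2)) \<partial>lborel) = of_real (sqrt (2 * pi / e) ^ DIM('a))"
    using integral_gauss_cis[OF e, where z = "0::'a"] by simp
  show "integrable lborel (\<lambda>p::'a. exp (- (e * (norm p)\<^sup>2) / 2))"
    using integrable_Re[OF 1] by simp
  show "(\<integral>p. exp (- (e * (norm (p::'a))\<^sup>2) / 2) \<partial>lborel) = sqrt (2 * pi / e) ^ DIM('a)"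
    using 2 unfolding integral_complex_of_real of_real_eq_iff .
qed

lemma nn_integral_gauss:
  assumes "0 < e"
  shows "(\<integral>\<^sup>+p. ennreal (exp (- (e * (norm (p::'a::euclidean_space))\<^sup>2) / 2)) \<partial>lborel) = ennreal (sqrt (2 * pi / e) ^ DIM('a))"
  unfolding integral_gauss[OF assms, where 'a = 'a, symmetric]
  by (rule nn_integral_eq_integral[OF integrable_gauss[OF assms]]) simp

lemma measurable_fst_snd_borel [measurable]:
  "(fst :: 'a::euclidean_space \<times> 'b::euclidean_space \<Rightarrow> 'a) \<in> borel_measurable borel"
  "(snd :: 'a::euclidean_space \<times> 'b::euclidean_space \<Rightarrow> 'b) \<in> borel_measurable borel"
  by (intro borel_measurable_continuous_onI continuous_intros)+

lemma integrable_pair_mult: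
  fixes f :: "'a::euclidean_space \<Rightarrow> 'c::{real_normed_algebra, banach, second_countable_topology}"
    and g :: "'b::euclidean_space \<Rightarrow> 'c"
  assumes f: "integrable lborel f" and g: "integrable lborel g"
  shows "integrable (lborel \<Otimes>\<^sub>M lborel) (\<lambda>(x, y). f x * g y)"
proof (rule integrableI_bounded)
  have [measurable]: "f \<in> borel_measurable borel" "g \<in> borel_measurable borel" using f g by auto
  show "(\<lambda>(x, y). f x * g y) \<in> borel_measurable (lborel \<Otimes>\<^sub>M lborel)" by measurable
  have "(\<integral>\<^sup>+ z. ennreal (norm (case z of (x, y) \<Rightarrow> f x * g y)) \<partial>(lborel \<Otimes>\<^sub>M lborel))
    \<le> (\<integral>\<^sup>+ z. (case z of (x, y) \<Rightarrow> ennreal (norm (f x)) * ennreal (norm (g y))) \<partial>(lborel \<Otimes>\<^sub>M lborel))"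
    by (intro nn_integral_mono) (auto simp: norm_mult_ineq simp flip: ennreal_mult)
  also have "\<dots> = (\<integral>\<^sup>+x. (\<integral>\<^sup>+y. ennreal (norm (f x)) * ennreal (norm (g y)) \<partial>lborel) \<partial>lborel)"
    by (subst lborel.nn_integral_fst[symmetric]) simp_all
  also have "\<dots> = (\<integral>\<^sup>+x. ennreal (norm (f x)) \<partial>lborel) * (\<integral>\<^sup>+y. ennreal (norm (g y)) \<partial>lborel)"
    by (simp add: nn_integral_cmult nn_integral_multc)
  also have "\<dots> < \<infinity>"
    using f g by (auto simp: integrable_iff_bounded ennreal_mult_less_top)
  finally show "(\<integral>\<^sup>+ z. ennreal (norm (case z of (x, y) \<Rightarrow> f x * g y)) \<partial>(lborel \<Otimes>\<^sub>M lborel)) < \<infinity>" .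
qed

section \<open>The unnormalised Fourier transform: Bessel's inequality and Plancherel's
  identity\<close>

definition fourier :: "('a::euclidean_space \<Rightarrow> complex) \<Rightarrow> 'a \<Rightarrow> complex" where
  "fourier f p = (\<integral>x. f x * cis (- (p \<bullet> x)) \<partial>lborel)"

lemma measurable_fourier [measurable]:
  assumes [measurable]: "f \<in> borel_measurable borel"
  shows "fourier f \<in> borel_measurable borel"
proof -
  have "(\<lambda>p. (\<integral>x. f x * cis (- (p \<bullet> x)) \<partial>lborel)) \<in> borel_measurable lborel" by measurable
  then show ?thesis by (simp add: fourier_def[abs_def])
qed

lemma integrable_mult_cis:
  fixes f :: "'a::euclidean_space \<Rightarrow> complex"
  assumes "integrable lborel f" and [measurable]: "g \<in> borel_measurable borel"
  shows "integrable lborel (\<lambda>x. f x * cis (g x))"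
  by (rule Bochner_Integration.integrable_bound[OF assms(1)]) (use assms in \<open>auto simp: norm_mult\<close>)

lemma norm_fourier_le: "norm (fourier f p) \<le> (\<integral>x. norm (f x) \<partial>lborel)"
  unfolding fourier_def using integral_norm_bound[of lborel "\<lambda>x. f x * cis (- (p \<bullet> x))"] by (simp add: norm_mult)

text \<open>The squared modulus is expanded into a double integral and the variable \<open>p\<close>
  is integrated first, which yields a Gaussian kernel in \<open>x - y\<close>. The transform of an
  integrable function is merely bounded, so the damping factor is what makes Fubini
  applicable.\<close>

lemma
  fixes f :: "'a::euclidean_space \<Rightarrow> complex"
  assumes f: "integrable lborel f" and e: "0 < e"
  shows integrable_gauss_fourier: "integrable lborel (\<lambda>p. exp (- (e * (norm p)\<^sup>2) / 2) * (norm (fourier f p))\<^sup>2)"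
    and integral_gauss_fourier: "of_real (\<integral>p. exp (- (e * (norm p)\<^sup>2) / 2) * (norm (fourier f p))\<^sup>2 \<partial>lborel)
      = of_real (sqrt (2 * pi / e) ^ DIM('a)) *
        (\<integral>x. (\<integral>y. f x * cnj (f y) * of_real (exp (- (norm (x - y))\<^sup>2 / (2 * e))) \<partial>lborel) \<partial>lborel)"
proof -
  have m [measurable]: "f \<in> borel_measurable borel" using f by auto
  define K where "K = (\<integral>x. norm (f x) \<partial>lborel)"
  have K: "norm (fourier f p) \<le> K" for p by (simp add: K_def norm_fourier_le)
  show "integrable lborel (\<lambda>p. exp (- (e * (norm p)\<^sup>2) / 2) * (norm (fourier f p))\<^sup>2)"
    by (rule Bochner_Integration.integrable_bound[OF integrable_mult_left[OF integrable_gauss[OF e], of "K\<^sup>2"]])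
       (use K in \<open>auto intro!: AE_I2 mult_left_mono power_mono\<close>)
  define g where "g p = complex_of_real (exp (- (e * (norm p)\<^sup>2) / 2))" for p :: 'a
  have g [measurable]: "g \<in> borel_measurable borel" unfolding g_def by measurable
  define f2 where "f2 z = f (fst z) * cnj (f (snd z))" for z
  have f2: "integrable lborel f2"
    using integrable_pair_mult[OF f integrable_cnj[OF f]] by (simp add: lborel_prod f2_def[abs_def] case_prod_beta')
  then have f2m [measurable]: "f2 \<in> borel_measurable borel" by auto
  have gi: "integrable lborel g"
    using integrable_gauss_cis[OF e, where z = "0::'a"] by (simp add: g_def[abs_def])
  have H: "integrable (lborel \<Otimes>\<^sub>M lborel) (\<lambda>(p, z). g p * f2 z * cis (- (p \<bullet> (fst z - snd z))))"
    by (rule Bochner_Integration.integrable_bound[OF integrable_pair_mult[OF gi f2]])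
       (auto simp: norm_mult case_prod_beta')
  have "complex_of_real (\<integral>p. exp (- (e * (norm p)\<^sup>2) / 2) * (norm (fourier f p))\<^sup>2 \<partial>lborel)
     = (\<integral>p. g p * (fourier f p * cnj (fourier f p)) \<partial>lborel)"
    unfolding integral_complex_of_real[symmetric] g_def
    by (intro Bochner_Integration.integral_cong refl) (simp only: of_real_mult complex_norm_square)
  also have "\<dots> = (\<integral>p. (\<integral>z. g p * f2 z * cis (- (p \<bullet> (fst z - snd z))) \<partial>lborel) \<partial>lborel)"
  proof (intro Bochner_Integration.integral_cong refl)
    fix p
    let ?F = "\<lambda>x. f x * cis (- (p \<bullet> x))"
    have i: "integrable lborel ?F" by (rule integrable_mult_cis[OF f]) measurable
    have "fourier f p * cnj (fourier f p) = (\<integral>x. (\<integral>y. ?F x * cnj (?F y) \<partial>lborel) \<partial>lborel)"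
      unfolding fourier_def by (simp del: complex_cnj_mult add: integral_mult_right_zero)
    also have "\<dots> = (\<integral>z. ?F (fst z) * cnj (?F (snd z)) \<partial>(lborel \<Otimes>\<^sub>M lborel))"
      using lborel_pair.integral_fst'[OF integrable_pair_mult[OF i integrable_cnj[OF i]]]
      by (simp add: case_prod_beta')
    also have "\<dots> = (\<integral>z. f2 z * cis (- (p \<bullet> (fst z - snd z))) \<partial>lborel)"
      unfolding lborel_prod
      by (intro Bochner_Integration.integral_cong refl) (simp add: f2_def cis_cnj cis_mult inner_diff mult_ac)
    finally show "g p * (fourier f p * cnj (fourier f p)) = (\<integral>z. g p * f2 z * cis (- (p \<bullet> (fst z - snd z))) \<partial>lborel)"
      by (simp add: mult.assoc)
  qed
  also have "\<dots> = (\<integral>z. (\<integral>p. g p * f2 z * cis (- (p \<bullet> (fst z - snd z))) \<partial>lborel) \<partial>lborel)"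
    by (rule lborel_pair.Fubini_integral[symmetric, OF H])
  also have "\<dots> = (\<integral>z. f2 z * of_real (sqrt (2 * pi / e) ^ DIM('a) * exp (- (norm (fst z - snd z))\<^sup>2 / (2 * e))) \<partial>lborel)"
  proof (intro Bochner_Integration.integral_cong refl)
    fix z :: "'a \<times> 'a"
    have "(\<integral>p. g p * f2 z * cis (- (p \<bullet> (fst z - snd z))) \<partial>lborel)
      = f2 z * (\<integral>p. g p * cis (p \<bullet> (snd z - fst z)) \<partial>lborel)"
      by (subst integral_mult_right_zero[symmetric]) (simp add: inner_diff mult_ac)
    then show "(\<integral>p. g p * f2 z * cis (- (p \<bullet> (fst z - snd z))) \<partial>lborel)
       = f2 z * of_real (sqrt (2 * pi / e) ^ DIM('a) * exp (- (norm (fst z - snd z))\<^sup>2 / (2 * e)))"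
      unfolding g_def integral_gauss_cis[OF e] by (simp add: norm_minus_commute)
  qed
  also have "\<dots> = (\<integral>z. of_real (sqrt (2 * pi / e) ^ DIM('a)) * (f2 z * of_real (exp (- (norm (fst z - snd z))\<^sup>2 / (2 * e)))) \<partial>lborel)"
    by (simp add: mult_ac)
  also have "\<dots> = of_real (sqrt (2 * pi / e) ^ DIM('a)) * (\<integral>z. f2 z * of_real (exp (- (norm (fst z - snd z))\<^sup>2 / (2 * e))) \<partial>lborel)"
    by (rule integral_mult_right_zero)
  also have "(\<integral>z. f2 z * of_real (exp (- (norm (fst z - snd z))\<^sup>2 / (2 * e))) \<partial>lborel)
     = (\<integral>x. (\<integral>y. f x * cnj (f y) * of_real (exp (- (norm (x - y))\<^sup>2 / (2 * e))) \<partial>lborel) \<partial>lborel)"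
  proof -
    have "integrable lborel (\<lambda>z. f2 z * of_real (exp (- (norm (fst z - snd z))\<^sup>2 / (2 * e))))"
      by (rule Bochner_Integration.integrable_bound[OF f2])
         (use e in \<open>auto simp: norm_mult intro!: AE_I2 mult_left_le\<close>)
    then show ?thesis
      unfolding lborel_prod[symmetric] by (subst lborel_pair.integral_fst'[symmetric]) (simp_all add: f2_def)
  qed
  finally show "of_real (\<integral>p. exp (- (e * (norm p)\<^sup>2) / 2) * (norm (fourier f p))\<^sup>2 \<partial>lborel)
      = of_real (sqrt (2 * pi / e) ^ DIM('a)) *
        (\<integral>x. (\<integral>y. f x * cnj (f y) * of_real (exp (- (norm (x - y))\<^sup>2 / (2 * e))) \<partial>lborel) \<partial>lborel)" .
qed

lemma nn_integral_gauss_damping_limit: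
  fixes F :: "'a::euclidean_space \<Rightarrow> real"
  assumes [measurable]: "F \<in> borel_measurable borel" and F: "\<And>p. 0 \<le> F p"
  shows "(\<lambda>k. \<integral>\<^sup>+p. ennreal (exp (- ((1 / real (Suc k)) * (norm p)\<^sup>2) / 2) * F p) \<partial>lborel)
    \<longlonglongrightarrow> (\<integral>\<^sup>+p. ennreal (F p) \<partial>lborel)"
proof -
  let ?f = "\<lambda>k p. ennreal (exp (- ((1 / real (Suc k)) * (norm p)\<^sup>2) / 2) * F p)"
  have inc: "incseq ?f"
    by (intro incseq_SucI le_funI ennreal_leI mult_right_mono F) (auto intro!: divide_left_mono divide_right_mono simp del: of_nat_Suc simp: of_nat_Suc[symmetric])
  have lim: "(\<lambda>k. ?f k p) \<longlonglongrightarrow> ennreal (F p)" for p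
  proof -
    have "(\<lambda>k. exp (- ((1 / real (Suc k)) * (norm p)\<^sup>2) / 2) * F p) \<longlonglongrightarrow> exp (- (0 * (norm p)\<^sup>2) / 2) * F p"
      by (intro tendsto_intros LIMSEQ_Suc lim_1_over_n) auto
    then show ?thesis by (intro tendsto_ennrealI) simp
  qed
  have sup: "(SUP k. ?f k p) = ennreal (F p)" for p
    using LIMSEQ_unique[OF LIMSEQ_SUP lim] inc by (auto simp: incseq_def le_fun_def)
  have "(\<lambda>k. integral\<^sup>N lborel (?f k)) \<longlonglongrightarrow> (SUP k. integral\<^sup>N lborel (?f k))"
    by (intro LIMSEQ_SUP) (use inc in \<open>auto simp: incseq_def le_fun_def intro!: nn_integral_mono\<close>)
  also have "(SUP k. integral\<^sup>N lborel (?f k)) = (\<integral>\<^sup>+p. (SUP k. ?f k p) \<partial>lborel)"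
    by (rule nn_integral_monotone_convergence_SUP[symmetric, OF inc]) measurable
  finally show ?thesis by (simp only: sup)
qed

lemma norm_integral_le_nn_integral: "ennreal (norm (integral\<^sup>L M f)) \<le> (\<integral>\<^sup>+x. ennreal (norm (f x)) \<partial>M)"
  by (cases "integrable M f") (auto intro: integral_norm_bound_ennreal simp: not_integrable_integral_eq)

text \<open>Schur's test for the Gaussian kernel: the product of two values of \<open>f\<close> is
  bounded by half the sum of their squares, and the kernel has the same total mass
  \<open>sqrt (2 * pi * e) ^ DIM('a)\<close> in either variable. Multiplied by the prefactor
  \<open>sqrt (2 * pi / e) ^ DIM('a)\<close> this is \<open>(2 * pi) ^ DIM('a)\<close> for every
  \<open>e\<close>, so the damping can be removed.\<close>

lemma fourier_bessel:
  fixes f :: "'a::euclidean_space \<Rightarrow> complex"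
  assumes f: "integrable lborel f"
  shows "(\<integral>\<^sup>+p. ennreal ((norm (fourier f p))\<^sup>2) \<partial>lborel)
    \<le> ennreal ((2 * pi) ^ DIM('a)) * (\<integral>\<^sup>+x. ennreal ((norm (f x))\<^sup>2) \<partial>lborel)"
proof (rule LIMSEQ_le_const2[OF nn_integral_gauss_damping_limit])
  have m [measurable]: "f \<in> borel_measurable borel" using f by auto
  show "(\<lambda>p. (norm (fourier f p))\<^sup>2) \<in> borel_measurable borel" by measurable
  show "\<exists>N. \<forall>k\<ge>N. (\<integral>\<^sup>+p. ennreal (exp (- ((1 / real (Suc k)) * (norm p)\<^sup>2) / 2) * (norm (fourier f p))\<^sup>2) \<partial>lborel)
    \<le> ennreal ((2 * pi) ^ DIM('a)) * (\<integral>\<^sup>+x. ennreal ((norm (f x))\<^sup>2) \<partial>lborel)"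
  proof (intro exI allI impI)
    fix k
    define e where "e = 1 / real (Suc k)"
    have e: "0 < e" by (simp add: e_def)
    let ?k = "\<lambda>x y :: 'a. ennreal (exp (- (norm (x - y))\<^sup>2 / (2 * e)))"
    have ky: "(\<integral>\<^sup>+y. ?k x y \<partial>lborel) = ennreal (sqrt (2 * pi * e) ^ DIM('a))" for x
      using nn_integral_gauss[of "1 / e", where 'a = 'a] lborel_nn_integral_reflect[of "\<lambda>y. ennreal (exp (- (norm y)\<^sup>2 / (2 * e)))" x] e
      by (simp add: mult.commute)
    have kx: "(\<integral>\<^sup>+x. ?k x y \<partial>lborel) = ennreal (sqrt (2 * pi * e) ^ DIM('a))" for y
      using ky[of y] by (simp add: norm_minus_commute)
    let ?N = "\<lambda>x. ennreal ((norm (f x))\<^sup>2)"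
    have half: "ennreal (1/2 * (a * b)) = ennreal (1/2) * (ennreal a * ennreal b)" if "0 \<le> a" "0 \<le> b" for a b :: real
    proof -
      have "ennreal (1/2 * (a * b)) = ennreal (1/2) * ennreal (a * b)" by (rule ennreal_mult) (use that in auto)
      also have "ennreal (a * b) = ennreal a * ennreal b" by (rule ennreal_mult) (use that in auto)
      finally show ?thesis .
    qed
    let ?I = "\<integral>x. (\<integral>y. f x * cnj (f y) * of_real (exp (- (norm (x - y))\<^sup>2 / (2 * e))) \<partial>lborel) \<partial>lborel"
    have "ennreal (norm ?I) \<le> (\<integral>\<^sup>+x. ennreal (norm (\<integral>y. f x * cnj (f y) * of_real (exp (- (norm (x - y))\<^sup>2 / (2 * e))) \<partial>lborel)) \<partial>lborel)"
      by (rule norm_integral_le_nn_integral)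
    also have "\<dots> \<le> (\<integral>\<^sup>+x. (\<integral>\<^sup>+y. ennreal (norm (f x * cnj (f y) * of_real (exp (- (norm (x - y))\<^sup>2 / (2 * e))))) \<partial>lborel) \<partial>lborel)"
      by (intro nn_integral_mono norm_integral_le_nn_integral)
    also have "\<dots> \<le> (\<integral>\<^sup>+x. (\<integral>\<^sup>+y. ennreal (1/2) * (?N x * ?k x y) + ennreal (1/2) * (?N y * ?k x y) \<partial>lborel) \<partial>lborel)"
    proof (intro nn_integral_mono)
      fix x y
      have "2 * (norm (f x) * norm (f y)) \<le> (norm (f x))\<^sup>2 + (norm (f y))\<^sup>2"
        using zero_le_power2 [of "norm (f x) - norm (f y)"] by (simp add: power2_diff)
      then have "norm (f x) * norm (f y) * exp (- (norm (x - y))\<^sup>2 / (2 * e))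
          \<le> ((norm (f x))\<^sup>2 + (norm (f y))\<^sup>2) / 2 * exp (- (norm (x - y))\<^sup>2 / (2 * e))"
        by (intro mult_right_mono) auto
      also have "\<dots> = 1/2 * ((norm (f x))\<^sup>2 * exp (- (norm (x - y))\<^sup>2 / (2 * e))) + 1/2 * ((norm (f y))\<^sup>2 * exp (- (norm (x - y))\<^sup>2 / (2 * e)))" (is "_ = ?a + ?b")
        by (simp add: field_simps)
      finally have "norm (f x) * norm (f y) * exp (- (norm (x - y))\<^sup>2 / (2 * e)) \<le> ?a + ?b" .
        then have "ennreal (norm (f x * cnj (f y) * of_real (exp (- (norm (x - y))\<^sup>2 / (2 * e))))) \<le> ennreal (?a + ?b)"
          by (intro ennreal_leI) (simp add: norm_mult)
        also have "\<dots> = ennreal (1/2) * (?N x * ?k x y) + ennreal (1/2) * (?N y * ?k x y)"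
          by (subst ennreal_plus, simp, simp, intro arg_cong2[where f = "(+)"] half) auto
      finally show "ennreal (norm (f x * cnj (f y) * of_real (exp (- (norm (x - y))\<^sup>2 / (2 * e)))))
         \<le> ennreal (1/2) * (?N x * ?k x y) + ennreal (1/2) * (?N y * ?k x y)" .
    qed
    also have "\<dots> = (\<integral>\<^sup>+x. (\<integral>\<^sup>+y. ennreal (1/2) * (?N x * ?k x y) \<partial>lborel) \<partial>lborel) + (\<integral>\<^sup>+x. (\<integral>\<^sup>+y. ennreal (1/2) * (?N y * ?k x y) \<partial>lborel) \<partial>lborel)"
      by (simp add: nn_integral_add)
    also have "(\<integral>\<^sup>+x. (\<integral>\<^sup>+y. ennreal (1/2) * (?N y * ?k x y) \<partial>lborel) \<partial>lborel)
      = (\<integral>\<^sup>+y. (\<integral>\<^sup>+x. ennreal (1/2) * (?N y * ?k x y) \<partial>lborel) \<partial>lborel)"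
      by (rule lborel_pair.Fubini'[symmetric]) measurable
    also have "(\<integral>\<^sup>+x. (\<integral>\<^sup>+y. ennreal (1/2) * (?N x * ?k x y) \<partial>lborel) \<partial>lborel) + \<dots>
      = ennreal (sqrt (2 * pi * e) ^ DIM('a)) * (\<integral>\<^sup>+x. ?N x \<partial>lborel)"
    proof -
      have "ennreal (1/2) + ennreal (1/2) = 1" by (subst ennreal_plus[symmetric]) auto
      then have h: "ennreal (1/2) * a + ennreal (1/2) * a = a" for a
        by (simp only: distrib_right[symmetric] mult_1)
      have "(\<integral>\<^sup>+y. ennreal (1/2) * (c * ?k x y) \<partial>lborel) = ennreal (1/2) * (c * ennreal (sqrt (2 * pi * e) ^ DIM('a)))"
        and "(\<integral>\<^sup>+y. ennreal (1/2) * (c * ?k y x) \<partial>lborel) = ennreal (1/2) * (c * ennreal (sqrt (2 * pi * e) ^ DIM('a)))" for c x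
        by (subst nn_integral_cmult, measurable, subst nn_integral_cmult, measurable, simp only: kx ky)+
      moreover have "(\<integral>\<^sup>+x. ennreal (1/2) * (?N x * G) \<partial>lborel) = ennreal (1/2) * ((\<integral>\<^sup>+x. ?N x \<partial>lborel) * G)" for G
        by (subst nn_integral_cmult, measurable, subst nn_integral_multc, measurable)
      ultimately show ?thesis by (simp only: h) (rule mult.commute)
    qed
    finally have I: "ennreal (norm ?I) \<le> ennreal (sqrt (2 * pi * e) ^ DIM('a)) * (\<integral>\<^sup>+x. ?N x \<partial>lborel)" .
    have "(\<integral>\<^sup>+p. ennreal (exp (- (e * (norm p)\<^sup>2) / 2) * (norm (fourier f p))\<^sup>2) \<partial>lborel)
      = ennreal (\<integral>p. exp (- (e * (norm p)\<^sup>2) / 2) * (norm (fourier f p))\<^sup>2 \<partial>lborel)"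
      by (rule nn_integral_eq_integral[OF integrable_gauss_fourier[OF f e]]) simp
    also have "\<dots> \<le> ennreal (norm (complex_of_real (\<integral>p. exp (- (e * (norm p)\<^sup>2) / 2) * (norm (fourier f p))\<^sup>2 \<partial>lborel)))"
      by (intro ennreal_leI) simp
    also have "\<dots> = ennreal (sqrt (2 * pi / e) ^ DIM('a)) * ennreal (norm ?I)"
      unfolding integral_gauss_fourier[OF f e] norm_mult
      using e by (subst ennreal_mult) (auto simp: norm_power)
    also have "\<dots> \<le> ennreal (sqrt (2 * pi / e) ^ DIM('a)) * (ennreal (sqrt (2 * pi * e) ^ DIM('a)) * (\<integral>\<^sup>+x. ?N x \<partial>lborel))"
      by (intro mult_left_mono I) simp
    also have "\<dots> = ennreal ((2 * pi) ^ DIM('a)) * (\<integral>\<^sup>+x. ?N x \<partial>lborel)"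
    proof -
      have "sqrt (2 * pi / e) * sqrt (2 * pi * e) = sqrt ((2 * pi)\<^sup>2)"
        using e by (subst real_sqrt_mult[symmetric]) (simp add: power2_eq_square)
      also have "\<dots> = 2 * pi" by (simp only: real_sqrt_abs) simp
      finally have "sqrt (2 * pi / e) * sqrt (2 * pi * e) = 2 * pi" .
      then have "sqrt (2 * pi / e) ^ DIM('a) * sqrt (2 * pi * e) ^ DIM('a) = (2 * pi) ^ DIM('a)"
        by (simp only: power_mult_distrib[symmetric])
      then show ?thesis using e by (simp add: mult.assoc[symmetric] ennreal_mult[symmetric])
    qed
    finally show "(\<integral>\<^sup>+p. ennreal (exp (- ((1 / real (Suc k)) * (norm p)\<^sup>2) / 2) * (norm (fourier f p))\<^sup>2) \<partial>lborel)
      \<le> ennreal ((2 * pi) ^ DIM('a)) * (\<integral>\<^sup>+x. ennreal ((norm (f x))\<^sup>2) \<partial>lborel)"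
      by (simp add: e_def)
  qed
qed simp

text \<open>Equality comes from the Gaussian kernel acting as an approximate identity: after the
  substitution \<open>y = x + sqrt e *\<^sub>R z\<close> the inner integral converges at every point
  of continuity. Boundedness of \<open>f\<close> supplies the dominating functions for both
  integrals. Windowed indicators of boxes satisfy these hypotheses.\<close>

lemma fourier_plancherel:
  fixes f :: "'a::euclidean_space \<Rightarrow> complex"
  assumes f: "integrable lborel f" and B: "\<And>x. norm (f x) \<le> B" and c: "AE x in lborel. isCont f x"
  shows "(\<integral>\<^sup>+p. ennreal ((norm (fourier f p))\<^sup>2) \<partial>lborel)
    = ennreal ((2 * pi) ^ DIM('a) * (\<integral>x. (norm (f x))\<^sup>2 \<partial>lborel))"
proof -
  have m [measurable]: "f \<in> borel_measurable borel" using f by auto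
  have B0: "0 \<le> B" using B[of 0] norm_ge_zero order_trans by blast
  define e where "e k = 1 / real (Suc k)" for k
  have e: "0 < e k" for k by (simp add: e_def)
  have e0: "(\<lambda>k. sqrt (e k)) \<longlonglongrightarrow> 0"
    using tendsto_real_sqrt[OF LIMSEQ_Suc[OF lim_1_over_n]] by (simp add: e_def del: of_nat_Suc)
  define r where "r k = (\<integral>p. exp (- (e k * (norm p)\<^sup>2) / 2) * (norm (fourier f p))\<^sup>2 \<partial>lborel)" for k
  define g where "g z = exp (- (1 * (norm z)\<^sup>2) / 2)" for z :: 'a
  have g0: "0 \<le> g z" for z by (simp add: g_def)
  have gm [measurable]: "g \<in> borel_measurable borel" unfolding g_def by measurable
  have gi: "integrable lborel g" "(\<integral>z. g z \<partial>lborel) = sqrt (2 * pi) ^ DIM('a)"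
    unfolding g_def using integrable_gauss[of 1, where 'a = 'a] integral_gauss[of 1, where 'a = 'a] by auto
  define J where "J k x = (\<integral>z. f x * cnj (f (x + sqrt (e k) *\<^sub>R z)) * of_real (g z) \<partial>lborel)" for k x
  have Jm [measurable]: "J k \<in> borel_measurable borel" for k
  proof -
    have "(\<lambda>x. \<integral>z. f x * cnj (f (x + sqrt (e k) *\<^sub>R z)) * of_real (g z) \<partial>lborel) \<in> borel_measurable lborel"
      by measurable
    then show ?thesis by (simp add: J_def[abs_def])
  qed
  have r: "of_real (r k) = of_real (sqrt (2 * pi) ^ DIM('a)) * (\<integral>x. J k x \<partial>lborel)" for k
  proof -
    have "(\<integral>y. f x * cnj (f y) * of_real (exp (- (norm (x - y))\<^sup>2 / (2 * e k))) \<partial>lborel)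
        = sqrt (e k) ^ DIM('a) *\<^sub>R J k x" for x
      unfolding J_def
      by (subst lborel_integral_affine[where c = "sqrt (e k)" and t = x])
         (use e[of k] in \<open>auto simp: g_def power_mult_distrib\<close>)
    then have "of_real (r k) = of_real (sqrt (2 * pi / e k) ^ DIM('a)) * (\<integral>x. sqrt (e k) ^ DIM('a) *\<^sub>R J k x \<partial>lborel)"
      unfolding r_def integral_gauss_fourier[OF f e] by simp
    also have "\<dots> = of_real (sqrt (2 * pi / e k) ^ DIM('a) * sqrt (e k) ^ DIM('a)) * (\<integral>x. J k x \<partial>lborel)"
      by (simp add: scaleR_conv_of_real)
    also have "sqrt (2 * pi / e k) ^ DIM('a) * sqrt (e k) ^ DIM('a) = sqrt (2 * pi) ^ DIM('a)"
      using e[of k] by (simp flip: power_mult_distrib real_sqrt_mult)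
    finally show ?thesis .
  qed
  have Jlim: "AE x in lborel. (\<lambda>k. J k x) \<longlonglongrightarrow> of_real ((norm (f x))\<^sup>2 * sqrt (2 * pi) ^ DIM('a))"
    using c
  proof eventually_elim
    case (elim x)
    have "(\<lambda>k. J k x) \<longlonglongrightarrow> (\<integral>z. f x * cnj (f x) * of_real (g z) \<partial>lborel)"
      unfolding J_def
    proof (rule integral_dominated_convergence[where w = "\<lambda>z. norm (f x) * B * g z"])
      show "integrable lborel (\<lambda>z. norm (f x) * B * g z)" by (intro integrable_mult_right gi)
      show "AE z in lborel. (\<lambda>k. f x * cnj (f (x + sqrt (e k) *\<^sub>R z)) * of_real (g z)) \<longlonglongrightarrow> f x * cnj (f x) * of_real (g z)"
      proof (intro AE_I2 tendsto_intros)
        fix z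
        have "(\<lambda>k. x + sqrt (e k) *\<^sub>R z) \<longlonglongrightarrow> x + 0 *\<^sub>R z" by (intro tendsto_intros e0)
        then show "(\<lambda>k. f (x + sqrt (e k) *\<^sub>R z)) \<longlonglongrightarrow> f x"
          using isCont_tendsto_compose[OF elim] by simp
      qed
      show "AE z in lborel. norm (f x * cnj (f (x + sqrt (e k) *\<^sub>R z)) * of_real (g z)) \<le> norm (f x) * B * g z" for k
        using B g0 by (intro AE_I2) (auto simp: norm_mult intro!: mult_right_mono mult_left_mono)
    qed measurable
    also have "(\<integral>z. f x * cnj (f x) * of_real (g z) \<partial>lborel) = of_real ((norm (f x))\<^sup>2 * sqrt (2 * pi) ^ DIM('a))"
      by (simp only: integral_mult_right_zero integral_complex_of_real gi complex_norm_square of_real_mult)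
    finally show ?case .
  qed
  have fin: "integrable lborel (\<lambda>x. (norm (f x))\<^sup>2)"
    by (rule Bochner_Integration.integrable_bound[OF integrable_mult_left[OF integrable_norm[OF f], of B]])
       (use B B0 in \<open>auto simp: power2_eq_square intro!: AE_I2 mult_left_mono\<close>)
  have J1: "(\<lambda>k. \<integral>x. J k x \<partial>lborel) \<longlonglongrightarrow> (\<integral>x. of_real ((norm (f x))\<^sup>2 * sqrt (2 * pi) ^ DIM('a)) \<partial>lborel)"
  proof (rule integral_dominated_convergence[OF _ _ _ Jlim, where w = "\<lambda>x. norm (f x) * (B * sqrt (2 * pi) ^ DIM('a))"])
    show "integrable lborel (\<lambda>x. norm (f x) * (B * sqrt (2 * pi) ^ DIM('a)))"
      by (intro integrable_mult_left integrable_norm f)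
    show "AE x in lborel. norm (J k x) \<le> norm (f x) * (B * sqrt (2 * pi) ^ DIM('a))" for k
    proof (rule AE_I2)
      fix x
      have pw: "norm (f x * cnj (f (x + sqrt (e k) *\<^sub>R z)) * of_real (g z)) \<le> norm (f x) * B * g z" for z
        using B g0 by (auto simp: norm_mult intro!: mult_right_mono mult_left_mono)
      have gi2: "integrable lborel (\<lambda>z. norm (f x) * B * g z)" by (intro integrable_mult_right gi)
      have "norm (J k x) \<le> (\<integral>z. norm (f x) * B * g z \<partial>lborel)"
        unfolding J_def
      proof (rule Bochner_Integration.integral_norm_bound_integral[OF _ gi2 pw])
        show "integrable lborel (\<lambda>z. f x * cnj (f (x + sqrt (e k) *\<^sub>R z)) * of_real (g z))"
          using pw by (intro Bochner_Integration.integrable_bound[OF gi2]) (auto intro!: AE_I2 order_trans[OF pw])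
      qed
      then show "norm (J k x) \<le> norm (f x) * (B * sqrt (2 * pi) ^ DIM('a))" by (simp add: gi mult.assoc)
    qed
  qed measurable
  have sq: "sqrt (2 * pi) ^ DIM('a) * sqrt (2 * pi) ^ DIM('a) = (2 * pi) ^ DIM('a)"
    by (simp only: power_mult_distrib[symmetric] real_sqrt_mult_self) simp
  from J1 have "(\<lambda>k. complex_of_real (r k)) \<longlonglongrightarrow> of_real (sqrt (2 * pi) ^ DIM('a)) * of_real ((\<integral>x. (norm (f x))\<^sup>2 \<partial>lborel) * sqrt (2 * pi) ^ DIM('a))"
    unfolding r integral_complex_of_real integral_mult_left_zero by (intro tendsto_mult tendsto_const)
  then have "(\<lambda>k. complex_of_real (r k)) \<longlonglongrightarrow> of_real ((2 * pi) ^ DIM('a) * (\<integral>x. (norm (f x))\<^sup>2 \<partial>lborel))"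
    unfolding of_real_mult[symmetric] mult.left_commute[of "sqrt (2 * pi) ^ DIM('a)"] sq
    by (simp only: mult.commute)
  then have rl: "r \<longlonglongrightarrow> (2 * pi) ^ DIM('a) * (\<integral>x. (norm (f x))\<^sup>2 \<partial>lborel)"
    by (simp only: tendsto_of_real_iff)
  have "ennreal (r k) = (\<integral>\<^sup>+p. ennreal (exp (- ((1 / real (Suc k)) * (norm p)\<^sup>2) / 2) * (norm (fourier f p))\<^sup>2) \<partial>lborel)" for k
    unfolding r_def e_def[symmetric]
    by (rule nn_integral_eq_integral[symmetric, OF integrable_gauss_fourier[OF f e]]) simp
  then have "(\<lambda>k. ennreal (r k)) \<longlonglongrightarrow> (\<integral>\<^sup>+p. ennreal ((norm (fourier f p))\<^sup>2) \<partial>lborel)"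
    using nn_integral_gauss_damping_limit[of "\<lambda>p. (norm (fourier f p))\<^sup>2"] by simp
  then show ?thesis using LIMSEQ_unique tendsto_ennrealI[OF rl] by blast
qed

section \<open>Coherent states\<close>

definition gauss_window :: "real \<Rightarrow> real^3 \<Rightarrow> real" where
  "gauss_window h y = (pi * h) powr (- 3 / 4) * exp (- (norm y)\<^sup>2 / (2 * h))"

lemma gauss_window_nonneg: "0 \<le> gauss_window h y"
  by (simp add: gauss_window_def)

lemma measurable_gauss_window [measurable]: "gauss_window h \<in> borel_measurable borel"
  unfolding gauss_window_def by measurable

lemma coherent_state_alt: "coherent_state h q p x = of_real (gauss_window h (x - q)) * cis (((1 / h) *\<^sub>R p) \<bullet> x)"
  by (simp add: coherent_state_def gauss_window_def cis_conv_exp)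

lemma gauss_window_sq:
  assumes h: "0 < h"
  shows "(gauss_window h y)\<^sup>2 = (1 / sqrt (pi * h)) ^ 3 * exp (- ((2 / h) * (norm y)\<^sup>2) / 2)"
proof -
  have "((pi * h) powr (- 3 / 4))\<^sup>2 = (pi * h) powr (- 3 / 2)"
    by (simp add: power2_eq_square powr_add[symmetric])
  also have "\<dots> = ((pi * h) powr (- 1 / 2)) powr 3" by (simp add: powr_powr)
  also have "\<dots> = ((pi * h) powr (- 1 / 2)) ^ 3" using h by (subst powr_numeral) auto
  also have "(pi * h) powr (- 1 / 2) = 1 / sqrt (pi * h)"
    using powr_minus_divide[of "pi * h" "1 / 2"] h by (simp add: powr_half_sqrt)
  finally have 1: "((pi * h) powr (- 3 / 4))\<^sup>2 = (1 / sqrt (pi * h)) ^ 3" .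
  have "(exp (- (norm y)\<^sup>2 / (2 * h)))\<^sup>2 = exp (- ((2 / h) * (norm y)\<^sup>2) / 2)"
    using h by (simp add: power2_eq_square exp_add[symmetric] field_simps)
  with 1 show ?thesis unfolding gauss_window_def power_mult_distrib by simp
qed

lemma nn_integral_gauss_window_sq:
  assumes h: "0 < h" shows "(\<integral>\<^sup>+y. ennreal ((gauss_window h y)\<^sup>2) \<partial>lborel) = 1"
proof -
  have "(\<integral>\<^sup>+y. ennreal ((gauss_window h y)\<^sup>2) \<partial>lborel)
     = ennreal ((1 / sqrt (pi * h)) ^ 3) * (\<integral>\<^sup>+y. ennreal (exp (- ((2 / h) * (norm (y::real^3))\<^sup>2) / 2)) \<partial>lborel)"
    unfolding gauss_window_sq[OF h] using h by (subst nn_integral_cmult[symmetric]) (auto simp: ennreal_mult)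
  also have "\<dots> = ennreal ((1 / sqrt (pi * h)) ^ 3 * sqrt (2 * pi / (2 / h)) ^ 3)"
    using h by (subst nn_integral_gauss) (auto simp: ennreal_mult)
  also have "(1 / sqrt (pi * h)) ^ 3 * sqrt (2 * pi / (2 / h)) ^ 3 = 1"
    using h by (simp flip: power_mult_distrib)
  finally show ?thesis by simp
qed

text \<open>The one constant behind all error terms: a multiplier bounded by
  \<open>k * (1 + (norm (x - q))\<^sup>2 / h)\<close> costs at most the factor
  \<open>k\<^sup>2 * window_moment\<close> in the squared norm of the transform.\<close>

definition window_moment :: ennreal where
  "window_moment = (\<integral>\<^sup>+y. ennreal ((gauss_window 1 y * (1 + (norm y)\<^sup>2))\<^sup>2) \<partial>lborel)"

lemma window_moment_finite: "window_moment < \<infinity>"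
proof -
  have "(gauss_window 1 y * (1 + (norm y)\<^sup>2))\<^sup>2 \<le> ((1 / sqrt (pi * 1)) ^ 3 * 8) * exp (- (1 * (norm y)\<^sup>2) / 2)" for y
  proof -
    define t where "t = (norm y)\<^sup>2"
    have t: "0 \<le> t" by (simp add: t_def)
    \<comment> \<open>Half of the Gaussian decay pays for the polynomial. The factor
      \<open>8\<close> makes the quadratic Taylor term of \<open>exp (t / 2)\<close> equal to
      \<open>t\<^sup>2\<close>.\<close>
    have "(1 + t)\<^sup>2 \<le> 8 * (1 + t / 2 + (t / 2)\<^sup>2 / 2)"
      using t by (simp add: power2_eq_square field_simps)
    also have "\<dots> \<le> 8 * exp (t / 2)"
      using exp_lower_Taylor_quadratic[of "t / 2"] t by simp
    finally have "exp (- t) * (1 + t)\<^sup>2 \<le> exp (- t) * (8 * exp (t / 2))" by (intro mult_left_mono) auto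
    also have "\<dots> = 8 * exp (- t / 2)" by (simp flip: exp_add)
    finally have "exp (- t) * (1 + t)\<^sup>2 \<le> 8 * exp (- t / 2)" .
    then have "(1 / sqrt (pi * 1)) ^ 3 * (exp (- t) * (1 + t)\<^sup>2) \<le> (1 / sqrt (pi * 1)) ^ 3 * (8 * exp (- t / 2))"
      by (intro mult_left_mono) auto
    then show ?thesis by (simp add: power_mult_distrib gauss_window_sq[of 1] t_def mult_ac)
  qed
  then have "window_moment \<le> (\<integral>\<^sup>+y. ennreal (((1 / sqrt (pi * 1)) ^ 3 * 8) * exp (- (1 * (norm (y::real^3))\<^sup>2) / 2)) \<partial>lborel)"
    unfolding window_moment_def by (intro nn_integral_mono ennreal_leI)
  also have "\<dots> = ennreal ((1 / sqrt (pi * 1)) ^ 3 * 8) * (\<integral>\<^sup>+y. ennreal (exp (- (1 * (norm (y::real^3))\<^sup>2) / 2)) \<partial>lborel)"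
    by (subst nn_integral_cmult[symmetric]) (auto simp: ennreal_mult)
  also have "\<dots> < \<infinity>" by (subst nn_integral_gauss) (auto simp: ennreal_mult_less_top)
  finally show ?thesis .
qed

text \<open>Scaling by \<open>sqrt h\<close> maps the window of width \<open>h\<close> and its
  adapted weight to those at \<open>h = 1\<close>.\<close>

lemma nn_integral_window_moment:
  assumes h: "0 < h"
  shows "(\<integral>\<^sup>+y. ennreal ((gauss_window h y * (1 + (norm y)\<^sup>2 / h))\<^sup>2) \<partial>lborel) = window_moment"
proof -
  have "(\<integral>\<^sup>+y. ennreal ((gauss_window h y * (1 + (norm y)\<^sup>2 / h))\<^sup>2) \<partial>lborel)
    = ennreal (sqrt h ^ 3) * (\<integral>\<^sup>+z. ennreal ((gauss_window h (0 + sqrt h *\<^sub>R z) * (1 + (norm (0 + sqrt h *\<^sub>R z))\<^sup>2 / h))\<^sup>2) \<partial>lborel)"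
    using h by (subst lborel_nn_integral_affine[where c = "sqrt h" and t = 0]) auto
  also have "\<dots> = (\<integral>\<^sup>+z. ennreal (sqrt h ^ 3 * (gauss_window h (sqrt h *\<^sub>R z) * (1 + (norm (sqrt h *\<^sub>R z))\<^sup>2 / h))\<^sup>2) \<partial>lborel)"
    using h by (subst nn_integral_cmult[symmetric]) (auto simp: ennreal_mult)
  also have "\<dots> = window_moment"
    unfolding window_moment_def
  proof (intro nn_integral_cong arg_cong[where f = ennreal])
    fix z :: "real^3"
    have "sqrt h ^ 3 * (1 / sqrt (pi * h)) ^ 3 = (1 / sqrt (pi * 1)) ^ 3"
      using h by (simp add: real_sqrt_mult flip: power_mult_distrib)
    moreover have n: "(norm (sqrt h *\<^sub>R z))\<^sup>2 = h * (norm z)\<^sup>2" using h by (simp add: power_mult_distrib)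
    ultimately have "sqrt h ^ 3 * (gauss_window h (sqrt h *\<^sub>R z))\<^sup>2 = (gauss_window 1 z)\<^sup>2"
      using h by (simp only: gauss_window_sq[OF h] gauss_window_sq[of 1] zero_less_one mult.assoc[symmetric]) (simp add: field_simps)
    then show "sqrt h ^ 3 * (gauss_window h (sqrt h *\<^sub>R z) * (1 + (norm (sqrt h *\<^sub>R z))\<^sup>2 / h))\<^sup>2
       = (gauss_window 1 z * (1 + (norm z)\<^sup>2))\<^sup>2"
      using h n by (simp add: power_mult_distrib mult.assoc[symmetric])
  qed
  finally show ?thesis .
qed

text \<open>The coherent transform of \<open>u\<close> with a multiplier inserted that may depend on
  the base point \<open>q\<close>. The multiplier \<open>1\<close> gives the transform itself; the
  others used below are the error terms created by the Schroedinger operator.\<close>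

definition weighted_coherent :: "real \<Rightarrow> (real^3 \<Rightarrow> real^3 \<Rightarrow> complex) \<Rightarrow> L2 \<Rightarrow> (real^3) \<times> (real^3) \<Rightarrow> complex" where
  "weighted_coherent h m u z =
     (\<integral>x. cnj (coherent_state h (fst z) (snd z) x) * (m (fst z) x * rep_L2 u x) \<partial>lborel)"

lemma measurable_coherent_state_joint [measurable]:
  "(\<lambda>(z, x). coherent_state h (fst z) (snd z) x) \<in> borel_measurable (lborel \<Otimes>\<^sub>M lborel)"
  unfolding coherent_state_alt by measurable

lemma measurable_coherent_state [measurable]: "coherent_state h q p \<in> borel_measurable borel"
  unfolding coherent_state_alt by measurable

lemma measurable_weighted_coherent:
  assumes [measurable]: "(\<lambda>(q, x). m q x) \<in> borel_measurable (lborel \<Otimes>\<^sub>M lborel)"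
  shows "weighted_coherent h m u \<in> borel_measurable borel"
proof -
  let ?L6 = "lborel :: ((real^3) \<times> (real^3)) measure" and ?L3 = "lborel :: (real^3) measure"
  have "(\<lambda>y. (fst (fst y), snd y)) \<in> ?L6 \<Otimes>\<^sub>M ?L3 \<rightarrow>\<^sub>M ?L3 \<Otimes>\<^sub>M ?L3"
  proof (rule measurable_Pair)
    show "(\<lambda>y. fst (fst y)) \<in> ?L6 \<Otimes>\<^sub>M ?L3 \<rightarrow>\<^sub>M ?L3"
      using measurable_compose[OF measurable_fst[of ?L6 ?L3], of fst ?L3] by simp
  qed (rule measurable_snd)
  from measurable_compose[OF this assms]
  have [measurable]: "(\<lambda>(z :: (real^3) \<times> (real^3), x). m (fst z) x) \<in> borel_measurable (lborel \<Otimes>\<^sub>M lborel)"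
    by (simp add: case_prod_beta')
  have "(\<lambda>z. \<integral>x. cnj (coherent_state h (fst z) (snd z) x) * (m (fst z) x * rep_L2 u x) \<partial>lborel) \<in> borel_measurable lborel"
    by measurable
  then show ?thesis by (simp add: weighted_coherent_def[abs_def])
qed

lemma weighted_coherent_fourier:
  "weighted_coherent h m u (q, p) = fourier (\<lambda>x. of_real (gauss_window h (x - q)) * m q x * rep_L2 u x) ((1 / h) *\<^sub>R p)"
  unfolding weighted_coherent_def fourier_def coherent_state_alt
  by (intro Bochner_Integration.integral_cong refl) (simp add: cis_cnj)

lemma nn_integral_weighted_coherent_p:
  assumes h: "0 < h" and [measurable]: "(\<lambda>x. of_real (gauss_window h (x - q)) * m q x * rep_L2 u x) \<in> borel_measurable borel"
  shows "(\<integral>\<^sup>+p. ennreal ((norm (weighted_coherent h m u (q, p)))\<^sup>2) \<partial>lborel)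
    = ennreal (h ^ 3) * (\<integral>\<^sup>+k. ennreal ((norm (fourier (\<lambda>x. of_real (gauss_window h (x - q)) * m q x * rep_L2 u x) k))\<^sup>2) \<partial>lborel)"
  unfolding weighted_coherent_fourier
  by (subst lborel_nn_integral_affine[where c = h and t = 0]) (use h in auto)

text \<open>For fixed \<open>q\<close> the transform is a Fourier transform at \<open>p / h\<close>,
  so Bessel's inequality applies and the substitution contributes \<open>h ^ 3\<close>. Exchanging
  the integrals in \<open>q\<close> and \<open>x\<close> then isolates the integral of the squared
  weighted window over \<open>q\<close>, which is \<open>window_moment\<close> for every
  \<open>x\<close>.\<close>

lemma
  assumes h: "0 < h" and k: "0 \<le> k"
    and m [measurable]: "(\<lambda>(q, x). m q x) \<in> borel_measurable (lborel \<Otimes>\<^sub>M lborel)"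
    and mb: "\<And>q x. norm (m q x) \<le> k * (1 + (norm (x - q))\<^sup>2 / h)"
  shows square_integrable_weighted_window: "square_integrable (\<lambda>x. of_real (gauss_window h (x - q)) * m q x)"
    and integrable_weighted_window: "integrable lborel (\<lambda>x. of_real (gauss_window h (x - q)) * m q x * rep_L2 u x)"
    and weighted_coherent_bound: "(\<integral>\<^sup>+z. ennreal ((norm (weighted_coherent h m u z))\<^sup>2) \<partial>lborel)
      \<le> ennreal ((2 * pi * h) ^ 3) * (ennreal (k\<^sup>2) * window_moment * ennreal ((norm u)\<^sup>2))"
proof -
  let ?v = "\<lambda>y. ennreal ((gauss_window h y * (1 + (norm y)\<^sup>2 / h))\<^sup>2)"
  have mq [measurable]: "m q \<in> borel_measurable borel" for q
    using measurable_Pair2[OF m, of q] by simp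
  have win: "(norm (of_real (gauss_window h (x - q)) * m q x))\<^sup>2 \<le> k\<^sup>2 * (gauss_window h (x - q) * (1 + (norm (x - q))\<^sup>2 / h))\<^sup>2" for q x
  proof -
    have "norm (of_real (gauss_window h (x - q)) * m q x) \<le> gauss_window h (x - q) * (k * (1 + (norm (x - q))\<^sup>2 / h))"
      unfolding norm_mult using gauss_window_nonneg[of h "x - q"] mb by (intro mult_mono) auto
    then have "(norm (of_real (gauss_window h (x - q)) * m q x))\<^sup>2 \<le> (gauss_window h (x - q) * (k * (1 + (norm (x - q))\<^sup>2 / h)))\<^sup>2"
      by (intro power_mono) auto
    then show ?thesis by (simp add: power_mult_distrib mult_ac)
  qed
  have vx: "(\<integral>\<^sup>+x. ?v (x - q) \<partial>lborel) = window_moment" for q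
    using lborel_nn_integral_affine[of ?v 1 "- q"] nn_integral_window_moment[OF h] by simp
  have vq: "(\<integral>\<^sup>+q. ?v (x - q) \<partial>lborel) = window_moment" for x
    using lborel_nn_integral_reflect[of ?v x] nn_integral_window_moment[OF h] by simp
  show sq: "square_integrable (\<lambda>x. of_real (gauss_window h (x - q)) * m q x)" for q
  proof (rule square_integrableI)
    have "(\<integral>\<^sup>+ x. ennreal ((norm (of_real (gauss_window h (x - q)) * m q x))\<^sup>2) \<partial>lborel)
      \<le> (\<integral>\<^sup>+ x. ennreal (k\<^sup>2) * ?v (x - q) \<partial>lborel)"
      using win by (intro nn_integral_mono) (simp add: ennreal_mult[symmetric] ennreal_leI)
    also have "\<dots> = ennreal (k\<^sup>2) * window_moment" by (simp add: nn_integral_cmult vx)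
    also have "\<dots> < \<infinity>" using window_moment_finite by (simp add: ennreal_mult_less_top)
    finally show "(\<integral>\<^sup>+ x. ennreal ((norm (of_real (gauss_window h (x - q)) * m q x))\<^sup>2) \<partial>lborel) < \<infinity>" .
  qed measurable
  show int: "integrable lborel (\<lambda>x. of_real (gauss_window h (x - q)) * m q x * rep_L2 u x)" for q
  proof -
    have "square_integrable (\<lambda>x. cnj (of_real (gauss_window h (x - q)) * m q x))"
      using sq[of q] by (auto simp: square_integrable_def simp del: complex_cnj_mult)
    from square_integrable_mult_integrable[OF this square_integrable_rep[of u]] show ?thesis by simp
  qed
  have wm [measurable]: "weighted_coherent h m u \<in> borel_measurable borel" by (rule measurable_weighted_coherent[OF m])
  have "(\<integral>\<^sup>+z. ennreal ((norm (weighted_coherent h m u z))\<^sup>2) \<partial>lborel)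
     = (\<integral>\<^sup>+q. (\<integral>\<^sup>+p. ennreal ((norm (weighted_coherent h m u (q, p)))\<^sup>2) \<partial>lborel) \<partial>lborel)"
    unfolding lborel_prod[symmetric] by (rule lborel.nn_integral_fst[symmetric]) (simp add: lborel_prod)
  also have "\<dots> \<le> (\<integral>\<^sup>+q. ennreal (h ^ 3) * (ennreal ((2 * pi) ^ 3) *
      (\<integral>\<^sup>+x. ennreal ((norm (of_real (gauss_window h (x - q)) * m q x * rep_L2 u x))\<^sup>2) \<partial>lborel)) \<partial>lborel)"
    using fourier_bessel[OF int]
    by (intro nn_integral_mono, subst nn_integral_weighted_coherent_p[OF h]) (auto intro!: mult_left_mono)
  also have "\<dots> \<le> (\<integral>\<^sup>+q. ennreal (h ^ 3) * (ennreal ((2 * pi) ^ 3) *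
      (\<integral>\<^sup>+x. ennreal (k\<^sup>2) * (?v (x - q) * ennreal ((norm (rep_L2 u x))\<^sup>2)) \<partial>lborel)) \<partial>lborel)"
  proof (intro nn_integral_mono mult_left_mono)
    fix q x
    show "ennreal ((norm (of_real (gauss_window h (x - q)) * m q x * rep_L2 u x))\<^sup>2)
      \<le> ennreal (k\<^sup>2) * (?v (x - q) * ennreal ((norm (rep_L2 u x))\<^sup>2))"
      using mult_right_mono[OF win[of x q], of "(norm (rep_L2 u x))\<^sup>2"]
      by (simp add: ennreal_mult[symmetric] norm_mult power_mult_distrib mult.assoc ennreal_leI)
  qed auto
  also have "\<dots> = ennreal (h ^ 3) * (ennreal ((2 * pi) ^ 3) * (ennreal (k\<^sup>2) *
      (\<integral>\<^sup>+q. (\<integral>\<^sup>+x. ?v (x - q) * ennreal ((norm (rep_L2 u x))\<^sup>2) \<partial>lborel) \<partial>lborel)))"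
    by (simp add: nn_integral_cmult)
  also have "(\<integral>\<^sup>+q. (\<integral>\<^sup>+x. ?v (x - q) * ennreal ((norm (rep_L2 u x))\<^sup>2) \<partial>lborel) \<partial>lborel)
     = (\<integral>\<^sup>+x. (\<integral>\<^sup>+q. ?v (x - q) * ennreal ((norm (rep_L2 u x))\<^sup>2) \<partial>lborel) \<partial>lborel)"
    by (rule lborel_pair.Fubini') measurable
  also have "\<dots> = window_moment * ennreal ((norm u)\<^sup>2)"
    by (simp add: nn_integral_multc vq nn_integral_cmult nn_integral_rep_L2)
  finally have "(\<integral>\<^sup>+z. ennreal ((norm (weighted_coherent h m u z))\<^sup>2) \<partial>lborel)
    \<le> ennreal (h ^ 3) * (ennreal ((2 * pi) ^ 3) * (ennreal (k\<^sup>2) * (window_moment * ennreal ((norm u)\<^sup>2))))" .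
  moreover have "ennreal ((2 * pi * h) ^ 3) = ennreal (h ^ 3) * ennreal ((2 * pi) ^ 3)"
    using h by (simp add: ennreal_mult[symmetric] power_mult_distrib mult_ac)
  ultimately show "(\<integral>\<^sup>+z. ennreal ((norm (weighted_coherent h m u z))\<^sup>2) \<partial>lborel)
      \<le> ennreal ((2 * pi * h) ^ 3) * (ennreal (k\<^sup>2) * window_moment * ennreal ((norm u)\<^sup>2))"
    by (simp add: mult_ac)
qed

text \<open>Boxes are stable under intersection and generate the Borel sets, so a Dynkin argument
  makes the integral over every Borel subset of a bounded box vanish.\<close>

lemma AE_zero_if_box_integrals_zero:
  fixes f :: "'a::euclidean_space \<Rightarrow> real"
  assumes m [measurable]: "f \<in> borel_measurable borel"
    and i: "\<And>a b. integrable lborel (\<lambda>x. indicator (box a b) x * f x)"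
    and z: "\<And>a b. (\<integral>x. indicator (box a b) x * f x \<partial>lborel) = 0"
  shows "AE x in lborel. f x = 0"
proof -
  \<comment> \<open>Integrability is available only over boxes; the argument runs inside each member
    of an exhausting sequence of cubes.\<close>
  define B where "B n = box (- (real n *\<^sub>R One)) (real n *\<^sub>R One :: 'a)" for n :: nat
  have "AE x in lborel. indicator (B n) x * f x = 0" for n
  proof (rule density_unique_real)
    let ?f = "\<lambda>x. indicator (B n) x * f x"
    show fi: "integrable lborel ?f" unfolding B_def by (rule i)
    show "integrable lborel (\<lambda>x. 0)" by simp
    fix A :: "'a set" assume "A \<in> sets lborel"
    then have A: "A \<in> sigma_sets UNIV (range (\<lambda>(a, b). box a b))"
      by (simp add: borel_eq_box)
    have G: "Int_stable (range (\<lambda>(a, b). box a b :: 'a set))" "range (\<lambda>(a, b). box a b :: 'a set) \<subseteq> Pow UNIV"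
      by (auto simp: Int_stable_def box_Int_box)
    from G A have "(\<integral>x\<in>A. ?f x \<partial>lborel) = 0 \<and> A \<in> sets borel"
    proof (induction rule: sigma_sets_induct_disjoint)
      case (basic A)
      then obtain a b where A: "A = box a b" by auto
      then obtain c d where cd: "A \<inter> B n = box c d" by (auto simp: B_def box_Int_box)
      have "(\<integral>x\<in>A. ?f x \<partial>lborel) = (\<integral>x. indicator (box c d) x * f x \<partial>lborel)"
        unfolding set_lebesgue_integral_def cd[symmetric]
        by (intro Bochner_Integration.integral_cong refl) (auto simp: indicator_def)
      then show ?case using A z by simp
    next
      case empty show ?case by (simp add: set_lebesgue_integral_def)
    next
      case (compl A)
      then have [measurable]: "A \<in> sets borel" by simp
      have iA: "integrable lborel (\<lambda>x. indicator A x * ?f x)"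
        using integrable_mult_indicator[OF _ fi, of A] by simp
      have "(\<integral>x\<in>UNIV - A. ?f x \<partial>lborel) = (\<integral>x. ?f x - indicator A x * ?f x \<partial>lborel)"
        unfolding set_lebesgue_integral_def by (intro Bochner_Integration.integral_cong refl) (auto simp: indicator_def)
      also have "\<dots> = (\<integral>x. ?f x \<partial>lborel) - (\<integral>x. indicator A x * ?f x \<partial>lborel)"
        by (rule Bochner_Integration.integral_diff[OF fi iA])
      also have "\<dots> = 0" using compl z unfolding B_def by (simp add: set_lebesgue_integral_def)
      finally show ?case by simp
    next
      case (union A)
      then have [measurable]: "\<And>i. A i \<in> sets borel" by auto
      have "(\<integral>x\<in>(\<Union>i. A i). ?f x \<partial>lborel) = (\<Sum>i. \<integral>x\<in>A i. ?f x \<partial>lborel)"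
        using union(1) by (intro lebesgue_integral_countable_add)
          (auto simp: disjoint_family_on_def set_integrable_def intro!: integrable_mult_indicator[OF _ fi, simplified])
      then show ?case using union by auto
    qed
    then show "(\<integral>x\<in>A. ?f x \<partial>lborel) = (\<integral>x\<in>A. 0 \<partial>lborel)" by (simp add: set_lebesgue_integral_def)
  qed
  then have "AE x in lborel. \<forall>n. indicator (B n) x * f x = 0"
    unfolding AE_all_countable by blast
  then show ?thesis
  proof eventually_elim
    case (elim x)
    obtain n :: nat where n: "norm x < real n" using reals_Archimedean2 by blast
    have "x \<in> B n" unfolding B_def mem_box
    proof (intro ballI)
      fix b :: 'a assume b: "b \<in> Basis"
      have "\<bar>x \<bullet> b\<bar> < real n" using Basis_le_norm[OF b, of x] n by linarith
      then show "- (real n *\<^sub>R One) \<bullet> b < x \<bullet> b \<and> x \<bullet> b < (real n *\<^sub>R One) \<bullet> b"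
        using b unfolding abs_less_iff by simp
    qed
    then show ?case using elim[rule_format, of n] by simp
  qed
qed

text \<open>The test vectors of the isometry proof: they are total in the space, bounded, and
  continuous almost everywhere.\<close>

definition box_fun :: "real^3 \<Rightarrow> real^3 \<Rightarrow> real^3 \<Rightarrow> complex" where
  "box_fun a b x = of_real (indicator (box a b) x)"

lemma measurable_box_fun [measurable]: "box_fun a b \<in> borel_measurable borel"
  unfolding box_fun_def by measurable

lemma integrable_indicator_box: "integrable lborel (\<lambda>x. indicator (box a b) x :: real)"
  using emeasure_bounded_finite[OF bounded_box, of a b] by (simp add: integrable_indicator_iff)

lemma square_integrable_box_fun: "square_integrable (box_fun a b)"
proof -
  have "(\<lambda>x. (norm (box_fun a b x))\<^sup>2) = indicator (box a b)" by (auto simp: box_fun_def indicator_def)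
  then show ?thesis using integrable_indicator_box[of a b] by (simp add: square_integrable_def)
qed

lemma orthogonal_boxes_imp_zero:
  assumes "\<And>a b. cinner (abs_L2 (box_fun a b)) v = 0"
  shows "v = 0"
proof -
  have i: "integrable lborel (\<lambda>x. cnj (box_fun a b x) * rep_L2 v x)" for a b
    by (rule square_integrable_mult_integrable[OF square_integrable_box_fun square_integrable_rep])
  have z: "(\<integral>x. cnj (box_fun a b x) * rep_L2 v x \<partial>lborel) = 0" for a b
    using assms[of a b] by (simp add: cinner_abs_left[OF square_integrable_box_fun])
  have R: "indicator (box a b) x * Re (rep_L2 v x) = Re (cnj (box_fun a b x) * rep_L2 v x)"
    and I: "indicator (box a b) x * Im (rep_L2 v x) = Im (cnj (box_fun a b x) * rep_L2 v x)" for a b x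
    by (auto simp: box_fun_def)
  have "AE x in lborel. Re (rep_L2 v x) = 0"
    by (rule AE_zero_if_box_integrals_zero, measurable)
       (simp_all only: R integrable_Re[OF i] integral_Re[OF i] z zero_complex.simps)
  moreover have "AE x in lborel. Im (rep_L2 v x) = 0"
    by (rule AE_zero_if_box_integrals_zero, measurable)
       (simp_all only: I integrable_Im[OF i] integral_Im[OF i] z zero_complex.simps)
  ultimately have "AE x in lborel. rep_L2 v x = rep_L2 0 x"
    using rep_zero by eventually_elim (simp add: complex_eq_iff)
  then show ?thesis by (rule L2_eqI)
qed

lemma AE_isCont_box_fun: "AE x in lborel. isCont (box_fun a b) x"
proof -
  have "negligible (frontier (box a b))" by (rule negligible_convex_frontier) simp
  then have "frontier (box a b) \<in> null_sets lebesgue" by (simp add: negligible_iff_null_sets)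
  then have "frontier (box a b) \<in> null_sets lborel" by (simp add: null_sets_completion_iff)
  then have "AE x in lborel. x \<notin> frontier (box a b)" by (rule AE_not_in)
  then show ?thesis
  proof eventually_elim
    case (elim x)
    have "isCont (indicator (box a b) :: _ \<Rightarrow> real) x" using elim by (simp add: isCont_indicator)
    then show ?case unfolding box_fun_def[abs_def] by (intro continuous_intros)
  qed
qed

section \<open>The coherent transform is a multiple of an isometry\<close>

definition coherent_transform :: "real \<Rightarrow> L2 \<Rightarrow> (real^3) \<times> (real^3) \<Rightarrow> complex" where
  "coherent_transform h u z = cinner (abs_L2 (coherent_state h (fst z) (snd z))) u"

context
  fixes h :: real assumes h: "0 < h"
begin

lemma square_integrable_coherent_state: "square_integrable (coherent_state h q p)"
proof -
  have "(\<integral>\<^sup>+x. ennreal ((norm (coherent_state h q p x))\<^sup>2) \<partial>lborel) = (\<integral>\<^sup>+x. ennreal ((gauss_window h (x - q))\<^sup>2) \<partial>lborel)"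
    by (simp add: coherent_state_alt norm_mult gauss_window_nonneg)
  also have "\<dots> = 1"
    using lborel_nn_integral_affine[of "\<lambda>y. ennreal ((gauss_window h y)\<^sup>2)" 1 "- q"] nn_integral_gauss_window_sq[OF h] by simp
  finally show ?thesis by (intro square_integrableI) auto
qed

lemma coherent_transform_weighted: "coherent_transform h u = weighted_coherent h (\<lambda>_ _. 1) u"
  by (simp add: coherent_transform_def weighted_coherent_def cinner_abs_left square_integrable_coherent_state fun_eq_iff)

lemma measurable_coherent_transform [measurable]: "coherent_transform h u \<in> borel_measurable borel"
  unfolding coherent_transform_weighted by (rule measurable_weighted_coherent) measurable

lemma coherent_transform_add: "coherent_transform h (u + v) z = coherent_transform h u z + coherent_transform h v z"
  and coherent_transform_diff: "coherent_transform h (u - v) z = coherent_transform h u z - coherent_transform h v z"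
  and coherent_transform_scaleC: "coherent_transform h (scaleC c u) z = c * coherent_transform h u z"
  and coherent_transform_scaleR: "coherent_transform h (r *\<^sub>R u) z = of_real r * coherent_transform h u z"
  by (simp_all add: coherent_transform_def cinner_add_right cinner_diff_right cinner_scaleC_right cinner_scaleR_right)

lemma integrable_window_mult: "integrable lborel (\<lambda>x. of_real (gauss_window h (x - q)) * 1 * rep_L2 u x)"
  by (rule integrable_weighted_window[OF h, of 1]) (use h in auto)

lemma nn_integral_window_mult:
  "(\<integral>\<^sup>+q. (\<integral>\<^sup>+x. ennreal ((norm (of_real (gauss_window h (x - q)) * 1 * rep_L2 u x))\<^sup>2) \<partial>lborel) \<partial>lborel)
    = ennreal ((norm u)\<^sup>2)"
proof -
  have "(\<integral>\<^sup>+q. (\<integral>\<^sup>+x. ennreal ((norm (of_real (gauss_window h (x - q)) * 1 * rep_L2 u x))\<^sup>2) \<partial>lborel) \<partial>lborel)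
    = (\<integral>\<^sup>+q. (\<integral>\<^sup>+x. ennreal ((gauss_window h (x - q))\<^sup>2) * ennreal ((norm (rep_L2 u x))\<^sup>2) \<partial>lborel) \<partial>lborel)"
    by (intro nn_integral_cong) (simp add: norm_mult power_mult_distrib ennreal_mult)
  also have "\<dots> = (\<integral>\<^sup>+x. (\<integral>\<^sup>+q. ennreal ((gauss_window h (x - q))\<^sup>2) * ennreal ((norm (rep_L2 u x))\<^sup>2) \<partial>lborel) \<partial>lborel)"
    by (rule lborel_pair.Fubini') measurable
  also have "\<dots> = (\<integral>\<^sup>+x. ennreal ((norm (rep_L2 u x))\<^sup>2) \<partial>lborel)"
    using lborel_nn_integral_reflect[of "\<lambda>y. ennreal ((gauss_window h y)\<^sup>2)"] nn_integral_gauss_window_sq[OF h]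
    by (simp add: nn_integral_multc)
  finally show ?thesis by (simp add: nn_integral_rep_L2)
qed

lemma nn_integral_coherent_transform_fst:
  "(\<integral>\<^sup>+z. ennreal ((norm (coherent_transform h u z))\<^sup>2) \<partial>lborel)
    = (\<integral>\<^sup>+q. ennreal (h ^ 3) * (\<integral>\<^sup>+k. ennreal ((norm (fourier (\<lambda>x. of_real (gauss_window h (x - q)) * 1 * rep_L2 u x) k))\<^sup>2) \<partial>lborel) \<partial>lborel)"
proof -
  have wm [measurable]: "weighted_coherent h (\<lambda>_ _. 1) u \<in> borel_measurable borel" by (rule measurable_weighted_coherent) measurable
  have "(\<integral>\<^sup>+z. ennreal ((norm (weighted_coherent h (\<lambda>_ _. 1) u z))\<^sup>2) \<partial>lborel)
     = (\<integral>\<^sup>+q. (\<integral>\<^sup>+p. ennreal ((norm (weighted_coherent h (\<lambda>_ _. 1) u (q, p)))\<^sup>2) \<partial>lborel) \<partial>lborel)"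
    unfolding lborel_prod[symmetric] by (rule lborel.nn_integral_fst[symmetric]) (simp add: lborel_prod)
  then show ?thesis
    unfolding coherent_transform_weighted by (subst (asm) nn_integral_weighted_coherent_p[OF h]) auto
qed

lemma volume_split: "ennreal (h ^ 3) * (ennreal ((2 * pi) ^ 3) * c) = ennreal ((2 * pi * h) ^ 3) * c"
proof -
  have "ennreal ((2 * pi * h) ^ 3) = ennreal (h ^ 3) * ennreal ((2 * pi) ^ 3)"
    using h by (simp add: ennreal_mult[symmetric] power_mult_distrib mult_ac)
  then show ?thesis by (simp add: mult.assoc)
qed

lemma coherent_transform_bessel:
  "(\<integral>\<^sup>+z. ennreal ((norm (coherent_transform h u z))\<^sup>2) \<partial>lborel) \<le> ennreal ((2 * pi * h) ^ 3) * ennreal ((norm u)\<^sup>2)"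
proof -
  have "(\<integral>\<^sup>+z. ennreal ((norm (coherent_transform h u z))\<^sup>2) \<partial>lborel)
     \<le> (\<integral>\<^sup>+q. ennreal (h ^ 3) * (ennreal ((2 * pi) ^ 3) *
      (\<integral>\<^sup>+x. ennreal ((norm (of_real (gauss_window h (x - q)) * 1 * rep_L2 u x))\<^sup>2) \<partial>lborel)) \<partial>lborel)"
    unfolding nn_integral_coherent_transform_fst
    using fourier_bessel[OF integrable_window_mult] by (intro nn_integral_mono mult_left_mono) auto
  also have "\<dots> = ennreal ((2 * pi * h) ^ 3) *
      (\<integral>\<^sup>+q. (\<integral>\<^sup>+x. ennreal ((norm (of_real (gauss_window h (x - q)) * 1 * rep_L2 u x))\<^sup>2) \<partial>lborel) \<partial>lborel)"
    unfolding volume_split by (rule nn_integral_cmult) measurable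
  finally show ?thesis unfolding nn_integral_window_mult .
qed

text \<open>For a box the windowed function satisfies the hypotheses of
  \<open>fourier_plancherel\<close>, so Bessel's inequality in \<open>p\<close> is an equality for
  each \<open>q\<close>.\<close>

lemma coherent_transform_box:
  "(\<integral>\<^sup>+z. ennreal ((norm (coherent_transform h (abs_L2 (box_fun a b)) z))\<^sup>2) \<partial>lborel)
    = ennreal ((2 * pi * h) ^ 3) * ennreal ((norm (abs_L2 (box_fun a b)))\<^sup>2)"
proof -
  let ?u = "abs_L2 (box_fun a b)"
  let ?g = "\<lambda>q x. of_real (gauss_window h (x - q)) * 1 * rep_L2 ?u x"
  have ae: "AE x in lborel. rep_L2 ?u x = box_fun a b x" by (rule rep_abs_L2[OF square_integrable_box_fun])
  have "(\<integral>\<^sup>+k. ennreal ((norm (fourier (?g q) k))\<^sup>2) \<partial>lborel)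
    = ennreal ((2 * pi) ^ 3) * (\<integral>\<^sup>+x. ennreal ((norm (?g q x))\<^sup>2) \<partial>lborel)" for q
  proof -
    let ?f = "\<lambda>x. of_real (gauss_window h (x - q)) * box_fun a b x"
    have aef: "AE x in lborel. ?g q x = ?f x" using ae by eventually_elim simp
    have fi: "integrable lborel ?f"
      using integrable_window_mult[of q ?u] by (rule Bochner_Integration.integrable_cong_AE_imp) (use aef in \<open>auto elim: eventually_mono\<close>)
    have F: "fourier (?g q) k = fourier ?f k" for k
      unfolding fourier_def by (rule integral_cong_AE) (use aef in \<open>auto elim!: eventually_mono\<close>)
    have N: "(\<integral>\<^sup>+x. ennreal ((norm (?g q x))\<^sup>2) \<partial>lborel) = (\<integral>\<^sup>+x. ennreal ((norm (?f x))\<^sup>2) \<partial>lborel)"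
      by (rule nn_integral_cong_AE) (use aef in \<open>auto elim!: eventually_mono\<close>)
    have bd: "norm (?f x) \<le> (pi * h) powr (- 3 / 4)" for x
    proof -
      have "norm (?f x) \<le> gauss_window h (x - q)"
        using gauss_window_nonneg[of h "x - q"] by (auto simp: norm_mult box_fun_def indicator_def)
      also have "\<dots> \<le> (pi * h) powr (- 3 / 4)"
        unfolding gauss_window_def using h by (intro mult_left_le) auto
      finally show ?thesis .
    qed
    have c: "AE x in lborel. isCont ?f x"
      using AE_isCont_box_fun[of a b]
    proof eventually_elim
      case (elim x)
      show ?case unfolding gauss_window_def by (intro continuous_intros elim) (use h in auto)
    qed
    have n2: "integrable lborel (\<lambda>x. (norm (?f x))\<^sup>2)"
      by (rule Bochner_Integration.integrable_bound[OF integrable_mult_left[OF integrable_norm[OF fi], of "(pi * h) powr (- 3 / 4)"]])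
         (use bd fi in \<open>auto simp: power2_eq_square intro!: AE_I2 mult_left_mono\<close>)
    show ?thesis
      unfolding F N fourier_plancherel[OF fi bd c]
      by (subst nn_integral_eq_integral[OF n2]) (auto simp: ennreal_mult)
  qed
  then have "(\<integral>\<^sup>+z. ennreal ((norm (coherent_transform h ?u z))\<^sup>2) \<partial>lborel)
     = (\<integral>\<^sup>+q. ennreal ((2 * pi * h) ^ 3) * (\<integral>\<^sup>+x. ennreal ((norm (?g q x))\<^sup>2) \<partial>lborel) \<partial>lborel)"
    unfolding nn_integral_coherent_transform_fst volume_split[symmetric] by simp
  also have "\<dots> = ennreal ((2 * pi * h) ^ 3) * (\<integral>\<^sup>+q. (\<integral>\<^sup>+x. ennreal ((norm (?g q x))\<^sup>2) \<partial>lborel) \<partial>lborel)"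
    by (rule nn_integral_cmult) measurable
  finally show ?thesis unfolding nn_integral_window_mult .
qed

lemma integrable_coherent_transform_sq: "integrable lborel (\<lambda>z. (norm (coherent_transform h u z))\<^sup>2)"
proof (rule integrableI_bounded)
  have "(\<integral>\<^sup>+z. ennreal (norm ((norm (coherent_transform h u z))\<^sup>2)) \<partial>lborel) \<le> ennreal ((2 * pi * h) ^ 3) * ennreal ((norm u)\<^sup>2)"
    using coherent_transform_bessel[of u] by simp
  also have "\<dots> < \<infinity>" by (simp add: ennreal_mult_less_top)
  finally show "(\<integral>\<^sup>+z. ennreal (norm ((norm (coherent_transform h u z))\<^sup>2)) \<partial>lborel) < \<infinity>" .
qed measurable

text \<open>The defect \<open>b\<close> in the Bessel inequality is nonnegative and obeys the
  parallelogram law, so its zeros form a subspace. This contains all boxes and is therefore dense;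
  the bound \<open>b (u + v) \<le> 2 * b u + 2 * b v\<close> carries the vanishing to the
  closure.\<close>

theorem coherent_transform_isometry:
  "(\<integral>z. (norm (coherent_transform h u z))\<^sup>2 \<partial>lborel) = (2 * pi * h) ^ 3 * (norm u)\<^sup>2"
proof -
  define Q where "Q u = (\<integral>z. (norm (coherent_transform h u z))\<^sup>2 \<partial>lborel)" for u
  define b where "b u = (2 * pi * h) ^ 3 * (norm u)\<^sup>2 - Q u" for u
  have Qn: "ennreal (Q u) = (\<integral>\<^sup>+z. ennreal ((norm (coherent_transform h u z))\<^sup>2) \<partial>lborel)" for u
    unfolding Q_def by (rule nn_integral_eq_integral[symmetric, OF integrable_coherent_transform_sq]) simp
  have Q0: "0 \<le> Q u" for u unfolding Q_def by simp
  have b0: "0 \<le> b u" for u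
  proof -
    have "ennreal (Q u) \<le> ennreal ((2 * pi * h) ^ 3 * (norm u)\<^sup>2)"
      using coherent_transform_bessel[of u] h unfolding Qn by (simp add: ennreal_mult)
    then show ?thesis using h by (simp add: b_def ennreal_le_iff)
  qed
  have par: "b (u + v) + b (u - v) = 2 * b u + 2 * b v" for u v
  proof -
    have *: "(norm (x + y))\<^sup>2 + (norm (x - y))\<^sup>2 = 2 * (norm x)\<^sup>2 + 2 * (norm y)\<^sup>2" for x y :: "'b::real_inner"
      by (simp add: power2_norm_eq_inner inner_add inner_diff inner_commute)
    have "Q (u + v) + Q (u - v) = (\<integral>z. (norm (coherent_transform h (u + v) z))\<^sup>2 + (norm (coherent_transform h (u - v) z))\<^sup>2 \<partial>lborel)"
      unfolding Q_def by (rule Bochner_Integration.integral_add[symmetric]) (rule integrable_coherent_transform_sq)+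
    also have "\<dots> = (\<integral>z. 2 * (norm (coherent_transform h u z))\<^sup>2 + 2 * (norm (coherent_transform h v z))\<^sup>2 \<partial>lborel)"
      by (simp only: coherent_transform_add coherent_transform_diff *)
    also have "\<dots> = 2 * Q u + 2 * Q v"
      unfolding Q_def
      by (subst Bochner_Integration.integral_add) (auto intro: integrable_coherent_transform_sq)
    finally have "Q (u + v) + Q (u - v) = 2 * Q u + 2 * Q v" .
    moreover have "b (u + v) + b (u - v) = (2 * pi * h) ^ 3 * ((norm (u + v))\<^sup>2 + (norm (u - v))\<^sup>2) - (Q (u + v) + Q (u - v))"
      by (simp only: b_def distrib_left)
    ultimately show ?thesis unfolding * by (simp only: b_def distrib_left right_diff_distrib mult.left_commute)
  qed
  have b2: "b (u + v) \<le> 2 * b u + 2 * b v" for u v using par[of u v] b0[of "u - v"] by linarith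
  define S where "S = {u. b u = 0}"
  \<comment> \<open>The density criterion speaks of the real inner product; stability of
    \<open>S\<close> under the imaginary unit turns real orthogonality into complex orthogonality to
    the boxes.\<close>
  have scale: "scaleC c u \<in> S" if "u \<in> S" for c u
    using that by (simp add: S_def b_def Q_def coherent_transform_scaleC norm_scaleC norm_mult power_mult_distrib)
  have "subspace S"
  proof (rule subspaceI)
    show "0 \<in> S" using par[of 0 0] by (simp add: S_def)
    show "x + y \<in> S" if "x \<in> S" "y \<in> S" for x y
      using that b2[of x y] b0[of "x + y"] by (simp add: S_def)
    show "c *\<^sub>R x \<in> S" if "x \<in> S" for c x
      using scale[OF that, of "of_real c"] by (simp add: scaleC_of_real)
  qed
  moreover have "v = 0" if v: "\<And>s. s \<in> S \<Longrightarrow> inner v s = 0" for v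
  proof (rule orthogonal_boxes_imp_zero)
    fix a c
    have "ennreal (Q (abs_L2 (box_fun a c))) = ennreal ((2 * pi * h) ^ 3 * (norm (abs_L2 (box_fun a c)))\<^sup>2)"
      unfolding Qn coherent_transform_box using h by (simp add: ennreal_mult)
    then have S1: "abs_L2 (box_fun a c) \<in> S" using h Q0 by (simp add: S_def b_def)
    show "cinner (abs_L2 (box_fun a c)) v = 0"
      using v[OF S1] v[OF scale[OF S1, of \<i>]]
      by (simp add: cinner_eq_inner complex_eq_iff inner_commute)
  qed
  ultimately have cl: "closure S = UNIV" by (rule dense_if_orthogonal_trivial)
  have "b u \<le> 0"
  proof (rule field_le_epsilon)
    fix e :: real assume e: "0 < e"
    define d where "d = sqrt (e / (2 * (2 * pi * h) ^ 3))"
    have d: "0 < d" "2 * ((2 * pi * h) ^ 3 * d\<^sup>2) = e" using e h by (auto simp: d_def)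
    obtain s where s: "s \<in> S" "dist s u < d" using cl d(1) closure_approachable[of u S] by auto
    have "b u \<le> 2 * b s + 2 * b (u - s)" using b2[of s "u - s"] by simp
    also have "\<dots> \<le> 2 * ((2 * pi * h) ^ 3 * (norm (u - s))\<^sup>2)" using s(1) Q0[of "u - s"] by (simp add: S_def b_def)
    also have "\<dots> \<le> 2 * ((2 * pi * h) ^ 3 * d\<^sup>2)"
      using s(2) h by (intro mult_left_mono power_mono) (auto simp: dist_norm norm_minus_commute)
    finally show "b u \<le> 0 + e" using d(2) by simp
  qed
  then show ?thesis using b0[of u] by (simp add: b_def Q_def)
qed

end

section \<open>Smooth functions and test functions\<close>

lemma partial_deriv_eqI: "(f has_derivative f') (at x) \<Longrightarrow> partial_deriv i f x = f' (axis i 1)"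
  unfolding partial_deriv_def using frechet_derivative_at by metis

lemma has_derivative_frechet: "f differentiable_on UNIV \<Longrightarrow> (f has_derivative frechet_derivative f (at x)) (at x)"
  by (simp add: differentiable_on_def frechet_derivative_works)

lemma differentiable_on_UNIV_I: "(\<And>x. (f has_derivative F x) (at x)) \<Longrightarrow> f differentiable_on UNIV"
  by (auto simp: differentiable_on_def differentiable_def)

lemma differentiable_imp_continuous_UNIV:
  fixes f :: "real^3 \<Rightarrow> real" assumes "f differentiable_on UNIV" shows "continuous_on UNIV f"
  by (rule differentiable_imp_continuous_on[OF assms])

lemma
  assumes f: "f differentiable_on UNIV" and g: "g differentiable_on UNIV"
  shows differentiable_on_add': "(\<lambda>x. f x + g x) differentiable_on UNIV"
    and partial_deriv_add: "partial_deriv i (\<lambda>x. f x + g x) x = partial_deriv i f x + partial_deriv i g x"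
    and differentiable_on_mult': "(\<lambda>x. f x * g x) differentiable_on UNIV"
    and partial_deriv_mult: "partial_deriv i (\<lambda>x. f x * g x) x = partial_deriv i f x * g x + f x * partial_deriv i g x"
proof -
  note F = has_derivative_frechet[OF f] and G = has_derivative_frechet[OF g]
  note A = has_derivative_add[OF F G] and M = has_derivative_mult[OF F G]
  show "(\<lambda>x. f x + g x) differentiable_on UNIV" by (rule differentiable_on_UNIV_I[OF A])
  show "(\<lambda>x. f x * g x) differentiable_on UNIV" by (rule differentiable_on_UNIV_I[OF M])
  show "partial_deriv i (\<lambda>x. f x + g x) x = partial_deriv i f x + partial_deriv i g x"
    by (subst partial_deriv_eqI[OF A]) (simp add: partial_deriv_def)
  show "partial_deriv i (\<lambda>x. f x * g x) x = partial_deriv i f x * g x + f x * partial_deriv i g x"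
    by (subst partial_deriv_eqI[OF M]) (simp add: partial_deriv_def)
qed

lemma
  assumes g: "g differentiable_on UNIV" and F: "\<And>t. (F has_real_derivative F' t) (at t)"
  shows differentiable_on_comp': "(\<lambda>x. F (g x)) differentiable_on UNIV"
    and partial_deriv_comp: "partial_deriv i (\<lambda>x. F (g x)) x = F' (g x) * partial_deriv i g x"
proof -
  note G = has_derivative_frechet[OF g]
  have C: "((\<lambda>x. F (g x)) has_derivative (\<lambda>v. F' (g x) * frechet_derivative g (at x) v)) (at x)" for x
    using has_derivative_compose[OF G F[THEN has_field_derivative_imp_has_derivative]] by simp
  show "(\<lambda>x. F (g x)) differentiable_on UNIV" by (rule differentiable_on_UNIV_I[OF C])
  show "partial_deriv i (\<lambda>x. F (g x)) x = F' (g x) * partial_deriv i g x"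
    by (subst partial_deriv_eqI[OF C]) (simp add: partial_deriv_def)
qed

lemma partial_deriv_const: "partial_deriv i (\<lambda>x. c) x = 0"
  by (subst partial_deriv_eqI[OF has_derivative_const]) simp

lemma has_derivative_inner_const: "((\<lambda>x. x \<bullet> v) has_derivative (\<lambda>x. x \<bullet> v)) (at y)" for v :: "real^3"
  by (rule bounded_linear_imp_has_derivative[OF bounded_linear_inner_left])

lemma partial_deriv_inner: "partial_deriv i (\<lambda>x. x \<bullet> v) x = v $ i"
  by (subst partial_deriv_eqI[OF has_derivative_inner_const]) (simp add: inner_axis')

lemma partial_deriv_scale:
  assumes f: "f differentiable_on UNIV"
  shows "partial_deriv i (\<lambda>x. f (c *\<^sub>R x)) x = c * partial_deriv i f (c *\<^sub>R x)"
proof -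
  have "((\<lambda>x. f (c *\<^sub>R x)) has_derivative (\<lambda>v. frechet_derivative f (at (c *\<^sub>R x)) (c *\<^sub>R v))) (at x)"
    by (rule has_derivative_compose[OF _ has_derivative_frechet[OF f]])
       (rule bounded_linear_imp_has_derivative[OF bounded_linear_scaleR_right])
  note this[THEN partial_deriv_eqI]
  then show ?thesis
    using linear_cmul[OF has_derivative_linear[OF has_derivative_frechet[OF f]]]
    by (simp add: partial_deriv_def)
qed

text \<open>A class of expressions closed under partial derivatives, so that differentiability to
  all orders follows by induction. The rule \<open>comp\<close> takes a whole sequence of successive
  derivatives \<open>F k\<close>, because then the derivative of a composite is again of the same
  shape, with \<open>k\<close> shifted by one.\<close>

inductive smooth_expr :: "(real^3 \<Rightarrow> real) \<Rightarrow> bool" where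
  const: "smooth_expr (\<lambda>x. c)"
| inner: "smooth_expr (\<lambda>x. x \<bullet> v)"
| add: "smooth_expr f \<Longrightarrow> smooth_expr g \<Longrightarrow> smooth_expr (\<lambda>x. f x + g x)"
| mult: "smooth_expr f \<Longrightarrow> smooth_expr g \<Longrightarrow> smooth_expr (\<lambda>x. f x * g x)"
| comp: "smooth_expr g \<Longrightarrow> (\<And>k t. (F k has_real_derivative F (Suc k) t) (at t)) \<Longrightarrow> smooth_expr (\<lambda>x. F (k::nat) (g x))"

lemma smooth_expr_step:
  assumes "smooth_expr f"
  shows "f differentiable_on UNIV" and "smooth_expr (partial_deriv i f)"
proof -
  from assms have "f differentiable_on UNIV \<and> smooth_expr (partial_deriv i f)"
  proof (induction rule: smooth_expr.induct)
    case (const c)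
    then show ?case using smooth_expr.const[of 0] by (simp add: partial_deriv_const[abs_def])
  next
    case (inner v)
    then show ?case using smooth_expr.const[of "v $ i"]
      by (simp add: partial_deriv_inner[abs_def] differentiable_on_UNIV_I[OF has_derivative_inner_const])
  next
    case (add f g)
    have "partial_deriv i (\<lambda>x. f x + g x) = (\<lambda>x. partial_deriv i f x + partial_deriv i g x)"
      using partial_deriv_add[OF conjunct1[OF add.IH(1)] conjunct1[OF add.IH(2)]] by blast
    then show ?case using add.IH by (auto intro: smooth_expr.add differentiable_on_add')
  next
    case (mult f g)
    have "partial_deriv i (\<lambda>x. f x * g x) = (\<lambda>x. partial_deriv i f x * g x + f x * partial_deriv i g x)"
      using partial_deriv_mult[OF conjunct1[OF mult.IH(1)] conjunct1[OF mult.IH(2)]] by blast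
    then show ?case using mult.IH mult.hyps by (auto intro: smooth_expr.add smooth_expr.mult differentiable_on_mult')
  next
    case (comp g F k)
    have d: "\<And>t. (F k has_real_derivative F (Suc k) t) (at t)" by (rule comp.hyps(2))
    have "partial_deriv i (\<lambda>x. F k (g x)) = (\<lambda>x. F (Suc k) (g x) * partial_deriv i g x)"
      using partial_deriv_comp[OF conjunct1[OF comp.IH] d] by blast
    moreover have "smooth_expr (\<lambda>x. F (Suc k) (g x))" by (rule smooth_expr.comp[of g F "Suc k", OF comp.hyps(1) comp.hyps(2)])
    ultimately show ?case
      using comp.IH differentiable_on_comp'[OF conjunct1[OF comp.IH] d] by (auto intro: smooth_expr.mult)
  qed
  then show "f differentiable_on UNIV" and "smooth_expr (partial_deriv i f)" by auto
qed

lemma smooth_expr_foldr: "smooth_expr f \<Longrightarrow> smooth_expr (foldr partial_deriv is f)"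
  by (induction "is") (auto intro: smooth_expr_step)

lemma test_functionI:
  assumes "smooth_expr f" "compact K" "\<And>x. x \<notin> K \<Longrightarrow> f x = 0"
  shows "test_function f"
  using assms smooth_expr_step(1)[OF smooth_expr_foldr] by (auto simp: test_function_def)

lemma test_function_partial:
  assumes "test_function f"
  shows "foldr partial_deriv is f differentiable_on UNIV" and "f differentiable_on UNIV"
    and "partial_deriv i f differentiable_on UNIV" and "partial_deriv i (partial_deriv i f) differentiable_on UNIV"
  using assms by (auto simp: test_function_def dest: spec[of _ "[]"] spec[of _ "[i]"] spec[of _ "[i, i]"])

lemma partial_deriv_zero_outside:
  assumes "closed K" "\<And>x. x \<notin> K \<Longrightarrow> f x = 0" "x \<notin> K"
  shows "partial_deriv i f x = 0"
proof -
  have "(f has_derivative (\<lambda>v. 0)) (at x)"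
    by (rule has_derivative_transform_within_open[OF has_derivative_const[of 0], where s = "- K"])
       (use assms in auto)
  then show ?thesis using partial_deriv_eqI by fastforce
qed

lemma bounded_if_compact_support:
  fixes f :: "real^3 \<Rightarrow> real"
  assumes "continuous_on UNIV f" "compact K" "\<And>x. x \<notin> K \<Longrightarrow> f x = 0"
  shows "\<exists>B\<ge>0. \<forall>x. \<bar>f x\<bar> \<le> B"
proof -
  have "compact (f ` K)" using assms(1,2) by (intro compact_continuous_image continuous_on_subset[OF assms(1)]) auto
  then obtain B where B: "\<And>y. y \<in> f ` K \<Longrightarrow> norm y \<le> B" using compact_imp_bounded bounded_iff by metis
  have "\<bar>f x\<bar> \<le> max B 0" for x using B[of "f x"] assms(3)[of x] by (cases "x \<in> K") auto
  then show ?thesis by (intro exI[of _ "max B 0"]) auto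
qed

lemma integrable_compact_support:
  fixes f :: "real^3 \<Rightarrow> real"
  assumes f: "continuous_on UNIV f" and K: "compact K" "\<And>x. x \<notin> K \<Longrightarrow> f x = 0"
  shows "integrable lborel f"
proof -
  obtain B where B: "0 \<le> B" "\<And>x. \<bar>f x\<bar> \<le> B" using bounded_if_compact_support[OF f K] by blast
  have "K \<in> sets borel" using K(1) compact_imp_closed borel_closed by blast
  then have "integrable lborel (\<lambda>x. B * indicator K x)"
    using emeasure_bounded_finite[OF compact_imp_bounded[OF K(1)]] by (intro integrable_mult_right) (simp add: integrable_indicator_iff)
  then show ?thesis
  proof (rule Bochner_Integration.integrable_bound)
    show "f \<in> borel_measurable lborel" using borel_measurable_continuous_onI[OF f] by simp
    show "AE x in lborel. norm (f x) \<le> norm (B * indicator K x)"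
      using B K(2) by (intro AE_I2) (auto simp: indicator_def)
  qed
qed

subsection \<open>A bump function\<close>

text \<open>The general derivative of \<open>exp (- 1 / t)\<close> extended by zero to the left.
  Differentiation stays in this family and acts on the polynomial, in the variable
  \<open>y = 1 / t\<close>, by P -> y^2 (P - P').\<close>

definition flat_exp :: "real poly \<Rightarrow> real \<Rightarrow> real" where
  "flat_exp P t = (if 0 < t then poly P (1 / t) * exp (- (1 / t)) else 0)"

lemma poly_exp_tendsto_0: "((\<lambda>y. poly P y * exp (- y)) \<longlongrightarrow> 0) at_top" for P :: "real poly"
proof -
  have "((\<lambda>y. \<Sum>i\<le>degree P. coeff P i * (y ^ i / exp y)) \<longlongrightarrow> (\<Sum>i\<le>degree P. coeff P i * 0)) at_top"
    by (intro tendsto_intros tendsto_power_div_exp_0)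
  then show ?thesis by (simp add: poly_altdef sum_distrib_right exp_minus divide_inverse mult.assoc)
qed

lemma flat_exp_derivative:
  "(flat_exp P has_real_derivative flat_exp ([:0, 0, 1:] * (P - pderiv P)) t) (at t)"
proof (cases t "0::real" rule: linorder_cases)
  case less
  have "(flat_exp P has_real_derivative 0) (at t)"
    by (rule has_field_derivative_transform_within_open[OF DERIV_const[of 0], where S = "{..<0}"])
       (use less in \<open>auto simp: flat_exp_def\<close>)
  then show ?thesis using less by (simp add: flat_exp_def)
next
  case greater
  have "((\<lambda>t. poly P (1 / t) * exp (- (1 / t))) has_real_derivative
     poly P (1 / t) * (exp (- (1 / t)) * (1 / t\<^sup>2)) + poly (pderiv P) (1 / t) * (- (1 / t\<^sup>2)) * exp (- (1 / t))) (at t)"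
    using greater
    by (auto intro!: derivative_eq_intros DERIV_chain2[OF poly_DERIV] simp: power2_eq_square field_simps)
  then have "(flat_exp P has_real_derivative
     poly P (1 / t) * (exp (- (1 / t)) * (1 / t\<^sup>2)) + poly (pderiv P) (1 / t) * (- (1 / t\<^sup>2)) * exp (- (1 / t))) (at t)"
    by (rule has_field_derivative_transform_within_open[where S = "{0<..}"])
       (use greater in \<open>auto simp: flat_exp_def\<close>)
  also have "poly P (1 / t) * (exp (- (1 / t)) * (1 / t\<^sup>2)) + poly (pderiv P) (1 / t) * (- (1 / t\<^sup>2)) * exp (- (1 / t))
    = flat_exp ([:0, 0, 1:] * (P - pderiv P)) t"
    using greater by (simp add: flat_exp_def power2_eq_square field_simps)
  finally show ?thesis .
next
  case equal
  \<comment> \<open>The right difference quotient at \<open>0\<close> is again of this form, with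
    the polynomial multiplied by its variable, and hence tends to \<open>0\<close>.\<close>
  have "((\<lambda>t. (1 / t) * poly P (1 / t) * exp (- (1 / t))) \<longlongrightarrow> 0) (at_right 0)"
    using filterlim_compose[OF poly_exp_tendsto_0[of "[:0, 1:] * P"] filterlim_inverse_at_top_right]
    by (simp add: inverse_eq_divide)
  then have "((\<lambda>t. (flat_exp P t - flat_exp P 0) / (t - 0)) \<longlongrightarrow> 0) (at_right 0)"
    by (rule Lim_transform_eventually)
       (auto simp: flat_exp_def eventually_at_filter)
  moreover have "((\<lambda>t. (flat_exp P t - flat_exp P 0) / (t - 0)) \<longlongrightarrow> 0) (at_left 0)"
    by (rule tendsto_eventually) (auto simp: flat_exp_def eventually_at_filter)
  ultimately have "((\<lambda>t. (flat_exp P t - flat_exp P 0) / (t - 0)) \<longlongrightarrow> 0) (at 0)"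
    by (simp add: filterlim_split_at)
  then have "(flat_exp P has_real_derivative 0) (at 0)" by (simp only: has_field_derivative_iff)
  then show ?thesis using equal by (simp add: flat_exp_def)
qed

lemma smooth_expr_flat_exp: "smooth_expr g \<Longrightarrow> smooth_expr (\<lambda>x. flat_exp 1 (g x))"
  using smooth_expr.comp[of g "\<lambda>k. flat_exp (((\<lambda>P. [:0, 0, 1:] * (P - pderiv P)) ^^ k) 1)" 0]
  using flat_exp_derivative by simp

lemma smooth_expr_exp: "smooth_expr g \<Longrightarrow> smooth_expr (\<lambda>x. exp (g x))"
  using smooth_expr.comp[of g "\<lambda>k. exp" 0] DERIV_exp by simp

lemma smooth_expr_cos: "smooth_expr g \<Longrightarrow> smooth_expr (\<lambda>x. cos (g x + c))"
proof -
  \<comment> \<open>Successive derivatives of the cosine are phase shifts by \<open>pi / 2\<close>,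
    which supplies the sequence demanded by \<open>smooth_expr.comp\<close>.\<close>
  have "((\<lambda>t. cos (t + c + real k * (pi / 2))) has_real_derivative cos (t + c + real (Suc k) * (pi / 2))) (at t)" for k t
  proof -
    have "cos (t + c + real (Suc k) * (pi / 2)) = cos ((t + c + real k * (pi / 2)) + pi / 2)"
      by (simp add: algebra_simps add_divide_distrib)
    also have "\<dots> = - sin (t + c + real k * (pi / 2))" by (simp add: cos_add)
    finally show ?thesis by (auto intro!: derivative_eq_intros)
  qed
  from smooth_expr.comp[of g "\<lambda>k t. cos (t + c + real k * (pi / 2))" 0, OF _ this]
  show "smooth_expr g \<Longrightarrow> ?thesis" by simp
qed

lemma smooth_expr_norm_sq: "smooth_expr (\<lambda>x. c * (norm (x - q))\<^sup>2)"
proof -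
  have "(norm (x - q))\<^sup>2 = (\<Sum>i\<in>UNIV. (x \<bullet> axis i 1 + - (q $ i)) * (x \<bullet> axis i 1 + - (q $ i)))" for x
    unfolding power2_norm_eq_inner inner_vec_def[of "x - q"] by (simp add: inner_axis)
  moreover have "smooth_expr (\<lambda>x. c * (\<Sum>i\<in>UNIV. (x \<bullet> axis i 1 + - (q $ i)) * (x \<bullet> axis i 1 + - (q $ i))))"
    unfolding sum_3 by (intro smooth_expr.const smooth_expr.inner smooth_expr.add smooth_expr.mult)
  ultimately show ?thesis by simp
qed

text \<open>The factor \<open>exp 1\<close> normalises the value at the origin to \<open>1\<close>;
  the inner expression is written so as to match \<open>smooth_expr_norm_sq\<close>.\<close>

definition bump :: "real^3 \<Rightarrow> real" where
  "bump x = exp 1 * flat_exp 1 (1 + -1 * (norm (x - 0))\<^sup>2)"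

lemma smooth_expr_bump: "smooth_expr bump"
  unfolding bump_def by (intro smooth_expr.mult smooth_expr.const smooth_expr_flat_exp smooth_expr.add smooth_expr_norm_sq)

lemma bump_0: "bump 0 = 1"
  by (simp add: bump_def flat_exp_def flip: exp_add)

lemma bump_outside:
  assumes "x \<notin> cball 0 1" shows "bump x = 0"
proof -
  have "1 \<le> (norm x)\<^sup>2" using assms by (intro one_le_power) simp
  then show ?thesis by (simp add: bump_def flat_exp_def)
qed

lemma smooth_expr_scale: "smooth_expr f \<Longrightarrow> smooth_expr (\<lambda>x. f (c *\<^sub>R x))"
proof (induction rule: smooth_expr.induct)
  case (inner v)
  have "(\<lambda>x::real^3. (c *\<^sub>R x) \<bullet> v) = (\<lambda>x. c * (x \<bullet> v))" by simp
  then show ?case by (simp only:) (intro smooth_expr.const smooth_expr.inner smooth_expr.mult)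
next
  case (comp g F k)
  show ?case by (rule smooth_expr.comp[of "\<lambda>x. g (c *\<^sub>R x)" F k, OF comp.IH comp.hyps(2)])
qed (auto intro: smooth_expr.const smooth_expr.add smooth_expr.mult)

subsection \<open>Laplacians of products\<close>

lemma laplacian_mult:
  assumes f: "smooth_expr f" and g: "smooth_expr g"
  shows "laplacian (\<lambda>x. f x * g x) x = laplacian f x * g x
    + 2 * (\<Sum>i\<in>UNIV. partial_deriv i f x * partial_deriv i g x) + f x * laplacian g x"
proof -
  note F = smooth_expr_step[OF f] and G = smooth_expr_step[OF g]
  note F2 = smooth_expr_step(1)[OF F(2)] and G2 = smooth_expr_step(1)[OF G(2)]
  have "partial_deriv i (\<lambda>x. f x * g x) = (\<lambda>x. partial_deriv i f x * g x + f x * partial_deriv i g x)" for i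
    using partial_deriv_mult[OF F(1) G(1)] by blast
  then have "partial_deriv i (partial_deriv i (\<lambda>x. f x * g x)) x
    = partial_deriv i (partial_deriv i f) x * g x + 2 * (partial_deriv i f x * partial_deriv i g x)
      + f x * partial_deriv i (partial_deriv i g) x" for i
    by (simp add: partial_deriv_add[OF differentiable_on_mult'[OF F2 G(1)] differentiable_on_mult'[OF F(1) G2]]
      partial_deriv_mult[OF F2 G(1)] partial_deriv_mult[OF F(1) G2])
  then show ?thesis
    by (simp add: laplacian_def sum.distrib sum_distrib_left sum_distrib_right)
qed

lemma laplacian_scale:
  assumes f: "smooth_expr f"
  shows "laplacian (\<lambda>x. f (c *\<^sub>R x)) x = c\<^sup>2 * laplacian f (c *\<^sub>R x)"
proof -
  have "partial_deriv i (\<lambda>x. f (c *\<^sub>R x)) = (\<lambda>x. c * partial_deriv i f (c *\<^sub>R x))" for i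
    using partial_deriv_scale[OF smooth_expr_step(1)[OF f]] by blast
  moreover have "partial_deriv i (\<lambda>x. c * partial_deriv i f (c *\<^sub>R x)) x = c * (c * partial_deriv i (partial_deriv i f) (c *\<^sub>R x))" for i
    using partial_deriv_mult[OF smooth_expr_step(1)[OF smooth_expr.const] smooth_expr_step(1)[OF smooth_expr_scale[OF smooth_expr_step(2)[OF f]]], of i c i c]
      partial_deriv_scale[OF smooth_expr_step(1)[OF smooth_expr_step(2)[OF f]]]
    by (simp add: partial_deriv_const)
  ultimately show ?thesis
    by (simp add: laplacian_def sum_distrib_left power2_eq_square mult.assoc)
qed

lemma smooth_expr_laplacian: "smooth_expr f \<Longrightarrow> smooth_expr (laplacian f)"
  unfolding laplacian_def[abs_def] sum_3 by (intro smooth_expr.add smooth_expr_step)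

lemma smooth_expr_continuous: "smooth_expr f \<Longrightarrow> continuous_on UNIV f"
  using smooth_expr_step(1) differentiable_imp_continuous_UNIV by blast

lemma smooth_expr_measurable: "smooth_expr f \<Longrightarrow> f \<in> borel_measurable borel"
  using smooth_expr_continuous borel_measurable_continuous_onI by blast

text \<open>Difference quotients in the direction of the \<open>i\<close>-th axis integrate to zero
  by translation invariance. By the mean value theorem they are bounded by the maximum of the
  derivative, and for steps at most \<open>1\<close> they live in a ball of radius
  \<open>r + 1\<close>, so dominated convergence applies.\<close>

lemma integral_partial_deriv_zero:
  fixes f :: "real^3 \<Rightarrow> real"
  assumes d: "f differentiable_on UNIV" and c: "continuous_on UNIV (partial_deriv i f)"
    and K: "compact K" "\<And>x. x \<notin> K \<Longrightarrow> f x = 0"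
  shows "(\<integral>x. partial_deriv i f x \<partial>lborel) = 0"
proof -
  define e :: "real^3" where "e = axis i 1"
  have ne: "norm e = 1" by (simp add: e_def)
  obtain B where B: "0 \<le> B" "\<And>x. \<bar>partial_deriv i f x\<bar> \<le> B"
    using bounded_if_compact_support[OF c K(1) partial_deriv_zero_outside[OF compact_imp_closed[OF K(1)], of f]] K(2) by blast
  obtain r where "\<forall>x\<in>K. norm x \<le> r" using compact_imp_bounded[OF K(1)] unfolding bounded_iff by blast
  then have r: "K \<subseteq> cball 0 r" by auto
  have fc: "continuous_on UNIV f" by (rule differentiable_imp_continuous_UNIV[OF d])
  have fm [measurable]: "f \<in> borel_measurable borel" by (rule borel_measurable_continuous_onI[OF fc])
  have pm [measurable]: "partial_deriv i f \<in> borel_measurable borel" by (rule borel_measurable_continuous_onI[OF c])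
  have ib: "integrable lborel (\<lambda>x. C * indicator (cball (0::real^3) s) x)" for C s :: real
    using emeasure_bounded_finite[OF bounded_cball, of "0::real^3" s] by (intro integrable_mult_right) (simp add: integrable_indicator_iff)
  have fi: "integrable lborel f" by (rule integrable_compact_support[OF fc K])
  define t where "t n = 1 / real (Suc n)" for n
  have t: "0 < t n" "t n \<le> 1" for n by (auto simp: t_def)
  have t0: "t \<longlonglongrightarrow> 0" unfolding t_def by (rule LIMSEQ_Suc[OF lim_1_over_n])
  have "t n \<noteq> 0" for n using t(1)[of n] by simp
  then have tt: "filterlim t (at 0) sequentially" using t0 by (simp add: filterlim_at)
  have der: "((\<lambda>s. f (x + s *\<^sub>R e)) has_real_derivative partial_deriv i f (x + s *\<^sub>R e)) (at s)" for x s
  proof -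
    have "((\<lambda>s. x + s *\<^sub>R e) has_derivative (\<lambda>v. v *\<^sub>R e)) (at s)" by (auto intro!: derivative_eq_intros)
    note has_derivative_compose[OF this has_derivative_frechet[OF d]]
    then show ?thesis
      using linear_cmul[OF has_derivative_linear[OF has_derivative_frechet[OF d]]]
      by (simp add: has_field_derivative_def partial_deriv_def e_def mult.commute[of _ "frechet_derivative _ _ _"])
  qed
  define q where "q n x = (f (x + t n *\<^sub>R e) - f x) / t n" for n x
  have qb: "\<bar>q n x\<bar> \<le> B * indicator (cball 0 (r + 1)) x" for n x
  proof -
    obtain z where "0 < z" "z < t n" "f (x + t n *\<^sub>R e) - f (x + 0 *\<^sub>R e) = (t n - 0) * partial_deriv i f (x + z *\<^sub>R e)"
      using MVT2[OF t(1)[of n], of "\<lambda>s. f (x + s *\<^sub>R e)" "\<lambda>s. partial_deriv i f (x + s *\<^sub>R e)", OF der] by blast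
    then have "q n x = partial_deriv i f (x + z *\<^sub>R e)" using t(1)[of n] by (simp add: q_def)
    then have 1: "\<bar>q n x\<bar> \<le> B" using B(2) by simp
    show ?thesis
    proof (cases "x \<in> cball 0 (r + 1)")
      case False
      have "norm x \<le> norm (x + t n *\<^sub>R e) + norm (t n *\<^sub>R e)"
        using norm_triangle_ineq4[of "x + t n *\<^sub>R e" "t n *\<^sub>R e"] by simp
      then have "x + t n *\<^sub>R e \<notin> K" "x \<notin> K" using False r t[of n] ne by (auto simp: subset_iff mem_cball)
      then show ?thesis using K(2) by (simp add: q_def B(1))
    qed (use 1 in simp)
  qed
  have "(\<lambda>n. \<integral>x. q n x \<partial>lborel) \<longlonglongrightarrow> (\<integral>x. partial_deriv i f x \<partial>lborel)"
  proof (rule integral_dominated_convergence[OF _ _ ib])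
    show "AE x in lborel. (\<lambda>n. q n x) \<longlonglongrightarrow> partial_deriv i f x"
    proof (rule AE_I2)
      fix x
      have "((\<lambda>s. (f (x + s *\<^sub>R e) - f (x + 0 *\<^sub>R e)) / (s - 0)) \<longlongrightarrow> partial_deriv i f (x + 0 *\<^sub>R e)) (at 0)"
        using der[of x 0] by (simp only: has_field_derivative_iff)
      from filterlim_compose[OF this tt]
      show "(\<lambda>n. q n x) \<longlonglongrightarrow> partial_deriv i f x" by (simp add: q_def)
    qed
    show "AE x in lborel. norm (q n x) \<le> B * indicator (cball 0 (r + 1)) x" for n using qb by auto
    show "q n \<in> borel_measurable lborel" for n unfolding q_def by measurable
  qed measurable
  moreover have "(\<integral>x. q n x \<partial>lborel) = 0" for n
  proof -
    have D: "lborel = distr lborel borel (\<lambda>x. t n *\<^sub>R e + x)"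
      using lborel_distr_plus[of "t n *\<^sub>R e"] by simp
    have f2: "integrable lborel (\<lambda>x. f (t n *\<^sub>R e + x))"
      using fi by (subst (asm) D) (simp add: integrable_distr_eq)
    have "(\<integral>x. f (t n *\<^sub>R e + x) \<partial>lborel) = (\<integral>x. f x \<partial>lborel)"
      by (subst (2) D) (simp add: integral_distr)
    then show ?thesis unfolding q_def using f2 fi by (simp add: add.commute)
  qed
  ultimately have "(\<lambda>n. 0) \<longlonglongrightarrow> (\<integral>x. partial_deriv i f x \<partial>lborel)" by simp
  then show ?thesis by (simp add: LIMSEQ_const_iff)
qed

subsection \<open>Weak Laplacians\<close>

definition real_L2 :: "(real^3 \<Rightarrow> real) \<Rightarrow> L2" where
  "real_L2 f = abs_L2 (\<lambda>x. of_real (f x))"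

lemma square_integrable_compact_support:
  fixes f :: "real^3 \<Rightarrow> real"
  assumes f: "continuous_on UNIV f" and K: "compact K" "\<And>x. x \<notin> K \<Longrightarrow> f x = 0"
  shows "square_integrable (\<lambda>x. of_real (f x))"
proof -
  have [measurable]: "f \<in> borel_measurable borel" by (rule borel_measurable_continuous_onI[OF f])
  have "integrable lborel (\<lambda>x. (f x)\<^sup>2)"
    by (rule integrable_compact_support[OF _ K(1)]) (use K in \<open>auto intro!: continuous_intros f\<close>)
  then show ?thesis by (simp add: square_integrable_def)
qed

lemma cinner_real_L2:
  assumes "square_integrable (\<lambda>x. of_real (f x))"
  shows "cinner (real_L2 f) u = (\<integral>x. of_real (f x) * rep_L2 u x \<partial>lborel)"
  unfolding real_L2_def using cinner_abs_left[OF assms, of u] by simp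

lemma
  assumes "test_function f"
  shows square_integrable_test: "square_integrable (\<lambda>x. of_real (f x))"
    and square_integrable_laplacian_test: "square_integrable (\<lambda>x. of_real (laplacian f x))"
proof -
  obtain K where K: "compact K" "\<And>x. x \<notin> K \<Longrightarrow> f x = 0" using assms by (auto simp: test_function_def)
  show "square_integrable (\<lambda>x. of_real (f x))"
    by (rule square_integrable_compact_support[OF _ K])
       (rule differentiable_imp_continuous_UNIV[OF test_function_partial(2)[OF assms]])
  have c: "continuous_on UNIV (\<lambda>x. partial_deriv i (partial_deriv i f) x)" for i
    using differentiable_imp_continuous_UNIV[OF test_function_partial(4)[OF assms]] by simp
  have z: "partial_deriv i (partial_deriv i f) x = 0" if "x \<notin> K" for i x
    by (intro partial_deriv_zero_outside[OF compact_imp_closed[OF K(1)]] K(2) that)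
  show "square_integrable (\<lambda>x. of_real (laplacian f x))"
    by (rule square_integrable_compact_support[OF _ K(1)])
       (use z in \<open>auto simp: laplacian_def[abs_def] intro!: continuous_intros c\<close>)
qed

lemma has_weak_laplacian_cinner:
  "has_weak_laplacian u l \<longleftrightarrow> (\<forall>f. test_function f \<longrightarrow> cinner (real_L2 (laplacian f)) u = cinner (real_L2 f) l)"
  unfolding has_weak_laplacian_def
  by (auto simp: cinner_real_L2 square_integrable_test square_integrable_laplacian_test)

lemma has_weak_laplacian_add:
  "has_weak_laplacian u l \<Longrightarrow> has_weak_laplacian u' l' \<Longrightarrow> has_weak_laplacian (u + u') (l + l')"
  by (auto simp: has_weak_laplacian_cinner cinner_add_right)

lemma has_weak_laplacian_scaleC:
  "has_weak_laplacian u l \<Longrightarrow> has_weak_laplacian (scaleC c u) (scaleC c l)"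
  by (auto simp: has_weak_laplacian_cinner cinner_scaleC_right)

text \<open>Green's identity, one coordinate at a time: the difference of the integrands is the
  derivative of \<open>?h\<close>, which has compact support.\<close>

lemma test_laplacian_symmetric:
  assumes f: "test_function f" and g: "test_function g"
  shows "(\<integral>x. laplacian f x * g x \<partial>lborel) = (\<integral>x. f x * laplacian g x \<partial>lborel)"
proof -
  obtain K where K: "compact K" "\<And>x. x \<notin> K \<Longrightarrow> f x = 0" using f by (auto simp: test_function_def)
  note F = test_function_partial[OF f] and G = test_function_partial[OF g]
  note cF = differentiable_imp_continuous_UNIV[OF F(2)] differentiable_imp_continuous_UNIV[OF F(3)] differentiable_imp_continuous_UNIV[OF F(4)]
  note cG = differentiable_imp_continuous_UNIV[OF G(2)] differentiable_imp_continuous_UNIV[OF G(3)] differentiable_imp_continuous_UNIV[OF G(4)]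
  note zK = partial_deriv_zero_outside[OF compact_imp_closed[OF K(1)]]
  have z1: "partial_deriv i f x = 0" if "x \<notin> K" for i x by (rule zK) (use K(2) that in auto)
  have z2: "partial_deriv i (partial_deriv i f) x = 0" if "x \<notin> K" for i x by (rule zK) (use z1 that in auto)
  have z: "(\<integral>x. partial_deriv i (partial_deriv i f) x * g x - f x * partial_deriv i (partial_deriv i g) x \<partial>lborel) = 0" for i
  proof -
    let ?h = "\<lambda>x. partial_deriv i f x * g x + (-1) * (f x * partial_deriv i g x)"
    have cm: "(\<lambda>x::real^3. -1 :: real) differentiable_on UNIV" by (rule differentiable_on_const)
    note d1 = differentiable_on_mult'[OF F(3)[of i] G(2)] and d2 = differentiable_on_mult'[OF F(2) G(3)[of i]]
    note d3 = differentiable_on_mult'[OF cm d2]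
    have "partial_deriv i ?h x = partial_deriv i (partial_deriv i f) x * g x - f x * partial_deriv i (partial_deriv i g) x" for x
      unfolding partial_deriv_add[OF d1 d3] partial_deriv_mult[OF F(3) G(2)] partial_deriv_mult[OF cm d2]
        partial_deriv_mult[OF F(2) G(3)] partial_deriv_const by simp
    then have eq: "partial_deriv i ?h = (\<lambda>x. partial_deriv i (partial_deriv i f) x * g x - f x * partial_deriv i (partial_deriv i g) x)"
      by blast
    have "(\<integral>x. partial_deriv i ?h x \<partial>lborel) = 0"
    proof (rule integral_partial_deriv_zero[OF differentiable_on_add'[OF d1 d3] _ K(1)])
      show "continuous_on UNIV (partial_deriv i ?h)" unfolding eq by (intro continuous_intros cF cG)
    qed (use K(2) z1 in auto)
    then show ?thesis unfolding eq .
  qed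
  have i1: "integrable lborel (\<lambda>x. partial_deriv i (partial_deriv i f) x * g x)" for i
    by (rule integrable_compact_support[OF _ K(1)]) (use z2 in \<open>auto intro!: continuous_intros cF cG\<close>)
  have i2: "integrable lborel (\<lambda>x. f x * partial_deriv i (partial_deriv i g) x)" for i
    by (rule integrable_compact_support[OF _ K(1)]) (use K(2) in \<open>auto intro!: continuous_intros cF cG\<close>)
  have "(\<integral>x. partial_deriv i (partial_deriv i f) x * g x \<partial>lborel) = (\<integral>x. f x * partial_deriv i (partial_deriv i g) x \<partial>lborel)" for i
    using z[of i] unfolding Bochner_Integration.integral_diff[OF i1 i2] by simp
  then show ?thesis
    unfolding laplacian_def sum_distrib_left sum_distrib_right
    by (subst (1 2) Bochner_Integration.integral_sum) (auto intro: i1 i2)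
qed

lemma has_weak_laplacian_test:
  assumes f: "test_function f"
  shows "has_weak_laplacian (real_L2 f) (real_L2 (laplacian f))"
  unfolding has_weak_laplacian_cinner
proof (intro allI impI)
  fix g assume g: "test_function g"
  have R: "cinner (real_L2 a) (real_L2 b) = of_real (\<integral>x. a x * b x \<partial>lborel)"
    if "square_integrable (\<lambda>x. of_real (a x))" "square_integrable (\<lambda>x. of_real (b x))" for a b
  proof -
    have "cinner (real_L2 a) (real_L2 b) = cnj (\<integral>x. of_real (b x) * rep_L2 (real_L2 a) x \<partial>lborel)"
      by (subst cinner_commute) (simp add: cinner_real_L2 that)
    also have "(\<integral>x. of_real (b x) * rep_L2 (real_L2 a) x \<partial>lborel) = (\<integral>x. complex_of_real (a x * b x) \<partial>lborel)"
    proof (rule integral_cong_AE)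
      show "AE x in lborel. of_real (b x) * rep_L2 (real_L2 a) x = complex_of_real (a x * b x)"
        using rep_abs_L2[OF that(1)] unfolding real_L2_def by eventually_elim simp
      have "(\<lambda>x. Re (complex_of_real (a x))) \<in> borel_measurable borel" "(\<lambda>x. Re (complex_of_real (b x))) \<in> borel_measurable borel"
        using that unfolding square_integrable_def by (auto simp del: Re_complex_of_real)
      then have [measurable]: "a \<in> borel_measurable borel" "b \<in> borel_measurable borel" by auto
      show "(\<lambda>x. of_real (b x) * rep_L2 (real_L2 a) x) \<in> borel_measurable lborel"
        "(\<lambda>x. complex_of_real (a x * b x)) \<in> borel_measurable lborel" by measurable
    qed
    finally show ?thesis by (simp only: integral_complex_of_real complex_cnj_complex_of_real)
  qed
  show "cinner (real_L2 (laplacian g)) (real_L2 f) = cinner (real_L2 g) (real_L2 (laplacian f))"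
    using test_laplacian_symmetric[OF g f]
    by (simp add: R square_integrable_test square_integrable_laplacian_test f g)
qed

text \<open>Extends the defining identity of the weak Laplacian from test functions to functions
  without compact support, such as Gaussians. The cutoff is \<open>bump (c n *\<^sub>R x)\<close>
  with \<open>c n\<close> tending to \<open>0\<close>: each derivative falling on it brings a factor
  \<open>c n\<close>, and square integrability of \<open>f\<close> and its derivatives provides the
  dominating functions.\<close>

lemma weak_laplacian_cutoff:
  assumes u: "has_weak_laplacian u l" and f: "smooth_expr f"
    and sq: "square_integrable (\<lambda>x. of_real (f x))" "\<And>i. square_integrable (\<lambda>x. of_real (partial_deriv i f x))"
      "square_integrable (\<lambda>x. of_real (laplacian f x))"
  shows "(\<integral>x. of_real (laplacian f x) * rep_L2 u x \<partial>lborel) = (\<integral>x. of_real (f x) * rep_L2 l x \<partial>lborel)"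
proof -
  note sb = smooth_expr_bump
  have zb: "partial_deriv i bump x = 0" if "x \<notin> cball 0 1" for i x
    by (rule partial_deriv_zero_outside[OF closed_cball bump_outside that]) auto
  have zb2: "laplacian bump x = 0" if x: "x \<notin> cball 0 1" for x
    unfolding laplacian_def using partial_deriv_zero_outside[OF closed_cball zb x] by simp
  have "\<exists>B\<ge>0. \<forall>x. \<bar>partial_deriv i bump x\<bar> \<le> B" for i
    by (rule bounded_if_compact_support[OF smooth_expr_continuous[OF smooth_expr_step(2)[OF sb]] compact_cball zb])
  then obtain B1 where B1: "\<And>i. 0 \<le> B1 i" "\<And>i x. \<bar>partial_deriv i bump x\<bar> \<le> B1 i" by metis
  obtain B0 where B0: "0 \<le> B0" "\<And>x. \<bar>bump x\<bar> \<le> B0"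
    using bounded_if_compact_support[OF smooth_expr_continuous[OF sb] compact_cball bump_outside] by blast
  obtain B2 where B2: "0 \<le> B2" "\<And>x. \<bar>laplacian bump x\<bar> \<le> B2"
    using bounded_if_compact_support[OF smooth_expr_continuous[OF smooth_expr_laplacian[OF sb]] compact_cball zb2] by blast
  define c where "c n = 1 / real (Suc n)" for n
  have c: "0 < c n" "c n \<le> 1" for n by (auto simp: c_def)
  have c0: "c \<longlonglongrightarrow> 0" unfolding c_def by (rule LIMSEQ_Suc[OF lim_1_over_n])
  define X where "X n x = bump (c n *\<^sub>R x)" for n x
  have X: "smooth_expr (X n)" for n unfolding X_def by (rule smooth_expr_scale[OF sb])
  have Xf: "smooth_expr (\<lambda>x. X n x * f x)" for n by (rule smooth_expr.mult[OF X f])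
  have test: "test_function (\<lambda>x. X n x * f x)" for n
  proof (rule test_functionI[OF Xf compact_cball])
    fix x :: "real^3" assume "x \<notin> cball 0 (1 / c n)"
    then have "1 < norm (c n *\<^sub>R x)" using c(1)[of n] by (simp add: not_le pos_divide_less_eq mult.commute)
    then show "X n x * f x = 0" using bump_outside by (simp add: X_def)
  qed
  have pX: "partial_deriv i (X n) x = c n * partial_deriv i bump (c n *\<^sub>R x)" for i n x
    unfolding X_def by (rule partial_deriv_scale[OF smooth_expr_step(1)[OF sb]])
  have lX: "laplacian (X n) x = (c n)\<^sup>2 * laplacian bump (c n *\<^sub>R x)" for n x
    unfolding X_def by (rule laplacian_scale[OF sb])
  have lXf: "laplacian (\<lambda>x. X n x * f x) x = (c n)\<^sup>2 * laplacian bump (c n *\<^sub>R x) * f x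
      + 2 * (\<Sum>i\<in>UNIV. c n * partial_deriv i bump (c n *\<^sub>R x) * partial_deriv i f x) + X n x * laplacian f x" for n x
    unfolding laplacian_mult[OF X f] pX lX ..
  have bz: "(\<lambda>n. a n * b n) \<longlonglongrightarrow> 0" if "a \<longlonglongrightarrow> 0" "\<And>n. \<bar>b n\<bar> \<le> K" for a b :: "nat \<Rightarrow> real" and K
  proof (rule Lim_null_comparison)
    show "\<forall>\<^sub>F n in sequentially. norm (a n * b n) \<le> \<bar>a n\<bar> * K"
      using that(2) by (auto simp: abs_mult intro!: always_eventually mult_left_mono)
    show "(\<lambda>n. \<bar>a n\<bar> * K) \<longlonglongrightarrow> 0" using tendsto_mult_left_zero[OF tendsto_rabs_zero[OF that(1)]] .
  qed
  have X1: "(\<lambda>n. X n x) \<longlonglongrightarrow> 1" for x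
  proof -
    have "isCont bump 0" using smooth_expr_continuous[OF sb] by (simp add: continuous_on_eq_continuous_at)
    moreover have "(\<lambda>n. c n *\<^sub>R x) \<longlonglongrightarrow> 0 *\<^sub>R x" by (intro tendsto_intros c0)
    ultimately show ?thesis using isCont_tendsto_compose[of 0 bump] bump_0 by (simp add: X_def)
  qed
  have lim: "(\<lambda>n. laplacian (\<lambda>x. X n x * f x) x) \<longlonglongrightarrow> laplacian f x" for x
  proof -
    have c2: "(\<lambda>n. (c n)\<^sup>2) \<longlonglongrightarrow> 0" using tendsto_power[OF c0, of 2] by simp
    have "(\<lambda>n. laplacian (\<lambda>x. X n x * f x) x) \<longlonglongrightarrow> 0 * f x + 2 * (\<Sum>i\<in>UNIV. 0 * partial_deriv i f x) + 1 * laplacian f x"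
      unfolding lXf by (intro tendsto_intros X1 bz[OF c0 B1(2)] bz[OF c2 B2(2)])
    then show ?thesis by simp
  qed
  note ms = smooth_expr_measurable[OF f] smooth_expr_measurable[OF smooth_expr_laplacian[OF f]]
    smooth_expr_measurable[OF smooth_expr_step(2)[OF f]] smooth_expr_measurable[OF Xf]
    smooth_expr_measurable[OF smooth_expr_laplacian[OF Xf]] smooth_expr_measurable[OF X]
  note [measurable] = ms
  have iu: "integrable lborel (\<lambda>x. \<bar>g x\<bar> * norm (rep_L2 w x))" if "square_integrable (\<lambda>x. of_real (g x))" for g w
    using integrable_norm[OF square_integrable_mult_integrable[OF that square_integrable_rep[of w]]] by (simp add: norm_mult)
  have L: "(\<lambda>n. \<integral>x. of_real (laplacian (\<lambda>x. X n x * f x) x) * rep_L2 u x \<partial>lborel) \<longlonglongrightarrow> (\<integral>x. of_real (laplacian f x) * rep_L2 u x \<partial>lborel)"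
  proof (rule integral_dominated_convergence[where w = "\<lambda>x. B2 * (\<bar>f x\<bar> * norm (rep_L2 u x))
      + 2 * (\<Sum>i\<in>UNIV. B1 i * (\<bar>partial_deriv i f x\<bar> * norm (rep_L2 u x))) + B0 * (\<bar>laplacian f x\<bar> * norm (rep_L2 u x))"])
    show "integrable lborel (\<lambda>x. B2 * (\<bar>f x\<bar> * norm (rep_L2 u x))
      + 2 * (\<Sum>i\<in>UNIV. B1 i * (\<bar>partial_deriv i f x\<bar> * norm (rep_L2 u x))) + B0 * (\<bar>laplacian f x\<bar> * norm (rep_L2 u x)))"
      by (intro Bochner_Integration.integrable_add integrable_mult_right Bochner_Integration.integrable_sum iu sq)
    show "AE x in lborel. (\<lambda>n. of_real (laplacian (\<lambda>x. X n x * f x) x) * rep_L2 u x) \<longlonglongrightarrow> of_real (laplacian f x) * rep_L2 u x"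
      by (intro AE_I2 tendsto_intros lim)
    show "AE x in lborel. norm (of_real (laplacian (\<lambda>x. X n x * f x) x) * rep_L2 u x) \<le> B2 * (\<bar>f x\<bar> * norm (rep_L2 u x))
      + 2 * (\<Sum>i\<in>UNIV. B1 i * (\<bar>partial_deriv i f x\<bar> * norm (rep_L2 u x))) + B0 * (\<bar>laplacian f x\<bar> * norm (rep_L2 u x))" for n
    proof (rule AE_I2)
      fix x
      have "\<bar>laplacian (\<lambda>x. X n x * f x) x\<bar> \<le> \<bar>(c n)\<^sup>2 * laplacian bump (c n *\<^sub>R x) * f x\<bar>
        + \<bar>2 * (\<Sum>i\<in>UNIV. c n * partial_deriv i bump (c n *\<^sub>R x) * partial_deriv i f x)\<bar> + \<bar>X n x * laplacian f x\<bar>"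
        unfolding lXf by linarith
      also have "\<dots> \<le> B2 * \<bar>f x\<bar> + 2 * (\<Sum>i\<in>UNIV. B1 i * \<bar>partial_deriv i f x\<bar>) + B0 * \<bar>laplacian f x\<bar>"
      proof (intro add_mono)
        have "(c n)\<^sup>2 \<le> 1" using c[of n] by (intro power_le_one) auto
        then have "\<bar>(c n)\<^sup>2 * laplacian bump (c n *\<^sub>R x)\<bar> \<le> 1 * B2" unfolding abs_mult using B2 by (intro mult_mono) auto
        then show "\<bar>(c n)\<^sup>2 * laplacian bump (c n *\<^sub>R x) * f x\<bar> \<le> B2 * \<bar>f x\<bar>"
          unfolding abs_mult[of _ "f x"] by (intro mult_right_mono) auto
        have "\<bar>\<Sum>i\<in>UNIV. c n * partial_deriv i bump (c n *\<^sub>R x) * partial_deriv i f x\<bar>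
          \<le> (\<Sum>i\<in>UNIV. \<bar>c n * partial_deriv i bump (c n *\<^sub>R x) * partial_deriv i f x\<bar>)" by (rule sum_abs)
        also have "\<dots> \<le> (\<Sum>i\<in>UNIV. B1 i * \<bar>partial_deriv i f x\<bar>)"
        proof (rule sum_mono)
          fix i
          have "\<bar>c n * partial_deriv i bump (c n *\<^sub>R x)\<bar> \<le> 1 * B1 i" unfolding abs_mult using B1 c[of n] by (intro mult_mono) auto
          then show "\<bar>c n * partial_deriv i bump (c n *\<^sub>R x) * partial_deriv i f x\<bar> \<le> B1 i * \<bar>partial_deriv i f x\<bar>"
            unfolding abs_mult[of _ "partial_deriv i f x"] by (intro mult_right_mono) auto
        qed
        finally show "\<bar>2 * (\<Sum>i\<in>UNIV. c n * partial_deriv i bump (c n *\<^sub>R x) * partial_deriv i f x)\<bar> \<le> 2 * (\<Sum>i\<in>UNIV. B1 i * \<bar>partial_deriv i f x\<bar>)"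
          by simp
        show "\<bar>X n x * laplacian f x\<bar> \<le> B0 * \<bar>laplacian f x\<bar>"
          unfolding abs_mult X_def by (intro mult_right_mono B0) auto
      qed
      finally have "\<bar>laplacian (\<lambda>x. X n x * f x) x\<bar> * norm (rep_L2 u x) \<le> (B2 * \<bar>f x\<bar> + 2 * (\<Sum>i\<in>UNIV. B1 i * \<bar>partial_deriv i f x\<bar>) + B0 * \<bar>laplacian f x\<bar>) * norm (rep_L2 u x)"
        by (intro mult_right_mono) auto
      then show "norm (of_real (laplacian (\<lambda>x. X n x * f x) x) * rep_L2 u x) \<le> B2 * (\<bar>f x\<bar> * norm (rep_L2 u x))
      + 2 * (\<Sum>i\<in>UNIV. B1 i * (\<bar>partial_deriv i f x\<bar> * norm (rep_L2 u x))) + B0 * (\<bar>laplacian f x\<bar> * norm (rep_L2 u x))"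
        by (simp add: norm_mult distrib_right sum_distrib_right mult.assoc)
    qed
  qed measurable
  have R: "(\<lambda>n. \<integral>x. of_real (X n x * f x) * rep_L2 l x \<partial>lborel) \<longlonglongrightarrow> (\<integral>x. of_real (f x) * rep_L2 l x \<partial>lborel)"
  proof (rule integral_dominated_convergence[where w = "\<lambda>x. B0 * (\<bar>f x\<bar> * norm (rep_L2 l x))"])
    show "integrable lborel (\<lambda>x. B0 * (\<bar>f x\<bar> * norm (rep_L2 l x)))" by (intro integrable_mult_right iu sq)
    show "AE x in lborel. (\<lambda>n. of_real (X n x * f x) * rep_L2 l x) \<longlonglongrightarrow> of_real (f x) * rep_L2 l x"
    proof (rule AE_I2)
      fix x
      have "(\<lambda>n. of_real (X n x * f x) * rep_L2 l x) \<longlonglongrightarrow> of_real (1 * f x) * rep_L2 l x" by (intro tendsto_intros X1)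
      then show "(\<lambda>n. of_real (X n x * f x) * rep_L2 l x) \<longlonglongrightarrow> of_real (f x) * rep_L2 l x" by simp
    qed
    show "AE x in lborel. norm (of_real (X n x * f x) * rep_L2 l x) \<le> B0 * (\<bar>f x\<bar> * norm (rep_L2 l x))" for n
      using B0 by (intro AE_I2) (auto simp: norm_mult abs_mult X_def mult.assoc intro!: mult_right_mono)
  qed measurable
  have "(\<integral>x. of_real (laplacian (\<lambda>x. X n x * f x) x) * rep_L2 u x \<partial>lborel) = (\<integral>x. of_real (X n x * f x) * rep_L2 l x \<partial>lborel)" for n
    using u test[of n] unfolding has_weak_laplacian_def by blast
  then show ?thesis using LIMSEQ_unique[OF L] R by simp
qed

subsection \<open>Testing weak Laplacians against coherent states\<close>

lemma square_integrable_gauss_bound: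
  assumes h: "0 < h" and [measurable]: "f \<in> borel_measurable borel"
    and b: "\<And>x. \<bar>f x\<bar> \<le> k * (gauss_window h (x - q) * (1 + (norm (x - q))\<^sup>2 / h))"
  shows "square_integrable (\<lambda>x. of_real (f x))"
proof (rule square_integrableI)
  let ?v = "\<lambda>y. ennreal ((gauss_window h y * (1 + (norm y)\<^sup>2 / h))\<^sup>2)"
  have "(\<integral>\<^sup>+x. ennreal ((norm (complex_of_real (f x)))\<^sup>2) \<partial>lborel) \<le> (\<integral>\<^sup>+x. ennreal (k\<^sup>2) * ?v (x - q) \<partial>lborel)"
  proof (intro nn_integral_mono)
    fix x
    have "\<bar>f x\<bar>\<^sup>2 \<le> (k * (gauss_window h (x - q) * (1 + (norm (x - q))\<^sup>2 / h)))\<^sup>2"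
      by (intro power_mono b) auto
    then show "ennreal ((norm (complex_of_real (f x)))\<^sup>2) \<le> ennreal (k\<^sup>2) * ?v (x - q)"
      by (simp add: ennreal_mult[symmetric] ennreal_leI power_mult_distrib)
  qed
  also have "\<dots> = ennreal (k\<^sup>2) * window_moment"
    using lborel_nn_integral_affine[of ?v 1 "- q"] nn_integral_window_moment[OF h] by (simp add: nn_integral_cmult)
  also have "\<dots> < \<infinity>" using window_moment_finite by (simp add: ennreal_mult_less_top)
  finally show "(\<integral>\<^sup>+x. ennreal ((norm (complex_of_real (f x)))\<^sup>2) \<partial>lborel) < \<infinity>" .
qed measurable

text \<open>The real and imaginary parts of a coherent state are of this form, up to the phase \<open>c\<close>.\<close>
definition gauss_wave :: "real \<Rightarrow> real^3 \<Rightarrow> real^3 \<Rightarrow> real \<Rightarrow> real^3 \<Rightarrow> real" where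
  "gauss_wave h q k c x = (pi * h) powr (- 3 / 4) * (exp ((- 1 / (2 * h)) * (norm (x - q))\<^sup>2) * cos (x \<bullet> k + c))"

lemma smooth_expr_gauss_wave: "smooth_expr (gauss_wave h q k c)"
  unfolding gauss_wave_def[abs_def]
  by (intro smooth_expr.mult smooth_expr.const smooth_expr_exp smooth_expr_cos smooth_expr_norm_sq smooth_expr.inner)

lemma gauss_wave_alt: "gauss_wave h q k c x = gauss_window h (x - q) * cos (x \<bullet> k + c)"
  by (simp add: gauss_wave_def gauss_window_def)

lemma has_derivative_gauss_window:
  assumes "0 < h"
  shows "((\<lambda>x. gauss_window h (x - q)) has_derivative (\<lambda>v. - (((x - q) \<bullet> v) / h) * gauss_window h (x - q))) (at x)"
proof -
  have "((\<lambda>x. (pi * h) powr (- 3 / 4) * exp (- ((x - q) \<bullet> (x - q)) / (2 * h))) has_derivative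
    (\<lambda>v. - (((x - q) \<bullet> v) / h) * ((pi * h) powr (- 3 / 4) * exp (- ((x - q) \<bullet> (x - q)) / (2 * h))))) (at x)"
    using assms by (auto intro!: derivative_eq_intros ext simp: inner_commute field_simps)
  then show ?thesis by (simp add: gauss_window_def power2_norm_eq_inner)
qed

lemma has_derivative_cos_wave:
  "((\<lambda>x::real^3. cos (x \<bullet> k + c)) has_derivative (\<lambda>v. - sin (x \<bullet> k + c) * (v \<bullet> k))) (at x)"
  "((\<lambda>x::real^3. sin (x \<bullet> k + c)) has_derivative (\<lambda>v. cos (x \<bullet> k + c) * (v \<bullet> k))) (at x)"
  by (auto intro!: derivative_eq_intros ext)

lemma partial_deriv_gauss_wave:
  assumes "0 < h"
  shows "partial_deriv i (gauss_wave h q k c) x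
    = gauss_window h (x - q) * (- ((x - q) $ i / h) * cos (x \<bullet> k + c) - k $ i * sin (x \<bullet> k + c))"
  unfolding gauss_wave_alt[abs_def]
  by (subst partial_deriv_eqI[OF has_derivative_mult[OF has_derivative_gauss_window[OF assms] has_derivative_cos_wave(1)]])
     (simp add: inner_axis inner_axis' algebra_simps)

lemma partial_deriv2_gauss_wave:
  assumes h: "0 < h"
  shows "partial_deriv i (partial_deriv i (gauss_wave h q k c)) x
    = gauss_window h (x - q) * ((((x - q) $ i)\<^sup>2 / h\<^sup>2 - 1 / h - (k $ i)\<^sup>2) * cos (x \<bullet> k + c)
      + 2 / h * ((x - q) $ i * k $ i) * sin (x \<bullet> k + c))"
proof -
  let ?Q = "\<lambda>x. - (((x - q) \<bullet> axis i 1) / h) * cos (x \<bullet> k + c) - k $ i * sin (x \<bullet> k + c)"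
  have eq: "partial_deriv i (gauss_wave h q k c) = (\<lambda>x. gauss_window h (x - q) * ?Q x)"
    by (rule ext) (simp add: partial_deriv_gauss_wave[OF h] inner_axis)
  have Q: "(?Q has_derivative (\<lambda>v. - ((v \<bullet> axis i 1) / h) * cos (x \<bullet> k + c)
     - (((x - q) \<bullet> axis i 1) / h) * (- sin (x \<bullet> k + c) * (v \<bullet> k)) - k $ i * (cos (x \<bullet> k + c) * (v \<bullet> k)))) (at x)"
    using h by (auto intro!: derivative_eq_intros ext simp: add_divide_distrib diff_divide_distrib)
  show ?thesis
    unfolding eq
    by (subst partial_deriv_eqI[OF has_derivative_mult[OF has_derivative_gauss_window[OF h] Q]])
       (use h in \<open>simp add: inner_axis inner_axis' field_simps power2_eq_square\<close>)
qed

lemma laplacian_gauss_wave: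
  assumes h: "0 < h"
  shows "laplacian (gauss_wave h q k c) x
    = gauss_window h (x - q) * (((norm (x - q))\<^sup>2 / h\<^sup>2 - 3 / h - (norm k)\<^sup>2) * cos (x \<bullet> k + c)
      + 2 / h * ((x - q) \<bullet> k) * sin (x \<bullet> k + c))"
proof -
  have n: "(norm (x - q))\<^sup>2 = ((x - q) $ 1)\<^sup>2 + ((x - q) $ 2)\<^sup>2 + ((x - q) $ 3)\<^sup>2"
    and k: "(norm k)\<^sup>2 = (k $ 1)\<^sup>2 + (k $ 2)\<^sup>2 + (k $ 3)\<^sup>2"
    and xk: "(x - q) \<bullet> k = (x - q) $ 1 * k $ 1 + (x - q) $ 2 * k $ 2 + (x - q) $ 3 * k $ 3"
    unfolding power2_norm_eq_inner inner_vec_def sum_3 by (simp_all add: power2_eq_square)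
  show ?thesis
    unfolding laplacian_def partial_deriv2_gauss_wave[OF h] sum_3 n k xk
    by (simp add: algebra_simps add_divide_distrib diff_divide_distrib)
qed

lemma norm_le_weight:
  assumes h: "0 < h" shows "norm y \<le> (1 + h) * (1 + (norm y)\<^sup>2 / h)" "(norm y)\<^sup>2 \<le> h * (1 + (norm y)\<^sup>2 / h)" "1 \<le> 1 + (norm y)\<^sup>2 / h"
proof -
  have "0 \<le> (norm y - 1/2)\<^sup>2" by simp
  then have "norm y \<le> 1 + (norm y)\<^sup>2" by (simp add: power2_eq_square algebra_simps)
  also have "\<dots> \<le> 1 + (norm y)\<^sup>2 + h + (norm y)\<^sup>2 / h" using h by simp
  also have "\<dots> = (1 + h) * (1 + (norm y)\<^sup>2 / h)" using h by (simp add: field_simps)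
  finally show "norm y \<le> (1 + h) * (1 + (norm y)\<^sup>2 / h)" .
  show "(norm y)\<^sup>2 \<le> h * (1 + (norm y)\<^sup>2 / h)" "1 \<le> 1 + (norm y)\<^sup>2 / h" using h by (auto simp: field_simps)
qed

text \<open>The three memberships required by \<open>weak_laplacian_cutoff\<close>; each function is
  the window times a factor dominated by the quadratic weight, with a constant depending on
  \<open>h\<close> and \<open>k\<close>.\<close>

lemma
  assumes h: "0 < h"
  shows square_integrable_gauss_wave: "square_integrable (\<lambda>x. of_real (gauss_wave h q k c x))"
    and square_integrable_partial_gauss_wave: "square_integrable (\<lambda>x. of_real (partial_deriv i (gauss_wave h q k c) x))"
    and square_integrable_laplacian_gauss_wave: "square_integrable (\<lambda>x. of_real (laplacian (gauss_wave h q k c) x))"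
proof -
  note S = smooth_expr_gauss_wave[of h q k c]
  let ?w = "\<lambda>x. gauss_window h (x - q)" and ?r = "\<lambda>x. 1 + (norm (x - q))\<^sup>2 / h"
  note w0 = gauss_window_nonneg[of h]
  note W = norm_le_weight[OF h]
  have r0: "0 \<le> ?r x" for x using h by auto
  have abs_cs: "\<bar>cos t\<bar> \<le> 1" "\<bar>sin t\<bar> \<le> 1" for t :: real by auto
  have "\<bar>gauss_wave h q k c x\<bar> \<le> 1 * (?w x * ?r x)" for x
  proof -
    have "\<bar>cos (x \<bullet> k + c)\<bar> \<le> ?r x" using abs_cs(1) W(3) by (meson order_trans)
    then show ?thesis using w0[of "x - q"] by (simp add: gauss_wave_alt abs_mult mult_left_mono)
  qed
  then show "square_integrable (\<lambda>x. of_real (gauss_wave h q k c x))"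
    by (rule square_integrable_gauss_bound[OF h smooth_expr_measurable[OF S]])
  have cm: "\<bar>a * cos t\<bar> \<le> \<bar>a\<bar>" "\<bar>a * sin t\<bar> \<le> \<bar>a\<bar>" for a t :: real
    by (auto simp: abs_mult mult_left_le)
  have "\<bar>partial_deriv i (gauss_wave h q k c) x\<bar> \<le> ((1 + h) / h + norm k) * (?w x * ?r x)" for x
  proof -
    have "\<bar>- ((x - q) $ i / h) * cos (x \<bullet> k + c) - k $ i * sin (x \<bullet> k + c)\<bar> \<le> \<bar>- ((x - q) $ i / h)\<bar> + \<bar>k $ i\<bar>"
      using cm(1)[of "- ((x - q) $ i / h)" "x \<bullet> k + c"] cm(2)[of "k $ i" "x \<bullet> k + c"] by linarith
    also have "\<dots> \<le> norm (x - q) / h + norm k"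
      using component_le_norm_cart[of "x - q" i] component_le_norm_cart[of k i] h by (intro add_mono) (auto simp: divide_right_mono)
    also have "\<dots> \<le> (1 + h) * ?r x / h + norm k * ?r x"
      using W(1)[of "x - q"] W(3)[of "x - q"] h by (intro add_mono divide_right_mono) (auto intro: mult_right_mono[of 1, simplified] simp: mult_le_cancel_left1)
    also have "\<dots> = ((1 + h) / h + norm k) * ?r x" by (simp add: algebra_simps add_divide_distrib)
    finally have "?w x * \<bar>- ((x - q) $ i / h) * cos (x \<bullet> k + c) - k $ i * sin (x \<bullet> k + c)\<bar> \<le> ?w x * (((1 + h) / h + norm k) * ?r x)"
      by (intro mult_left_mono w0)
    then show ?thesis using w0[of "x - q"] by (simp add: partial_deriv_gauss_wave[OF h] abs_mult mult_ac)
  qed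
  then show "square_integrable (\<lambda>x. of_real (partial_deriv i (gauss_wave h q k c) x))"
    by (rule square_integrable_gauss_bound[OF h smooth_expr_measurable[OF smooth_expr_step(2)[OF S]]])
  have "\<bar>laplacian (gauss_wave h q k c) x\<bar> \<le> (h / h\<^sup>2 + 3 / h + (norm k)\<^sup>2 + 2 / h * ((1 + h) * norm k)) * (?w x * ?r x)" for x
  proof -
    let ?m = "(norm (x - q))\<^sup>2 / h\<^sup>2 - 3 / h - (norm k)\<^sup>2" and ?s = "2 / h * ((x - q) \<bullet> k)"
    have "\<bar>?m * cos (x \<bullet> k + c) + ?s * sin (x \<bullet> k + c)\<bar> \<le> \<bar>?m\<bar> + \<bar>?s\<bar>"
      using cm(1)[of ?m "x \<bullet> k + c"] cm(2)[of ?s "x \<bullet> k + c"] by linarith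
    also have "\<dots> \<le> ((norm (x - q))\<^sup>2 / h\<^sup>2 + 3 / h + (norm k)\<^sup>2) + 2 / h * (norm (x - q) * norm k)"
    proof (rule add_mono)
      have "0 \<le> (norm (x - q))\<^sup>2 / h\<^sup>2" "0 \<le> 3 / h" "0 \<le> (norm k)\<^sup>2" using h by auto
      then show "\<bar>?m\<bar> \<le> (norm (x - q))\<^sup>2 / h\<^sup>2 + 3 / h + (norm k)\<^sup>2" by linarith
      have "\<bar>?s\<bar> = 2 / h * \<bar>(x - q) \<bullet> k\<bar>" using h by (simp add: abs_mult)
      also have "\<dots> \<le> 2 / h * (norm (x - q) * norm k)" using h by (intro mult_left_mono Cauchy_Schwarz_ineq2) auto
      finally show "\<bar>?s\<bar> \<le> 2 / h * (norm (x - q) * norm k)" .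
    qed
    also have "\<dots> \<le> (h * ?r x / h\<^sup>2 + 3 / h * ?r x + (norm k)\<^sup>2 * ?r x) + 2 / h * (((1 + h) * ?r x) * norm k)"
    proof (intro add_mono)
      show "(norm (x - q))\<^sup>2 / h\<^sup>2 \<le> h * ?r x / h\<^sup>2" using W(2) by (intro divide_right_mono) auto
      show "3 / h \<le> 3 / h * ?r x" using mult_left_mono[OF W(3)[of "x - q"], of "3 / h"] h by simp
      show "(norm k)\<^sup>2 \<le> (norm k)\<^sup>2 * ?r x" using mult_left_mono[OF W(3)[of "x - q"], of "(norm k)\<^sup>2"] by simp
      show "2 / h * (norm (x - q) * norm k) \<le> 2 / h * (((1 + h) * ?r x) * norm k)"
        using W(1) h by (intro mult_left_mono mult_right_mono) auto
    qed
    also have "\<dots> = (h / h\<^sup>2 + 3 / h + (norm k)\<^sup>2 + 2 / h * ((1 + h) * norm k)) * ?r x"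
    proof -
      have "(h * r / H + 3 / h * r + K * r) + 2 / h * (((1 + h) * r) * n) = (h / H + 3 / h + K + 2 / h * ((1 + h) * n)) * r" for r H K n :: real
        by (simp add: algebra_simps add_divide_distrib)
      then show ?thesis .
    qed
    finally have "?w x * \<bar>?m * cos (x \<bullet> k + c) + ?s * sin (x \<bullet> k + c)\<bar> \<le> ?w x * ((h / h\<^sup>2 + 3 / h + (norm k)\<^sup>2 + 2 / h * ((1 + h) * norm k)) * ?r x)"
      by (intro mult_left_mono w0)
    then show ?thesis unfolding laplacian_gauss_wave[OF h] abs_mult using w0[of "x - q"] by (simp only: abs_of_nonneg mult.left_commute)
  qed
  then show "square_integrable (\<lambda>x. of_real (laplacian (gauss_wave h q k c) x))"
    by (rule square_integrable_gauss_bound[OF h smooth_expr_measurable[OF smooth_expr_laplacian[OF S]]])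
qed

lemma weak_laplacian_gauss_wave:
  assumes "0 < h" "has_weak_laplacian u l"
  shows "(\<integral>x. of_real (laplacian (gauss_wave h q k c) x) * rep_L2 u x \<partial>lborel) = (\<integral>x. of_real (gauss_wave h q k c x) * rep_L2 l x \<partial>lborel)"
  by (rule weak_laplacian_cutoff[OF assms(2) smooth_expr_gauss_wave])
     (rule square_integrable_gauss_wave square_integrable_partial_gauss_wave square_integrable_laplacian_gauss_wave, rule assms)+

text \<open>The Laplacian is moved onto the coherent state. With y = x - q, the logarithmic gradient
  of the conjugate state is -y / h - i p / h; its square minus \<open>3 / h\<close> is the complex
  multiplier in the integrand.\<close>

lemma weak_laplacian_coherent:
  assumes h: "0 < h" and u: "has_weak_laplacian u l"
  shows "coherent_transform h l (q, p) = (\<integral>x. cnj (coherent_state h q p x) *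
    (Complex ((norm (x - q))\<^sup>2 / h\<^sup>2 - 3 / h - (norm p)\<^sup>2 / h\<^sup>2) (2 / h\<^sup>2 * ((x - q) \<bullet> p)) * rep_L2 u x) \<partial>lborel)"
proof -
  define k where "k = (1 / h) *\<^sub>R p"
  have nk: "(norm k)\<^sup>2 = (norm p)\<^sup>2 / h\<^sup>2" using h by (simp add: k_def power_divide)
  \<comment> \<open>Test functions are real, so the coherent state is split into a cosine wave and,
    by the phase \<open>- (pi / 2)\<close>, a sine wave, and reassembled at the end.\<close>
  let ?C = "gauss_wave h q k 0" and ?S = "gauss_wave h q k (- (pi / 2))"
  have i: "integrable lborel (\<lambda>x. of_real (f x) * rep_L2 w x)" if "square_integrable (\<lambda>x. of_real (f x))" for f w
    using square_integrable_mult_integrable[OF that square_integrable_rep[of w]] by simp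
  note iC = i[OF square_integrable_gauss_wave[OF h, of q k 0]] i[OF square_integrable_laplacian_gauss_wave[OF h, of q k 0]]
  note iS = i[OF square_integrable_gauss_wave[OF h, of q k "- (pi / 2)"]] i[OF square_integrable_laplacian_gauss_wave[OF h, of q k "- (pi / 2)"]]
  have cs: "cos (t - pi / 2) = sin t" "sin (t - pi / 2) = - cos t" for t :: real
    by (simp_all add: cos_diff sin_diff)
  have e: "cnj (coherent_state h q p x) = of_real (?C x) - \<i> * of_real (?S x)" for x
    by (simp add: coherent_state_alt gauss_wave_alt complex_eq_iff k_def inner_commute cs)
  have "coherent_transform h l (q, p) = (\<integral>x. of_real (?C x) * rep_L2 l x - \<i> * (of_real (?S x) * rep_L2 l x) \<partial>lborel)"
    unfolding coherent_transform_def by (simp add: cinner_abs_left[OF square_integrable_coherent_state[OF h]] e algebra_simps)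
  also have "\<dots> = (\<integral>x. of_real (?C x) * rep_L2 l x \<partial>lborel) - \<i> * (\<integral>x. of_real (?S x) * rep_L2 l x \<partial>lborel)"
    by (subst Bochner_Integration.integral_diff) (simp_all add: iC iS)
  also have "\<dots> = (\<integral>x. of_real (laplacian ?C x) * rep_L2 u x \<partial>lborel) - \<i> * (\<integral>x. of_real (laplacian ?S x) * rep_L2 u x \<partial>lborel)"
    by (simp only: weak_laplacian_gauss_wave[OF h u])
  also have "\<dots> = (\<integral>x. of_real (laplacian ?C x) * rep_L2 u x - \<i> * (of_real (laplacian ?S x) * rep_L2 u x) \<partial>lborel)"
    by (subst Bochner_Integration.integral_diff) (simp_all add: iC iS)
  also have "\<dots> = (\<integral>x. cnj (coherent_state h q p x) *
    (Complex ((norm (x - q))\<^sup>2 / h\<^sup>2 - 3 / h - (norm p)\<^sup>2 / h\<^sup>2) (2 / h\<^sup>2 * ((x - q) \<bullet> p)) * rep_L2 u x) \<partial>lborel)"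
  proof (intro Bochner_Integration.integral_cong refl)
    fix x
    have "of_real (laplacian ?C x) - \<i> * of_real (laplacian ?S x) = cnj (coherent_state h q p x) *
      Complex ((norm (x - q))\<^sup>2 / h\<^sup>2 - 3 / h - (norm p)\<^sup>2 / h\<^sup>2) (2 / h\<^sup>2 * ((x - q) \<bullet> p))"
      unfolding e laplacian_gauss_wave[OF h] gauss_wave_alt nk
      using h by (simp add: complex_eq_iff cs k_def power2_eq_square algebra_simps add_divide_distrib diff_divide_distrib)
    then show "of_real (laplacian ?C x) * rep_L2 u x - \<i> * (of_real (laplacian ?S x) * rep_L2 u x) = cnj (coherent_state h q p x) *
    (Complex ((norm (x - q))\<^sup>2 / h\<^sup>2 - 3 / h - (norm p)\<^sup>2 / h\<^sup>2) (2 / h\<^sup>2 * ((x - q) \<bullet> p)) * rep_L2 u x)"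
      by (metis (no_types, lifting) left_diff_distrib mult.assoc)
  qed
  finally show ?thesis .
qed

section \<open>Spectral families\<close>

lemma sums_sum_list: "(\<And>x. x \<in> set L \<Longrightarrow> (\<lambda>n. f x n) sums s x) \<Longrightarrow> (\<lambda>n. \<Sum>x\<leftarrow>L. f x n) sums (\<Sum>x\<leftarrow>L. s x)"
  for f :: "'a \<Rightarrow> nat \<Rightarrow> real"
  by (induction L) (auto intro: sums_add)

lemma tendsto_sum_list: "(\<And>x. x \<in> set L \<Longrightarrow> (\<lambda>n. f x n) \<longlonglongrightarrow> s x) \<Longrightarrow> (\<lambda>n. \<Sum>x\<leftarrow>L. f x n) \<longlonglongrightarrow> (\<Sum>x\<leftarrow>L. s x)"
  for f :: "'a \<Rightarrow> nat \<Rightarrow> real"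
  by (induction L) (auto intro: tendsto_add)

lemma sum_list_sum_swap: "(\<Sum>x\<leftarrow>L. \<Sum>y\<in>A. f x y) = (\<Sum>y\<in>A. \<Sum>x\<leftarrow>L. f x y)" for f :: "'a \<Rightarrow> 'b \<Rightarrow> real"
  by (induction L) (auto simp: sum.distrib)

text \<open>This replaces the calculus of signed measures.\<close>
lemma measures_linear_identity:
  fixes L :: "(real \<times> real measure) list"
  assumes fin: "\<And>a M. (a, M) \<in> set L \<Longrightarrow> finite_borel_measure M"
    and cdf: "\<And>t. (\<Sum>(a, M)\<leftarrow>L. a * measure M {..t}) = 0"
    and int: "\<And>a M. (a, M) \<in> set L \<Longrightarrow> integrable M g"
    and g [measurable]: "g \<in> borel_measurable borel"
  shows "(\<Sum>(a, M)\<leftarrow>L. a * (\<integral>x. g x \<partial>M)) = (0 :: real)"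
proof -
  have fm: "finite_measure M" "sets M = sets borel" "space M = UNIV" if "(a, M) \<in> set L" for a M
  proof -
    interpret finite_borel_measure M using fin[OF that] .
    show "finite_measure M" by unfold_locales
    show "sets M = sets borel" by (rule M_is_borel)
    show "space M = UNIV" by (rule borel_UNIV)
  qed
  \<comment> \<open>The total masses are the limits of the masses of half-lines; the case of
    complements below depends on them.\<close>
  have UNIV0: "(\<Sum>(a, M)\<leftarrow>L. a * measure M UNIV) = 0"
  proof (rule LIMSEQ_unique)
    have U: "(\<Union>n. {..real n}) = UNIV"
      using real_arch_simple by auto
    show "(\<lambda>n. \<Sum>(a, M)\<leftarrow>L. a * measure M {..real n}) \<longlonglongrightarrow> (\<Sum>(a, M)\<leftarrow>L. a * measure M UNIV)"
      unfolding split_def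
    proof (intro tendsto_sum_list tendsto_mult tendsto_const)
      fix x assume "x \<in> set L"
      then have x: "(fst x, snd x) \<in> set L" by simp
      interpret finite_measure "snd x" by (rule fm(1)[OF x])
      show "(\<lambda>n. measure (snd x) {..real n}) \<longlonglongrightarrow> measure (snd x) UNIV"
      proof -
        have "range (\<lambda>n. {..real n}) \<subseteq> sets (snd x)" by (simp add: fm(2)[OF x] image_subset_iff)
        then show ?thesis using finite_Lim_measure_incseq[of "\<lambda>n. {..real n}"] U by (auto simp: incseq_def)
      qed
    qed
    show "(\<lambda>n. \<Sum>(a, M)\<leftarrow>L. a * measure M {..real n}) \<longlonglongrightarrow> 0" by (simp add: cdf)
  qed
  have sets0: "(\<Sum>(a, M)\<leftarrow>L. a * measure M A) = 0" if "A \<in> sets borel" for A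
  proof -
    have A: "A \<in> sigma_sets UNIV (range (\<lambda>t. {..t::real}))"
      using that by (simp add: borel_eq_atMost)
    have G: "Int_stable (range (\<lambda>t. {..t::real}))" "range (\<lambda>t. {..t::real}) \<subseteq> Pow UNIV"
      by (auto simp: Int_stable_def)
    from G A have "(\<Sum>(a, M)\<leftarrow>L. a * measure M A) = 0 \<and> A \<in> sets borel"
    proof (induction rule: sigma_sets_induct_disjoint)
      case (basic A) then show ?case using cdf by auto
    next
      case empty show ?case by (auto simp: split_def)
    next
      case (compl A)
      have "(\<Sum>(a, M)\<leftarrow>L. a * measure M (UNIV - A)) = (\<Sum>(a, M)\<leftarrow>L. a * measure M UNIV - a * measure M A)"
      proof (intro arg_cong[where f = sum_list] map_cong refl, clarify)
        fix a M assume x: "(a, M) \<in> set L"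
        interpret finite_measure M by (rule fm(1)[OF x])
        show "a * measure M (UNIV - A) = a * measure M UNIV - a * measure M A"
          using finite_measure_compl[of A] compl fm(2,3)[OF x] by (simp add: right_diff_distrib)
      qed
      also have "\<dots> = 0" using compl UNIV0 by (simp add: split_def sum_list_subtractf)
      finally show ?case using compl by auto
    next
      case (union A)
      have "(\<lambda>n. \<Sum>(a, M)\<leftarrow>L. a * measure M (A n)) sums (\<Sum>(a, M)\<leftarrow>L. a * measure M (\<Union>n. A n))"
        unfolding split_def
      proof (intro sums_sum_list sums_mult)
        fix x assume "x \<in> set L"
        then have x: "(fst x, snd x) \<in> set L" by simp
        interpret finite_measure "snd x" by (rule fm(1)[OF x])
        show "(\<lambda>n. measure (snd x) (A n)) sums measure (snd x) (\<Union>n. A n)"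
          using union fm(2)[OF x] by (intro finite_measure_UNION) auto
      qed
      then have "(\<lambda>n. 0) sums (\<Sum>(a, M)\<leftarrow>L. a * measure M (\<Union>n. A n))" using union by simp
      then show ?case using union sums_unique2[OF sums_zero] by auto
    qed
    then show ?thesis by blast
  qed
  \<comment> \<open>One sequence of simple functions, dominated by \<open>2 * norm (g x)\<close>,
    serves all measures of the list simultaneously.\<close>
  obtain s where s: "\<And>i. simple_function borel (s i)" "\<And>x. (\<lambda>i. s i x) \<longlonglongrightarrow> g x" "\<And>i x. dist (s i x) 0 \<le> 2 * dist (g x) 0"
    using borel_measurable_implies_sequence_metric[OF g, of 0] by auto
  have s0: "(\<Sum>(a, M)\<leftarrow>L. a * (\<integral>x. s i x \<partial>M)) = 0" for i
  proof -
    have fr: "finite (range (s i))" using s(1)[of i] by (auto simp: simple_function_def)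
    have pre: "s i -` {y} \<in> sets borel" if "y \<in> range (s i)" for y
      using s(1)[of i] that by (auto simp: simple_function_def)
    have se: "s i x = (\<Sum>y\<in>range (s i). y * indicator (s i -` {y}) x)" for x
      using fr by (subst sum.remove[of _ "s i x"]) (auto simp: indicator_def)
    have "(\<Sum>(a, M)\<leftarrow>L. a * (\<integral>x. s i x \<partial>M)) = (\<Sum>(a, M)\<leftarrow>L. \<Sum>y\<in>range (s i). y * (a * measure M (s i -` {y})))"
    proof (intro arg_cong[where f = sum_list] map_cong refl, clarify)
      fix a M assume x: "(a, M) \<in> set L"
      interpret finite_measure M by (rule fm(1)[OF x])
      have "(\<integral>x. s i x \<partial>M) = (\<Sum>y\<in>range (s i). \<integral>x. y * indicator (s i -` {y}) x \<partial>M)"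
        by (subst se, subst Bochner_Integration.integral_sum)
           (use pre fm(2)[OF x] in \<open>auto intro!: integrable_mult_right integrable_real_indicator simp: less_top[symmetric]\<close>)
      also have "\<dots> = (\<Sum>y\<in>range (s i). y * measure M (s i -` {y}))"
        using fm(3)[OF x] by (intro sum.cong refl) simp
      finally show "a * (\<integral>x. s i x \<partial>M) = (\<Sum>y\<in>range (s i). y * (a * measure M (s i -` {y})))"
        by (simp add: sum_distrib_left mult_ac)
    qed
    also have "\<dots> = (\<Sum>y\<in>range (s i). y * (\<Sum>(a, M)\<leftarrow>L. a * measure M (s i -` {y})))"
      unfolding split_def by (simp add: sum_list_sum_swap sum_list_const_mult)
    also have "\<dots> = 0" using sets0 pre by (intro sum.neutral) auto
    finally show ?thesis .
  qed
  show ?thesis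
  proof (rule LIMSEQ_unique)
    show "(\<lambda>i. \<Sum>(a, M)\<leftarrow>L. a * (\<integral>x. s i x \<partial>M)) \<longlonglongrightarrow> (\<Sum>(a, M)\<leftarrow>L. a * (\<integral>x. g x \<partial>M))"
      unfolding split_def
    proof (intro tendsto_sum_list tendsto_mult tendsto_const)
      fix x assume "x \<in> set L"
      then have x: "(fst x, snd x) \<in> set L" by simp
      have sm: "s i \<in> borel_measurable borel" for i using borel_measurable_simple_function[OF s(1)] .
      show "(\<lambda>i. \<integral>t. s i t \<partial>snd x) \<longlonglongrightarrow> (\<integral>t. g t \<partial>snd x)"
      proof (rule integral_dominated_convergence[where w = "\<lambda>t. 2 * norm (g t)"])
        show "integrable (snd x) (\<lambda>t. 2 * norm (g t))" using int[OF x] by (intro integrable_mult_right integrable_norm)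
        show "g \<in> borel_measurable (snd x)" "s i \<in> borel_measurable (snd x)" for i
          using g sm unfolding measurable_cong_sets[OF fm(2)[OF x] refl] by auto
      qed (use s in \<open>auto simp: dist_norm\<close>)
    qed
    show "(\<lambda>i. \<Sum>(a, M)\<leftarrow>L. a * (\<integral>x. s i x \<partial>M)) \<longlonglongrightarrow> 0" by (simp add: s0)
  qed
qed

text \<open>Measures with a nonnegative density, so that identities involving a density still fit
  the list of positive measures in \<open>measures_linear_identity\<close>.\<close>

definition weight_measure :: "real measure \<Rightarrow> (real \<Rightarrow> real) \<Rightarrow> real measure" where
  "weight_measure M f = density M (\<lambda>x. ennreal (f x))"

context
  fixes M :: "real measure" and f :: "real \<Rightarrow> real"
  assumes M: "finite_borel_measure M" and f: "integrable M f" "\<And>x. 0 \<le> f x" and fm [measurable]: "f \<in> borel_measurable borel"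
begin

lemma weight_sets: "sets M = sets borel" "space M = UNIV"
  using finite_borel_measure.M_is_borel[OF M] finite_borel_measure.borel_UNIV[OF M] by auto

lemma weight_measurable: "g \<in> borel_measurable borel \<Longrightarrow> g \<in> borel_measurable M"
  using weight_sets measurable_cong_sets by blast

lemma measure_weight:
  assumes "A \<in> sets borel" shows "measure (weight_measure M f) A = (\<integral>x. indicator A x * f x \<partial>M)"
proof -
  have i: "integrable M (\<lambda>x. indicator A x * f x)"
    using integrable_mult_indicator[OF _ f(1), of A] assms weight_sets by simp
  have "emeasure (weight_measure M f) A = (\<integral>\<^sup>+x. ennreal (indicator A x * f x) \<partial>M)"
    unfolding weight_measure_def
    by (subst emeasure_density) (use assms weight_sets weight_measurable[OF fm] in \<open>auto intro!: nn_integral_cong simp: indicator_def\<close>)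
  also have "\<dots> = ennreal (\<integral>x. indicator A x * f x \<partial>M)"
    by (rule nn_integral_eq_integral[OF i]) (use f in auto)
  finally show ?thesis using f(2) by (simp add: measure_def)
qed

lemma finite_weight: "finite_borel_measure (weight_measure M f)"
proof (intro finite_borel_measure.intro finite_measureI finite_borel_measure_axioms.intro)
  have "emeasure (weight_measure M f) (space M) = (\<integral>\<^sup>+x. ennreal (f x) \<partial>M)"
    unfolding weight_measure_def using weight_measurable[OF fm] by (subst emeasure_density) (auto simp: weight_sets)
  also have "\<dots> < \<infinity>" using f(1) f(2) by (simp add: nn_integral_eq_integral)
  finally show "emeasure (weight_measure M f) (space (weight_measure M f)) \<noteq> \<infinity>"
    by (simp add: weight_measure_def)
  show "sets (weight_measure M f) = sets borel" by (simp add: weight_measure_def weight_sets)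
qed

lemma integral_weight: "g \<in> borel_measurable borel \<Longrightarrow> (\<integral>x. g x \<partial>weight_measure M f) = (\<integral>x. f x * g x \<partial>M)"
  unfolding weight_measure_def
  by (subst integral_density) (use weight_measurable fm f in auto)

lemma integrable_weight: "g \<in> borel_measurable borel \<Longrightarrow> integrable (weight_measure M f) g \<longleftrightarrow> integrable M (\<lambda>x. f x * g x)"
  unfolding weight_measure_def
  by (subst integrable_density) (use weight_measurable fm f in auto)

end

section \<open>Spectral measures and polarised forms of a resolution of the identity\<close>

locale spectral_family =
  fixes E :: "real \<Rightarrow> L2 \<Rightarrow> L2"
  assumes roi: "resolution_of_identity E"
begin

lemma E_cinner: "cinner (E t u) v = cinner u (E t v)"
  and E_idem: "E t (E t u) = E t u"
  and E_le: "s \<le> t \<Longrightarrow> E s (E t u) = E s u"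
  using roi by (auto simp: resolution_of_identity_def orthogonal_projection_def)

lemma E_inner: "inner (E t u) v = inner u (E t v)"
  by (simp add: inner_L2_def E_cinner)

lemma inner_eqI: "(\<And>w::L2. inner w u = inner w v) \<Longrightarrow> u = v"
  using inner_diff_right[of "u - v" u v] by (metis inner_eq_zero_iff right_minus_eq)

lemma E_add: "E t (u + v) = E t u + E t v"
  by (rule inner_eqI) (simp add: E_inner[symmetric] inner_add)

lemma E_diff: "E t (u - v) = E t u - E t v"
  by (rule inner_eqI) (simp add: E_inner[symmetric] inner_diff)

lemma E_scaleR: "E t (r *\<^sub>R u) = r *\<^sub>R E t u"
  by (rule inner_eqI) (simp add: E_inner[symmetric])

lemma E_zero: "E t 0 = 0" using E_scaleR[of t 0 0] by simp

lemma E_scaleC: "E t (scaleC c u) = scaleC c (E t u)"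
  by (rule cinner_eqI) (simp add: E_cinner[symmetric] cinner_scaleC_right)

lemma E_ge: "t \<le> s \<Longrightarrow> E s (E t u) = E t u"
  by (rule inner_eqI) (metis E_inner E_le)

lemma E_min: "E s (E t u) = E (min s t) u"
  by (cases "s \<le> t") (auto simp: E_le E_ge min_def)

lemma E_norm_sq: "(norm (E t u))\<^sup>2 = inner (E t u) u"
  by (simp add: power2_norm_eq_inner E_inner E_idem)

lemma E_norm_diff: "s \<le> t \<Longrightarrow> (norm (E t u - E s u))\<^sup>2 = (norm (E t u))\<^sup>2 - (norm (E s u))\<^sup>2"
  by (simp add: power2_norm_eq_inner inner_diff) (simp add: E_inner E_min min_def inner_commute)

lemma E_mono: "s \<le> t \<Longrightarrow> (norm (E s u))\<^sup>2 \<le> (norm (E t u))\<^sup>2"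
  using E_norm_diff[of s t u] zero_le_power2[of "norm (E t u - E s u)"] by linarith

text \<open>The bridge from operators to measures: an inner product with a spectral projection
  becomes a difference of distribution functions of spectral measures.\<close>

lemma E_polar: "4 * inner (E t u) w = (norm (E t (u + w)))\<^sup>2 - (norm (E t (u - w)))\<^sup>2"
proof -
  have "inner (E t w) u = inner (E t u) w" by (metis E_inner inner_commute)
  then show ?thesis unfolding E_norm_sq by (simp add: E_add E_diff inner_add inner_diff)
qed

abbreviation mu :: "L2 \<Rightarrow> real measure" where "mu u \<equiv> spectral_measure E u"

lemma cdf_props:
  shows "continuous (at_right a) (\<lambda>t. (norm (E t u))\<^sup>2)" "((\<lambda>t. (norm (E t u))\<^sup>2) \<longlongrightarrow> 0) at_bot"
    "((\<lambda>t. (norm (E t u))\<^sup>2) \<longlongrightarrow> (norm u)\<^sup>2) at_top"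
proof -
  have r: "((\<lambda>s. E s u) \<longlongrightarrow> E a u) (at_right a)" "((\<lambda>t. E t u) \<longlongrightarrow> 0) at_bot" "((\<lambda>t. E t u) \<longlongrightarrow> u) at_top"
    using roi by (auto simp: resolution_of_identity_def)
  show "continuous (at_right a) (\<lambda>t. (norm (E t u))\<^sup>2)"
    unfolding continuous_within by (intro tendsto_intros r)
  show "((\<lambda>t. (norm (E t u))\<^sup>2) \<longlongrightarrow> 0) at_bot"
    using tendsto_power[OF tendsto_norm[OF r(2)], of 2] by simp
  show "((\<lambda>t. (norm (E t u))\<^sup>2) \<longlongrightarrow> (norm u)\<^sup>2) at_top" by (intro tendsto_intros r)
qed

lemma mu_finite: "finite_borel_measure (mu u)"
  unfolding spectral_measure_def
  by (rule finite_borel_measure_interval_measure[where m = "(norm u)\<^sup>2"]) (erule E_mono | rule cdf_props | simp)+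

lemma mu_atMost: "measure (mu u) {..t} = (norm (E t u))\<^sup>2"
  unfolding spectral_measure_def
  by (rule measure_interval_measure_Iic) (erule E_mono | rule cdf_props | simp)+

lemma mu_UNIV: "measure (mu u) UNIV = (norm u)\<^sup>2"
proof -
  have "emeasure (mu u) UNIV = ennreal ((norm u)\<^sup>2)" unfolding spectral_measure_def
    by (rule interval_measure_UNIV) (erule E_mono | rule cdf_props | simp)+
  then show ?thesis by (simp add: measure_def)
qed

lemma mu_sets: "sets (mu u) = sets borel" "space (mu u) = UNIV"
  by (auto simp: spectral_measure_def)

lemma mu_measurable: "g \<in> borel_measurable borel \<Longrightarrow> g \<in> borel_measurable (mu u)"
  using measurable_cong_sets[OF mu_sets(1) refl] by blast

lemma mu_finite_measure: "finite_measure (mu u)"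
  using mu_finite finite_borel_measure.axioms(1) by blast

lemma mu_eqI: "(\<And>t. norm (E t u) = norm (E t v)) \<Longrightarrow> mu u = mu v"
  by (simp add: spectral_measure_def)

lemma mu_minus_commute: "mu (u - v) = mu (v - u)"
  by (rule mu_eqI) (simp add: E_diff norm_minus_commute)

lemma mu_scaleC_i: "mu (scaleC \<i> u) = mu u"
  by (rule mu_eqI) (simp add: E_scaleC norm_scaleC)

lemma mu_integrable_AE_bounded:
  fixes g :: "real \<Rightarrow> real"
  assumes "g \<in> borel_measurable borel" "AE x in mu u. \<bar>g x\<bar> \<le> B"
  shows "integrable (mu u) g"
  by (rule finite_measure.integrable_const_bound[OF mu_finite_measure, where B = B])
     (simp_all only: real_norm_def assms(2) mu_measurable[OF assms(1)])

lemma mu_integrable_bounded: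
  fixes g :: "real \<Rightarrow> real"
  assumes "g \<in> borel_measurable borel" "\<And>x. \<bar>g x\<bar> \<le> B"
  shows "integrable (mu u) g"
  by (rule mu_integrable_AE_bounded[OF assms(1), where B = B]) (use assms(2) in auto)

lemma mu_AE_le: assumes "E t u = u" shows "AE x in mu u. x \<le> t"
proof -
  interpret finite_measure "mu u" by (rule mu_finite_measure)
  have "measure (mu u) (UNIV - {..t}) = 0"
    using finite_measure_compl[of "{..t}"] assms by (simp add: mu_sets mu_UNIV mu_atMost)
  then have "UNIV - {..t} \<in> null_sets (mu u)" by (simp add: null_sets_def emeasure_eq_measure mu_sets)
  then have "AE x in mu u. x \<notin> UNIV - {..t}" by (rule AE_not_in)
  then show ?thesis by eventually_elim auto
qed

lemma mu_AE_gt: assumes "E s u = 0" shows "AE x in mu u. s < x"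
proof -
  interpret finite_measure "mu u" by (rule mu_finite_measure)
  have "{..s} \<in> null_sets (mu u)"
    using assms mu_atMost[of u s] by (simp add: null_sets_def emeasure_eq_measure mu_sets)
  then have "AE x in mu u. x \<notin> {..s}" by (rule AE_not_in)
  then show ?thesis by eventually_elim auto
qed

text \<open>The integral of \<open>g\<close> against the real signed measure d<E u, w>, by
  polarisation over the reals.\<close>

definition form :: "(real \<Rightarrow> real) \<Rightarrow> L2 \<Rightarrow> L2 \<Rightarrow> real" where
  "form g u w = ((\<integral>x. g x \<partial>mu (u + w)) - (\<integral>x. g x \<partial>mu (u - w))) / 4"

lemma form_commute: "form g u w = form g w u"
  unfolding form_def add.commute[of u w] mu_minus_commute[of u w] ..

lemma mu_scaleR_integral:
  assumes [measurable]: "g \<in> borel_measurable borel" and "integrable (mu u) g" "integrable (mu (r *\<^sub>R u)) g"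
  shows "(\<integral>x. g x \<partial>mu (r *\<^sub>R u)) = r\<^sup>2 * (\<integral>x. g x \<partial>mu u)"
proof -
  have "(\<Sum>(a, M)\<leftarrow>[(1, mu (r *\<^sub>R u)), (- r\<^sup>2, mu u)]. a * (\<integral>x. g x \<partial>M)) = 0"
    by (rule measures_linear_identity)
       (use assms in \<open>auto simp: mu_finite mu_atMost E_scaleR power_mult_distrib\<close>)
  then show ?thesis by simp
qed

text \<open>On the diagonal the polarised form involves the spectral measures of
  \<open>2 *\<^sub>R u\<close> and of \<open>0\<close>; the first scales by four and the second is
  the null measure.\<close>

lemma form_diag:
  assumes [measurable]: "g \<in> borel_measurable borel" and i: "integrable (mu u) g" "integrable (mu (2 *\<^sub>R u)) g"
  shows "form g u u = (\<integral>x. g x \<partial>mu u)"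
proof -
  have "(\<integral>x. g x \<partial>mu (2 *\<^sub>R u)) = 2\<^sup>2 * (\<integral>x. g x \<partial>mu u)" by (rule mu_scaleR_integral) (use assms in auto)
  moreover have "(\<integral>x. g x \<partial>mu 0) = 0"
  proof -
    have "AE x in mu 0. False"
      using mu_AE_le[of 0 0] mu_AE_gt[of 0 0] by (auto simp: E_zero elim: eventually_elim2)
    then have "(\<integral>x. g x \<partial>mu 0) = (\<integral>x. 0 \<partial>mu 0)"
      by (intro integral_cong_AE) (auto simp: mu_measurable elim: eventually_mono)
    then show ?thesis by simp
  qed
  ultimately show ?thesis by (simp add: form_def scaleR_2)
qed

lemma form_add:
  assumes g: "g \<in> borel_measurable borel"
    and i: "\<And>x. x \<in> {u + v + w, u + v - w, u + w, u - w, v + w, v - w} \<Longrightarrow> integrable (mu x) g"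
  shows "form g (u + v) w = form g u w + form g v w"
proof -
  have "4 * inner (E t (u + v)) w = 4 * inner (E t u) w + 4 * inner (E t v) w" for t
    by (simp add: E_add inner_add)
  then have "(\<Sum>(a, M)\<leftarrow>[(1, mu (u + v + w)), (-1, mu (u + v - w)), (-1, mu (u + w)), (1, mu (u - w)), (-1, mu (v + w)), (1, mu (v - w))].
      a * (\<integral>x. g x \<partial>M)) = 0"
    unfolding E_polar
    by (intro measures_linear_identity; use i g in \<open>auto simp: mu_finite mu_atMost; smt (verit)\<close>)
  then show ?thesis by (simp add: form_def field_simps)
qed

lemma form_scaleR:
  assumes g: "g \<in> borel_measurable borel"
    and i: "\<And>x. x \<in> {r *\<^sub>R u + w, r *\<^sub>R u - w, u + w, u - w} \<Longrightarrow> integrable (mu x) g"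
  shows "form g (r *\<^sub>R u) w = r * form g u w"
proof -
  have "4 * inner (E t (r *\<^sub>R u)) w = r * (4 * inner (E t u) w)" for t by (simp add: E_scaleR)
  then have "(\<Sum>(a, M)\<leftarrow>[(1, mu (r *\<^sub>R u + w)), (-1, mu (r *\<^sub>R u - w)), (- r, mu (u + w)), (r, mu (u - w))].
      a * (\<integral>x. g x \<partial>M)) = 0"
    unfolding E_polar
    by (intro measures_linear_identity; use i g in \<open>auto simp: mu_finite mu_atMost algebra_simps; smt (verit)\<close>)
  then show ?thesis by (simp add: form_def field_simps)
qed

lemma form_cong:
  assumes g: "g \<in> borel_measurable borel" and "\<And>t. inner (E t u) w = inner (E t u') w'"
    and i: "\<And>x. x \<in> {u + w, u - w, u' + w', u' - w'} \<Longrightarrow> integrable (mu x) g"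
  shows "form g u w = form g u' w'"
proof -
  have "4 * inner (E t u) w = 4 * inner (E t u') w'" for t using assms(2) by simp
  then have "(\<Sum>(a, M)\<leftarrow>[(1, mu (u + w)), (-1, mu (u - w)), (-1, mu (u' + w')), (1, mu (u' - w'))].
      a * (\<integral>x. g x \<partial>M)) = 0"
    unfolding E_polar
    by (intro measures_linear_identity; use i g in \<open>auto simp: mu_finite mu_atMost; smt (verit)\<close>)
  then show ?thesis by (simp add: form_def)
qed

lemma form_scaleC_i: "form g (scaleC \<i> u) w = - form g u (scaleC \<i> w)"
proof -
  have i2: "scaleC \<i> (scaleC \<i> w) = - w" by (simp add: scaleC_scaleC scaleC_of_real[of "-1", simplified])
  have "mu (scaleC \<i> u + w) = mu (u - scaleC \<i> w)" "mu (scaleC \<i> u - w) = mu (u + scaleC \<i> w)"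
    using mu_scaleC_i[of "u - scaleC \<i> w"] mu_scaleC_i[of "u + scaleC \<i> w"]
    by (simp_all add: scaleC_diff scaleC_add i2)
  then show ?thesis by (simp add: form_def diff_divide_distrib)
qed

subsection \<open>Bounded functional calculus\<close>

text \<open>Riesz representation of a bounded bilinear form. The parallelogram identity first bounds
  the form by a sum of squares, and normalising both arguments turns this into a product of
  norms.\<close>

lemma bounded_calculus:
  assumes g [measurable]: "g \<in> borel_measurable borel" and G: "\<And>x. \<bar>g x\<bar> \<le> G"
  shows "\<exists>A. bounded_linear A \<and> (\<forall>u w. inner w (A u) = form g u w) \<and> (\<forall>u. A (scaleC \<i> u) = scaleC \<i> (A u))"
proof -
  have i: "integrable (mu u) g" for u by (rule mu_integrable_bounded[OF g G])
  have G0: "0 \<le> G" using G[of 0] by linarith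
  have ib: "\<bar>\<integral>x. g x \<partial>mu u\<bar> \<le> G * (norm u)\<^sup>2" for u
  proof -
    interpret finite_measure "mu u" by (rule mu_finite_measure)
    have "norm (\<integral>x. g x \<partial>mu u) \<le> (\<integral>x. G \<partial>mu u)"
      by (rule Bochner_Integration.integral_norm_bound_integral) (use i G in auto)
    then show ?thesis by (simp add: mu_sets mu_UNIV mult.commute)
  qed
  have add: "form g (u + v) w = form g u w + form g v w" and sc: "form g (r *\<^sub>R u) w = r * form g u w" for u v w r
    by (rule form_add form_scaleR; use i in simp)+
  have add2: "form g w (u + v) = form g w u + form g w v" and sc2: "form g w (r *\<^sub>R u) = r * form g w u" for u v w r
    using add[of u v w] sc[of r u w] by (simp_all add: form_commute)
  have b1: "\<bar>form g u w\<bar> \<le> G * ((norm u)\<^sup>2 + (norm w)\<^sup>2) / 2" for u w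
  proof -
    have "4 * \<bar>form g u w\<bar> \<le> \<bar>\<integral>x. g x \<partial>mu (u + w)\<bar> + \<bar>\<integral>x. g x \<partial>mu (u - w)\<bar>"
      unfolding form_def by simp
    also have "\<dots> \<le> G * ((norm (u + w))\<^sup>2 + (norm (u - w))\<^sup>2)" using ib[of "u + w"] ib[of "u - w"] by (simp add: distrib_left)
    also have "(norm (u + w))\<^sup>2 + (norm (u - w))\<^sup>2 = 2 * ((norm u)\<^sup>2 + (norm w)\<^sup>2)"
      by (simp add: power2_norm_eq_inner inner_add inner_diff inner_commute)
    finally show ?thesis by (simp add: algebra_simps)
  qed
  have b: "\<bar>form g u w\<bar> \<le> G * (norm u * norm w)" for u w
  proof (cases "u = 0 \<or> w = 0")
    case True
    then show ?thesis using sc[of 0 u w] sc2[of u 0 w] by auto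
  next
    case False
    define u' where "u' = (1 / norm u) *\<^sub>R u"
    define w' where "w' = (1 / norm w) *\<^sub>R w"
    have n: "norm u' = 1" "norm w' = 1" using False by (auto simp: u'_def w'_def)
    have "u = norm u *\<^sub>R u'" "w = norm w *\<^sub>R w'" using False by (auto simp: u'_def w'_def)
    then have "form g u w = norm u * (norm w * form g u' w')" using sc sc2 by metis
    then have "\<bar>form g u w\<bar> = (norm u * norm w) * \<bar>form g u' w'\<bar>" by (simp add: abs_mult)
    also have "\<dots> \<le> (norm u * norm w) * G" using b1[of u' w'] n by (intro mult_left_mono) auto
    finally show ?thesis by (simp add: mult_ac)
  qed
  have "\<exists>v. \<forall>w. form g u w = inner w v" for u
  proof (rule riesz_representation)
    show "bounded_linear (form g u)"
      by (rule bounded_linear_intro[where K = "G * norm u"]) (use b[of u] in \<open>auto simp: add2 sc2 mult_ac\<close>)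
  qed
  then obtain A where A: "\<And>u w. form g u w = inner w (A u)" by metis
  have "bounded_linear A"
  proof (rule bounded_linear_intro[where K = G])
    show "A (x + y) = A x + A y" for x y by (rule inner_eqI) (simp add: A[symmetric] add inner_add_right)
    show "A (r *\<^sub>R x) = r *\<^sub>R A x" for r x by (rule inner_eqI) (simp add: A[symmetric] sc)
    show "norm (A x) \<le> norm x * G" for x
    proof (cases "A x = 0")
      case False
      have "(norm (A x))\<^sup>2 = form g x (A x)" by (simp add: A power2_norm_eq_inner)
      also have "\<dots> \<le> G * (norm x * norm (A x))" using b[of x "A x"] by linarith
      finally show ?thesis using False by (simp add: power2_eq_square mult_ac)
    qed (use G0 in simp)
  qed
  moreover have "A (scaleC \<i> u) = scaleC \<i> (A u)" for u
    by (rule inner_eqI) (metis A form_scaleC_i inner_scaleC_i_left minus_minus)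
  ultimately show ?thesis using A by metis
qed

subsection \<open>Spectral integrals\<close>

lemma spectral_domain_scaleC_i: "scaleC \<i> u \<in> spectral_domain E g \<longleftrightarrow> u \<in> spectral_domain E g"
  by (simp add: spectral_domain_def mu_scaleC_i)

text \<open>The four-term polarisation sum has real part \<open>form g u w\<close> and imaginary
  part \<open>form g u (scaleC \<i> w)\<close>. As the domain is stable under the imaginary unit,
  testing real parts is enough.\<close>

lemma spectral_integral_form:
  "(u, v) \<in> spectral_integral E g \<longleftrightarrow> u \<in> spectral_domain E g \<and> (\<forall>w\<in>spectral_domain E g. inner w v = form g u w)"
proof -
  have s: "(1 / 4) * (\<Sum>k<4. \<i> ^ k * of_real (\<integral>t. g t \<partial>spectral_measure E (u + scaleC (\<i> ^ k) w)))
     = Complex (form g u w) (form g u (scaleC \<i> w))" for w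
  proof -
    have "\<i> ^ 3 = - \<i>" by (simp add: power3_eq_cube)
    moreover have "scaleC (-1) w = - w" "scaleC 1 w = w" "scaleC (- \<i>) w = - scaleC \<i> w"
      using scaleC_of_real[of "-1" w] scaleC_of_real[of 1 w] by (auto simp: scaleC_minus_left)
    ultimately show ?thesis
      by (simp add: form_def complex_eq_iff eval_nat_numeral lessThan_Suc)
  qed
  have c: "cinner w v = Complex (inner w v) (inner (scaleC \<i> w) v)" for w by (rule cinner_eq_inner)
  show ?thesis
    unfolding spectral_integral_def mem_Collect_eq prod.case s c
    using spectral_domain_scaleC_i by auto
qed

lemma integrable_if_square_integrable:
  fixes g :: "real \<Rightarrow> real"
  assumes g: "g \<in> borel_measurable borel" and i: "integrable (mu u) (\<lambda>t. (g t)\<^sup>2)"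
  shows "integrable (mu u) g"
proof -
  interpret finite_measure "mu u" by (rule mu_finite_measure)
  have "integrable (mu u) (\<lambda>t. 1 + (g t)\<^sup>2)" using i by simp
  then show ?thesis
  proof (rule Bochner_Integration.integrable_bound)
    show "AE x in mu u. norm (g x) \<le> norm (1 + (g x)\<^sup>2)"
    proof (rule AE_I2)
      fix x
      have "0 \<le> (\<bar>g x\<bar> - 1/2)\<^sup>2" by simp
      then have "\<bar>g x\<bar> \<le> 1 + (g x)\<^sup>2" by (simp add: power2_eq_square algebra_simps)
      then show "norm (g x) \<le> norm (1 + (g x)\<^sup>2)" by simp
    qed
  qed (use g mu_measurable in auto)
qed

text \<open>The parallelogram law for spectral measures is integrated against the bounded
  truncations \<open>gn n\<close> of \<open>g\<^sup>2\<close>, where integrability is free, and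
  monotone convergence removes the truncation.\<close>

lemma spectral_domain_lin:
  assumes g [measurable]: "g \<in> borel_measurable borel" and u: "u \<in> spectral_domain E g" and v: "v \<in> spectral_domain E g"
  shows "u + v \<in> spectral_domain E g" "u - v \<in> spectral_domain E g"
proof -
  define gn where "gn n t = min ((g t)\<^sup>2) (real n)" for n t
  have gn [measurable]: "gn n \<in> borel_measurable borel" for n unfolding gn_def by measurable
  have gnb: "\<bar>gn n x\<bar> \<le> real n" "0 \<le> gn n x" "gn n x \<le> (g x)\<^sup>2" for n x by (auto simp: gn_def)
  have iu: "integrable (mu u) (\<lambda>t. (g t)\<^sup>2)" "integrable (mu v) (\<lambda>t. (g t)\<^sup>2)" using u v by (auto simp: spectral_domain_def)
  have i: "integrable (mu x) (gn n)" for x n by (rule mu_integrable_bounded[OF gn gnb(1)])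
  define K where "K = 2 * (\<integral>t. (g t)\<^sup>2 \<partial>mu u) + 2 * (\<integral>t. (g t)\<^sup>2 \<partial>mu v)"
  have par: "(norm (E t (u + v)))\<^sup>2 + (norm (E t (u - v)))\<^sup>2 = 2 * (norm (E t u))\<^sup>2 + 2 * (norm (E t v))\<^sup>2" for t
    by (simp add: E_add E_diff power2_norm_eq_inner inner_add inner_diff inner_commute)
  have "(\<Sum>(a, M)\<leftarrow>[(1, mu (u + v)), (1, mu (u - v)), (-2, mu u), (-2, mu v)]. a * (\<integral>x. gn n x \<partial>M)) = 0" for n
    by (intro measures_linear_identity; use i par in \<open>auto simp: mu_finite mu_atMost; smt (verit)\<close>)
  note L = this
  have s: "(\<integral>x. gn n x \<partial>mu (u + v)) + (\<integral>x. gn n x \<partial>mu (u - v)) = 2 * (\<integral>x. gn n x \<partial>mu u) + 2 * (\<integral>x. gn n x \<partial>mu v)" for n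
    using L[of n] by (simp; linarith)
  have le: "(\<integral>x. gn n x \<partial>mu u) \<le> (\<integral>t. (g t)\<^sup>2 \<partial>mu u)" "(\<integral>x. gn n x \<partial>mu v) \<le> (\<integral>t. (g t)\<^sup>2 \<partial>mu v)" for n
    by (intro integral_mono i iu gnb)+
  have p: "0 \<le> (\<integral>x. gn n x \<partial>mu x')" for x' n by (intro integral_nonneg_AE) (use gnb in auto)
  have KK: "(\<integral>x. gn n x \<partial>mu (u + v)) \<le> K" "(\<integral>x. gn n x \<partial>mu (u - v)) \<le> K" for n
    using s[of n] le[of n] p[of "u + v" n] p[of "u - v" n] unfolding K_def by linarith+
  have fin: "integrable (mu x) (\<lambda>t. (g t)\<^sup>2)" if "\<And>n. (\<integral>t. gn n t \<partial>mu x) \<le> K" for x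
  proof (rule integrableI_nn_integral_finite[where x = "enn2real (\<integral>\<^sup>+t. ennreal ((g t)\<^sup>2) \<partial>mu x)"])
    have sup: "(SUP n. ennreal (gn n t)) = ennreal ((g t)\<^sup>2)" for t
    proof (rule antisym)
      show "(SUP n. ennreal (gn n t)) \<le> ennreal ((g t)\<^sup>2)" by (intro SUP_least ennreal_leI gnb)
      obtain n where "(g t)\<^sup>2 \<le> real n" using real_arch_simple by blast
      then have "gn n t = (g t)\<^sup>2" by (simp add: gn_def)
      then show "ennreal ((g t)\<^sup>2) \<le> (SUP n. ennreal (gn n t))" by (metis SUP_upper UNIV_I)
    qed
    have "(\<integral>\<^sup>+t. ennreal ((g t)\<^sup>2) \<partial>mu x) = (SUP n. \<integral>\<^sup>+t. ennreal (gn n t) \<partial>mu x)"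
      unfolding sup[symmetric]
      by (rule nn_integral_monotone_convergence_SUP)
         (auto simp: incseq_def le_fun_def gn_def mu_measurable intro!: ennreal_leI)
    also have "\<dots> \<le> ennreal K"
      using that by (intro SUP_least) (subst nn_integral_eq_integral[OF i], use gnb in \<open>auto intro: ennreal_leI\<close>)
    finally have "(\<integral>\<^sup>+t. ennreal ((g t)\<^sup>2) \<partial>mu x) \<noteq> \<infinity>" by (auto simp: top_unique)
    then show "(\<integral>\<^sup>+t. ennreal ((g t)\<^sup>2) \<partial>mu x) = ennreal (enn2real (\<integral>\<^sup>+t. ennreal ((g t)\<^sup>2) \<partial>mu x))"
      by (simp add: ennreal_enn2real less_top)
  qed (auto simp: mu_measurable)
  show "u + v \<in> spectral_domain E g" "u - v \<in> spectral_domain E g"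
    using fin[OF KK(1)] fin[OF KK(2)] by (auto simp: spectral_domain_def)
qed

lemma truncation_in_domain:
  assumes "s \<le> t" shows "E t x - E s x \<in> spectral_domain E (\<lambda>t. t)"
proof -
  let ?z = "E t x - E s x"
  have z: "E t ?z = ?z" "E s ?z = 0" using assms by (simp_all add: E_diff E_min min_def)
  have "AE y :: real in mu ?z. \<bar>y\<^sup>2\<bar> \<le> s\<^sup>2 + t\<^sup>2"
    using mu_AE_le[OF z(1)] mu_AE_gt[OF z(2)]
  proof eventually_elim
    case (elim y)
    have "y\<^sup>2 \<le> max \<bar>s\<bar> \<bar>t\<bar> ^ 2" using elim by (intro power2_le_iff_abs_le[THEN iffD2]) auto
    then show ?case by (auto simp: max_def split: if_splits intro: order_trans)
  qed
  then show ?thesis unfolding spectral_domain_def using mu_integrable_AE_bounded[where g = "\<lambda>y. y\<^sup>2" and u = ?z and B = "s\<^sup>2 + t\<^sup>2"] by auto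
qed

lemma domain_dense: "closure (spectral_domain E (\<lambda>t. t)) = UNIV"
proof -
  have "x \<in> closure (spectral_domain E (\<lambda>t. t))" for x
  proof -
    have r: "((\<lambda>t. E t x) \<longlongrightarrow> 0) at_bot" "((\<lambda>t. E t x) \<longlongrightarrow> x) at_top"
      using roi by (auto simp: resolution_of_identity_def)
    have "((\<lambda>t. E t x - E (- t) x) \<longlongrightarrow> x - 0) at_top"
      by (intro tendsto_diff r filterlim_compose[OF r(1) filterlim_uminus_at_bot_at_top])
    then have "(\<lambda>n. E (real n) x - E (- real n) x) \<longlonglongrightarrow> x - 0"
      using filterlim_compose filterlim_real_sequentially by blast
    moreover have "E (real n) x - E (- real n) x \<in> spectral_domain E (\<lambda>t. t)" for n
      by (rule truncation_in_domain) simp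
    ultimately show ?thesis unfolding closure_sequential by (auto intro!: exI[of _ "\<lambda>n. E (real n) x - E (- real n) x"])
  qed
  then show ?thesis by auto
qed

end

section \<open>What the graph of the spectral integral of the identity function determines\<close>

context spectral_family
begin

lemma id_domain_integrable: "w \<in> spectral_domain E (\<lambda>t. t) \<Longrightarrow> integrable (mu w) (\<lambda>t. t)"
  using integrable_if_square_integrable[of "\<lambda>t. t" w] by (simp add: spectral_domain_def)

lemma domain_closed:
  "u \<in> spectral_domain E (\<lambda>t. t) \<Longrightarrow> v \<in> spectral_domain E (\<lambda>t. t) \<Longrightarrow> u + v \<in> spectral_domain E (\<lambda>t. t)"
  "u \<in> spectral_domain E (\<lambda>t. t) \<Longrightarrow> v \<in> spectral_domain E (\<lambda>t. t) \<Longrightarrow> u - v \<in> spectral_domain E (\<lambda>t. t)"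
  using spectral_domain_lin[of "\<lambda>t. t" u v] by auto

lemma integral_mu_cong:
  assumes "f \<in> borel_measurable borel" "g \<in> borel_measurable borel" "AE x in mu u. f x = g x"
  shows "(\<integral>x. f x \<partial>mu u) = (\<integral>x. g x \<partial>mu u)"
  by (rule integral_cong_AE[OF mu_measurable[OF assms(1)] mu_measurable[OF assms(2)] assms(3)])

lemma spectral_integral_id_diag:
  assumes "(u, v) \<in> spectral_integral E (\<lambda>t. t)"
  shows "inner u v = (\<integral>t. t \<partial>mu u)"
proof -
  have u: "u \<in> spectral_domain E (\<lambda>t. t)" using assms by (simp add: spectral_integral_form)
  have "2 *\<^sub>R u \<in> spectral_domain E (\<lambda>t. t)" using domain_closed(1)[OF u u] by (simp add: scaleR_2)
  then have "form (\<lambda>t. t) u u = (\<integral>t. t \<partial>mu u)"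
    using u by (intro form_diag id_domain_integrable) auto
  then show ?thesis using assms u by (simp add: spectral_integral_form)
qed

text \<open>On the spectral subspace of the interval from \<open>s\<close> to \<open>t\<close> the
  identity function coincides with its clipped version \<open>g\<close>, and the bounded calculus of
  \<open>g\<close> provides the image vector.\<close>

lemma truncation_in_graph:
  assumes "s \<le> t" shows "\<exists>v. (E t x - E s x, v) \<in> spectral_integral E (\<lambda>t. t)"
proof -
  define z where "z = E t x - E s x"
  define K where "K = max \<bar>s\<bar> \<bar>t\<bar>"
  define g where "g r = max (- K) (min K r)" for r :: real
  have K0: "0 \<le> K" by (simp add: K_def)
  have g: "g \<in> borel_measurable borel" unfolding g_def by measurable
  have gb: "\<bar>g r\<bar> \<le> K" for r using K0 by (auto simp: g_def)
  have gi: "integrable (mu u) g" for u by (rule mu_integrable_bounded[OF g gb])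
  obtain A where A: "\<And>u w. inner w (A u) = form g u w" using bounded_calculus[OF g gb] by blast
  have tr: "E t (E t y - E s y) = E t y - E s y" "E s (E t y - E s y) = 0" for y
    using assms by (simp_all add: E_diff E_min min_def)
  have zd: "z \<in> spectral_domain E (\<lambda>t. t)" unfolding z_def by (rule truncation_in_domain[OF assms])
  have "inner w (A z) = form (\<lambda>t. t) z w" if w: "w \<in> spectral_domain E (\<lambda>t. t)" for w
  proof -
    \<comment> \<open>The clipping is harmless only for spectral measures carried by the interval,
      so the test vector \<open>w\<close> is truncated too; the form does not notice, because
      \<open>z\<close> is already truncated.\<close>
    define w' where "w' = E t w - E s w"
    have wd: "w' \<in> spectral_domain E (\<lambda>t. t)" unfolding w'_def by (rule truncation_in_domain[OF assms])
    have eq: "inner (E r z) w = inner (E r z) w'" for r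
    proof -
      have "E t (E r z) = E r z" "E s (E r z) = 0"
        using tr[of x] unfolding z_def by (metis E_min min.commute, metis E_min E_zero min.commute)
      then show ?thesis unfolding w'_def inner_diff_right E_inner[of t "E r z" w, symmetric] E_inner[of s "E r z" w, symmetric]
        by simp
    qed
    have "form g z w = form g z w'" by (rule form_cong[OF g eq gi])
    moreover have "form (\<lambda>t. t) z w = form (\<lambda>t. t) z w'"
      by (rule form_cong[OF _ eq]) (use zd w wd in \<open>auto intro!: id_domain_integrable domain_closed\<close>)
    moreover have "form (\<lambda>t. t) z w' = form g z w'"
    proof -
      have "(\<integral>r. r \<partial>mu y) = (\<integral>r. g r \<partial>mu y)" if "E t y = y" "E s y = 0" for y
      proof (rule integral_mu_cong[OF _ g])
        show "AE r in mu y. r = g r"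
          using mu_AE_le[OF that(1)] mu_AE_gt[OF that(2)]
          by eventually_elim (auto simp: g_def K_def)
      qed simp
      then show ?thesis
        using tr[of x] tr[of w] unfolding form_def z_def w'_def by (simp add: E_add E_diff)
    qed
    ultimately show ?thesis by (simp add: A)
  qed
  then have "(z, A z) \<in> spectral_integral E (\<lambda>t. t)" using zd by (simp add: spectral_integral_form)
  then show ?thesis unfolding z_def by blast
qed

text \<open>A vector \<open>z\<close> in the spectral range between \<open>s\<close> and some
  \<open>t\<close> lies in the graph and satisfies
  \<open>s * (norm z)\<^sup>2 \<le> inner z v\<close>, which contradicts the form bound
  \<open>m < s\<close> unless \<open>z = 0\<close>. Letting \<open>t\<close> tend to infinity gives
  the claim.\<close>

lemma spectral_support:
  assumes up: "\<And>u v. (u, v) \<in> spectral_integral E (\<lambda>t. t) \<Longrightarrow> inner u v \<le> m * (norm u)\<^sup>2"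
    and s: "m < s"
  shows "E s x = x"
proof -
  have eq: "E t x = E s x" if st: "s \<le> t" for t
  proof -
    define z where "z = E t x - E s x"
    obtain v where v: "(z, v) \<in> spectral_integral E (\<lambda>t. t)" using truncation_in_graph[OF st, of x] by (auto simp: z_def)
    interpret finite_measure "mu z" by (rule mu_finite_measure)
    have "E s z = 0" using st by (simp add: z_def E_diff E_min min_def)
    then have ae: "AE r in mu z. s \<le> r" using mu_AE_gt by (force elim: eventually_mono)
    have zd: "z \<in> spectral_domain E (\<lambda>t. t)" using v by (simp add: spectral_integral_form)
    have "s * (norm z)\<^sup>2 = (\<integral>r. s \<partial>mu z)" by (simp add: mu_sets mu_UNIV)
    also have "\<dots> \<le> (\<integral>r. r \<partial>mu z)" using ae by (intro integral_mono_AE id_domain_integrable zd) auto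
    also have "\<dots> = inner z v" by (rule spectral_integral_id_diag[OF v, symmetric])
    also have "\<dots> \<le> m * (norm z)\<^sup>2" by (rule up[OF v])
    finally have "(s - m) * (norm z)\<^sup>2 \<le> 0" by (simp add: algebra_simps)
    then have "(norm z)\<^sup>2 \<le> 0" using s by (simp add: mult_le_0_iff)
    then show ?thesis by (simp add: z_def)
  qed
  have "\<forall>\<^sub>F t in at_top. E t x = E s x"
    using eventually_ge_at_top[of s] by (rule eventually_mono) (rule eq)
  then have "((\<lambda>t. E t x) \<longlongrightarrow> E s x) at_top" by (rule tendsto_eventually)
  moreover have "((\<lambda>t. E t x) \<longlongrightarrow> x) at_top" using roi by (auto simp: resolution_of_identity_def)
  ultimately show ?thesis using tendsto_unique trivial_limit_at_top_linorder by blast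
qed

lemma weight_cdf:
  assumes "f \<in> borel_measurable borel" "integrable (mu u) f" "\<And>x. 0 \<le> f x"
  shows "measure (weight_measure (mu u) f) {..r} = (\<integral>x. indicator {..r} x * f x \<partial>mu u)"
    and "finite_borel_measure (weight_measure (mu u) f)"
  using measure_weight[OF mu_finite assms(2,3,1), of "{..r}"] finite_weight[OF mu_finite assms(2,3,1)] by auto

lemma indicator_weight:
  fixes g :: "real \<Rightarrow> real"
  shows "measure (weight_measure (mu u) (indicator {..t})) {..r} = (norm (E (min r t) u))\<^sup>2"
    and "finite_borel_measure (weight_measure (mu u) (indicator {..t}))"
    and "g \<in> borel_measurable borel \<Longrightarrow> (\<integral>x. g x \<partial>weight_measure (mu u) (indicator {..t})) = (\<integral>x. indicator {..t} x * g x \<partial>mu u)"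
    and "g \<in> borel_measurable borel \<Longrightarrow> integrable (mu u) g \<Longrightarrow> integrable (weight_measure (mu u) (indicator {..t})) g"
proof -
  have i: "integrable (mu u) (indicator {..t} :: real \<Rightarrow> real)"
    by (rule mu_integrable_bounded[where B = 1]) (auto simp: indicator_def)
  note W = weight_cdf[of "indicator {..t}" u, OF _ i]
  have "(\<integral>x. indicator {..r} x * indicator {..t} x \<partial>mu u) = (\<integral>x. (indicator {..min r t} x :: real) \<partial>mu u)"
    by (intro Bochner_Integration.integral_cong refl) (auto simp: indicator_def)
  also have "\<dots> = (norm (E (min r t) u))\<^sup>2" by (simp add: mu_sets mu_atMost)
  finally show "measure (weight_measure (mu u) (indicator {..t})) {..r} = (norm (E (min r t) u))\<^sup>2"
    using W(1)[of r] by simp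
  show "finite_borel_measure (weight_measure (mu u) (indicator {..t}))" using W(2) by simp
  show "g \<in> borel_measurable borel \<Longrightarrow> (\<integral>x. g x \<partial>weight_measure (mu u) (indicator {..t})) = (\<integral>x. indicator {..t} x * g x \<partial>mu u)"
    using integral_weight[OF mu_finite i, of g] by simp
  assume g: "g \<in> borel_measurable borel" "integrable (mu u) g"
  have "integrable (mu u) (\<lambda>x. indicator {..t} x * g x)"
    using integrable_mult_indicator[OF _ g(2), of "{..t}"] by (simp add: mu_sets)
  then show "integrable (weight_measure (mu u) (indicator {..t})) g"
    using integrable_weight[OF mu_finite i, of g] g by simp
qed

lemma mu_E: "mu (E t x) = weight_measure (mu x) (indicator {..t})"
  by (rule cdf_unique'[OF mu_finite indicator_weight(2)])
     (auto simp: fun_eq_iff cdf_def mu_atMost indicator_weight(1) E_min)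

lemma E_domain: "x \<in> spectral_domain E (\<lambda>t. t) \<Longrightarrow> E t x \<in> spectral_domain E (\<lambda>t. t)"
  unfolding spectral_domain_def by (simp add: mu_E indicator_weight(4))

text \<open>In terms of measures, d<E v, x> = r d<E u, x> whenever \<open>v\<close> is the image of
  \<open>u\<close>; this is its distribution function, polarised.\<close>

lemma E_graph_form:
  assumes uv: "(u, v) \<in> spectral_integral E (\<lambda>t. t)" and x: "x \<in> spectral_domain E (\<lambda>t. t)"
  shows "4 * inner (E t x) v = (\<integral>r. indicator {..t} r * r \<partial>mu (u + x)) - (\<integral>r. indicator {..t} r * r \<partial>mu (u - x))"
proof -
  have u: "u \<in> spectral_domain E (\<lambda>t. t)" using uv by (simp add: spectral_integral_form)
  note Ex = E_domain[OF x, of t]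
  have i: "integrable (mu (u + x)) (\<lambda>t. t)" "integrable (mu (u - x)) (\<lambda>t. t)"
    "integrable (mu (u + E t x)) (\<lambda>t. t)" "integrable (mu (u - E t x)) (\<lambda>t. t)"
    by (intro id_domain_integrable domain_closed u x Ex)+
  have c: "(norm (E r (u + E t x)))\<^sup>2 - (norm (E r (u - E t x)))\<^sup>2
      = (norm (E (min r t) (u + x)))\<^sup>2 - (norm (E (min r t) (u - x)))\<^sup>2" for r
    unfolding E_polar[symmetric] by (metis E_inner E_min)
  have "(\<Sum>(a, M)\<leftarrow>[(1, mu (u + E t x)), (-1, mu (u - E t x)), (-1, weight_measure (mu (u + x)) (indicator {..t})),
      (1, weight_measure (mu (u - x)) (indicator {..t}))]. a * (\<integral>x. x \<partial>M)) = 0"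
  proof (rule measures_linear_identity)
    fix r
    show "(\<Sum>(a, M)\<leftarrow>[(1, mu (u + E t x)), (-1, mu (u - E t x)), (-1, weight_measure (mu (u + x)) (indicator {..t})),
      (1, weight_measure (mu (u - x)) (indicator {..t}))]. a * measure M {..r}) = 0"
      using c[of r] by (simp add: mu_atMost indicator_weight(1))
  next
    fix a M assume "(a, M) \<in> set [(1, mu (u + E t x)), (-1, mu (u - E t x)), (-1, weight_measure (mu (u + x)) (indicator {..t})),
      (1 :: real, weight_measure (mu (u - x)) (indicator {..t}))]"
    then consider "M = mu (u + E t x)" | "M = mu (u - E t x)" | "M = weight_measure (mu (u + x)) (indicator {..t})"
      | "M = weight_measure (mu (u - x)) (indicator {..t})" by fastforce
    note cs = this
    from cs show "finite_borel_measure M" by cases (simp_all only: mu_finite indicator_weight(2))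
    from cs show "integrable M (\<lambda>x. x)" by cases (simp_all add: i indicator_weight(4))
  next
    show "(\<lambda>x::real. x) \<in> borel_measurable borel" by simp
  qed
  then have "4 * form (\<lambda>t. t) u (E t x) = (\<integral>r. indicator {..t} r * r \<partial>mu (u + x)) - (\<integral>r. indicator {..t} r * r \<partial>mu (u - x))"
    unfolding form_def by (simp add: indicator_weight(3))
  then show ?thesis using uv Ex by (simp add: spectral_integral_form)
qed

text \<open>Let B be the operator of the graph and \<open>y = c *\<^sub>R u - v\<close>, that is, y
  = (c - B) u. For \<open>x\<close> in the dense domain d<E y, x> = (c - r) d<E u, x>, so
  integrating \<open>g = 1 / (c - r)\<close> returns \<open>inner x u\<close>. Hence the bounded
  operator belonging to \<open>g\<close> maps \<open>y\<close> to \<open>u\<close>, and its form at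
  \<open>y\<close> is the spectral integral.\<close>

lemma resolvent_form:
  assumes uv: "(u, v) \<in> spectral_integral E (\<lambda>t. t)" and Es: "\<And>x. E s x = x" and sc: "s < c"
  shows "(\<integral>r. (if r \<le> s then 1 / (c - r) else 0) \<partial>mu (c *\<^sub>R u - v)) = inner (c *\<^sub>R u - v) u"
proof -
  define y where "y = c *\<^sub>R u - v"
  define g where "g r = (if r \<le> s then 1 / (c - r) else 0)" for r :: real
  have g [measurable]: "g \<in> borel_measurable borel" unfolding g_def by measurable
  have gb: "\<bar>g r\<bar> \<le> 1 / (c - s)" for r using sc by (auto simp: g_def frac_le)
  have gi: "integrable (mu a) g" for a by (rule mu_integrable_bounded[OF g gb])
  \<comment> \<open>The density must be nonnegative everywhere; on the support, where
    \<open>r \<le> s < c\<close>, it is \<open>c - r\<close>.\<close>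
  define k where "k r = max 0 (c - r)" for r :: real
  have k [measurable]: "k \<in> borel_measurable borel" and k0: "0 \<le> k r" for r unfolding k_def by auto
  have u: "u \<in> spectral_domain E (\<lambda>t. t)" using uv by (simp add: spectral_integral_form)
  have ae: "AE r in mu a. r \<le> s" for a by (rule mu_AE_le[OF Es])
  obtain A where A: "bounded_linear A" "\<And>u w. inner w (A u) = form g u w" using bounded_calculus[OF g gb] by blast
  have main: "form g y x = inner x u" if x: "x \<in> spectral_domain E (\<lambda>t. t)" for x
  proof -
    let ?P = "u + x" and ?N = "u - x"
    have d: "?P \<in> spectral_domain E (\<lambda>t. t)" "?N \<in> spectral_domain E (\<lambda>t. t)" by (intro domain_closed u x)+
    have ki: "integrable (mu a) k" if "a \<in> spectral_domain E (\<lambda>t. t)" for a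
    proof -
      interpret finite_measure "mu a" by (rule mu_finite_measure)
      show ?thesis unfolding k_def
        by (intro integrable_max Bochner_Integration.integrable_diff id_domain_integrable that) auto
    qed
    have kc: "measure (weight_measure (mu a) k) {..t} = c * (norm (E t a))\<^sup>2 - (\<integral>r. indicator {..t} r * r \<partial>mu a)"
      if a: "a \<in> spectral_domain E (\<lambda>t. t)" for a t
    proof -
      interpret finite_measure "mu a" by (rule mu_finite_measure)
      have i1: "integrable (mu a) (\<lambda>r. c * indicator {..t} r)"
        by (rule mu_integrable_bounded[where B = "\<bar>c\<bar>"]) (auto simp: indicator_def)
      have i2: "integrable (mu a) (\<lambda>r. indicator {..t} r * r)"
        using integrable_mult_indicator[OF _ id_domain_integrable[OF a], of "{..t}"] by (simp add: mu_sets)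
      have "(\<integral>r. indicator {..t} r * k r \<partial>mu a) = (\<integral>r. c * indicator {..t} r - indicator {..t} r * r \<partial>mu a)"
        by (rule integral_mu_cong, measurable) (use ae[of a] sc in \<open>auto elim!: eventually_mono simp: k_def indicator_def\<close>)
      also have "\<dots> = c * (norm (E t a))\<^sup>2 - (\<integral>r. indicator {..t} r * r \<partial>mu a)"
        by (subst Bochner_Integration.integral_diff[OF i1 i2]) (simp add: mu_sets mu_atMost)
      finally show ?thesis using weight_cdf(1)[OF k ki[OF a] k0, of t] by simp
    qed
    have kg: "k r * g r = 1" if "r \<le> s" for r using that sc by (simp add: k_def g_def max_def)
    have kgi: "(\<integral>r. g r \<partial>weight_measure (mu a) k) = (norm a)\<^sup>2" "integrable (weight_measure (mu a) k) g"
      if a: "a \<in> spectral_domain E (\<lambda>t. t)" for a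
    proof -
      interpret finite_measure "mu a" by (rule mu_finite_measure)
      have aekg: "AE r in mu a. k r * g r = 1" using ae[of a] kg by (auto elim: eventually_mono)
      have "(\<integral>r. g r \<partial>weight_measure (mu a) k) = (\<integral>r. 1 \<partial>mu a)"
        unfolding integral_weight[OF mu_finite ki[OF a] k0 k g]
        by (rule integral_mu_cong[OF _ _ aekg]) auto
      then show "(\<integral>r. g r \<partial>weight_measure (mu a) k) = (norm a)\<^sup>2" by (simp add: mu_sets mu_UNIV)
      show "integrable (weight_measure (mu a) k) g"
        unfolding integrable_weight[OF mu_finite ki[OF a] k0 k g]
        by (rule mu_integrable_AE_bounded[where B = 1]) (use aekg in \<open>auto elim: eventually_mono\<close>)
    qed
    have cdf: "(norm (E t (y + x)))\<^sup>2 - (norm (E t (y - x)))\<^sup>2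
      = (c * (norm (E t ?P))\<^sup>2 - (\<integral>r. indicator {..t} r * r \<partial>mu ?P)) - (c * (norm (E t ?N))\<^sup>2 - (\<integral>r. indicator {..t} r * r \<partial>mu ?N))" for t
    proof -
      have "(norm (E t (y + x)))\<^sup>2 - (norm (E t (y - x)))\<^sup>2 = 4 * inner (E t y) x" by (rule E_polar[symmetric])
      also have "\<dots> = c * (4 * inner (E t u) x) - 4 * inner (E t x) v"
      proof -
        have "inner (E t v) x = inner (E t x) v" by (metis E_inner inner_commute)
        then show ?thesis by (simp add: y_def E_diff E_scaleR inner_diff)
      qed
      also have "\<dots> = c * ((norm (E t ?P))\<^sup>2 - (norm (E t ?N))\<^sup>2)
          - ((\<integral>r. indicator {..t} r * r \<partial>mu ?P) - (\<integral>r. indicator {..t} r * r \<partial>mu ?N))"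
        unfolding E_polar[of t u x] E_graph_form[OF uv x] ..
      finally show ?thesis by (simp add: right_diff_distrib)
    qed
    have "(\<Sum>(a, M)\<leftarrow>[(1, mu (y + x)), (-1, mu (y - x)), (-1, weight_measure (mu ?P) k), (1, weight_measure (mu ?N) k)].
       a * (\<integral>r. g r \<partial>M)) = 0"
    proof (rule measures_linear_identity)
      fix t
      show "(\<Sum>(a, M)\<leftarrow>[(1, mu (y + x)), (-1, mu (y - x)), (-1, weight_measure (mu ?P) k), (1, weight_measure (mu ?N) k)].
       a * measure M {..t}) = 0"
        using cdf[of t] by (simp add: mu_atMost kc d)
    qed (use d k0 in \<open>auto simp: mu_finite weight_cdf(2)[OF k ki k0] gi kgi(2)\<close>)
    then have "4 * form g y x = (norm ?P)\<^sup>2 - (norm ?N)\<^sup>2" by (simp add: form_def kgi d)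
    also have "\<dots> = 4 * inner x u" by (simp add: power2_norm_eq_inner inner_add inner_diff inner_commute)
    finally show ?thesis by simp
  qed
  have "A y = u"
  proof -
    have "closed {x. inner x (A y - u) = 0}" by (intro closed_Collect_eq continuous_intros)
    moreover have "spectral_domain E (\<lambda>t. t) \<subseteq> {x. inner x (A y - u) = 0}" using main A(2) by (auto simp: inner_diff_right)
    ultimately have "closure (spectral_domain E (\<lambda>t. t)) \<subseteq> {x. inner x (A y - u) = 0}" by (rule closure_minimal[rotated])
    then have "inner (A y - u) (A y - u) = 0" unfolding domain_dense by blast
    then show ?thesis by simp
  qed
  then have "inner y u = form g y y" using A(2)[of y y] by simp
  also have "\<dots> = (\<integral>r. g r \<partial>mu y)" by (rule form_diag[OF g gi gi])
  finally show ?thesis unfolding g_def y_def by simp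
qed

text \<open>\<open>f\<close> agrees almost everywhere, for every spectral measure, with its bounded
  cutoff \<open>g\<close>. So the domain is the whole space, the graph is that of the bounded
  operator of \<open>g\<close>, and \<open>op_apply\<close> returns this operator.\<close>

lemma bounded_on_support_calculus:
  assumes f [measurable]: "f \<in> borel_measurable borel" and Es: "\<And>x. E s x = x" and G: "\<And>r. r \<le> s \<Longrightarrow> \<bar>f r\<bar> \<le> G"
  shows "bounded_linear (op_apply (spectral_integral E f))"
    and "inner (op_apply (spectral_integral E f) u) w = inner u (op_apply (spectral_integral E f) w)"
    and "inner u (op_apply (spectral_integral E f) u) = (\<integral>r. f r \<partial>mu u)"
    and "integrable (mu u) f"
proof -
  have ae: "AE r in mu a. r \<le> s" for a by (rule mu_AE_le[OF Es])
  define g where "g r = (if r \<le> s then f r else 0)" for r :: real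
  have g [measurable]: "g \<in> borel_measurable borel" unfolding g_def by measurable
  have "0 \<le> G" using G[of s] by linarith
  then have gb: "\<bar>g r\<bar> \<le> G" for r using G by (auto simp: g_def)
  have gi: "integrable (mu a) g" for a by (rule mu_integrable_bounded[OF g gb])
  have fg: "AE r in mu a. f r = g r" for a using ae[of a] by (auto elim!: eventually_mono simp: g_def)
  have int: "(\<integral>r. f r \<partial>mu a) = (\<integral>r. g r \<partial>mu a)" for a by (rule integral_mu_cong[OF f g fg])
  have ff: "form f = form g" by (simp add: form_def int fun_eq_iff)
  show fi: "integrable (mu a) f" for a
    by (rule mu_integrable_AE_bounded[OF f, where B = G]) (use ae[of a] G in \<open>auto elim!: eventually_mono\<close>)
  have "integrable (mu a) (\<lambda>r. (f r)\<^sup>2)" for a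
  proof (rule mu_integrable_AE_bounded[where B = "G\<^sup>2"])
    show "AE r in mu a. \<bar>(f r)\<^sup>2\<bar> \<le> G\<^sup>2"
      using ae[of a] by eventually_elim (metis G abs_power2 power2_abs power_mono abs_ge_zero)
  qed measurable
  then have dom: "spectral_domain E f = UNIV" by (auto simp: spectral_domain_def)
  obtain A where A: "bounded_linear A" "\<And>u w. inner w (A u) = form g u w" using bounded_calculus[OF g gb] by blast
  have "(u, v) \<in> spectral_integral E f \<longleftrightarrow> v = A u" for u v
    unfolding spectral_integral_form dom ff A(2)[symmetric] using inner_eqI[of v "A u"] by auto
  then have eq: "op_apply (spectral_integral E f) = A" by (simp add: op_apply_def fun_eq_iff)
  show "bounded_linear (op_apply (spectral_integral E f))" unfolding eq by (rule A)
  show "inner (op_apply (spectral_integral E f) u) w = inner u (op_apply (spectral_integral E f) w)"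
    unfolding eq using A(2)[of w u] A(2)[of u w] form_commute[of g u w] by (simp add: inner_commute)
  show "inner u (op_apply (spectral_integral E f) u) = (\<integral>r. f r \<partial>mu u)"
    unfolding eq A(2) int by (rule form_diag[OF g gi gi])
qed

end

section \<open>The spectral theorem for semibounded operators\<close>

lemma proj_on_tower:
  fixes S T :: "'a :: {real_inner, complete_space} set"
  assumes S: "subspace S" "closed S" and T: "subspace T" "closed T" and ST: "S \<subseteq> T"
  shows "proj_on S (proj_on T u) = proj_on S u"
proof (rule proj_on_unique[OF S proj_on_in[OF S]])
  fix v assume v: "v \<in> S"
  have "inner (u - proj_on S u) v = 0" "inner (u - proj_on T u) v = 0"
    using proj_on_orth[OF S v] proj_on_orth[OF T] v ST by auto
  then show "inner (proj_on T u - proj_on S u) v = 0" by (simp add: inner_diff)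
qed

lemma proj_on_norm_diff:
  fixes S T :: "'a :: {real_inner, complete_space} set"
  assumes S: "subspace S" "closed S" and T: "subspace T" "closed T" and ST: "S \<subseteq> T"
  shows "(norm (proj_on T u - proj_on S u))\<^sup>2 = (norm (proj_on T u))\<^sup>2 - (norm (proj_on S u))\<^sup>2"
proof -
  have "inner (proj_on T u) (proj_on S u) = inner (proj_on S (proj_on T u)) (proj_on S u)"
    by (simp add: proj_on_symmetric[OF S] proj_on_id[OF S proj_on_in[OF S]])
  then have "inner (proj_on T u) (proj_on S u) = inner (proj_on S u) (proj_on S u)"
    by (simp add: proj_on_tower[OF assms])
  then show ?thesis by (simp add: power2_norm_eq_inner inner_diff inner_commute)
qed

text \<open>The norms of the projections decrease and so converge, Pythagoras makes the projections
  themselves Cauchy, and the limit lies in every \<open>T k\<close>.\<close>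

lemma proj_on_decreasing_limit:
  fixes T :: "nat \<Rightarrow> 'a :: {real_inner, complete_space} set"
  assumes T: "\<And>n. subspace (T n)" "\<And>n. closed (T n)" and dec: "\<And>m n. m \<le> n \<Longrightarrow> T n \<subseteq> T m"
  shows "(\<lambda>n. proj_on (T n) u) \<longlonglongrightarrow> proj_on (\<Inter>n. T n) u"
proof -
  define a where "a n = (norm (proj_on (T n) u))\<^sup>2" for n
  have d: "(norm (proj_on (T m) u - proj_on (T n) u))\<^sup>2 = a m - a n" if "m \<le> n" for m n
    unfolding a_def by (rule proj_on_norm_diff[OF T T dec[OF that]])
  then have mono: "a n \<le> a m" if "m \<le> n" for m n using that by (metis diff_ge_0_iff_ge zero_le_power2)
  have "convergent a"
  proof (rule Bseq_monoseq_convergent)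
    show "Bseq a" using mono[of 0] by (intro BseqI'[of _ "a 0"]) (auto simp: a_def)
    show "monoseq a" using mono by (auto simp: monoseq_def)
  qed
  then have ca: "Cauchy a" by (rule convergent_Cauchy)
  have "Cauchy (\<lambda>n. proj_on (T n) u)"
  proof (rule CauchyI)
    fix e :: real assume e: "0 < e"
    obtain N where N: "\<And>m n. m \<ge> N \<Longrightarrow> n \<ge> N \<Longrightarrow> norm (a m - a n) < e\<^sup>2"
      using CauchyD[OF ca, of "e\<^sup>2"] e by auto
    have *: "norm (proj_on (T m) u - proj_on (T n) u) < e" if "N \<le> m" "m \<le> n" for m n
    proof (rule power2_less_imp_less)
      have "norm (a m - a n) < e\<^sup>2" using N that by simp
      then show "(norm (proj_on (T m) u - proj_on (T n) u))\<^sup>2 < e\<^sup>2"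
        unfolding d[OF that(2)] real_norm_def by linarith
    qed (use e in simp)
    show "\<exists>M. \<forall>m\<ge>M. \<forall>n\<ge>M. norm (proj_on (T m) u - proj_on (T n) u) < e"
      using * by (metis nle_le norm_minus_commute)
  qed
  then obtain p where p: "(\<lambda>n. proj_on (T n) u) \<longlonglongrightarrow> p" using Cauchy_convergent convergent_def by blast
  have "p \<in> T k" for k
  proof (rule closed_sequentially[OF T(2)])
    show "(\<lambda>n. proj_on (T (n + k)) u) \<longlonglongrightarrow> p" by (rule LIMSEQ_ignore_initial_segment[OF p])
    show "proj_on (T (n + k)) u \<in> T k" for n using proj_on_in[OF T] dec[of k "n + k"] by auto
  qed
  moreover have "inner (u - p) v = 0" if "v \<in> (\<Inter>n. T n)" for v
  proof (rule LIMSEQ_unique)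
    show "(\<lambda>n. inner (u - proj_on (T n) u) v) \<longlonglongrightarrow> inner (u - p) v" by (intro tendsto_intros p)
    show "(\<lambda>n. inner (u - proj_on (T n) u) v) \<longlonglongrightarrow> 0" using that proj_on_orth[OF T] by simp
  qed
  ultimately have "proj_on (\<Inter>n. T n) u = p"
    using T by (intro proj_on_unique subspace_Inter closed_INT) auto
  then show ?thesis using p by simp
qed

text \<open>Over \<open>N\<close> equal pieces the bounds telescope to
  \<open>(t - s) / N * (F t - F s)\<close>, which is arbitrarily small.\<close>

lemma zero_variation:
  fixes f F :: "real \<Rightarrow> real"
  assumes "\<And>s t. s < t \<Longrightarrow> t \<le> b \<Longrightarrow> \<bar>f t - f s\<bar> \<le> (t - s) * (F t - F s)" and st: "s < t" "t \<le> b"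
  shows "f t = f s"
proof -
  have "\<bar>f t - f s\<bar> \<le> (t - s) * (F t - F s) / real (Suc n)" for n
  proof -
    define N where "N = Suc n"
    define d where "d = (t - s) / real N"
    have N: "0 < N" by (simp add: N_def)
    have d: "0 < d" using st N by (simp add: d_def)
    define x where "x k = s + real k * d" for k
    have x0: "x 0 = s" and xN: "x N = t" using N by (simp_all add: x_def d_def)
    have dx: "x (Suc k) - x k = d" for k by (simp add: x_def algebra_simps)
    have xb: "x (Suc k) \<le> b" if "k < N" for k
    proof -
      have "real (Suc k) * d \<le> real N * d" using that d by (intro mult_right_mono) auto
      then have "x (Suc k) \<le> x N" by (simp add: x_def)
      then show ?thesis using xN st by simp
    qed
    have "f t - f s = (\<Sum>k<N. f (x (Suc k)) - f (x k))"
      using sum_lessThan_telescope[of "\<lambda>k. f (x k)" N] by (simp add: x0 xN)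
    then have "\<bar>f t - f s\<bar> \<le> (\<Sum>k<N. \<bar>f (x (Suc k)) - f (x k)\<bar>)" by (simp add: sum_abs)
    also have "\<dots> \<le> (\<Sum>k<N. d * (F (x (Suc k)) - F (x k)))"
    proof (rule sum_mono)
      fix k assume "k \<in> {..<N}"
      then show "\<bar>f (x (Suc k)) - f (x k)\<bar> \<le> d * (F (x (Suc k)) - F (x k))"
        using assms(1)[of "x k" "x (Suc k)"] dx[of k] d xb[of k] by simp
    qed
    also have "\<dots> = d * (F t - F s)"
      using sum_lessThan_telescope[of "\<lambda>k. F (x k)" N] by (simp add: x0 xN flip: sum_distrib_left)
    finally show ?thesis by (simp add: d_def N_def)
  qed
  moreover have "(\<lambda>n. (t - s) * (F t - F s) / real (Suc n)) \<longlonglongrightarrow> 0"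
    using LIMSEQ_Suc[OF lim_const_over_n] by blast
  ultimately have "\<bar>f t - f s\<bar> \<le> 0" by (intro LIMSEQ_le_const) auto
  then show ?thesis by simp
qed

text \<open>\<open>R\<close> plays the role of the inverse of c - B, so B is defined by
  \<open>R\<close> and \<open>c\<close>. Contractivity of \<open>R\<close> corresponds to B \<le> c
  - 1 and injectivity to the absence of spectral mass at minus infinity.\<close>

locale resolvent = positive_contraction R for R :: "L2 \<Rightarrow> L2" +
  fixes c :: real
  assumes R_scaleC: "R (scaleC \<i> u) = scaleC \<i> (R u)"
    and R_inj: "R u = 0 \<Longrightarrow> u = 0"
begin

text \<open>The value B \<le> t corresponds to \<open>R\<close> having values at most
  \<open>1 / (c - t)\<close>. Already from \<open>t = c - 1\<close> on this is the whole
  space.\<close>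

definition S :: "real \<Rightarrow> L2 set" where
  "S t = (if t < c then growth_space (1 / (c - t)) else UNIV)"

definition E :: "real \<Rightarrow> L2 \<Rightarrow> L2" where "E t = proj_on (S t)"

lemma growth_space_UNIV: "1 \<le> l \<Longrightarrow> growth_space l = UNIV"
proof -
  assume l: "1 \<le> l"
  have n: "norm ((R ^^ n) u) \<le> norm u" for n u
    by (induction n) (auto intro: order_trans[OF contr])
  have "norm ((R ^^ n) u) \<le> l ^ n * norm u" for n u
  proof -
    have "1 * norm u \<le> l ^ n * norm u" using l by (intro mult_right_mono) auto
    then show ?thesis using n[of n u] by simp
  qed
  then show ?thesis by (auto simp: growth_space_def)
qed

lemma S_UNIV: "c - 1 \<le> t \<Longrightarrow> S t = UNIV"
  by (auto simp: S_def growth_space_UNIV)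

lemma S_sub: "subspace (S t)" "closed (S t)"
  by (auto simp: S_def growth_space_subspace growth_space_closed subspace_UNIV)

lemma S_mono: "s \<le> t \<Longrightarrow> S s \<subseteq> S t"
proof (cases "t < c")
  case True
  assume "s \<le> t"
  then have "1 / (c - s) \<le> 1 / (c - t)" using True by (intro divide_left_mono) auto
  then show ?thesis using True \<open>s \<le> t\<close> growth_space_mono[of "1 / (c - s)" "1 / (c - t)"] by (auto simp: S_def)
qed (simp add: S_def)

lemma S_scaleC: "u \<in> S t \<Longrightarrow> scaleC \<i> u \<in> S t" "u \<in> S t \<Longrightarrow> R u \<in> S t"
  using growth_space_invariant[OF _ bounded_linear_scaleC[of \<i>], of "1 / (c - t)" u]
    growth_space_invariant[OF _ lin, of "1 / (c - t)" u]
  by (auto simp: S_def R_scaleC split: if_splits)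

lemma E_R: "E t (R u) = R (E t u)"
  unfolding E_def by (rule proj_on_commute[OF S_sub R.linear sym]) (auto intro: S_scaleC)

lemma E_id: "c - 1 \<le> t \<Longrightarrow> E t u = u"
  unfolding E_def using proj_on_id[OF S_sub, of u t] S_UNIV[of t] by simp

lemma E_seq:
  assumes s: "\<And>m n. m \<le> n \<Longrightarrow> s n \<le> s m"
  shows "(\<lambda>n. E (s n) u) \<longlonglongrightarrow> proj_on (\<Inter>n. S (s n)) u"
  unfolding E_def by (rule proj_on_decreasing_limit[OF S_sub]) (use s S_mono in auto)

text \<open>Right continuity holds because the growth bounds defining \<open>S t\<close> are limits
  of those for parameters decreasing to \<open>t\<close>. At minus infinity a vector in all
  \<open>S t\<close> satisfies \<open>R x = 0\<close>, and injectivity kills it. At plus infinity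
  \<open>E t\<close> is eventually the identity.\<close>

lemma resolution_E: "resolution_of_identity E"
  unfolding resolution_of_identity_def
proof (intro conjI allI impI)
  fix t u
  have "E t (scaleC \<i> v) = scaleC \<i> (E t v)" for v
    unfolding E_def
    by (rule proj_on_commute[OF S_sub bounded_linear.linear[OF bounded_linear_scaleC], where C' = "\<lambda>v. - scaleC \<i> v"])
       (auto simp: inner_scaleC_i_left S_scaleC subspace_neg[OF S_sub(1)])
  then have "cinner (E t u) v = cinner u (E t v)" for u v
    by (intro cinner_symmetric_if_inner) (simp_all add: E_def proj_on_symmetric[OF S_sub])
  then show "orthogonal_projection (E t)"
    unfolding orthogonal_projection_def by (auto simp: E_def proj_on_id[OF S_sub proj_on_in[OF S_sub]])
next
  fix s t u assume "s \<le> (t::real)"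
  then show "E s (E t u) = E s u" unfolding E_def by (intro proj_on_tower S_sub S_mono)
next
  fix t u
  show "((\<lambda>s. E s u) \<longlongrightarrow> E t u) (at_right t)"
  proof -
    define s where "s n = t + 1 / real (Suc n)" for n
    have sd: "s n \<le> s m" if "m \<le> n" for m n using that by (auto simp: s_def frac_le)
    have st: "t < s n" for n by (simp add: s_def)
    have int: "(\<Inter>n. S (s n)) = S t"
    proof
      show "S t \<subseteq> (\<Inter>n. S (s n))" using S_mono[of t] st less_imp_le by blast
      show "(\<Inter>n. S (s n)) \<subseteq> S t"
      proof (cases "t < c")
        case False then show ?thesis by (simp add: S_def)
      next
        case True
        have lim: "s \<longlonglongrightarrow> t + 0" unfolding s_def by (intro tendsto_intros LIMSEQ_Suc[OF lim_1_over_n])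
        then have ev: "\<forall>\<^sub>F n in sequentially. s n < c" using True by (intro order_tendstoD(2)[of s t]) auto
        have "x \<in> growth_space (1 / (c - t))" if x: "\<And>n. x \<in> S (s n)" for x
          unfolding growth_space_def
        proof (intro CollectI allI)
          fix k
          have "(\<lambda>n. (1 / (c - s n)) ^ k * norm x) \<longlonglongrightarrow> (1 / (c - (t + 0))) ^ k * norm x"
            using True by (intro tendsto_intros lim) auto
          moreover have "\<forall>\<^sub>F n in sequentially. norm ((R ^^ k) x) \<le> (1 / (c - s n)) ^ k * norm x"
            using ev
          proof eventually_elim
            case (elim n) then show ?case using x[of n] by (simp add: S_def growth_space_def)
          qed
          ultimately show "norm ((R ^^ k) x) \<le> (1 / (c - t)) ^ k * norm x"
            using tendsto_lowerbound[of _ _ sequentially "norm ((R ^^ k) x)"] by simp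
        qed
        then show ?thesis using True by (auto simp: S_def)
      qed
    qed
    have lim: "(\<lambda>n. E (s n) u) \<longlonglongrightarrow> E t u" using E_seq[of s u, OF sd] int by (simp add: E_def)
    \<comment> \<open>Monotonicity in the parameter upgrades convergence along the sequence
      \<open>s\<close> to the one-sided limit.\<close>
    have mono: "norm (E x u - E t u) \<le> norm (E y u - E t u)" if "t \<le> x" "x \<le> y" for x y
    proof (rule power2_le_imp_le)
      have "(norm (E x u))\<^sup>2 \<le> (norm (E y u))\<^sup>2"
        using proj_on_norm_diff[OF S_sub S_sub S_mono[OF that(2)], of u] zero_le_power2[of "norm (E y u - E x u)"]
        by (simp add: E_def)
      then show "(norm (E x u - E t u))\<^sup>2 \<le> (norm (E y u - E t u))\<^sup>2"
        using proj_on_norm_diff[OF S_sub S_sub S_mono[of t x], of u] proj_on_norm_diff[OF S_sub S_sub S_mono[of t y], of u] that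
        by (simp add: E_def)
    qed simp
    show ?thesis
    proof (rule tendstoI)
      fix e :: real assume "0 < e"
      then obtain n where n: "dist (E (s n) u) (E t u) < e" using metric_LIMSEQ_D[OF lim] by blast
      show "\<forall>\<^sub>F x in at_right t. dist (E x u) (E t u) < e"
        unfolding eventually_at_right[OF st[of n]]
      proof (intro exI[of _ "s n"] conjI allI impI st)
        fix x assume "t < x" "x < s n"
        then show "dist (E x u) (E t u) < e" using mono[of x "s n"] n by (simp add: dist_norm)
      qed
    qed
  qed
next
  fix u
  show "((\<lambda>t. E t u) \<longlongrightarrow> 0) at_bot"
  proof -
    define s where "s n = c - real (Suc n)" for n
    have sd: "s n \<le> s m" if "m \<le> n" for m n using that by (auto simp: s_def)
    have int: "(\<Inter>n. S (s n)) = {0}"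
    proof
      show "{0} \<subseteq> (\<Inter>n. S (s n))" using S_sub(1) by (auto simp: subspace_0)
      show "(\<Inter>n. S (s n)) \<subseteq> {0}"
      proof
        fix x assume x: "x \<in> (\<Inter>n. S (s n))"
        have "norm (R x) \<le> (1 / real (Suc n)) * norm x" for n
        proof -
          have "x \<in> growth_space (1 / real (Suc n))" using x by (auto simp: S_def s_def)
          then show ?thesis by (auto simp: growth_space_def dest: spec[of _ 1])
        qed
        moreover have "(\<lambda>n. (1 / real (Suc n)) * norm x) \<longlonglongrightarrow> 0 * norm x"
          by (intro tendsto_intros LIMSEQ_Suc[OF lim_1_over_n])
        ultimately have "norm (R x) \<le> 0 * norm x" by (intro LIMSEQ_le_const) auto
        then show "x \<in> {0}" using R_inj by simp
      qed
    qed
    have "proj_on {0} u = 0" using proj_on_in[OF subspace_single_0 closed_singleton, of u] by simp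
    then have lim: "(\<lambda>n. E (s n) u) \<longlonglongrightarrow> 0" using E_seq[of s u, OF sd] int by simp
    have mono: "norm (E x u) \<le> norm (E y u)" if "x \<le> y" for x y
    proof (rule power2_le_imp_le)
      show "(norm (E x u))\<^sup>2 \<le> (norm (E y u))\<^sup>2"
        using proj_on_norm_diff[OF S_sub S_sub S_mono[OF that], of u] zero_le_power2[of "norm (E y u - E x u)"]
        by (simp add: E_def)
    qed simp
    show ?thesis
    proof (rule tendstoI)
      fix e :: real assume "0 < e"
      then obtain n where n: "dist (E (s n) u) 0 < e" using metric_LIMSEQ_D[OF lim] by blast
      show "\<forall>\<^sub>F x in at_bot. dist (E x u) 0 < e"
        using eventually_le_at_bot[of "s n"] by eventually_elim (use mono n in \<open>auto intro: le_less_trans\<close>)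
    qed
  qed
next
  fix u
  have "\<forall>\<^sub>F t in at_top. E t u = u" using eventually_ge_at_top[of "c - 1"] by eventually_elim (rule E_id)
  then show "((\<lambda>t. E t u) \<longlongrightarrow> u) at_top" by (rule tendsto_eventually)
qed

sublocale spectral_family E
  by unfold_locales (rule resolution_E)

text \<open>The function with B-integral \<open>R\<close>: it is \<open>1 / (c - r)\<close> on the
  support and cut off beyond \<open>c - 1\<close>, which keeps it between \<open>0\<close> and
  \<open>1\<close>.\<close>

definition lam :: "real \<Rightarrow> real" where "lam r = (if r \<le> c - 1 then 1 / (c - r) else 0)"

lemma lam_measurable [measurable]: "lam \<in> borel_measurable borel"
  unfolding lam_def by measurable

lemma lam_bounds: "0 \<le> lam r" "lam r \<le> 1" "\<bar>lam r\<bar> \<le> 1"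
  by (auto simp: lam_def)

lemma lam_integrable: "integrable (mu a) lam"
  by (rule mu_integrable_bounded[OF lam_measurable lam_bounds(3)])

lemma AE_mu: "AE r in mu a. r \<le> c - 1"
  by (rule mu_AE_le) (simp add: E_id)

lemma lam_indicator_integrable: "integrable (mu a) (\<lambda>r. indicator {..t} r * lam r)"
  by (rule mu_integrable_bounded[where B = 1]) (use lam_bounds in \<open>auto simp: indicator_def\<close>)

text \<open>The increment lies in \<open>S t\<close> and is orthogonal to \<open>S s\<close>; the
  two form estimates for growth spaces apply to it.\<close>

lemma local_bounds:
  assumes st: "s < t" "t \<le> c - 1"
  shows "lam s * (norm (E t y - E s y))\<^sup>2 \<le> inner (R (E t y - E s y)) (E t y - E s y)"
    and "inner (R (E t y - E s y)) (E t y - E s y) \<le> lam t * (norm (E t y - E s y))\<^sup>2"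
proof -
  let ?z = "E t y - E s y"
  have Et: "E t ?z = ?z" and Es: "E s ?z = 0" using st by (simp_all add: E_diff E_min min_def)
  have "?z \<in> S t" using Et proj_on_in[OF S_sub, of t ?z] by (metis E_def)
  then show "inner (R ?z) ?z \<le> lam t * (norm ?z)\<^sup>2"
    using st growth_space_form_le[of ?z "1 / (c - t)"] by (simp add: S_def lam_def)
  have "inner ?z k = 0" if "k \<in> S s" for k
    using proj_on_orth[OF S_sub that, of ?z] Es by (simp add: E_def)
  then show "lam s * (norm ?z)\<^sup>2 \<le> inner (R ?z) ?z"
    using st growth_space_orth_form_ge[of "1 / (c - s)" ?z] by (simp add: S_def lam_def)
qed

text \<open>The measures \<open>d\<langle>E R y, y\<rangle>\<close> and \<open>lam d\<langle>E y, y\<rangle>\<close> agree up to \<open>(t - s) \<mu>(s, t]\<close> on every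
  interval; hence they coincide.\<close>
lemma resolvent_distribution: "inner (E t (R y)) y = (\<integral>r. indicator {..t} r * lam r \<partial>mu y)"
proof -
  define k where "k t = inner (E t (R y)) y" for t
  define l where "l t = (\<integral>r. indicator {..t} r * lam r \<partial>mu y)" for t
  define F where "F t = (norm (E t y))\<^sup>2" for t
  define f where "f t = k t - l t" for t
  interpret finite_measure "mu y" by (rule mu_finite_measure)
  have step: "\<bar>f t - f s\<bar> \<le> (t - s) * (F t - F s)" if st: "s < t" "t \<le> c - 1" for s t
  proof -
    let ?z = "E t y - E s y"
    have z: "(norm ?z)\<^sup>2 = F t - F s" using E_norm_diff[of s t y] st by (simp add: F_def)
    have "inner (R ?z) ?z = inner (R y) (E t ?z) - inner (R y) (E s ?z)"
      by (simp add: R.diff E_R[symmetric] inner_diff_left E_inner)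
    also have "\<dots> = inner (R y) ?z" using st by (simp add: E_diff E_min min_def)
    also have "\<dots> = k t - k s" by (simp add: k_def inner_diff_right E_inner)
    finally have k: "lam s * (F t - F s) \<le> k t - k s" "k t - k s \<le> lam t * (F t - F s)"
      using local_bounds[OF st, of y] z by auto
    have i: "integrable (mu y) (\<lambda>r. a * (indicator {..t} r - indicator {..s} r))" for a :: real
      by (rule mu_integrable_bounded[where B = "\<bar>a\<bar>"]) (auto simp: indicator_def)
    have v: "(\<integral>r. a * (indicator {..t} r - indicator {..s} r) \<partial>mu y) = a * (F t - F s)" for a
    proof -
      have "integrable (mu y) (indicator {..x} :: real \<Rightarrow> real)" for x
        by (rule mu_integrable_bounded[where B = 1]) (auto simp: indicator_def)
      then show ?thesis by (simp add: mu_sets mu_atMost F_def)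
    qed
    have ld: "l t - l s = (\<integral>r. indicator {..t} r * lam r - indicator {..s} r * lam r \<partial>mu y)"
      unfolding l_def by (rule Bochner_Integration.integral_diff[OF lam_indicator_integrable lam_indicator_integrable, symmetric])
    have lm: "lam s \<le> lam r \<and> lam r \<le> lam t" if "s < r" "r \<le> t" for r
      using that st by (auto simp: lam_def frac_le)
    have l: "lam s * (F t - F s) \<le> l t - l s" "l t - l s \<le> lam t * (F t - F s)"
      unfolding ld v[symmetric] using st lm
      by (intro integral_mono i Bochner_Integration.integrable_diff lam_indicator_integrable; force simp: indicator_def)+
    have Fm: "0 \<le> F t - F s" using zero_le_power2[of "norm ?z"] z by simp
    \<comment> \<open>Below \<open>c - 1\<close> both denominators are at least \<open>1\<close>, so
      \<open>lam\<close> is Lipschitz with constant one there.\<close>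
    have "lam t - lam s \<le> t - s"
    proof -
      have "lam t - lam s = (t - s) / ((c - t) * (c - s))" using st by (simp add: lam_def field_simps)
      also have "\<dots> \<le> (t - s) / 1"
        using st mult_mono[of 1 "c - t" 1 "c - s"] by (intro divide_left_mono) auto
      finally show ?thesis by simp
    qed
    then have "(lam t - lam s) * (F t - F s) \<le> (t - s) * (F t - F s)" using Fm by (rule mult_right_mono)
    moreover have "\<bar>f t - f s\<bar> \<le> lam t * (F t - F s) - lam s * (F t - F s)" using k l unfolding f_def by linarith
    ultimately show ?thesis by (simp add: left_diff_distrib)
  qed
  have bd: "\<bar>f s\<bar> \<le> norm (E s y) * norm (R y) + F s" for s
  proof -
    have "\<bar>k s\<bar> \<le> norm (R y) * norm (E s y)" unfolding k_def E_inner by (rule Cauchy_Schwarz_ineq2)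
    moreover have "0 \<le> l s" unfolding l_def by (intro integral_nonneg_AE AE_I2) (use lam_bounds in auto)
    moreover have "l s \<le> (\<integral>r. indicator {..s} r \<partial>mu y)"
      unfolding l_def
    proof (rule integral_mono)
      show "integrable (mu y) (indicator {..s} :: real \<Rightarrow> real)"
        by (rule mu_integrable_bounded[where B = 1]) (auto simp: indicator_def)
    qed (use lam_indicator_integrable lam_bounds in \<open>auto simp: indicator_def\<close>)
    ultimately show ?thesis by (simp add: f_def F_def mu_sets mu_atMost mult.commute)
  qed
  \<comment> \<open>The estimate on increments makes \<open>f\<close> constant; that the constant is
    zero comes from the limit at minus infinity.\<close>
  have "((\<lambda>s. norm (E s y) * norm (R y) + F s) \<longlongrightarrow> 0 * norm (R y) + 0\<^sup>2) at_bot"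
  proof -
    have "((\<lambda>s. E s y) \<longlongrightarrow> 0) at_bot" using roi by (auto simp: resolution_of_identity_def)
    then have "((\<lambda>s. norm (E s y)) \<longlongrightarrow> 0) at_bot" by (rule tendsto_norm_zero)
    then show ?thesis unfolding F_def by (intro tendsto_intros)
  qed
  then have f0: "(f \<longlongrightarrow> 0) at_bot"
    by (intro Lim_null_comparison[of f "\<lambda>s. norm (E s y) * norm (R y) + F s"]) (use bd in \<open>auto intro: always_eventually\<close>)
  have main: "f t = 0" if t: "t \<le> c - 1" for t
  proof -
    have "\<forall>\<^sub>F s in at_bot. f s = f t"
      using eventually_gt_at_bot[of t]
      by eventually_elim (use zero_variation[of "c - 1" f F, OF step _ t] in auto)
    then have "(f \<longlongrightarrow> f t) at_bot" by (rule tendsto_eventually)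
    then show ?thesis using tendsto_unique[OF _ f0] by simp
  qed
  show ?thesis
  proof (cases "t \<le> c - 1")
    case True then show ?thesis using main[of t] by (simp add: f_def k_def l_def)
  next
    case False
    have "l t = l (c - 1)"
      unfolding l_def by (rule integral_mu_cong) (use AE_mu[of y] False in \<open>auto elim!: eventually_mono simp: indicator_def\<close>)
    moreover have "k t = k (c - 1)" using False by (simp add: k_def E_id)
    ultimately show ?thesis using main[of "c - 1"] by (simp add: f_def k_def l_def)
  qed
qed

lemma lam_integral: "(\<integral>r. lam r \<partial>mu y) = inner (R y) y"
proof -
  have "(\<integral>r. lam r \<partial>mu y) = (\<integral>r. indicator {..c - 1} r * lam r \<partial>mu y)"
    by (rule integral_mu_cong) (use AE_mu[of y] in \<open>auto elim!: eventually_mono\<close>)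
  then show ?thesis using resolvent_distribution[of "c - 1" y] by (simp add: E_id)
qed

lemma kappa_polar:
  "4 * inner (E t (R y)) w = (\<integral>r. indicator {..t} r * lam r \<partial>mu (y + w)) - (\<integral>r. indicator {..t} r * lam r \<partial>mu (y - w))"
proof -
  have "inner (E t (R w)) y = inner w (E t (R y))" by (simp only: E_inner sym E_R)
  then have "inner (E t (R w)) y = inner (E t (R y)) w" by (simp only: inner_commute)
  then show ?thesis unfolding resolvent_distribution[symmetric] by (simp add: R.add R.diff E_add E_diff inner_add inner_diff)
qed

lemma lam_weight_cdf: "measure (weight_measure (mu a) lam) {..t} = (\<integral>r. indicator {..t} r * lam r \<partial>mu a)"
  and lam_weight_finite: "finite_borel_measure (weight_measure (mu a) lam)"
  by (rule weight_cdf[OF lam_measurable lam_integrable lam_bounds(1)])+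

lemma lam_sq: "(\<lambda>r. (lam r)\<^sup>2) \<in> borel_measurable borel" "integrable (mu y) (\<lambda>r. (lam r)\<^sup>2)" "0 \<le> (lam r)\<^sup>2"
proof -
  show m: "(\<lambda>r. (lam r)\<^sup>2) \<in> borel_measurable borel" by measurable
  have "\<bar>(lam r)\<^sup>2\<bar> \<le> 1" for r using power_le_one[OF lam_bounds(1,2)] by simp
  then show "integrable (mu y) (\<lambda>r. (lam r)\<^sup>2)" by (rule mu_integrable_bounded[OF m])
qed simp

text \<open>Each of the two factors \<open>R\<close> in \<open>inner (E t (R y)) (R y)\<close>
  contributes one density \<open>lam\<close>: \<open>kappa_polar\<close> handles the first, and
  polarised spectral measures of \<open>y\<close> and \<open>R y\<close> handle the second.\<close>

lemma mu_R: "mu (R y) = weight_measure (mu y) (\<lambda>r. (lam r)\<^sup>2)"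
proof -
  note l2 = lam_sq
  note W = weight_cdf[OF l2]
  show ?thesis
  proof (rule cdf_unique'[OF mu_finite W(2)], rule ext)
    fix t
    let ?u = "R y" and ?g = "\<lambda>r. indicator {..t} r * lam r"
    have g: "?g \<in> borel_measurable borel" by measurable
    have gi: "integrable (weight_measure (mu y) lam) ?g"
      unfolding integrable_weight[OF mu_finite lam_integrable lam_bounds(1) lam_measurable g]
      by (rule mu_integrable_bounded[where B = 1]) (use lam_bounds in \<open>auto simp: indicator_def mult_le_one\<close>)
    have "(\<Sum>(a, M)\<leftarrow>[(1, mu (y + ?u)), (-1, mu (y - ?u)), (-4, weight_measure (mu y) lam)]. a * (\<integral>r. ?g r \<partial>M)) = 0"
    proof (rule measures_linear_identity[OF _ _ _ g])
      fix r
      have "(norm (E r (y + ?u)))\<^sup>2 - (norm (E r (y - ?u)))\<^sup>2 = 4 * inner (E r ?u) y"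
        unfolding E_polar[symmetric] by (metis E_inner inner_commute)
      then show "(\<Sum>(a, M)\<leftarrow>[(1, mu (y + ?u)), (-1, mu (y - ?u)), (-4, weight_measure (mu y) lam)]. a * measure M {..r}) = 0"
        by (simp add: mu_atMost lam_weight_cdf resolvent_distribution)
    qed (auto simp: mu_finite lam_weight_finite lam_indicator_integrable gi)
    then have "4 * inner (E t (R y)) ?u = 4 * (\<integral>r. ?g r \<partial>weight_measure (mu y) lam)"
      unfolding kappa_polar by simp
    also have "(\<integral>r. ?g r \<partial>weight_measure (mu y) lam) = (\<integral>r. indicator {..t} r * (lam r)\<^sup>2 \<partial>mu y)"
      unfolding integral_weight[OF mu_finite lam_integrable lam_bounds(1) lam_measurable g]
      by (simp add: power2_eq_square mult_ac)
    finally show "cdf (mu (R y)) t = cdf (weight_measure (mu y) (\<lambda>r. (lam r)\<^sup>2)) t"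
      by (simp add: cdf_def mu_atMost W(1) E_norm_sq)
  qed
qed

lemma lam_id_bound: "\<bar>lam r * r\<bar> \<le> \<bar>c\<bar> + 1"
proof (cases "r \<le> c - 1")
  case True
  then have "c - r \<noteq> 0" by simp
  then have "lam r * r = c * lam r - 1" using True by (simp add: lam_def diff_divide_eq_iff divide_eq_eq field_simps)
  moreover have "\<bar>c * lam r\<bar> \<le> \<bar>c\<bar>" using lam_bounds by (simp add: abs_mult mult_left_le)
  ultimately show ?thesis by linarith
qed (simp add: lam_def)

lemma R_domain: "R y \<in> spectral_domain E (\<lambda>t. t)"
proof -
  note l2 = lam_sq
  have "integrable (mu y) (\<lambda>r. (lam r)\<^sup>2 * r\<^sup>2)"
  proof (rule mu_integrable_bounded)
    show "\<bar>(lam r)\<^sup>2 * r\<^sup>2\<bar> \<le> (\<bar>c\<bar> + 1)\<^sup>2" for r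
      using power_mono[OF lam_id_bound[of r], of 2] by (simp add: power_mult_distrib abs_mult)
  qed measurable
  then show ?thesis unfolding spectral_domain_def mem_Collect_eq mu_R
    by (subst integrable_weight[OF mu_finite l2(2,3,1)]) auto
qed

text \<open>On the support \<open>r * lam r = c * lam r - 1\<close>. Integrated, this is the
  quadratic form of \<open>c *\<^sub>R R a - a\<close> at \<open>a\<close>, and polarisation gives
  the graph condition.\<close>

lemma R_in_graph: "(R y, c *\<^sub>R R y - y) \<in> spectral_integral E (\<lambda>t. t)"
  unfolding spectral_integral_form
proof (intro conjI ballI R_domain)
  fix w assume w: "w \<in> spectral_domain E (\<lambda>t. t)"
  let ?u = "R y"
  have i: "integrable (weight_measure (mu a) lam) (\<lambda>r. r)" for a
    by (subst integrable_weight[OF mu_finite lam_integrable lam_bounds(1) lam_measurable])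
       (auto intro: mu_integrable_bounded[OF _ lam_id_bound])
  have I: "(\<integral>r. r \<partial>weight_measure (mu a) lam) = c * inner (R a) a - (norm a)\<^sup>2" for a
  proof -
    interpret finite_measure "mu a" by (rule mu_finite_measure)
    have "(\<integral>r. r \<partial>weight_measure (mu a) lam) = (\<integral>r. lam r * r \<partial>mu a)"
      by (subst integral_weight[OF mu_finite lam_integrable lam_bounds(1) lam_measurable]) auto
    also have "\<dots> = (\<integral>r. c * lam r - 1 \<partial>mu a)"
      by (rule integral_mu_cong) (use AE_mu[of a] in \<open>auto elim!: eventually_mono simp: lam_def field_simps\<close>)
    also have "\<dots> = c * inner (R a) a - (norm a)\<^sup>2"
      by (subst Bochner_Integration.integral_diff) (auto simp: lam_integrable lam_integral mu_sets mu_UNIV)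
    finally show ?thesis .
  qed
  have "(\<Sum>(a, M)\<leftarrow>[(1, mu (?u + w)), (-1, mu (?u - w)), (-1, weight_measure (mu (y + w)) lam), (1, weight_measure (mu (y - w)) lam)].
     a * (\<integral>r. r \<partial>M)) = 0"
  proof (rule measures_linear_identity)
    fix t
    show "(\<Sum>(a, M)\<leftarrow>[(1, mu (?u + w)), (-1, mu (?u - w)), (-1, weight_measure (mu (y + w)) lam), (1, weight_measure (mu (y - w)) lam)].
     a * measure M {..t}) = 0"
      using E_polar[of t ?u w] kappa_polar[of t y w] by (simp add: mu_atMost lam_weight_cdf)
  next
    fix a M assume "(a, M) \<in> set [(1, mu (?u + w)), (-1, mu (?u - w)), (-1, weight_measure (mu (y + w)) lam), (1 :: real, weight_measure (mu (y - w)) lam)]"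
    then consider "M = mu (?u + w)" | "M = mu (?u - w)" | "M = weight_measure (mu (y + w)) lam" | "M = weight_measure (mu (y - w)) lam"
      by fastforce
    note cs = this
    from cs show "finite_borel_measure M" by cases (simp_all only: mu_finite lam_weight_finite)
    from cs show "integrable M (\<lambda>x. x)"
      by cases (simp_all add: i id_domain_integrable domain_closed R_domain w)
  qed simp
  then have "4 * form (\<lambda>t. t) ?u w = (c * inner (R (y + w)) (y + w) - (norm (y + w))\<^sup>2) - (c * inner (R (y - w)) (y - w) - (norm (y - w))\<^sup>2)"
    unfolding form_def by (simp add: I)
  also have "\<dots> = 4 * inner w (c *\<^sub>R ?u - y)"
  proof -
    have "inner (R w) y = inner w (R y)" by (rule sym)
    then show ?thesis
      by (simp add: R.add R.diff inner_add inner_diff power2_norm_eq_inner inner_commute algebra_simps)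
  qed
  finally show "inner w (c *\<^sub>R ?u - y) = form (\<lambda>t. t) ?u w" by simp
qed

text \<open>For the converse inclusion, let \<open>(u, v)\<close> be in the graph and compare
  \<open>u\<close> with \<open>R y\<close> for \<open>y = c *\<^sub>R u - v\<close>. The difference
  \<open>z\<close> is mapped to \<open>c *\<^sub>R z\<close>, but its spectral measure lives below
  \<open>c - 1\<close>, so it vanishes.\<close>

theorem spectral_theorem: "spectral_integral E (\<lambda>t. t) = {(R y, c *\<^sub>R R y - y) | y. True}"
proof (intro set_eqI iffI)
  fix p assume "p \<in> {(R y, c *\<^sub>R R y - y) | y. True}"
  then show "p \<in> spectral_integral E (\<lambda>t. t)" using R_in_graph by auto
next
  fix p assume p: "p \<in> spectral_integral E (\<lambda>t. t)"
  obtain u v where uv: "p = (u, v)" by force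
  define y where "y = c *\<^sub>R u - v"
  define z where "z = u - R y"
  have g1: "(u, v) \<in> spectral_integral E (\<lambda>t. t)" using p uv by simp
  note g2 = R_in_graph[of y]
  have ud: "u \<in> spectral_domain E (\<lambda>t. t)" using g1 by (simp add: spectral_integral_form)
  have zd: "z \<in> spectral_domain E (\<lambda>t. t)" unfolding z_def by (intro domain_closed ud R_domain)
  have "(z, c *\<^sub>R z) \<in> spectral_integral E (\<lambda>t. t)"
    unfolding spectral_integral_form
  proof (intro conjI ballI zd)
    fix w assume w: "w \<in> spectral_domain E (\<lambda>t. t)"
    have "form (\<lambda>t. t) (z + R y) w = form (\<lambda>t. t) z w + form (\<lambda>t. t) (R y) w"
      by (rule form_add) (use zd w R_domain in \<open>auto intro!: id_domain_integrable domain_closed\<close>)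
    then have "form (\<lambda>t. t) z w = inner w v - inner w (c *\<^sub>R R y - y)"
      using g1 g2 w by (simp add: z_def spectral_integral_form)
    then show "inner w (c *\<^sub>R z) = form (\<lambda>t. t) z w"
      by (simp add: z_def y_def inner_diff_right algebra_simps)
  qed
  then have "c * (norm z)\<^sup>2 = (\<integral>r. r \<partial>mu z)"
    using spectral_integral_id_diag[of z "c *\<^sub>R z"] by (simp add: power2_norm_eq_inner)
  also have "\<dots> \<le> (\<integral>r. c - 1 \<partial>mu z)"
  proof (rule integral_mono_AE[OF id_domain_integrable[OF zd] _ AE_mu])
    interpret finite_measure "mu z" by (rule mu_finite_measure)
    show "integrable (mu z) (\<lambda>r. c - 1)" by simp
  qed
  also have "\<dots> = (c - 1) * (norm z)\<^sup>2" by (simp add: mu_sets mu_UNIV)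
  finally have "(norm z)\<^sup>2 \<le> 0" by (simp add: algebra_simps)
  then have "u = R y" by (simp add: z_def)
  then show "p \<in> {(R y, c *\<^sub>R R y - y) | y. True}" using uv by (auto simp: y_def intro!: exI[of _ y])
qed

end

section \<open>The Schroedinger operator\<close>

subsection \<open>Kinetic energy in the coherent state representation\<close>

text \<open>This multiplier and the next one arise from applying h^2 times the Laplacian to a
  coherent state; in the weighted norm they have sizes \<open>3 * h\<close> and
  \<open>sqrt h\<close>.\<close>

definition quad_weight :: "real \<Rightarrow> real^3 \<Rightarrow> real^3 \<Rightarrow> complex" where
  "quad_weight h q x = of_real ((norm (x - q))\<^sup>2 - 3 * h)"

definition lin_weight :: "3 \<Rightarrow> real^3 \<Rightarrow> real^3 \<Rightarrow> complex" where
  "lin_weight j q x = of_real ((x - q) $ j)"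

lemma measurable_vec_nth3 [measurable]: "(\<lambda>x::real^3. x $ j) \<in> borel_measurable borel"
  by (intro borel_measurable_continuous_onI continuous_intros)

lemma measurable_weights [measurable]:
  "(\<lambda>(q, x). quad_weight h q x) \<in> borel_measurable (lborel \<Otimes>\<^sub>M lborel)"
  "(\<lambda>(q, x). lin_weight j q x) \<in> borel_measurable (lborel \<Otimes>\<^sub>M lborel)"
  unfolding quad_weight_def lin_weight_def by measurable

lemma norm_le_sqrt_weight:
  assumes h: "0 < h" shows "norm y \<le> sqrt h * (1 + (norm y)\<^sup>2 / h)"
proof -
  have "0 \<le> (norm y - sqrt h)\<^sup>2" by simp
  then have "2 * sqrt h * norm y \<le> (norm y)\<^sup>2 + h" using h by (simp add: power2_diff mult_ac)
  moreover have "0 \<le> sqrt h * norm y" using h by simp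
  ultimately have "sqrt h * norm y \<le> (norm y)\<^sup>2 + h" by linarith
  also have "\<dots> = sqrt h * (sqrt h * (1 + (norm y)\<^sup>2 / h))"
    using h by (simp add: field_simps)
  finally show ?thesis using h by simp
qed

lemma weight_bounds:
  assumes h: "0 < h"
  shows "norm (quad_weight h q x) \<le> (3 * h) * (1 + (norm (x - q))\<^sup>2 / h)"
    and "norm (lin_weight j q x) \<le> sqrt h * (1 + (norm (x - q))\<^sup>2 / h)"
proof -
  have "norm (quad_weight h q x) \<le> (norm (x - q))\<^sup>2 + 3 * h"
    unfolding quad_weight_def norm_of_real using h zero_le_power2[of "norm (x - q)"] by linarith
  also have "\<dots> \<le> (3 * h) * (1 + (norm (x - q))\<^sup>2 / h)" using h by (simp add: field_simps)
  finally show "norm (quad_weight h q x) \<le> (3 * h) * (1 + (norm (x - q))\<^sup>2 / h)" .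
  have "norm (lin_weight j q x) \<le> norm (x - q)"
    unfolding lin_weight_def norm_of_real by (rule component_le_norm_cart)
  then show "norm (lin_weight j q x) \<le> sqrt h * (1 + (norm (x - q))\<^sup>2 / h)"
    using norm_le_sqrt_weight[OF h, of "x - q"] by linarith
qed

lemma weighted_coherent_integrand:
  assumes h: "0 < h" and k: "0 \<le> k"
    and m: "(\<lambda>(q, x). m q x) \<in> borel_measurable (lborel \<Otimes>\<^sub>M lborel)"
    and mb: "\<And>q x. norm (m q x) \<le> k * (1 + (norm (x - q))\<^sup>2 / h)"
  shows "integrable lborel (\<lambda>x. cnj (coherent_state h q p x) * (m q x * rep_L2 u x))"
proof -
  have "integrable lborel (\<lambda>x. (of_real (gauss_window h (x - q)) * m q x * rep_L2 u x) * cis (- (((1 / h) *\<^sub>R p) \<bullet> x)))"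
    by (rule integrable_mult_cis[OF integrable_weighted_window[OF h k m mb]]) measurable
  then show ?thesis by (simp add: coherent_state_alt cis_cnj mult_ac)
qed

lemma
  assumes h: "0 < h" and k: "0 \<le> k"
    and m: "(\<lambda>(q, x). m q x) \<in> borel_measurable (lborel \<Otimes>\<^sub>M lborel)"
    and mb: "\<And>q x. norm (m q x) \<le> k * (1 + (norm (x - q))\<^sup>2 / h)"
  shows integrable_weighted_coherent_sq: "integrable lborel (\<lambda>z. (norm (weighted_coherent h m u z))\<^sup>2)"
    and integral_weighted_coherent_sq: "(\<integral>z. (norm (weighted_coherent h m u z))\<^sup>2 \<partial>lborel)
      \<le> (2 * pi * h) ^ 3 * (k\<^sup>2 * enn2real window_moment * (norm u)\<^sup>2)"
proof -
  note [measurable] = measurable_weighted_coherent[OF m]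
  let ?R = "(2 * pi * h) ^ 3 * (k\<^sup>2 * enn2real window_moment * (norm u)\<^sup>2)"
  have w: "window_moment = ennreal (enn2real window_moment)" using window_moment_finite by (simp add: less_top)
  have "ennreal ((2 * pi * h) ^ 3) * (ennreal (k\<^sup>2) * window_moment * ennreal ((norm u)\<^sup>2)) = ennreal ?R"
    by (subst w) (use h in \<open>simp add: ennreal_mult\<close>)
  then have b: "(\<integral>\<^sup>+z. ennreal ((norm (weighted_coherent h m u z))\<^sup>2) \<partial>lborel) \<le> ennreal ?R"
    using weighted_coherent_bound[OF h k m mb, of u] by simp
  show i: "integrable lborel (\<lambda>z. (norm (weighted_coherent h m u z))\<^sup>2)"
  proof (rule integrableI_bounded)
    show "(\<integral>\<^sup>+z. ennreal (norm ((norm (weighted_coherent h m u z))\<^sup>2)) \<partial>lborel) < \<infinity>"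
      using le_less_trans[OF b] by simp
  qed measurable
  have "ennreal (\<integral>z. (norm (weighted_coherent h m u z))\<^sup>2 \<partial>lborel) \<le> ennreal ?R"
    using b by (subst nn_integral_eq_integral[symmetric, OF i]) auto
  then show "(\<integral>z. (norm (weighted_coherent h m u z))\<^sup>2 \<partial>lborel) \<le> ?R"
    using h by (subst (asm) ennreal_le_iff) auto
qed

text \<open>In phase space h^2 times the Laplacian is multiplication by -|p|^2, up to a remainder of
  order \<open>h\<close> and one of order \<open>sqrt h\<close> times |p|.\<close>

lemma coherent_laplacian:
  assumes h: "0 < h" and u: "has_weak_laplacian u l"
  shows "of_real (h\<^sup>2) * coherent_transform h l z = weighted_coherent h (quad_weight h) u z
    - of_real ((norm (snd z))\<^sup>2) * coherent_transform h u z
    + 2 * \<i> * (\<Sum>j\<in>UNIV. of_real (snd z $ j) * weighted_coherent h (lin_weight j) u z)"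
proof -
  obtain q p where z: "z = (q, p)" by force
  let ?c = "\<lambda>x. cnj (coherent_state h q p x)"
  have i0: "integrable lborel (\<lambda>x. ?c x * (quad_weight h q x * rep_L2 u x))"
    by (rule weighted_coherent_integrand[OF h _ measurable_weights(1) weight_bounds(1)[OF h]]) (use h in auto)
  have ij: "integrable lborel (\<lambda>x. ?c x * (lin_weight j q x * rep_L2 u x))" for j
    by (rule weighted_coherent_integrand[OF h _ measurable_weights(2) weight_bounds(2)[OF h]]) (use h in auto)
  have i1: "integrable lborel (\<lambda>x. ?c x * (1 * rep_L2 u x))"
    by (rule weighted_coherent_integrand[OF h, of 1 "\<lambda>_ _. 1"]) (use h in auto)
  have pw: "of_real (h\<^sup>2) * (?c x * (Complex ((norm (x - q))\<^sup>2 / h\<^sup>2 - 3 / h - (norm p)\<^sup>2 / h\<^sup>2) (2 / h\<^sup>2 * ((x - q) \<bullet> p)) * rep_L2 u x))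
    = ?c x * (quad_weight h q x * rep_L2 u x) - of_real ((norm p)\<^sup>2) * (?c x * (1 * rep_L2 u x))
      + 2 * \<i> * (\<Sum>j\<in>UNIV. of_real (p $ j) * (?c x * (lin_weight j q x * rep_L2 u x)))" for x
  proof -
    have "(x - q) \<bullet> p = (\<Sum>j\<in>UNIV. p $ j * (x - q) $ j)" by (simp add: inner_vec_def mult.commute)
    then have s: "(\<Sum>j\<in>UNIV. of_real (p $ j) * (?c x * (lin_weight j q x * rep_L2 u x))) = of_real ((x - q) \<bullet> p) * (?c x * rep_L2 u x)"
      by (simp add: lin_weight_def sum_distrib_left sum_distrib_right of_real_sum mult_ac)
    have ac: "A * B = D \<Longrightarrow> A * (c * (B * r)) = D * (c * r)" for A B D c r :: complex
    proof -
      assume "A * B = D"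
      moreover have "A * (c * (B * r)) = (A * B) * (c * r)" by (simp add: mult_ac)
      ultimately show ?thesis by simp
    qed
    have "of_real (h\<^sup>2) * Complex ((norm (x - q))\<^sup>2 / h\<^sup>2 - 3 / h - (norm p)\<^sup>2 / h\<^sup>2) (2 / h\<^sup>2 * ((x - q) \<bullet> p))
      = quad_weight h q x - of_real ((norm p)\<^sup>2) + 2 * \<i> * of_real ((x - q) \<bullet> p)"
      using h by (simp add: complex_eq_iff quad_weight_def right_diff_distrib power2_eq_square)
    then have "of_real (h\<^sup>2) * (?c x * (Complex ((norm (x - q))\<^sup>2 / h\<^sup>2 - 3 / h - (norm p)\<^sup>2 / h\<^sup>2) (2 / h\<^sup>2 * ((x - q) \<bullet> p)) * rep_L2 u x))
      = (quad_weight h q x - of_real ((norm p)\<^sup>2) + 2 * \<i> * of_real ((x - q) \<bullet> p)) * (?c x * rep_L2 u x)"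
      by (rule ac)
    then show ?thesis unfolding s by (simp add: algebra_simps)
  qed
  have "of_real (h\<^sup>2) * coherent_transform h l (q, p) = (\<integral>x. of_real (h\<^sup>2) * (?c x *
     (Complex ((norm (x - q))\<^sup>2 / h\<^sup>2 - 3 / h - (norm p)\<^sup>2 / h\<^sup>2) (2 / h\<^sup>2 * ((x - q) \<bullet> p)) * rep_L2 u x)) \<partial>lborel)"
    unfolding weak_laplacian_coherent[OF h u] by (rule integral_mult_right_zero[symmetric])
  also have "\<dots> = (\<integral>x. ?c x * (quad_weight h q x * rep_L2 u x) \<partial>lborel) - of_real ((norm p)\<^sup>2) * (\<integral>x. ?c x * (1 * rep_L2 u x) \<partial>lborel)
     + 2 * \<i> * (\<Sum>j\<in>UNIV. of_real (p $ j) * (\<integral>x. ?c x * (lin_weight j q x * rep_L2 u x) \<partial>lborel))"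
    unfolding pw
    by (simp only: Bochner_Integration.integral_add Bochner_Integration.integral_diff Bochner_Integration.integral_sum
        integral_mult_right_zero integrable_mult_right Bochner_Integration.integrable_add
        Bochner_Integration.integrable_diff Bochner_Integration.integrable_sum i0 ij i1)
  finally show ?thesis
    unfolding z coherent_transform_weighted[OF h] by (simp add: weighted_coherent_def)
qed

lemma coherent_inner:
  assumes h: "0 < h"
  shows "integrable lborel (\<lambda>z. inner (coherent_transform h u z) (coherent_transform h v z))"
    and "(\<integral>z. inner (coherent_transform h u z) (coherent_transform h v z) \<partial>lborel) = (2 * pi * h) ^ 3 * inner u v"
proof -
  have pol: "inner a b = ((norm (a + b))\<^sup>2 - (norm (a - b))\<^sup>2) / 4" for a b :: "'b::real_inner"
    by (simp add: power2_norm_eq_inner inner_add inner_diff inner_commute)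
  have eq: "inner (coherent_transform h u z) (coherent_transform h v z)
    = ((norm (coherent_transform h (u + v) z))\<^sup>2 - (norm (coherent_transform h (u - v) z))\<^sup>2) / 4" for z
    unfolding coherent_transform_add[OF h] coherent_transform_diff[OF h] by (rule pol)
  note i = integrable_coherent_transform_sq[OF h]
  show "integrable lborel (\<lambda>z. inner (coherent_transform h u z) (coherent_transform h v z))"
    unfolding eq by (intro integrable_divide_zero Bochner_Integration.integrable_diff i)
  show "(\<integral>z. inner (coherent_transform h u z) (coherent_transform h v z) \<partial>lborel) = (2 * pi * h) ^ 3 * inner u v"
    unfolding eq pol[of u v]
    by (simp add: Bochner_Integration.integral_diff[OF i i] coherent_transform_isometry[OF h] right_diff_distrib)
qed

text \<open>The error terms have relative size \<open>1 / h\<close>, so the form bound follows by letting \<open>h\<close>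
  tend to infinity: here \<open>h\<close> is only the width of the coherent states.\<close>
lemma weak_laplacian_nonpos:
  assumes u: "has_weak_laplacian u l"
  shows "inner u l \<le> 0"
proof -
  define C where "C = enn2real window_moment"
  have C0: "0 \<le> C" by (simp add: C_def)
  \<comment> \<open>Coefficients of \<open>h\<close> in the total error: three linear weights give
    \<open>3 * C\<close>, and splitting the quadratic term, of size \<open>3 * h\<close>, by the
    inequality of means gives \<open>1 / 2\<close> and \<open>9 * C / 2\<close>.\<close>
  define K where "K = (3 * C + 1 / 2 + 9 * C / 2) * (norm u)\<^sup>2"
  have main: "inner u l \<le> K / h" if h: "0 < h" for h
  proof -
    let ?a = "coherent_transform h u" and ?d = "coherent_transform h l"
    let ?c = "weighted_coherent h (quad_weight h) u" and ?b = "\<lambda>j. weighted_coherent h (lin_weight j) u"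
    let ?N = "(2 * pi * h) ^ 3"
    have N: "0 < ?N" using h by simp
    note ic = integrable_weighted_coherent_sq[OF h _ measurable_weights(1) weight_bounds(1)[OF h], of u]
      and Ic = integral_weighted_coherent_sq[OF h _ measurable_weights(1) weight_bounds(1)[OF h], of u]
    note ib = integrable_weighted_coherent_sq[OF h _ measurable_weights(2) weight_bounds(2)[OF h], of _ u]
      and Ib = integral_weighted_coherent_sq[OF h _ measurable_weights(2) weight_bounds(2)[OF h], of _ u]
    note ia = integrable_coherent_transform_sq[OF h, of u]
    have pw: "h\<^sup>2 * inner (?a z) (?d z) \<le> (\<Sum>j\<in>UNIV. (norm (?b j z))\<^sup>2) + (h / 2 * (norm (?a z))\<^sup>2 + 1 / (2 * h) * (norm (?c z))\<^sup>2)" for z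
    proof -
      let ?p = "snd z"
      have e: "complex_of_real (h\<^sup>2) * ?d z = ?c z - of_real ((norm ?p)\<^sup>2) * ?a z + 2 * \<i> * (\<Sum>j\<in>UNIV. of_real (?p $ j) * ?b j z)"
        by (rule coherent_laplacian[OF h u])
      have re: "inner x (of_real r * y) = r * inner x y" for x y :: complex and r
        by (simp add: inner_complex_def algebra_simps)
      have "h\<^sup>2 * inner (?a z) (?d z) = inner (?a z) (of_real (h\<^sup>2) * ?d z)" by (simp only: re)
      also have "\<dots> = inner (?a z) (?c z) - (norm ?p)\<^sup>2 * (norm (?a z))\<^sup>2
         + inner (?a z) (2 * \<i> * (\<Sum>j\<in>UNIV. of_real (?p $ j) * ?b j z))"
        unfolding e inner_add_right inner_diff_right re by (simp add: power2_norm_eq_inner)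
      also have "inner (?a z) (?c z) \<le> h / 2 * (norm (?a z))\<^sup>2 + 1 / (2 * h) * (norm (?c z))\<^sup>2"
      proof -
        have "0 \<le> (h * norm (?a z) - norm (?c z))\<^sup>2" by simp
        then have "2 * h * (norm (?a z) * norm (?c z)) \<le> h\<^sup>2 * (norm (?a z))\<^sup>2 + (norm (?c z))\<^sup>2"
          by (simp add: power2_diff power_mult_distrib mult_ac)
        then have "norm (?a z) * norm (?c z) \<le> (h\<^sup>2 * (norm (?a z))\<^sup>2 + (norm (?c z))\<^sup>2) / (2 * h)"
          using h by (simp add: pos_le_divide_eq mult_ac)
        also have "\<dots> = h / 2 * (norm (?a z))\<^sup>2 + 1 / (2 * h) * (norm (?c z))\<^sup>2"
          using h by (simp add: add_divide_distrib power2_eq_square)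
        finally show ?thesis using norm_cauchy_schwarz[of "?a z" "?c z"] by linarith
      qed
      \<comment> \<open>The cross term growing with |p| is absorbed exactly by the negative main
        term -|p|^2 |a|^2; only the squares of the linear-weight transforms remain.\<close>
      also have "inner (?a z) (2 * \<i> * (\<Sum>j\<in>UNIV. of_real (?p $ j) * ?b j z))
        \<le> (norm ?p)\<^sup>2 * (norm (?a z))\<^sup>2 + (\<Sum>j\<in>UNIV. (norm (?b j z))\<^sup>2)"
      proof -
        have "inner (?a z) (2 * \<i> * (\<Sum>j\<in>UNIV. of_real (?p $ j) * ?b j z))
          \<le> norm (?a z) * norm (2 * \<i> * (\<Sum>j\<in>UNIV. of_real (?p $ j) * ?b j z))" by (rule norm_cauchy_schwarz)
        also have "\<dots> = 2 * (norm (?a z) * norm (\<Sum>j\<in>UNIV. of_real (?p $ j) * ?b j z))" by (simp add: norm_mult)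
        also have "\<dots> \<le> 2 * (norm (?a z) * (\<Sum>j\<in>UNIV. norm (of_real (?p $ j) * ?b j z)))"
          by (intro mult_left_mono norm_sum) auto
        also have "\<dots> = (\<Sum>j\<in>UNIV. 2 * ((\<bar>?p $ j\<bar> * norm (?a z)) * norm (?b j z)))"
          by (simp add: sum_distrib_left norm_mult mult_ac)
        also have "\<dots> \<le> (\<Sum>j\<in>UNIV. (\<bar>?p $ j\<bar> * norm (?a z))\<^sup>2 + (norm (?b j z))\<^sup>2)"
        proof (rule sum_mono)
          fix j
          show "2 * ((\<bar>?p $ j\<bar> * norm (?a z)) * norm (?b j z)) \<le> (\<bar>?p $ j\<bar> * norm (?a z))\<^sup>2 + (norm (?b j z))\<^sup>2"
            using zero_le_power2[of "\<bar>?p $ j\<bar> * norm (?a z) - norm (?b j z)"] by (simp add: power2_diff)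
        qed
        also have "\<dots> = (norm ?p)\<^sup>2 * (norm (?a z))\<^sup>2 + (\<Sum>j\<in>UNIV. (norm (?b j z))\<^sup>2)"
        proof -
          have "(norm ?p)\<^sup>2 = (\<Sum>j\<in>UNIV. (?p $ j)\<^sup>2)"
            unfolding power2_norm_eq_inner by (simp add: inner_vec_def power2_eq_square)
          then show ?thesis by (simp add: sum.distrib power_mult_distrib sum_distrib_right)
        qed
        finally show ?thesis .
      qed
      finally show ?thesis by linarith
    qed
    have ir: "integrable lborel (\<lambda>z. (\<Sum>j\<in>UNIV. (norm (?b j z))\<^sup>2) + (h / 2 * (norm (?a z))\<^sup>2 + 1 / (2 * h) * (norm (?c z))\<^sup>2))"
      by (intro Bochner_Integration.integrable_add Bochner_Integration.integrable_sum integrable_mult_right ib ia ic) (use h in auto)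
    have "h\<^sup>2 * (?N * inner u l) = (\<integral>z. h\<^sup>2 * inner (?a z) (?d z) \<partial>lborel)"
      by (simp add: coherent_inner[OF h])
    also have "\<dots> \<le> (\<integral>z. (\<Sum>j\<in>UNIV. (norm (?b j z))\<^sup>2) + (h / 2 * (norm (?a z))\<^sup>2 + 1 / (2 * h) * (norm (?c z))\<^sup>2) \<partial>lborel)"
      by (intro integral_mono integrable_mult_right coherent_inner[OF h] ir pw)
    also have "\<dots> = (\<Sum>j\<in>UNIV. \<integral>z. (norm (?b j z))\<^sup>2 \<partial>lborel) + (h / 2 * (\<integral>z. (norm (?a z))\<^sup>2 \<partial>lborel) + 1 / (2 * h) * (\<integral>z. (norm (?c z))\<^sup>2 \<partial>lborel))"
      using h by (simp add: ib ia ic)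
    also have "\<dots> \<le> (\<Sum>j\<in>(UNIV::3 set). ?N * (h * C * (norm u)\<^sup>2)) + (h / 2 * (?N * (norm u)\<^sup>2) + 1 / (2 * h) * (?N * ((3 * h)\<^sup>2 * C * (norm u)\<^sup>2)))"
    proof (intro add_mono sum_mono mult_left_mono)
      show "(\<integral>z. (norm (?b j z))\<^sup>2 \<partial>lborel) \<le> ?N * (h * C * (norm u)\<^sup>2)" for j
        using Ib[of j] h by (simp add: C_def)
      show "(\<integral>z. (norm (?a z))\<^sup>2 \<partial>lborel) \<le> ?N * (norm u)\<^sup>2" by (simp add: coherent_transform_isometry[OF h])
      show "(\<integral>z. (norm (?c z))\<^sup>2 \<partial>lborel) \<le> ?N * ((3 * h)\<^sup>2 * C * (norm u)\<^sup>2)" using Ic h by (simp add: C_def)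
    qed (use h in auto)
    also have "\<dots> = ?N * (h * K)"
    proof -
      have "3 * (N * (h * C * U)) + (h / 2 * (N * U) + 1 / (2 * h) * (N * ((3 * h)\<^sup>2 * C * U))) = N * (h * ((3 * C + 1 / 2 + 9 * C / 2) * U))" for N U
        using h by (simp add: field_simps power2_eq_square)
      then show ?thesis unfolding K_def by simp
    qed
    finally have "?N * (h * (h * inner u l)) \<le> ?N * (h * K)" by (simp add: power2_eq_square mult_ac)
    then have "h * inner u l \<le> K" using N h by simp
    then show ?thesis using h by (simp add: pos_le_divide_eq mult.commute)
  qed
  have "(\<lambda>n. K / real (Suc n)) \<longlonglongrightarrow> 0" using LIMSEQ_Suc[OF lim_const_over_n] by blast
  then show ?thesis using main by (intro LIMSEQ_le_const) (auto simp del: of_nat_Suc)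
qed

text \<open>Every weighted transform of \<open>0\<close> vanishes, hence so does the coherent
  transform of \<open>l\<close>, and the isometry gives \<open>l = 0\<close>. This makes the
  Schroedinger operator single-valued.\<close>

lemma weak_laplacian_unique_zero:
  assumes "has_weak_laplacian 0 l" shows "l = 0"
proof -
  have "weighted_coherent 1 m 0 z = 0" if "(\<lambda>(q, x). m q x) \<in> borel_measurable (lborel \<Otimes>\<^sub>M lborel)" for m z
    unfolding weighted_coherent_def
    by (rule integral_eq_zero_AE) (use rep_zero in \<open>auto elim: eventually_mono\<close>)
  then have "coherent_transform 1 l z = 0" for z
    using coherent_laplacian[of 1 0 l z] assms by (simp add: coherent_transform_weighted measurable_weights)
  then have "(norm l)\<^sup>2 = 0" using coherent_transform_isometry[of 1 l] by simp
  then show ?thesis by simp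
qed

subsection \<open>Self-adjointness\<close>

definition mult_op :: "(real^3 \<Rightarrow> real) \<Rightarrow> L2 \<Rightarrow> L2" where
  "mult_op V u = abs_L2 (\<lambda>x. of_real (V x) * rep_L2 u x)"

context
  fixes V :: "real^3 \<Rightarrow> real" and K :: real
  assumes Vm [measurable]: "V \<in> borel_measurable borel" and VK: "\<And>x. \<bar>V x\<bar> \<le> K"
begin

lemma potential_bound_nonneg: "0 \<le> K" using VK[of 0] by linarith

lemma square_integrable_mult_bounded: "square_integrable (\<lambda>x. of_real (V x) * rep_L2 u x)"
proof (rule square_integrableI)
  have "(\<integral>\<^sup>+x. ennreal ((norm (of_real (V x) * rep_L2 u x))\<^sup>2) \<partial>lborel) \<le> (\<integral>\<^sup>+x. ennreal (K\<^sup>2) * ennreal ((norm (rep_L2 u x))\<^sup>2) \<partial>lborel)"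
  proof (intro nn_integral_mono)
    fix x
    have "(norm (of_real (V x) * rep_L2 u x))\<^sup>2 \<le> K\<^sup>2 * (norm (rep_L2 u x))\<^sup>2"
      using power_mono[OF VK[of x], of 2] by (simp add: norm_mult power_mult_distrib mult_right_mono)
    then show "ennreal ((norm (of_real (V x) * rep_L2 u x))\<^sup>2) \<le> ennreal (K\<^sup>2) * ennreal ((norm (rep_L2 u x))\<^sup>2)"
      by (simp add: ennreal_mult[symmetric] ennreal_leI)
  qed
  also have "\<dots> = ennreal (K\<^sup>2) * ennreal ((norm u)\<^sup>2)" by (simp add: nn_integral_cmult nn_integral_rep_L2)
  also have "\<dots> < \<infinity>" by (simp add: ennreal_mult_less_top)
  finally show "(\<integral>\<^sup>+x. ennreal ((norm (of_real (V x) * rep_L2 u x))\<^sup>2) \<partial>lborel) < \<infinity>" .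
qed measurable

lemma rep_mult_op: "AE x in lborel. rep_L2 (mult_op V u) x = of_real (V x) * rep_L2 u x"
  unfolding mult_op_def by (rule rep_abs_L2[OF square_integrable_mult_bounded])

lemma cinner_mult_op: "cinner (mult_op V u) w = cinner u (mult_op V w)"
  unfolding mult_op_def cinner_abs_left[OF square_integrable_mult_bounded] cinner_abs_right[OF square_integrable_mult_bounded]
  by (simp add: mult_ac)

lemma mult_op_add: "mult_op V (u + w) = mult_op V u + mult_op V w"
  by (rule cinner_eqI) (simp add: cinner_mult_op[symmetric] cinner_add_right)

lemma mult_op_scaleC: "mult_op V (scaleC c u) = scaleC c (mult_op V u)"
  by (rule cinner_eqI) (simp add: cinner_mult_op[symmetric] cinner_scaleC_right)

lemma mult_op_scaleR: "mult_op V (r *\<^sub>R u) = r *\<^sub>R mult_op V u"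
  by (rule cinner_eqI) (simp add: cinner_mult_op[symmetric] cinner_scaleR_right)

lemma norm_mult_op: "norm (mult_op V u) \<le> K * norm u"
proof -
  have "(norm (mult_op V u))\<^sup>2 = (\<integral>x. (norm (of_real (V x) * rep_L2 u x))\<^sup>2 \<partial>lborel)"
    unfolding norm_L2_sq by (rule integral_cong_AE) (use rep_mult_op[of u] in \<open>auto elim!: eventually_mono\<close>)
  also have "\<dots> \<le> (\<integral>x. K\<^sup>2 * (norm (rep_L2 u x))\<^sup>2 \<partial>lborel)"
  proof (rule integral_mono)
    show "integrable lborel (\<lambda>x. (norm (of_real (V x) * rep_L2 u x))\<^sup>2)"
      using square_integrable_mult_bounded[of u] by (simp add: square_integrable_def)
    show "integrable lborel (\<lambda>x. K\<^sup>2 * (norm (rep_L2 u x))\<^sup>2)" by (intro integrable_mult_right integrable_rep_L2_sq)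
    show "(norm (of_real (V x) * rep_L2 u x))\<^sup>2 \<le> K\<^sup>2 * (norm (rep_L2 u x))\<^sup>2" for x
      using power_mono[OF VK[of x], of 2] by (simp add: norm_mult power_mult_distrib mult_right_mono)
  qed
  also have "\<dots> = (K * norm u)\<^sup>2" by (simp add: norm_L2_sq[symmetric] power_mult_distrib)
  finally show ?thesis by (rule power2_le_imp_le) (simp add: potential_bound_nonneg)
qed

lemma bounded_linear_mult_op: "bounded_linear (mult_op V)"
  by (rule bounded_linear_intro[where K = K]) (use norm_mult_op in \<open>auto simp: mult_op_add mult_op_scaleR mult.commute\<close>)

lemma schroedinger_iff:
  "(u, v) \<in> schroedinger h V \<longleftrightarrow> (\<exists>l. has_weak_laplacian u l \<and> v = - (h\<^sup>2 / 2) *\<^sub>R l + mult_op V u)"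
proof -
  have "(AE x in lborel. rep_L2 v x = - of_real (h\<^sup>2 / 2) * rep_L2 l x + of_real (V x) * rep_L2 u x)
    \<longleftrightarrow> v = - (h\<^sup>2 / 2) *\<^sub>R l + mult_op V u" for l
  proof -
    have *: "AE x in lborel. rep_L2 (- (h\<^sup>2 / 2) *\<^sub>R l + mult_op V u) x = - of_real (h\<^sup>2 / 2) * rep_L2 l x + of_real (V x) * rep_L2 u x"
      using rep_plus[of "- (h\<^sup>2 / 2) *\<^sub>R l" "mult_op V u"] rep_scaleR[of "- (h\<^sup>2 / 2)" l] rep_mult_op[of u]
      by eventually_elim simp
    show ?thesis
    proof
      assume a: "AE x in lborel. rep_L2 v x = - of_real (h\<^sup>2 / 2) * rep_L2 l x + of_real (V x) * rep_L2 u x"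
      show "v = - (h\<^sup>2 / 2) *\<^sub>R l + mult_op V u"
        by (rule L2_eqI) (use a * in eventually_elim, simp)
    qed (use * in simp)
  qed
  then show ?thesis by (auto simp: schroedinger_def)
qed

end

lemma tendsto_cinner_right: "f \<longlonglongrightarrow> l \<Longrightarrow> (\<lambda>n. cinner u (f n)) \<longlonglongrightarrow> cinner u l"
  unfolding cinner_eq_inner by (intro tendsto_Complex tendsto_intros)

lemma has_weak_laplacian_closed:
  assumes "\<And>n. has_weak_laplacian (u n) (l n)" "u \<longlonglongrightarrow> u'" "l \<longlonglongrightarrow> l'"
  shows "has_weak_laplacian u' l'"
  unfolding has_weak_laplacian_cinner
proof (intro allI impI)
  fix f assume "test_function f"
  then have "cinner (real_L2 (laplacian f)) (u n) = cinner (real_L2 f) (l n)" for n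
    using assms(1) by (auto simp: has_weak_laplacian_cinner)
  then show "cinner (real_L2 (laplacian f)) u' = cinner (real_L2 f) l'"
    using LIMSEQ_unique[OF tendsto_cinner_right[OF assms(2)]] tendsto_cinner_right[OF assms(3)] by simp
qed

text \<open>The margin \<open>1\<close> in \<open>K + 1 \<le> lambda\<close> makes lambda + H
  bounded below by one, so that its inverse is a contraction.\<close>

locale schroedinger_resolvent =
  fixes V :: "real^3 \<Rightarrow> real" and K h lambda :: real
  assumes Vm: "V \<in> borel_measurable borel" and VK: "\<And>x. \<bar>V x\<bar> \<le> K" and h: "0 < h" and lambda: "K + 1 \<le> lambda"
begin

abbreviation "H \<equiv> schroedinger h V"

lemmas H_iff = schroedinger_iff[OF Vm VK]

lemma K_nonneg: "0 \<le> K" using VK[of 0] by linarith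

lemma H_add: "(u, v) \<in> H \<Longrightarrow> (u', v') \<in> H \<Longrightarrow> (u + u', v + v') \<in> H"
  unfolding H_iff
proof (elim exE conjE)
  fix l l' assume "has_weak_laplacian u l" "has_weak_laplacian u' l'"
    and v: "v = - (h\<^sup>2 / 2) *\<^sub>R l + mult_op V u" "v' = - (h\<^sup>2 / 2) *\<^sub>R l' + mult_op V u'"
  then show "\<exists>l. has_weak_laplacian (u + u') l \<and> v + v' = - (h\<^sup>2 / 2) *\<^sub>R l + mult_op V (u + u')"
    by (intro exI[of _ "l + l'"]) (simp add: has_weak_laplacian_add mult_op_add[OF Vm VK] scaleR_add_right)
qed

lemma H_scaleC: "(u, v) \<in> H \<Longrightarrow> (scaleC c u, scaleC c v) \<in> H"
  unfolding H_iff
proof (elim exE conjE)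
  fix l assume "has_weak_laplacian u l" and "v = - (h\<^sup>2 / 2) *\<^sub>R l + mult_op V u"
  then show "\<exists>l. has_weak_laplacian (scaleC c u) l \<and> scaleC c v = - (h\<^sup>2 / 2) *\<^sub>R l + mult_op V (scaleC c u)"
    by (intro exI[of _ "scaleC c l"]) (simp add: has_weak_laplacian_scaleC mult_op_scaleC[OF Vm VK] scaleC_add scaleC_diff scaleC_scaleR)
qed

lemma H_scaleR: "(u, v) \<in> H \<Longrightarrow> (r *\<^sub>R u, r *\<^sub>R v) \<in> H"
  using H_scaleC[of u v "of_real r"] by (simp add: scaleC_of_real)

lemma H_diff: "(u, v) \<in> H \<Longrightarrow> (u', v') \<in> H \<Longrightarrow> (u - u', v - v') \<in> H"
  using H_add[of u v "- u'" "- v'"] H_scaleR[of u' v' "-1"] by simp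

lemma H_zero: "(0, v) \<in> H \<Longrightarrow> v = 0"
  unfolding H_iff using weak_laplacian_unique_zero mult_op_scaleR[OF Vm VK, of 0 0] by auto

lemma H_form: "(u, v) \<in> H \<Longrightarrow> - K * (norm u)\<^sup>2 \<le> inner u v"
proof -
  assume "(u, v) \<in> H"
  then obtain l where l: "has_weak_laplacian u l" "v = - (h\<^sup>2 / 2) *\<^sub>R l + mult_op V u" by (auto simp: H_iff)
  have "\<bar>inner u (mult_op V u)\<bar> \<le> norm u * (K * norm u)"
    using Cauchy_Schwarz_ineq2[of u "mult_op V u"] mult_left_mono[OF norm_mult_op[OF Vm VK, of u], of "norm u"] by simp
  moreover have "(h\<^sup>2 / 2) * inner u l \<le> 0" using weak_laplacian_nonpos[OF l(1)] by (simp add: mult_nonneg_nonpos)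
  moreover have "inner u v = - (h\<^sup>2 / 2) * inner u l + inner u (mult_op V u)"
    unfolding l(2) by (simp only: inner_add_right inner_scaleR_right)
  moreover have "norm u * (K * norm u) = K * (norm u)\<^sup>2" by (simp add: power2_eq_square)
  ultimately show ?thesis by linarith
qed

lemma H_lower: "(u, v) \<in> H \<Longrightarrow> (norm u)\<^sup>2 \<le> inner u (lambda *\<^sub>R u + v)"
proof -
  assume a: "(u, v) \<in> H"
  have "1 * (norm u)\<^sup>2 \<le> (lambda - K) * (norm u)\<^sup>2" using lambda by (intro mult_right_mono) auto
  then show ?thesis using H_form[OF a] by (simp add: inner_add_right power2_norm_eq_inner[symmetric] left_diff_distrib)
qed

lemma H_contract: "(u, v) \<in> H \<Longrightarrow> norm u \<le> norm (lambda *\<^sub>R u + v)"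
proof (cases "u = 0")
  case False
  assume "(u, v) \<in> H"
  then have "norm u * norm u \<le> norm u * norm (lambda *\<^sub>R u + v)"
    using H_lower[of u v] norm_cauchy_schwarz[of u "lambda *\<^sub>R u + v"] by (simp add: power2_eq_square)
  then show ?thesis using False by simp
qed simp

lemma H_closed:
  assumes "\<And>n. (u n, v n) \<in> H" "u \<longlonglongrightarrow> u'" "v \<longlonglongrightarrow> v'"
  shows "(u', v') \<in> H"
proof -
  obtain l where l: "\<And>n. has_weak_laplacian (u n) (l n)" "\<And>n. v n = - (h\<^sup>2 / 2) *\<^sub>R l n + mult_op V (u n)"
    using assms(1) unfolding H_iff by metis
  have ln: "l n = (2 / h\<^sup>2) *\<^sub>R (mult_op V (u n) - v n)" for n
    unfolding l(2) using h by simp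
  have mu: "(\<lambda>n. mult_op V (u n)) \<longlonglongrightarrow> mult_op V u'"
    by (rule bounded_linear.tendsto[OF bounded_linear_mult_op[OF Vm VK] assms(2)])
  have "l \<longlonglongrightarrow> (2 / h\<^sup>2) *\<^sub>R (mult_op V u' - v')" unfolding ln[abs_def] by (intro tendsto_intros mu assms)
  then have "has_weak_laplacian u' ((2 / h\<^sup>2) *\<^sub>R (mult_op V u' - v'))" by (rule has_weak_laplacian_closed[OF l(1) assms(2)])
  then show ?thesis unfolding H_iff using h by (intro exI[of _ "(2 / h\<^sup>2) *\<^sub>R (mult_op V u' - v')"]) simp
qed

text \<open>A posteriori \<open>Hs\<close> is all of \<open>H\<close>.\<close>
definition "Hs = {(u, v). (u, v) \<in> H \<and> (\<forall>w v'. (w, v') \<in> H \<longrightarrow> inner w v = inner v' u)}"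

lemma Hs_H: "(u, v) \<in> Hs \<Longrightarrow> (u, v) \<in> H" by (simp add: Hs_def)

lemma Hs_scaleC: assumes "(u, v) \<in> Hs" shows "(scaleC \<i> u, scaleC \<i> v) \<in> Hs"
proof -
  have "inner w (scaleC \<i> v) = inner v' (scaleC \<i> u)" if "(w, v') \<in> H" for w v'
  proof -
    have "inner (scaleC \<i> w) v = inner (scaleC \<i> v') u" using assms H_scaleC[OF that] by (auto simp: Hs_def)
    then show ?thesis by (simp add: inner_scaleC_i_left)
  qed
  then show ?thesis using assms H_scaleC by (auto simp: Hs_def)
qed

lemma Hs_test:
  assumes f: "test_function f"
  shows "(real_L2 f, - (h\<^sup>2 / 2) *\<^sub>R real_L2 (laplacian f) + mult_op V (real_L2 f)) \<in> Hs"
  unfolding Hs_def mem_Collect_eq prod.case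
proof (intro conjI allI impI)
  show "(real_L2 f, - (h\<^sup>2 / 2) *\<^sub>R real_L2 (laplacian f) + mult_op V (real_L2 f)) \<in> H"
    unfolding H_iff using has_weak_laplacian_test[OF f] by blast
  fix w v' assume "(w, v') \<in> H"
  then obtain l where l: "has_weak_laplacian w l" "v' = - (h\<^sup>2 / 2) *\<^sub>R l + mult_op V w" by (auto simp: H_iff)
  have "cinner (real_L2 (laplacian f)) w = cinner (real_L2 f) l" using l(1) f by (simp add: has_weak_laplacian_cinner)
  then have "inner (real_L2 (laplacian f)) w = inner (real_L2 f) l" by (simp add: inner_L2_def)
  moreover have "inner (mult_op V (real_L2 f)) w = inner (real_L2 f) (mult_op V w)"
    by (simp add: inner_L2_def cinner_mult_op[OF Vm VK])
  ultimately show "inner w (- (h\<^sup>2 / 2) *\<^sub>R real_L2 (laplacian f) + mult_op V (real_L2 f)) = inner v' (real_L2 f)"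
    by (simp add: l(2) inner_add inner_diff inner_commute)
qed

definition "X = {lambda *\<^sub>R u + v | u v. (u, v) \<in> Hs}"

lemma X_subspace: "subspace X"
proof (rule subspaceI)
  have "test_function (\<lambda>x. 0)" by (rule test_functionI[OF smooth_expr.const[of 0] compact_empty]) simp
  then obtain u v where "(u, v) \<in> H" using Hs_H[OF Hs_test] by blast
  then have "(0, 0) \<in> H" using H_scaleR[of u v 0] by simp
  then have "(0, 0) \<in> Hs" by (simp add: Hs_def)
  then show "0 \<in> X" unfolding X_def by force
  fix x y assume "x \<in> X" "y \<in> X"
  then obtain u v u' v' where x: "x = lambda *\<^sub>R u + v" "(u, v) \<in> Hs" and y: "y = lambda *\<^sub>R u' + v'" "(u', v') \<in> Hs"
    by (auto simp: X_def)
  have "(u + u', v + v') \<in> Hs" using x(2) y(2) H_add by (auto simp: Hs_def inner_add)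
  moreover have "x + y = lambda *\<^sub>R (u + u') + (v + v')" by (simp add: x(1) y(1) scaleR_add_right)
  ultimately show "x + y \<in> X" unfolding X_def by blast
next
  fix r x assume "x \<in> X"
  then obtain u v where x: "x = lambda *\<^sub>R u + v" "(u, v) \<in> Hs" by (auto simp: X_def)
  have "(r *\<^sub>R u, r *\<^sub>R v) \<in> Hs" using x(2) H_scaleR by (auto simp: Hs_def)
  moreover have "r *\<^sub>R x = lambda *\<^sub>R (r *\<^sub>R u) + r *\<^sub>R v" by (simp add: x(1) scaleR_add_right)
  ultimately show "r *\<^sub>R x \<in> X" unfolding X_def by blast
qed

text \<open>A vector \<open>w\<close> orthogonal to lambda + H on test functions solves the equation
  weakly: its weak Laplacian exists and is the square integrable \<open>l\<close>. Nonpositivity of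
  the Laplacian then gives (lambda - K) |w|^2 \<le> 0. Stability of \<open>Hs\<close> under the
  imaginary unit upgrades real to complex orthogonality.\<close>

lemma X_dense: "closure X = UNIV"
proof (rule dense_if_orthogonal_trivial[OF X_subspace])
  fix w assume w: "\<And>s. s \<in> X \<Longrightarrow> inner w s = 0"
  define l where "l = (2 / h\<^sup>2) *\<^sub>R (lambda *\<^sub>R w + mult_op V w)"
  have "has_weak_laplacian w l"
    unfolding has_weak_laplacian_cinner
  proof (intro allI impI)
    fix f assume f: "test_function f"
    define v where "v = - (h\<^sup>2 / 2) *\<^sub>R real_L2 (laplacian f) + mult_op V (real_L2 f)"
    have 1: "(real_L2 f, v) \<in> Hs" unfolding v_def by (rule Hs_test[OF f])
    have a: "lambda *\<^sub>R real_L2 f + v \<in> X" using 1 unfolding X_def by blast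
    have b: "lambda *\<^sub>R scaleC \<i> (real_L2 f) + scaleC \<i> v \<in> X" using Hs_scaleC[OF 1] unfolding X_def by blast
    have c: "lambda *\<^sub>R scaleC \<i> (real_L2 f) + scaleC \<i> v = scaleC \<i> (lambda *\<^sub>R real_L2 f + v)"
      by (simp add: scaleC_add scaleC_scaleR)
    have "inner (lambda *\<^sub>R real_L2 f + v) w = 0" "inner (scaleC \<i> (lambda *\<^sub>R real_L2 f + v)) w = 0"
      using w[OF a] w[OF b] unfolding c by (simp_all only: inner_commute[of w])
    then have "cinner (lambda *\<^sub>R real_L2 f + v) w = 0" by (simp add: cinner_eq_inner complex_eq_iff)
    then have "of_real (h\<^sup>2 / 2) * cinner (real_L2 (laplacian f)) w = of_real lambda * cinner (real_L2 f) w + cinner (real_L2 f) (mult_op V w)"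
      by (simp add: v_def cinner_add_left cinner_scaleR_left cinner_diff_left cinner_minus_left cinner_mult_op[OF Vm VK] algebra_simps)
    then have "cinner (real_L2 (laplacian f)) w = of_real (2 / h\<^sup>2) * (of_real lambda * cinner (real_L2 f) w + cinner (real_L2 f) (mult_op V w))"
      using h by (simp add: field_simps)
    then show "cinner (real_L2 (laplacian f)) w = cinner (real_L2 f) l"
      by (simp add: l_def cinner_scaleR_right cinner_add_right)
  qed
  then have "inner w l \<le> 0" by (rule weak_laplacian_nonpos)
  then have "inner w (lambda *\<^sub>R w + mult_op V w) \<le> 0" using h by (auto simp: l_def mult_le_0_iff divide_le_0_iff)
  moreover have "\<bar>inner w (mult_op V w)\<bar> \<le> K * (norm w)\<^sup>2"
    using Cauchy_Schwarz_ineq2[of w "mult_op V w"] mult_left_mono[OF norm_mult_op[OF Vm VK, of w], of "norm w"]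
    by (simp add: power2_eq_square mult_ac)
  ultimately have "(lambda - K) * (norm w)\<^sup>2 \<le> 0"
    by (simp add: inner_add_right power2_norm_eq_inner[symmetric] left_diff_distrib)
  moreover have "1 * (norm w)\<^sup>2 \<le> (lambda - K) * (norm w)\<^sup>2" using lambda by (intro mult_right_mono) auto
  ultimately have "(norm w)\<^sup>2 \<le> 0" by linarith
  then show "w = 0" by simp
qed

text \<open>The range is dense; it is closed because the inverse is contractive and the graph is
  closed.\<close>

lemma Hs_surj: "\<exists>u v. (u, v) \<in> Hs \<and> lambda *\<^sub>R u + v = y"
proof -
  obtain s where s: "\<And>n. s n \<in> X" "s \<longlonglongrightarrow> y" using X_dense closure_sequential[of y X] by auto
  then obtain u v where uv: "\<And>n. (u n, v n) \<in> Hs" "\<And>n. s n = lambda *\<^sub>R u n + v n" unfolding X_def by (auto, metis)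
  have d: "norm (u m - u n) \<le> norm (s m - s n)" for m n
    using H_contract[OF H_diff[OF Hs_H[OF uv(1)] Hs_H[OF uv(1)]], of m n] by (simp add: uv(2) algebra_simps)
  have "Cauchy s" using s(2) LIMSEQ_imp_Cauchy by blast
  then have "Cauchy u" unfolding Cauchy_iff using d by (meson le_less_trans)
  then obtain u' where u': "u \<longlonglongrightarrow> u'" using Cauchy_convergent convergent_def by blast
  have "v = (\<lambda>n. s n - lambda *\<^sub>R u n)" by (simp add: uv(2))
  then have v': "v \<longlonglongrightarrow> y - lambda *\<^sub>R u'" by (simp only:) (intro tendsto_intros s u')
  have "(u', y - lambda *\<^sub>R u') \<in> H" by (rule H_closed[OF Hs_H[OF uv(1)] u' v'])
  moreover have "inner w (y - lambda *\<^sub>R u') = inner z u'" if "(w, z) \<in> H" for w z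
  proof (rule LIMSEQ_unique)
    show "(\<lambda>n. inner w (v n)) \<longlonglongrightarrow> inner w (y - lambda *\<^sub>R u')" by (intro tendsto_intros v')
    have "inner w (v n) = inner z (u n)" for n using uv(1)[of n] that by (auto simp: Hs_def)
    then show "(\<lambda>n. inner w (v n)) \<longlonglongrightarrow> inner z u'" by (simp only:) (intro tendsto_intros u')
  qed
  ultimately have "(u', y - lambda *\<^sub>R u') \<in> Hs" by (auto simp: Hs_def)
  then show ?thesis by (intro exI[of _ u'] exI[of _ "y - lambda *\<^sub>R u'"]) simp
qed

lemma H_inj: "(u, v) \<in> H \<Longrightarrow> (u', v') \<in> H \<Longrightarrow> lambda *\<^sub>R u + v = lambda *\<^sub>R u' + v' \<Longrightarrow> u = u' \<and> v = v'"
proof -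
  assume a: "(u, v) \<in> H" "(u', v') \<in> H" "lambda *\<^sub>R u + v = lambda *\<^sub>R u' + v'"
  have "lambda *\<^sub>R (u - u') + (v - v') = 0" using a(3) by (simp add: algebra_simps)
  then have "norm (u - u') \<le> 0" using H_contract[OF H_diff[OF a(1,2)]] by simp
  then show ?thesis using a(3) by simp
qed

text \<open>Surjectivity of lambda + Hs and injectivity of lambda + H force the two graphs to
  coincide, and symmetry is built into \<open>Hs\<close>.\<close>

lemma H_symmetric: "(u, v) \<in> H \<Longrightarrow> (u', v') \<in> H \<Longrightarrow> inner u v' = inner v u'"
proof -
  assume a: "(u, v) \<in> H" "(u', v') \<in> H"
  obtain x y where xy: "(x, y) \<in> Hs" "lambda *\<^sub>R x + y = lambda *\<^sub>R u' + v'" using Hs_surj by blast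
  then have "(u', v') \<in> Hs" using H_inj[OF Hs_H[OF xy(1)] a(2)] by auto
  then show ?thesis using a(1) by (auto simp: Hs_def)
qed

definition R :: "L2 \<Rightarrow> L2" where "R y = (THE u. (u, y - lambda *\<^sub>R u) \<in> H)"

lemma R_H: "(R y, y - lambda *\<^sub>R R y) \<in> H"
proof -
  obtain u v where uv: "(u, v) \<in> Hs" "lambda *\<^sub>R u + v = y" using Hs_surj by blast
  have v: "v = y - lambda *\<^sub>R u" using uv(2) by (simp add: algebra_simps)
  have "(u, y - lambda *\<^sub>R u) \<in> H" using Hs_H[OF uv(1)] unfolding v .
  then show ?thesis unfolding R_def
  proof (rule theI)
    fix x assume "(x, y - lambda *\<^sub>R x) \<in> H"
    then show "x = u" using H_inj[OF _ Hs_H[OF uv(1)], of x "y - lambda *\<^sub>R x"] uv(2) by simp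
  qed
qed

lemma R_eqI: "(u, v) \<in> H \<Longrightarrow> lambda *\<^sub>R u + v = y \<Longrightarrow> R y = u"
proof -
  assume a: "(u, v) \<in> H" "lambda *\<^sub>R u + v = y"
  have "lambda *\<^sub>R R y + (y - lambda *\<^sub>R R y) = lambda *\<^sub>R u + v" using a(2) by simp
  then show "R y = u" using H_inj[OF R_H[of y] a(1)] by blast
qed

lemma norm_R: "norm (R y) \<le> norm y"
  using H_contract[OF R_H[of y]] by simp

lemma resolvent: "resolvent R"
proof (intro resolvent.intro positive_contraction.intro resolvent_axioms.intro)
  show "bounded_linear R"
  proof (rule bounded_linear_intro[where K = 1])
    show "R (x + y) = R x + R y" for x y
      by (rule R_eqI[OF H_add[OF R_H[of x] R_H[of y]]]) (simp add: algebra_simps)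
    show "R (r *\<^sub>R x) = r *\<^sub>R R x" for r x
      by (rule R_eqI[OF H_scaleR[OF R_H[of x]]]) (simp add: algebra_simps)
  qed (simp add: norm_R)
  show "norm (R u) \<le> norm u" for u by (rule norm_R)
  show "inner (R u) v = inner u (R v)" for u v
    using H_symmetric[OF R_H[of u] R_H[of v]] by (simp add: inner_diff)
  show "0 \<le> inner (R u) u" for u
    using H_lower[OF R_H[of u]] by (auto intro: order_trans[OF zero_le_power2])
  show "R (scaleC \<i> u) = scaleC \<i> (R u)" for u
    by (rule R_eqI[OF H_scaleC[OF R_H[of u]]]) (simp add: scaleC_diff scaleC_scaleR)
  show "u = 0" if "R u = 0" for u
    using R_H[of u] that H_zero[of u] by simp
qed

text \<open>For B = -m - H and \<open>c = lambda - m\<close> one has c - B = lambda + H, so the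
  resolvent of \<open>H\<close> at \<open>lambda\<close> is that of B at \<open>c\<close>.\<close>

lemma shifted_graph:
  "{(u, - m *\<^sub>R u - v) | u v. (u, v) \<in> H} = {(R y, (lambda - m) *\<^sub>R R y - y) | y. True}"
proof (intro set_eqI iffI)
  fix p assume "p \<in> {(u, - m *\<^sub>R u - v) | u v. (u, v) \<in> H}"
  then obtain u v where uv: "(u, v) \<in> H" "p = (u, - m *\<^sub>R u - v)" by blast
  have "R (lambda *\<^sub>R u + v) = u" by (rule R_eqI[OF uv(1) refl])
  then show "p \<in> {(R y, (lambda - m) *\<^sub>R R y - y) | y. True}"
    using uv(2) by (intro CollectI exI[of _ "lambda *\<^sub>R u + v"]) (simp add: algebra_simps)
next
  fix p assume "p \<in> {(R y, (lambda - m) *\<^sub>R R y - y) | y. True}"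
  then obtain y where p: "p = (R y, (lambda - m) *\<^sub>R R y - y)" by blast
  show "p \<in> {(u, - m *\<^sub>R u - v) | u v. (u, v) \<in> H}"
    unfolding p by (intro CollectI exI[of _ "R y"] exI[of _ "y - lambda *\<^sub>R R y"]) (simp add: R_H algebra_simps)
qed

end

section \<open>Toeplitz operators\<close>

context
  fixes h M :: real and f :: "(real^3) \<times> (real^3) \<Rightarrow> real"
  assumes h: "0 < h" and fm [measurable]: "f \<in> borel_measurable borel" and fM: "\<And>z. \<bar>f z\<bar> \<le> M"
begin

definition toeplitz_form :: "L2 \<Rightarrow> L2 \<Rightarrow> complex" where
  "toeplitz_form w u = of_real (1 / (2 * pi * h) ^ 3) *
     (\<integral>z. of_real (f z) * cnj (coherent_transform h w z) * coherent_transform h u z \<partial>lborel)"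

lemma toeplitz_integrand_bound:
  "norm (of_real (f z) * cnj (coherent_transform h w z) * coherent_transform h u z)
     \<le> M / 2 * ((norm (coherent_transform h w z))\<^sup>2 + (norm (coherent_transform h u z))\<^sup>2)"
proof -
  have ag: "a * b \<le> (a\<^sup>2 + b\<^sup>2) / 2" for a b :: real
    using zero_le_power2[of "a - b"] by (simp add: power2_diff)
  have "norm (of_real (f z) * cnj (coherent_transform h w z) * coherent_transform h u z)
    = \<bar>f z\<bar> * (norm (coherent_transform h w z) * norm (coherent_transform h u z))" by (simp add: norm_mult mult.assoc)
  also have "\<dots> \<le> M * (((norm (coherent_transform h w z))\<^sup>2 + (norm (coherent_transform h u z))\<^sup>2) / 2)"
    by (intro mult_mono fM ag) (use fM[of z] in auto)
  finally show ?thesis by simp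
qed

lemma toeplitz_integrable:
  "integrable lborel (\<lambda>z. of_real (f z) * cnj (coherent_transform h w z) * coherent_transform h u z)"
proof (rule Bochner_Integration.integrable_bound)
  note [measurable] = measurable_coherent_transform[OF h] measurable_cnj
  show "integrable lborel (\<lambda>z. M / 2 * ((norm (coherent_transform h w z))\<^sup>2 + (norm (coherent_transform h u z))\<^sup>2))"
    by (intro integrable_mult_right Bochner_Integration.integrable_add integrable_coherent_transform_sq[OF h])
  show "(\<lambda>z. of_real (f z) * cnj (coherent_transform h w z) * coherent_transform h u z) \<in> borel_measurable lborel"
    by measurable
  show "AE z in lborel. norm (of_real (f z) * cnj (coherent_transform h w z) * coherent_transform h u z)
     \<le> norm (M / 2 * ((norm (coherent_transform h w z))\<^sup>2 + (norm (coherent_transform h u z))\<^sup>2))"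
    using toeplitz_integrand_bound by (intro AE_I2) (metis abs_ge_self order_trans real_norm_def)
qed

lemma toeplitz_form_add_left: "toeplitz_form (w + w') u = toeplitz_form w u + toeplitz_form w' u"
  and toeplitz_form_add_right: "toeplitz_form w (u + u') = toeplitz_form w u + toeplitz_form w u'"
  unfolding toeplitz_form_def coherent_transform_add[OF h]
  by (simp_all add: distrib_left distrib_right toeplitz_integrable)

lemma toeplitz_form_scaleC_left: "toeplitz_form (scaleC c w) u = cnj c * toeplitz_form w u"
proof -
  have "of_real (f z) * cnj (coherent_transform h (scaleC c w) z) * coherent_transform h u z
    = cnj c * (of_real (f z) * cnj (coherent_transform h w z) * coherent_transform h u z)" for z
    by (simp add: coherent_transform_scaleC[OF h])
  then show ?thesis unfolding toeplitz_form_def by (simp only: integral_mult_right_zero mult.left_commute)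
qed

lemma toeplitz_form_scaleC_right: "toeplitz_form w (scaleC c u) = c * toeplitz_form w u"
proof -
  have "of_real (f z) * cnj (coherent_transform h w z) * coherent_transform h (scaleC c u) z
    = c * (of_real (f z) * cnj (coherent_transform h w z) * coherent_transform h u z)" for z
    by (simp add: coherent_transform_scaleC[OF h])
  then show ?thesis unfolding toeplitz_form_def by (simp only: integral_mult_right_zero mult.left_commute)
qed

lemma toeplitz_form_scaleR_left: "toeplitz_form (r *\<^sub>R w) u = of_real r * toeplitz_form w u"
  and toeplitz_form_scaleR_right: "toeplitz_form w (r *\<^sub>R u) = of_real r * toeplitz_form w u"
  using toeplitz_form_scaleC_left[of "of_real r"] toeplitz_form_scaleC_right[of _ "of_real r"]
  by (simp_all add: scaleC_of_real)

lemma toeplitz_form_commute: "toeplitz_form w u = cnj (toeplitz_form u w)"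
  unfolding toeplitz_form_def
  by (simp flip: Bochner_Integration.integral_cnj add: mult_ac)

lemma toeplitz_form_bound: "norm (toeplitz_form w u) \<le> M * norm w * norm u"
proof -
  let ?N = "(2 * pi * h) ^ 3"
  have N: "0 < ?N" using h by simp
  have b: "norm (toeplitz_form w u) \<le> M / 2 * ((norm w)\<^sup>2 + (norm u)\<^sup>2)" for w u
  proof -
    have "norm (\<integral>z. of_real (f z) * cnj (coherent_transform h w z) * coherent_transform h u z \<partial>lborel)
      \<le> (\<integral>z. M / 2 * ((norm (coherent_transform h w z))\<^sup>2 + (norm (coherent_transform h u z))\<^sup>2) \<partial>lborel)"
      by (rule Bochner_Integration.integral_norm_bound_integral[OF toeplitz_integrable _ toeplitz_integrand_bound])
        (intro integrable_mult_right Bochner_Integration.integrable_add integrable_coherent_transform_sq[OF h])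
    also have "\<dots> = ?N * (M / 2 * ((norm w)\<^sup>2 + (norm u)\<^sup>2))"
      by (simp add: integrable_coherent_transform_sq[OF h] coherent_transform_isometry[OF h] algebra_simps)
    finally have *: "norm (\<integral>z. of_real (f z) * cnj (coherent_transform h w z) * coherent_transform h u z \<partial>lborel) / ?N
      \<le> M / 2 * ((norm w)\<^sup>2 + (norm u)\<^sup>2)"
      using N by (simp only: pos_divide_le_eq mult.commute[of _ ?N])
    have "norm (toeplitz_form w u) = norm (\<integral>z. of_real (f z) * cnj (coherent_transform h w z) * coherent_transform h u z \<partial>lborel) / ?N"
      unfolding toeplitz_form_def norm_mult norm_of_real using N by simp
    with * show ?thesis by simp
  qed
  show ?thesis
  proof (cases "w = 0 \<or> u = 0")
    case True
    then show ?thesis using toeplitz_form_scaleR_left[of 0 0] toeplitz_form_scaleR_right[of _ 0 0] by auto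
  next
    case False
    then have w: "w = norm w *\<^sub>R sgn w" and u: "u = norm u *\<^sub>R sgn u" by (simp_all add: sgn_div_norm)
    have "norm (toeplitz_form (sgn w) (sgn u)) \<le> M" using b[of "sgn w" "sgn u"] False by (simp add: norm_sgn)
    then have "norm w * norm u * norm (toeplitz_form (sgn w) (sgn u)) \<le> norm w * norm u * M"
      by (intro mult_left_mono) auto
    moreover have "norm (toeplitz_form w u) = norm w * norm u * norm (toeplitz_form (sgn w) (sgn u))"
      by (subst w, subst u) (simp only: toeplitz_form_scaleR_left toeplitz_form_scaleR_right norm_mult norm_of_real abs_norm_cancel mult_ac)
    ultimately show ?thesis by (simp add: mult_ac)
  qed
qed

text \<open>For bounded symbols the integrability clause of \<open>toeplitz_def\<close> always holds
  and Riesz representation supplies the vector, so the definite description is meaningful.\<close>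

lemma cinner_toeplitz: "cinner w (toeplitz h f u) = toeplitz_form w u"
proof -
  have "\<exists>v. \<forall>w. cinner w v = toeplitz_form w u"
  proof (rule riesz_cinner)
    show "bounded_linear (\<lambda>w. toeplitz_form w u)"
      by (rule bounded_linear_intro[where K = "M * norm u"])
        (use toeplitz_form_bound in \<open>auto simp: toeplitz_form_add_left toeplitz_form_scaleR_left scaleR_conv_of_real mult_ac\<close>)
    show "toeplitz_form (scaleC \<i> w) u = - \<i> * toeplitz_form w u" for w
      by (simp add: toeplitz_form_scaleC_left)
  qed
  then obtain v where v: "\<And>w. cinner w v = toeplitz_form w u" by blast
  have cnj: "cinner w (abs_L2 (coherent_state h q p)) = cnj (coherent_transform h w (q, p))" for w q p
    unfolding coherent_transform_def by (subst cinner_commute) simp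
  have F: "(\<lambda>(q, p). of_real (f (q, p)) * cinner w (abs_L2 (coherent_state h q p)) * cinner (abs_L2 (coherent_state h q p)) u)
      = (\<lambda>z. of_real (f z) * cnj (coherent_transform h w z) * coherent_transform h u z)" for w
    unfolding cnj by (auto simp: fun_eq_iff coherent_transform_def)
  have "toeplitz h f u = (THE v. \<forall>w. cinner w v = toeplitz_form w u)"
    unfolding toeplitz_def Let_def F by (simp only: toeplitz_integrable simp_thms toeplitz_form_def)
  also have "\<dots> = v"
    by (rule the_equality) (use v in \<open>auto intro: cinner_eqI\<close>)
  finally show ?thesis using v by simp
qed

lemma toeplitz_symmetric: "inner (toeplitz h f u) w = inner u (toeplitz h f w)"
proof -
  have "inner w (toeplitz h f u) = inner u (toeplitz h f w)"
    unfolding inner_L2_def cinner_toeplitz by (subst toeplitz_form_commute) simp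
  then show ?thesis by (simp only: inner_commute)
qed

lemma toeplitz_inner_self:
  "inner u (toeplitz h f u) = 1 / (2 * pi * h) ^ 3 * (\<integral>z. f z * (norm (coherent_transform h u z))\<^sup>2 \<partial>lborel)"
proof -
  have "of_real (f z) * cnj (coherent_transform h u z) * coherent_transform h u z = of_real (f z * (norm (coherent_transform h u z))\<^sup>2)" for z
    by (simp only: of_real_mult complex_norm_square mult_ac)
  then have "toeplitz_form u u = of_real (1 / (2 * pi * h) ^ 3 * (\<integral>z. f z * (norm (coherent_transform h u z))\<^sup>2 \<partial>lborel))"
    unfolding toeplitz_form_def by (simp only: integral_complex_of_real of_real_mult[of "1 / _"])
  then show ?thesis unfolding inner_L2_def cinner_toeplitz by simp
qed

lemma bounded_linear_toeplitz: "bounded_linear (toeplitz h f)"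
proof (rule bounded_linear_intro[where K = M])
  show "toeplitz h f (u + u') = toeplitz h f u + toeplitz h f u'" for u u'
    by (rule cinner_eqI) (simp add: cinner_add_right cinner_toeplitz toeplitz_form_add_right)
  show "toeplitz h f (r *\<^sub>R u) = r *\<^sub>R toeplitz h f u" for r u
    by (rule cinner_eqI) (simp add: cinner_scaleR_right cinner_toeplitz toeplitz_form_scaleR_right)
  show "norm (toeplitz h f u) \<le> norm u * M" for u
  proof (cases "toeplitz h f u = 0")
    case True
    then show ?thesis using fM[of undefined] by (simp add: order_trans[OF abs_ge_zero])
  next
    case False
    have "norm (toeplitz h f u) * norm (toeplitz h f u) = inner (toeplitz h f u) (toeplitz h f u)"
      by (simp add: power2_norm_eq_inner[symmetric] power2_eq_square)
    also have "\<dots> \<le> norm (toeplitz_form (toeplitz h f u) u)"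
      unfolding inner_L2_def cinner_toeplitz by (rule complex_Re_le_cmod)
    also have "\<dots> \<le> norm (toeplitz h f u) * (norm u * M)"
      using toeplitz_form_bound[of "toeplitz h f u" u] by (simp add: mult_ac)
    finally show ?thesis using False by simp
  qed
qed

end

text \<open>Polarisation bounds \<open>inner x (D y)\<close> by \<open>e / 2\<close> times the sum
  of squared norms. Taking \<open>x\<close> along \<open>D u\<close> with the length of
  \<open>u\<close> balances the two squares.\<close>

lemma symmetric_norm_le:
  fixes D :: "'a :: real_inner \<Rightarrow> 'a"
  assumes D: "linear D" and sym: "\<And>x y. inner (D x) y = inner x (D y)"
    and q: "\<And>x. \<bar>inner x (D x)\<bar> \<le> e * (norm x)\<^sup>2"
  shows "norm (D u) \<le> e * norm u"
proof (cases "D u = 0 \<or> u = 0")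
  case True
  have "0 \<le> e * (norm u)\<^sup>2" using order_trans[OF abs_ge_zero q] .
  then show ?thesis using True linear_0[OF D] by (auto simp: zero_le_mult_iff)
next
  case False
  have pol: "4 * inner x (D y) \<le> 2 * e * ((norm x)\<^sup>2 + (norm y)\<^sup>2)" for x y
  proof -
    have "4 * inner x (D y) = inner (x + y) (D (x + y)) - inner (x - y) (D (x - y))"
      using sym[of y x] by (simp add: linear_add[OF D] linear_diff[OF D] inner_add inner_diff inner_commute)
    also have "\<dots> \<le> e * (norm (x + y))\<^sup>2 + e * (norm (x - y))\<^sup>2"
      using q[of "x + y"] q[of "x - y"] by linarith
    also have "\<dots> = 2 * e * ((norm x)\<^sup>2 + (norm y)\<^sup>2)"
      by (simp add: power2_norm_eq_inner inner_add inner_diff inner_commute algebra_simps)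
    finally show ?thesis .
  qed
  define x where "x = (norm u / norm (D u)) *\<^sub>R D u"
  have "inner x (D u) = norm u * norm (D u)"
    using False by (simp add: x_def power2_norm_eq_inner[symmetric] power2_eq_square)
  moreover have "norm x = norm u" using False by (simp add: x_def)
  ultimately have "4 * (norm u * norm (D u)) \<le> 4 * (norm u * (e * norm u))"
    using pol[of x u] by (simp add: power2_eq_square algebra_simps)
  then show ?thesis using False by simp
qed

section \<open>Semiclassical resolvent estimate\<close>

lemma powr_tenth_bounds:
  fixes h :: real assumes "0 < h" "h \<le> 1"
  shows "h \<le> h powr (1/10)" "sqrt h \<le> h powr (1/10)"
  using powr_mono'[of "1/10" 1 h] powr_mono'[of "1/10" "1/2" h] assms by (simp_all add: powr_half_sqrt)

text \<open>In the scaled variable \<open>t = r / sqrt h\<close> this is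
  \<open>t powr (1/5) \<le> 1 + t\<^sup>2\<close>; the scaling leaves the factor
  \<open>h powr (1/10)\<close>.\<close>

lemma hoelder_le_weight:
  fixes h r :: real
  assumes h: "0 < h" and r: "0 \<le> r"
  shows "r powr (1/5) \<le> h powr (1/10) * (1 + r\<^sup>2 / h)"
proof -
  define t where "t = r / sqrt h"
  have t0: "0 \<le> t" using r h by (simp add: t_def)
  have rt: "r = sqrt h * t" using h by (simp add: t_def)
  have "t powr (1/5) \<le> 1 + t\<^sup>2"
  proof (cases "t \<le> 1")
    case True
    then have "t powr (1/5) \<le> 1" using t0 by (intro powr_le1) auto
    then show ?thesis using zero_le_power2[of t] by linarith
  next
    case False
    then have "t powr (1/5) \<le> t powr 2" by (intro powr_mono) auto
    then show ?thesis using False by simp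
  qed
  moreover have "r powr (1/5) = h powr (1/10) * t powr (1/5)"
    using h t0 by (simp add: rt powr_mult powr_half_sqrt[symmetric] powr_powr)
  moreover have "t\<^sup>2 = r\<^sup>2 / h" using h by (simp add: t_def power_divide)
  ultimately show ?thesis using h by simp
qed

text \<open>There are five error terms: oscillation, quadratic weight and three linear weights. Each
  carries a multiplier constant at most \<open>(3 + K) * h powr (1/10)\<close>, and the halves come
  from the inequality of means.\<close>

definition resolvent_error :: "real \<Rightarrow> real" where
  "resolvent_error K = 5 / 2 * (1 + (3 + K)\<^sup>2 * enn2real window_moment)"

context schroedinger_resolvent
begin

lemma symbol_lower: "1 + (norm p)\<^sup>2 / 2 \<le> lambda + V q + (norm p)\<^sup>2 / 2"
  using VK[of q] lambda by linarith

definition "osc_weight q x = complex_of_real (V x - V q)"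

lemma measurable_osc_weight: "(\<lambda>(q, x). osc_weight q x) \<in> borel_measurable (lborel \<Otimes>\<^sub>M lborel)"
proof -
  note [measurable] = Vm
  show ?thesis unfolding osc_weight_def by measurable
qed

text \<open>The potential is frozen at the base point, \<open>V x = V q + (V x - V q)\<close>, and
  the kinetic part is \<open>coherent_laplacian\<close>; what is not multiplication by the symbol is
  collected in the last bracket.\<close>

lemma coherent_resolvent:
  assumes u: "has_weak_laplacian u l" and w: "w = - (h\<^sup>2 / 2) *\<^sub>R l + mult_op V u"
  shows "coherent_transform h (lambda *\<^sub>R u + w) z
    = of_real (lambda + V (fst z) + (norm (snd z))\<^sup>2 / 2) * coherent_transform h u z
      + (weighted_coherent h osc_weight u z - of_real (1 / 2) * weighted_coherent h (quad_weight h) u z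
         - \<i> * (\<Sum>j\<in>UNIV. of_real (snd z $ j) * weighted_coherent h (lin_weight j) u z))"
proof -
  obtain q p where z: "z = (q, p)" by force
  let ?c = "\<lambda>x. cnj (coherent_state h q p x)"
  have i1: "integrable lborel (\<lambda>x. ?c x * (1 * rep_L2 u x))"
    by (rule weighted_coherent_integrand[OF h, of 1 "\<lambda>_ _. 1"]) (use h in auto)
  have iV: "integrable lborel (\<lambda>x. ?c x * (osc_weight q x * rep_L2 u x))"
  proof (rule weighted_coherent_integrand[OF h _ measurable_osc_weight])
    show "0 \<le> 2 * K" using K_nonneg by simp
    show "norm (osc_weight q x) \<le> 2 * K * (1 + (norm (x - q))\<^sup>2 / h)" for q x
    proof -
      have "norm (osc_weight q x) \<le> 2 * K * 1"
        unfolding osc_weight_def norm_of_real using VK[of x] VK[of q] by linarith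
      also have "\<dots> \<le> 2 * K * (1 + (norm (x - q))\<^sup>2 / h)" using K_nonneg h by (intro mult_left_mono) auto
      finally show ?thesis .
    qed
  qed
  have "coherent_transform h (mult_op V u) z = (\<integral>x. ?c x * rep_L2 (mult_op V u) x \<partial>lborel)"
    unfolding coherent_transform_def by (simp add: z cinner_abs_left[OF square_integrable_coherent_state[OF h]])
  also have "\<dots> = (\<integral>x. of_real (V q) * (?c x * (1 * rep_L2 u x)) + ?c x * (osc_weight q x * rep_L2 u x) \<partial>lborel)"
  proof (rule integral_cong_AE)
    note [measurable] = measurable_cnj measurable_coherent_state measurable_rep_L2 Vm
    show "AE x in lborel. ?c x * rep_L2 (mult_op V u) x = of_real (V q) * (?c x * (1 * rep_L2 u x)) + ?c x * (osc_weight q x * rep_L2 u x)"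
      using rep_mult_op[OF Vm VK, of u] by eventually_elim (simp add: osc_weight_def algebra_simps)
    show "(\<lambda>x. ?c x * rep_L2 (mult_op V u) x) \<in> borel_measurable lborel" by measurable
    show "(\<lambda>x. of_real (V q) * (?c x * (1 * rep_L2 u x)) + ?c x * (osc_weight q x * rep_L2 u x)) \<in> borel_measurable lborel"
      unfolding osc_weight_def by measurable
  qed
  also have "\<dots> = of_real (V q) * coherent_transform h u z + weighted_coherent h osc_weight u z"
    unfolding coherent_transform_weighted[OF h] weighted_coherent_def z
    by (simp only: fst_conv snd_conv Bochner_Integration.integral_add integrable_mult_right i1 iV integral_mult_right_zero)
  finally have V: "coherent_transform h (mult_op V u) z = of_real (V q) * coherent_transform h u z + weighted_coherent h osc_weight u z" .
  have e: "coherent_transform h (lambda *\<^sub>R u + w) z = of_real lambda * coherent_transform h u z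
      - of_real (1 / 2) * (of_real (h\<^sup>2) * coherent_transform h l z) + coherent_transform h (mult_op V u) z"
    unfolding w coherent_transform_add[OF h] coherent_transform_scaleR[OF h] by simp
  show ?thesis
    unfolding e coherent_laplacian[OF h u] V unfolding z fst_conv snd_conv
    by (simp add: algebra_simps)
qed

text \<open>Writing \<open>d y\<close> and \<open>a\<close> for the transforms of \<open>y\<close>
  and \<open>u = R y\<close>, one has d = D a + e pointwise, so |d|^2 / D - <d, a> = <d, e> / D. As
  \<open>D\<close> dominates both \<open>1\<close> and each coordinate of \<open>p\<close>, the
  quotient e / D is bounded by weighted transforms of \<open>u\<close> alone; integrating, <d, a>
  becomes \<open>inner y u\<close>.\<close>

lemma resolvent_estimate:
  assumes h1: "h \<le> 1" and hoelder: "\<And>x y. \<bar>V x - V y\<bar> \<le> K * dist x y powr (1/5)"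
  shows "\<bar>1 / (2 * pi * h) ^ 3 * (\<integral>z. 1 / (lambda + V (fst z) + (norm (snd z))\<^sup>2 / 2) * (norm (coherent_transform h y z))\<^sup>2 \<partial>lborel)
    - inner y (R y)\<bar> \<le> resolvent_error K * h powr (1/10) * (norm y)\<^sup>2"
proof -
  define u where "u = R y"
  define D where "D z = lambda + V (fst z) + (norm (snd z))\<^sup>2 / 2" for z :: "(real^3) \<times> (real^3)"
  define d where "d = h powr (1/10)"
  define C where "C = enn2real window_moment"
  let ?N = "(2 * pi * h) ^ 3"
  let ?a = "coherent_transform h u" and ?d = "coherent_transform h y"
  let ?c = "weighted_coherent h (quad_weight h) u" and ?b = "\<lambda>j. weighted_coherent h (lin_weight j) u"
  let ?v = "weighted_coherent h osc_weight u"
  have N: "0 < ?N" using h by simp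
  have d0: "0 < d" using h by (simp add: d_def)
  have C0: "0 \<le> C" by (simp add: C_def)
  have uy: "norm u \<le> norm y" unfolding u_def by (rule norm_R)
  have osc_b: "norm (osc_weight q x) \<le> K * d * (1 + (norm (x - q))\<^sup>2 / h)" for q x
  proof -
    have "norm (osc_weight q x) \<le> K * dist x q powr (1/5)"
      unfolding osc_weight_def norm_of_real by (rule hoelder)
    also have "\<dots> \<le> K * (d * (1 + (norm (x - q))\<^sup>2 / h))"
      unfolding d_def dist_norm by (intro mult_left_mono hoelder_le_weight h K_nonneg) simp
    finally show ?thesis by (simp add: mult_ac)
  qed
  have Kd: "0 \<le> K * d" using K_nonneg d0 by simp
  note ic = integrable_weighted_coherent_sq[OF h _ measurable_weights(1) weight_bounds(1)[OF h], of u]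
    and Ic = integral_weighted_coherent_sq[OF h _ measurable_weights(1) weight_bounds(1)[OF h], of u]
  note ib = integrable_weighted_coherent_sq[OF h _ measurable_weights(2) weight_bounds(2)[OF h], of _ u]
    and Ib = integral_weighted_coherent_sq[OF h _ measurable_weights(2) weight_bounds(2)[OF h], of _ u]
  note iv = integrable_weighted_coherent_sq[OF h Kd measurable_osc_weight osc_b, of u]
    and Iv = integral_weighted_coherent_sq[OF h Kd measurable_osc_weight osc_b, of u]
  note id = integrable_coherent_transform_sq[OF h, of y]
  obtain l where l: "has_weak_laplacian u l" "y - lambda *\<^sub>R u = - (h\<^sup>2 / 2) *\<^sub>R l + mult_op V u"
    using R_H[of y] unfolding u_def H_iff by blast
  have D1: "1 + (norm (snd z))\<^sup>2 / 2 \<le> D z" for z unfolding D_def by (rule symbol_lower)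
  have Dpos: "1 \<le> D z" for z using D1[of z] zero_le_power2[of "norm (snd z)"] by linarith
  have Dm [measurable]: "D \<in> borel_measurable borel"
  proof -
    note [measurable] = Vm
    show ?thesis unfolding D_def[abs_def] by measurable
  qed
  define e where "e z = ?v z - of_real (1 / 2) * ?c z - \<i> * (\<Sum>j\<in>UNIV. of_real (snd z $ j) * ?b j z)" for z
  have de: "?d z = of_real (D z) * ?a z + e z" for z
    using coherent_resolvent[OF l, of z] by (simp add: D_def e_def)
  have eb: "norm (e z) \<le> D z * (norm (?v z) + norm (?c z) + (\<Sum>j\<in>UNIV. norm (?b j z)))" for z
  proof -
    have pj: "\<bar>snd z $ j\<bar> \<le> D z" for j
    proof -
      have "0 \<le> (norm (snd z) - 1)\<^sup>2" by simp
      then have "norm (snd z) \<le> 1 + (norm (snd z))\<^sup>2 / 2" by (simp add: power2_diff)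
      then show ?thesis using component_le_norm_cart[of "snd z" j] D1[of z] by linarith
    qed
    have "norm (e z) \<le> norm (?v z) + norm (of_real (1/2) * ?c z) + norm (\<i> * (\<Sum>j\<in>UNIV. of_real (snd z $ j) * ?b j z))"
      unfolding e_def by (intro order_trans[OF norm_triangle_ineq4] add_mono order_refl)
    also have "norm (of_real (1/2) * ?c z) \<le> norm (?c z)" by (simp add: norm_mult)
    also have "norm (\<i> * (\<Sum>j\<in>UNIV. of_real (snd z $ j) * ?b j z)) \<le> (\<Sum>j\<in>UNIV. D z * norm (?b j z))"
      unfolding norm_mult norm_ii mult_1
      by (rule sum_norm_le) (use pj in \<open>auto simp: norm_mult intro!: mult_right_mono\<close>)
    also have "norm (?v z) + norm (?c z) + (\<Sum>j\<in>UNIV. D z * norm (?b j z))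
      \<le> D z * norm (?v z) + D z * norm (?c z) + (\<Sum>j\<in>UNIV. D z * norm (?b j z))"
      using mult_right_mono[OF Dpos[of z], of "norm (?v z)"] mult_right_mono[OF Dpos[of z], of "norm (?c z)"] by simp
    finally show ?thesis by (simp add: distrib_left sum_distrib_left)
  qed
  define W where "W z = (norm (?v z))\<^sup>2 + (norm (?c z))\<^sup>2 + (\<Sum>j\<in>UNIV. (norm (?b j z))\<^sup>2)" for z
  have pw: "\<bar>1 / D z * (norm (?d z))\<^sup>2 - inner (?d z) (?a z)\<bar> \<le> 5 * d / 2 * (norm (?d z))\<^sup>2 + 1 / (2 * d) * W z" for z
  proof -
    have re: "inner x (of_real r * y) = r * inner x y" for x y :: complex and r
      by (simp add: inner_complex_def algebra_simps)
    have D0: "0 < D z" using Dpos[of z] by linarith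
    have "(norm (?d z))\<^sup>2 = D z * inner (?d z) (?a z) + inner (?d z) (e z)"
      unfolding power2_norm_eq_inner by (subst (2) de) (simp add: inner_add_right re)
    then have eq: "1 / D z * (norm (?d z))\<^sup>2 - inner (?d z) (?a z) = inner (?d z) (e z) / D z"
      using D0 by (simp add: field_simps)
    have "\<bar>inner (?d z) (e z)\<bar> \<le> norm (?d z) * (D z * (norm (?v z) + norm (?c z) + (\<Sum>j\<in>UNIV. norm (?b j z))))"
      by (rule order_trans[OF Cauchy_Schwarz_ineq2 mult_left_mono[OF eb]]) simp
    then have "\<bar>1 / D z * (norm (?d z))\<^sup>2 - inner (?d z) (?a z)\<bar>
      \<le> norm (?d z) * (D z * (norm (?v z) + norm (?c z) + (\<Sum>j\<in>UNIV. norm (?b j z)))) / D z"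
      unfolding eq abs_divide abs_of_pos[OF D0] by (rule divide_right_mono) (use D0 in simp)
    also have "\<dots> = norm (?d z) * norm (?v z) + norm (?d z) * norm (?c z) + (\<Sum>j\<in>UNIV. norm (?d z) * norm (?b j z))"
    proof -
      have "x * (D z * s) / D z = x * s" for x s using D0 by simp
      then show ?thesis unfolding \<open>\<And>x s. x * (D z * s) / D z = x * s\<close> by (simp only: distrib_left sum_distrib_left)
    qed
    finally have le: "\<bar>1 / D z * (norm (?d z))\<^sup>2 - inner (?d z) (?a z)\<bar>
      \<le> norm (?d z) * norm (?v z) + norm (?d z) * norm (?c z) + (\<Sum>j\<in>UNIV. norm (?d z) * norm (?b j z))" .
    \<comment> \<open>The parameter \<open>d = h powr (1/10)\<close> balances the splitting: |d y|^2
      receives the factor \<open>d\<close>, while error terms of squared size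
      \<open>d\<^sup>2\<close> receive \<open>1 / d\<close>.\<close>
    have ag: "norm (?d z) * x \<le> d / 2 * (norm (?d z))\<^sup>2 + 1 / (2 * d) * x\<^sup>2" for x
    proof -
      have "0 \<le> (d * norm (?d z) - x)\<^sup>2" by simp
      then have "2 * d * (norm (?d z) * x) \<le> d\<^sup>2 * (norm (?d z))\<^sup>2 + x\<^sup>2"
        by (simp add: power2_diff power_mult_distrib mult_ac)
      then have "norm (?d z) * x \<le> (d\<^sup>2 * (norm (?d z))\<^sup>2 + x\<^sup>2) / (2 * d)"
        using d0 by (simp add: pos_le_divide_eq mult_ac)
      also have "\<dots> = d / 2 * (norm (?d z))\<^sup>2 + 1 / (2 * d) * x\<^sup>2"
        using d0 by (simp add: add_divide_distrib power2_eq_square)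
      finally show ?thesis .
    qed
    have "(\<Sum>j\<in>UNIV. norm (?d z) * norm (?b j z)) \<le> (\<Sum>j\<in>(UNIV::3 set). d / 2 * (norm (?d z))\<^sup>2 + 1 / (2 * d) * (norm (?b j z))\<^sup>2)"
      by (intro sum_mono ag)
    also have "\<dots> = 3 * (d / 2 * (norm (?d z))\<^sup>2) + 1 / (2 * d) * (\<Sum>j\<in>UNIV. (norm (?b j z))\<^sup>2)"
      by (simp add: sum.distrib sum_distrib_left)
    finally show ?thesis using le ag[of "norm (?v z)"] ag[of "norm (?c z)"] unfolding W_def distrib_left by linarith
  qed
  have iW: "integrable lborel W" unfolding W_def[abs_def]
    by (intro Bochner_Integration.integrable_add Bochner_Integration.integrable_sum ib ic iv) (use h in auto)
  have iD: "integrable lborel (\<lambda>z. 1 / D z * (norm (?d z))\<^sup>2)"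
  proof (rule Bochner_Integration.integrable_bound[OF id])
    note [measurable] = measurable_coherent_transform[OF h]
    show "(\<lambda>z. 1 / D z * (norm (?d z))\<^sup>2) \<in> borel_measurable lborel" by measurable
    have "\<bar>1 / D z * (norm (?d z))\<^sup>2\<bar> \<le> 1 * (norm (?d z))\<^sup>2" for z
      using Dpos[of z] unfolding abs_mult by (intro mult_mono) auto
    then show "AE z in lborel. norm (1 / D z * (norm (?d z))\<^sup>2) \<le> norm ((norm (?d z))\<^sup>2)" by simp
  qed
  note ii = coherent_inner[OF h, of y u]
  have W: "(\<integral>z. W z \<partial>lborel) \<le> ?N * (5 * ((3 + K)\<^sup>2 * d\<^sup>2 * C * (norm y)\<^sup>2))"
  proof -
    have st: "?N * (k\<^sup>2 * C * (norm u)\<^sup>2) \<le> ?N * ((3 + K)\<^sup>2 * d\<^sup>2 * C * (norm y)\<^sup>2)" if "0 \<le> k" "k \<le> (3 + K) * d" for k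
      unfolding power_mult_distrib[symmetric, of "3 + K"] using N C0 uy that
      by (intro mult_left_mono mult_mono power_mono) auto
    have hd: "h \<le> d" "sqrt h \<le> d" unfolding d_def by (rule powr_tenth_bounds[OF h h1])+
    have Kd3: "(3 + K) * d = 3 * d + K * d" by (simp add: distrib_right)
    have "(\<integral>z. W z \<partial>lborel) = (\<integral>z. (norm (?v z))\<^sup>2 \<partial>lborel) + (\<integral>z. (norm (?c z))\<^sup>2 \<partial>lborel) + (\<Sum>j\<in>UNIV. \<integral>z. (norm (?b j z))\<^sup>2 \<partial>lborel)"
      unfolding W_def using h by (simp add: ib ic iv)
    also have "\<dots> \<le> ?N * ((3 + K)\<^sup>2 * d\<^sup>2 * C * (norm y)\<^sup>2) + ?N * ((3 + K)\<^sup>2 * d\<^sup>2 * C * (norm y)\<^sup>2)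
      + (\<Sum>j\<in>(UNIV::3 set). ?N * ((3 + K)\<^sup>2 * d\<^sup>2 * C * (norm y)\<^sup>2))"
    proof (intro add_mono sum_mono)
      show "(\<integral>z. (norm (?v z))\<^sup>2 \<partial>lborel) \<le> ?N * ((3 + K)\<^sup>2 * d\<^sup>2 * C * (norm y)\<^sup>2)"
        by (rule order_trans[OF Iv st[unfolded C_def], folded C_def]) (use Kd d0 Kd3 in auto)
      show "(\<integral>z. (norm (?c z))\<^sup>2 \<partial>lborel) \<le> ?N * ((3 + K)\<^sup>2 * d\<^sup>2 * C * (norm y)\<^sup>2)"
        by (rule order_trans[OF Ic st[unfolded C_def], folded C_def]) (use h Kd hd Kd3 in auto)
      show "(\<integral>z. (norm (?b j z))\<^sup>2 \<partial>lborel) \<le> ?N * ((3 + K)\<^sup>2 * d\<^sup>2 * C * (norm y)\<^sup>2)" for j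
        by (rule order_trans[OF Ib st[unfolded C_def], folded C_def]) (use h Kd d0 hd Kd3 in auto)
    qed
    also have "\<dots> = ?N * (5 * ((3 + K)\<^sup>2 * d\<^sup>2 * C * (norm y)\<^sup>2))"
    proof -
      have "n * x + n * x + (\<Sum>j\<in>(UNIV::3 set). n * x) = n * (5 * x)" for n x :: real by simp
      then show ?thesis .
    qed
    finally show ?thesis .
  qed
  have "\<bar>(\<integral>z. 1 / D z * (norm (?d z))\<^sup>2 \<partial>lborel) - ?N * inner y u\<bar> = \<bar>\<integral>z. 1 / D z * (norm (?d z))\<^sup>2 - inner (?d z) (?a z) \<partial>lborel\<bar>"
    by (simp only: Bochner_Integration.integral_diff[OF iD ii(1)] ii(2))
  also have "\<dots> \<le> (\<integral>z. 5 * d / 2 * (norm (?d z))\<^sup>2 + 1 / (2 * d) * W z \<partial>lborel)"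
    unfolding real_norm_def[symmetric]
    by (rule Bochner_Integration.integral_norm_bound_integral[OF Bochner_Integration.integrable_diff[OF iD ii(1)]
          Bochner_Integration.integrable_add[OF integrable_mult_right integrable_mult_right]])
      (simp_all only: id iW pw real_norm_def)
  also have "\<dots> = 5 * d / 2 * (?N * (norm y)\<^sup>2) + 1 / (2 * d) * (\<integral>z. W z \<partial>lborel)"
    by (simp add: id iW coherent_transform_isometry[OF h])
  also have "\<dots> \<le> 5 * d / 2 * (?N * (norm y)\<^sup>2) + 1 / (2 * d) * (?N * (5 * ((3 + K)\<^sup>2 * d\<^sup>2 * C * (norm y)\<^sup>2)))"
    using d0 by (intro add_left_mono mult_left_mono W) simp
  also have "\<dots> = ?N * (resolvent_error K * d * (norm y)\<^sup>2)"
  proof -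
    have "5 * d / 2 * (n * Y) + 1 / (2 * d) * (n * (5 * (k * d\<^sup>2 * C * Y))) = n * (5 / 2 * (1 + k * C) * d * Y)" for n Y k
      using d0 by (simp add: field_simps power2_eq_square)
    then show ?thesis unfolding resolvent_error_def C_def[symmetric] .
  qed
  finally have "\<bar>(\<integral>z. 1 / D z * (norm (?d z))\<^sup>2 \<partial>lborel) - ?N * inner y u\<bar> \<le> ?N * (resolvent_error K * d * (norm y)\<^sup>2)" .
  moreover have "1 / ?N * (\<integral>z. 1 / D z * (norm (?d z))\<^sup>2 \<partial>lborel) - inner y u
      = ((\<integral>z. 1 / D z * (norm (?d z))\<^sup>2 \<partial>lborel) - ?N * inner y u) / ?N"
    using h by (simp add: diff_divide_distrib)
  ultimately have "\<bar>1 / ?N * (\<integral>z. 1 / D z * (norm (?d z))\<^sup>2 \<partial>lborel) - inner y u\<bar> \<le> resolvent_error K * d * (norm y)\<^sup>2"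
    using N by (simp only: abs_divide abs_of_pos pos_divide_le_eq mult_ac)
  then show ?thesis unfolding D_def u_def d_def .
qed

end

section \<open>The closed span of the resolvent functions\<close>

definition resolvent_fun :: "real \<Rightarrow> real \<Rightarrow> real \<Rightarrow> real" where
  "resolvent_fun s c r = (if r \<le> s then 1 / (c - r) else 0)"

text \<open>The uniformly closed linear span of the generators. As an inductive predicate it lets
  every property stable under combinations and uniform limits be proved by rule induction.\<close>

inductive resolvent_span :: "real \<Rightarrow> (real \<Rightarrow> real) \<Rightarrow> bool" for s where
  gen: "s + 1 \<le> c \<Longrightarrow> resolvent_span s (resolvent_fun s c)"
| lin: "resolvent_span s f \<Longrightarrow> resolvent_span s g \<Longrightarrow> resolvent_span s (\<lambda>r. a * f r + b * g r)"
| lim: "\<forall>e>0. \<exists>f. resolvent_span s f \<and> (\<forall>r. \<bar>f r - g r\<bar> \<le> e) \<Longrightarrow> resolvent_span s g"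

lemma resolvent_fun_bounds: "s + 1 \<le> c \<Longrightarrow> 0 \<le> resolvent_fun s c r \<and> resolvent_fun s c r \<le> 1"
  by (auto simp: resolvent_fun_def divide_le_eq_1)

lemma measurable_resolvent_fun [measurable]: "resolvent_fun s c \<in> borel_measurable borel"
  unfolding resolvent_fun_def[abs_def] by measurable

lemma resolvent_fun_identity:
  assumes "s + 1 \<le> c" "s + 1 \<le> c'"
  shows "resolvent_fun s c r - resolvent_fun s c' r = (c' - c) * (resolvent_fun s c r * resolvent_fun s c' r)"
proof (cases "r \<le> s")
  case True
  then have "c - r \<noteq> 0" "c' - r \<noteq> 0" using assms by auto
  then show ?thesis using True by (simp add: resolvent_fun_def diff_frac_eq)
qed (simp add: resolvent_fun_def)

lemma resolvent_span_bounded: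
  "resolvent_span s g \<Longrightarrow> g \<in> borel_measurable borel \<and> (\<exists>B. \<forall>r. \<bar>g r\<bar> \<le> B)"
proof (induction rule: resolvent_span.induct)
  case (gen c)
  have "\<bar>resolvent_fun s c r\<bar> \<le> 1" for r using resolvent_fun_bounds[OF gen, of r] by simp
  then show ?case by (intro conjI measurable_resolvent_fun) blast
next
  case (lin f g a b)
  then obtain B B' where [measurable]: "f \<in> borel_measurable borel" "g \<in> borel_measurable borel"
    and B: "\<And>r. \<bar>f r\<bar> \<le> B" "\<And>r. \<bar>g r\<bar> \<le> B'" by blast
  have "\<bar>a * f r + b * g r\<bar> \<le> \<bar>a\<bar> * B + \<bar>b\<bar> * B'" for r
    using B(1)[of r] B(2)[of r]
    by (intro order_trans[OF abs_triangle_ineq] add_mono) (simp_all add: abs_mult mult_left_mono)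
  then show ?case by (intro conjI exI allI) measurable
next
  case (lim g)
  then have "\<forall>n. \<exists>f. (f \<in> borel_measurable borel \<and> (\<exists>B. \<forall>r. \<bar>f r\<bar> \<le> B)) \<and> (\<forall>r. \<bar>f r - g r\<bar> \<le> 1 / real (Suc n))"
    by (metis zero_less_divide_1_iff of_nat_0_less_iff zero_less_Suc)
  then obtain F where F: "\<And>n. F n \<in> borel_measurable borel" "\<And>n. \<exists>B. \<forall>r. \<bar>F n r\<bar> \<le> B"
    "\<And>n r. \<bar>F n r - g r\<bar> \<le> 1 / real (Suc n)" by metis
  have "(\<lambda>n. F n r) \<longlonglongrightarrow> g r" for r
  proof (rule LIM_zero_cancel, rule Lim_null_comparison)
    show "(\<lambda>n. 1 / real (Suc n)) \<longlonglongrightarrow> 0" using LIMSEQ_Suc[OF lim_const_over_n] by blast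
    show "\<forall>\<^sub>F n in sequentially. norm (F n r - g r) \<le> 1 / real (Suc n)"
      unfolding real_norm_def using F(3) by (intro always_eventually allI)
  qed
  then have "g \<in> borel_measurable borel" by (rule borel_measurable_LIMSEQ_real) (rule F(1))
  moreover obtain B where B: "\<And>r. \<bar>F 0 r\<bar> \<le> B" using F(2)[of 0] by blast
  have "\<bar>g r\<bar> \<le> B + 1" for r using B[of r] F(3)[of 0 r] by simp
  ultimately show ?case by blast
qed

lemma resolvent_span_cong: "resolvent_span s f \<Longrightarrow> (\<And>r. f r = g r) \<Longrightarrow> resolvent_span s g"
  by (subgoal_tac "f = g") auto

lemma resolvent_span_sum:
  assumes "finite A" "\<And>k. k \<in> A \<Longrightarrow> resolvent_span s (f k)"
  shows "resolvent_span s (\<lambda>r. \<Sum>k\<in>A. f k r)"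
  using assms
proof (induction A rule: finite_induct)
  case empty
  show ?case
    by (rule resolvent_span_cong[OF lin[OF gen[OF order_refl] gen[OF order_refl], of s 0 0]]) simp
next
  case (insert x A)
  then have "resolvent_span s (\<lambda>r. 1 * f x r + 1 * (\<Sum>k\<in>A. f k r))" by (intro lin) auto
  then show ?case using insert by simp
qed

text \<open>By the resolvent identity a product of two distinct generators is a linear combination of
  them; squares are limits of such products.\<close>
lemma resolvent_span_mult:
  "resolvent_span s g \<Longrightarrow> resolvent_span s (\<lambda>r. resolvent_fun s (s + 1) r * g r)"
proof (induction rule: resolvent_span.induct)
  let ?x = "resolvent_fun s (s + 1)"
  have gen': "resolvent_span s (\<lambda>r. ?x r * resolvent_fun s c r)" if c: "s + 1 < c" for c
  proof (rule resolvent_span_cong)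
    show "resolvent_span s (\<lambda>r. (1 / (c - (s + 1))) * ?x r + (- 1 / (c - (s + 1))) * resolvent_fun s c r)"
      using c by (intro lin gen) auto
    show "(1 / (c - (s + 1))) * ?x r + (- 1 / (c - (s + 1))) * resolvent_fun s c r = ?x r * resolvent_fun s c r" for r
    proof -
      have "(1 / (c - (s + 1))) * ?x r + (- 1 / (c - (s + 1))) * resolvent_fun s c r = (?x r - resolvent_fun s c r) / (c - (s + 1))"
        by (simp add: diff_divide_distrib)
      also have "\<dots> = ?x r * resolvent_fun s c r"
        using c resolvent_fun_identity[of s "s + 1" c r] by simp
      finally show ?thesis .
    qed
  qed
  {
    case (gen c)
    show ?case
    proof (cases "c = s + 1")
      case False
      then show ?thesis using gen' gen by simp
    next
      case True
      show ?thesis unfolding True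
      proof (rule lim, intro allI impI)
        fix e :: real assume e: "0 < e"
        \<comment> \<open>By the resolvent identity the difference is \<open>- e\<close> times a
          product of factors between \<open>0\<close> and \<open>1\<close>.\<close>
        have "\<bar>?x r * resolvent_fun s (s + 1 + e) r - ?x r * ?x r\<bar> \<le> e" for r
        proof -
          let ?y = "resolvent_fun s (s + 1 + e) r"
          have b: "0 \<le> ?x r" "?x r \<le> 1" "0 \<le> ?y" "?y \<le> 1"
            using resolvent_fun_bounds[of s "s + 1" r] resolvent_fun_bounds[of s "s + 1 + e" r] e by auto
          have "?x r - ?y = e * (?x r * ?y)" using resolvent_fun_identity[of s "s + 1" "s + 1 + e" r] e by simp
          then have "?x r * ?y - ?x r * ?x r = - (e * (?x r * (?x r * ?y)))"
            by (metis (no_types, opaque_lifting) minus_diff_eq mult.left_commute right_diff_distrib)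
          moreover have "?x r * (?x r * ?y) \<le> 1" using b by (intro mult_le_one mult_nonneg_nonneg) auto
          moreover have "0 \<le> ?x r * (?x r * ?y)" using b by simp
          ultimately show ?thesis using e by (simp add: abs_mult)
        qed
        then show "\<exists>f. resolvent_span s f \<and> (\<forall>r. \<bar>f r - ?x r * ?x r\<bar> \<le> e)"
          using gen'[of "s + 1 + e"] e by auto
      qed
    qed
  next
    case (lin f g a b)
    show ?case
      by (rule resolvent_span_cong[OF resolvent_span.lin[OF lin.IH, of a b]]) (simp add: algebra_simps)
  next
    case (lim g)
    show ?case
    proof (rule resolvent_span.lim, intro allI impI)
      fix e :: real assume "0 < e"
      then obtain f where f: "resolvent_span s (\<lambda>r. ?x r * f r)" "\<And>r. \<bar>f r - g r\<bar> \<le> e" using lim by blast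
      have "\<bar>?x r * f r - ?x r * g r\<bar> \<le> e" for r
      proof -
        have "\<bar>?x r\<bar> * \<bar>f r - g r\<bar> \<le> 1 * e"
          using resolvent_fun_bounds[of s "s + 1" r] f(2)[of r] by (intro mult_mono) auto
        then show ?thesis by (simp add: abs_mult[symmetric] right_diff_distrib)
      qed
      then show "\<exists>f. resolvent_span s f \<and> (\<forall>r. \<bar>f r - ?x r * g r\<bar> \<le> e)" using f(1) by blast
    qed
  }
qed

text \<open>Bernstein polynomials of \<open>b\<close> in the generator \<open>x\<close> for
  \<open>c = s + 1\<close>. All functions in the span tend to \<open>0\<close> at minus infinity;
  correspondingly \<open>b 0 = 0\<close> removes the term \<open>k = 0\<close>, and every other
  Bernstein term contains a factor \<open>x\<close>.\<close>

lemma resolvent_span_continuous: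
  assumes cont: "continuous_on {0..1} b" and b0: "b 0 = 0"
  shows "resolvent_span s (\<lambda>r. b (resolvent_fun s (s + 1) r))"
proof (rule lim, intro allI impI)
  let ?x = "resolvent_fun s (s + 1)"
  fix e :: real assume e: "0 < e"
  obtain N where N: "\<And>n x. N \<le> n \<Longrightarrow> x \<in> {0..1} \<Longrightarrow> \<bar>b x - (\<Sum>k\<le>n. b (k / n) * Bernstein n k x)\<bar> < e"
    using Bernstein_Weierstrass[OF cont e] by blast
  have pow: "resolvent_span s (\<lambda>r. ?x r ^ Suc k)" for k
  proof (induction k)
    case 0
    show ?case by (simp add: gen)
  next
    case (Suc k)
    then show ?case using resolvent_span_mult[of s "\<lambda>r. ?x r ^ Suc k"] by simp
  qed
  have mon: "resolvent_span s (\<lambda>r. ?x r ^ Suc k * (1 - ?x r) ^ m)" for k m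
  proof (induction m)
    case 0
    show ?case using pow[of k] by simp
  next
    case (Suc m)
    show ?case
      by (rule resolvent_span_cong[OF lin[OF Suc resolvent_span_mult[OF Suc], of 1 "- 1"]]) (simp add: algebra_simps)
  qed
  have "resolvent_span s (\<lambda>r. \<Sum>k\<le>N. b (k / N) * Bernstein N k (?x r))"
  proof (rule resolvent_span_sum)
    fix k
    show "resolvent_span s (\<lambda>r. b (k / N) * Bernstein N k (?x r))"
    proof (cases k)
      case 0
      have "resolvent_span s (\<lambda>r. \<Sum>k\<in>{}. 0)" by (rule resolvent_span_sum) auto
      then show ?thesis using 0 b0 by simp
    next
      case (Suc j)
      show ?thesis
        by (rule resolvent_span_cong[OF lin[OF mon mon, of "b (k / N) * (N choose k)" j "N - k" 0 0 0]])
          (simp add: Bernstein_def Suc mult_ac)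
    qed
  qed simp
  moreover have "\<bar>(\<Sum>k\<le>N. b (k / N) * Bernstein N k (?x r)) - b (?x r)\<bar> \<le> e" for r
    using N[OF order_refl, of "?x r"] resolvent_fun_bounds[of s "s + 1" r] by (simp add: abs_minus_commute less_imp_le)
  ultimately show "\<exists>f. resolvent_span s f \<and> (\<forall>r. \<bar>f r - b (?x r)\<bar> \<le> e)" by blast
qed

text \<open>The substitution \<open>x = 1 / (s + 1 - r)\<close> turns \<open>\<alpha>\<close> on \<open>{..s}\<close> into a continuous function on
  \<open>{0..1}\<close> vanishing near \<open>0\<close>.\<close>
lemma resolvent_span_cutoff:
  assumes cont: "continuous_on UNIV \<alpha>" and a0: "\<And>t. t \<le> 0 \<Longrightarrow> \<alpha> t = 0" and s: "0 \<le> s"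
  shows "resolvent_span s (\<lambda>r. if r \<le> s then \<alpha> r else 0)"
proof -
  define b where "b x = (if x \<le> 1 / (s + 1) then 0 else \<alpha> (s + 1 - 1 / x))" for x
  have pos: "0 < 1 / (s + 1)" using s by simp
  have cont': "continuous_on {1 / (s + 1)..} (\<lambda>x. \<alpha> (s + 1 - 1 / x))"
  proof (rule continuous_on_compose2[OF cont])
    show "continuous_on {1 / (s + 1)..} (\<lambda>x. s + 1 - 1 / x)"
      using pos by (intro continuous_intros) auto
  qed simp
  \<comment> \<open>At the joint \<open>1 / (s + 1)\<close> the argument of \<alpha> is
    \<open>0\<close>, where \<alpha> vanishes.\<close>
  have "continuous_on ({..1 / (s + 1)} \<union> {1 / (s + 1)..}) (\<lambda>x. if x \<le> 1 / (s + 1) then 0 else \<alpha> (s + 1 - 1 / x))"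
    by (rule continuous_on_If) (use cont' a0 in \<open>auto intro!: continuous_intros\<close>)
  then have "continuous_on {0..1} b"
    unfolding b_def[abs_def] by (rule continuous_on_subset) auto
  moreover have "b 0 = 0" using s by (simp add: b_def)
  ultimately have "resolvent_span s (\<lambda>r. b (resolvent_fun s (s + 1) r))" by (rule resolvent_span_continuous)
  then show ?thesis
  proof (rule resolvent_span_cong)
    fix r
    show "b (resolvent_fun s (s + 1) r) = (if r \<le> s then \<alpha> r else 0)"
    proof (cases "r \<le> s")
      case True
      have "1 / (s + 1 - r) \<le> 1 / (s + 1) \<longleftrightarrow> r \<le> 0" using True s by (simp add: divide_le_cancel frac_le_eq field_simps)
      then show ?thesis using True a0[of r] by (simp add: b_def resolvent_fun_def)
    next
      case False
      then show ?thesis using s by (simp add: b_def resolvent_fun_def)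
    qed
  qed
qed

section \<open>Convergence\<close>

text \<open>Names the very choice made inside \<open>functional_calculus\<close> for the operator -m
  - H.\<close>

definition energy_family :: "real \<Rightarrow> (real^3 \<Rightarrow> real) \<Rightarrow> real \<Rightarrow> real \<Rightarrow> L2 \<Rightarrow> L2" where
  "energy_family h V m = (SOME E. resolution_of_identity E \<and>
     spectral_integral E (\<lambda>t. t) = {(u, - m *\<^sub>R u - v) | u v. (u, v) \<in> schroedinger h V})"

definition symbol :: "(real^3 \<Rightarrow> real) \<Rightarrow> real \<Rightarrow> (real^3) \<times> (real^3) \<Rightarrow> real" where
  "symbol V m = (\<lambda>(q, p). - m - ((norm p)\<^sup>2 / 2 + V q))"

text \<open>The difference of the two quadratic forms at \<open>y\<close> for a function
  \<open>g\<close>. It is linear in \<open>g\<close> and, uniformly in \<open>h\<close>, controlled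
  by the supremum of \<open>g\<close>.\<close>

definition defect :: "real \<Rightarrow> (real^3 \<Rightarrow> real) \<Rightarrow> real \<Rightarrow> (real \<Rightarrow> real) \<Rightarrow> L2 \<Rightarrow> real" where
  "defect h V m g y = 1 / (2 * pi * h) ^ 3 * (\<integral>z. g (symbol V m z) * (norm (coherent_transform h y z))\<^sup>2 \<partial>lborel)
     - (\<integral>r. g r \<partial>spectral_measure (energy_family h V m) y)"

lemma functional_calculus_energy:
  "functional_calculus g {(u, - m *\<^sub>R u - v) | u v. (u, v) \<in> schroedinger h V} = spectral_integral (energy_family h V m) g"
  by (simp add: functional_calculus_def energy_family_def)

context
  fixes V :: "real^3 \<Rightarrow> real" and K h m :: real
  assumes Vm [measurable]: "V \<in> borel_measurable borel" and VK: "\<And>x. \<bar>V x\<bar> \<le> K" and h: "0 < h"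
begin

lemma measurable_symbol [measurable]: "symbol V m \<in> borel_measurable borel"
  unfolding symbol_def case_prod_beta by measurable

lemma symbol_le: "symbol V m z \<le> K - m"
proof -
  have "0 \<le> (norm (snd z))\<^sup>2" by simp
  then show ?thesis using VK[of "fst z"] unfolding symbol_def case_prod_beta by linarith
qed

lemma energy_family:
  "resolution_of_identity (energy_family h V m)"
  "spectral_integral (energy_family h V m) (\<lambda>t. t) = {(u, - m *\<^sub>R u - v) | u v. (u, v) \<in> schroedinger h V}"
proof -
  interpret schroedinger_resolvent V K h "K + 1" by unfold_locales (use Vm VK h in auto)
  have "\<exists>E. resolution_of_identity E \<and> spectral_integral E (\<lambda>t. t) = {(u, - m *\<^sub>R u - v) | u v. (u, v) \<in> schroedinger h V}"
    using resolvent.resolution_E[OF resolvent, of "K + 1 - m"] resolvent.spectral_theorem[OF resolvent, of "K + 1 - m"]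
      shifted_graph[of m] by metis
  from someI_ex[OF this] show "resolution_of_identity (energy_family h V m)"
    "spectral_integral (energy_family h V m) (\<lambda>t. t) = {(u, - m *\<^sub>R u - v) | u v. (u, v) \<in> schroedinger h V}"
    unfolding energy_family_def by blast+
qed

lemma energy_spectral_family: "spectral_family (energy_family h V m)"
  by (rule spectral_family.intro) (rule energy_family)

lemma energy_support:
  assumes "K - m < s" shows "energy_family h V m s x = x"
proof (rule spectral_family.spectral_support[OF energy_spectral_family _ assms])
  interpret schroedinger_resolvent V K h "K + 1" by unfold_locales (use Vm VK h in auto)
  fix u v assume "(u, v) \<in> spectral_integral (energy_family h V m) (\<lambda>t. t)"
  then obtain w where w: "(u, w) \<in> schroedinger h V" "v = - m *\<^sub>R u - w" unfolding energy_family(2) by blast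
  show "inner u v \<le> (K - m) * (norm u)\<^sup>2"
    using H_form[OF w(1)] by (simp add: w(2) inner_diff_right power2_norm_eq_inner[symmetric] left_diff_distrib)
qed

lemma defect_integrable:
  assumes g [measurable]: "g \<in> borel_measurable borel" and B: "\<And>r. \<bar>g r\<bar> \<le> B"
  shows "integrable lborel (\<lambda>z. g (symbol V m z) * (norm (coherent_transform h y z))\<^sup>2)"
    and "integrable (spectral_measure (energy_family h V m) y) g"
proof -
  note [measurable] = measurable_coherent_transform[OF h]
  show "integrable lborel (\<lambda>z. g (symbol V m z) * (norm (coherent_transform h y z))\<^sup>2)"
  proof (rule Bochner_Integration.integrable_bound[where f = "\<lambda>z. B * (norm (coherent_transform h y z))\<^sup>2"])
    show "integrable lborel (\<lambda>z. B * (norm (coherent_transform h y z))\<^sup>2)"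
      by (intro integrable_mult_right integrable_coherent_transform_sq[OF h])
    have "\<bar>g (symbol V m z)\<bar> * (norm (coherent_transform h y z))\<^sup>2 \<le> \<bar>B\<bar> * (norm (coherent_transform h y z))\<^sup>2" for z
      using B[of "symbol V m z"] by (intro mult_right_mono) auto
    then show "AE z in lborel. norm (g (symbol V m z) * (norm (coherent_transform h y z))\<^sup>2) \<le> norm (B * (norm (coherent_transform h y z))\<^sup>2)"
      by (simp add: abs_mult)
  qed measurable
  show "integrable (spectral_measure (energy_family h V m) y) g"
    by (rule spectral_family.mu_integrable_bounded[OF energy_spectral_family g B])
qed

lemma defect_lin:
  assumes "f \<in> borel_measurable borel" "\<And>r. \<bar>f r\<bar> \<le> B" "g \<in> borel_measurable borel" "\<And>r. \<bar>g r\<bar> \<le> B'"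
  shows "defect h V m (\<lambda>r. a * f r + b * g r) y = a * defect h V m f y + b * defect h V m g y"
proof -
  note i = defect_integrable[OF assms(1,2), of y] defect_integrable[OF assms(3,4), of y]
  have "(\<integral>z. (a * f (symbol V m z) + b * g (symbol V m z)) * (norm (coherent_transform h y z))\<^sup>2 \<partial>lborel)
    = (\<integral>z. a * (f (symbol V m z) * (norm (coherent_transform h y z))\<^sup>2) + b * (g (symbol V m z) * (norm (coherent_transform h y z))\<^sup>2) \<partial>lborel)"
    by (simp only: distrib_right mult.assoc)
  also have "\<dots> = a * (\<integral>z. f (symbol V m z) * (norm (coherent_transform h y z))\<^sup>2 \<partial>lborel)
    + b * (\<integral>z. g (symbol V m z) * (norm (coherent_transform h y z))\<^sup>2 \<partial>lborel)"
    by (simp only: Bochner_Integration.integral_add[OF integrable_mult_right[OF i(1)] integrable_mult_right[OF i(3)]] integral_mult_right_zero)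
  finally show ?thesis
    unfolding defect_def Bochner_Integration.integral_add[OF integrable_mult_right[OF i(2)] integrable_mult_right[OF i(4)]] integral_mult_right_zero
    by (simp add: algebra_simps)
qed

lemma defect_bound:
  assumes g [measurable]: "g \<in> borel_measurable borel" and B: "\<And>r. \<bar>g r\<bar> \<le> B"
  shows "\<bar>defect h V m g y\<bar> \<le> 2 * B * (norm y)\<^sup>2"
proof -
  interpret spectral_family "energy_family h V m" by (rule energy_spectral_family)
  interpret mu: finite_measure "mu y" by (rule mu_finite_measure)
  note i = defect_integrable[OF g B, of y]
  let ?N = "(2 * pi * h) ^ 3"
  have N: "0 < ?N" using h by simp
  have "\<bar>\<integral>z. g (symbol V m z) * (norm (coherent_transform h y z))\<^sup>2 \<partial>lborel\<bar> \<le> (\<integral>z. B * (norm (coherent_transform h y z))\<^sup>2 \<partial>lborel)"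
    unfolding real_norm_def[symmetric]
  proof (rule Bochner_Integration.integral_norm_bound_integral[OF i(1) integrable_mult_right[OF integrable_coherent_transform_sq[OF h]]])
    show "norm (g (symbol V m z) * (norm (coherent_transform h y z))\<^sup>2) \<le> B * (norm (coherent_transform h y z))\<^sup>2" for z
      using B[of "symbol V m z"] by (simp add: abs_mult mult_right_mono)
  qed
  also have "\<dots> = ?N * (B * (norm y)\<^sup>2)" by (simp add: coherent_transform_isometry[OF h])
  finally have "\<bar>\<integral>z. g (symbol V m z) * (norm (coherent_transform h y z))\<^sup>2 \<partial>lborel\<bar> / ?N \<le> B * (norm y)\<^sup>2"
    using N by (simp only: pos_divide_le_eq mult.commute[of _ ?N])
  then have 1: "\<bar>1 / ?N * (\<integral>z. g (symbol V m z) * (norm (coherent_transform h y z))\<^sup>2 \<partial>lborel)\<bar> \<le> B * (norm y)\<^sup>2"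
    using h by (simp add: abs_mult)
  have "\<bar>\<integral>r. g r \<partial>mu y\<bar> \<le> (\<integral>r. B \<partial>mu y)"
    unfolding real_norm_def[symmetric]
    by (rule Bochner_Integration.integral_norm_bound_integral[OF i(2)]) (use B in auto)
  also have "\<dots> = B * (norm y)\<^sup>2" by (simp add: mu_UNIV mu_sets)
  finally show ?thesis using 1 unfolding defect_def by linarith
qed

text \<open>With \<open>lambda = c + m\<close> both sides become resolvent quantities:
  \<open>c\<close> minus the symbol is lambda + V + |p|^2 / 2, and c - B is lambda + H.\<close>

lemma defect_resolvent:
  assumes h1: "h \<le> 1" and hoelder: "\<And>x y. \<bar>V x - V y\<bar> \<le> K * dist x y powr (1/5)"
    and c: "K + 1 \<le> c + m" and s: "K - m < s" "s < c"
  shows "\<bar>defect h V m (resolvent_fun s c) y\<bar> \<le> resolvent_error K * h powr (1/10) * (norm y)\<^sup>2"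
proof -
  interpret schroedinger_resolvent V K h "c + m" by unfold_locales (use Vm VK h c in auto)
  interpret E: spectral_family "energy_family h V m" by (rule energy_spectral_family)
  have "(R y, c *\<^sub>R R y - y) \<in> spectral_integral (energy_family h V m) (\<lambda>t. t)"
    unfolding energy_family(2) shifted_graph[of m] by auto
  from E.resolvent_form[OF this energy_support[OF s(1)] s(2)]
  have 1: "(\<integral>r. resolvent_fun s c r \<partial>spectral_measure (energy_family h V m) y) = inner y (R y)"
    by (simp add: resolvent_fun_def[abs_def])
  have "resolvent_fun s c (symbol V m z) = 1 / (c + m + V (fst z) + (norm (snd z))\<^sup>2 / 2)" for z
  proof -
    have "c - symbol V m z = c + m + V (fst z) + (norm (snd z))\<^sup>2 / 2" by (simp add: symbol_def case_prod_beta)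
    moreover have "symbol V m z \<le> s" using symbol_le[of z] s(1) by linarith
    ultimately show ?thesis by (simp add: resolvent_fun_def)
  qed
  then show ?thesis unfolding defect_def 1 using resolvent_estimate[OF h1 hoelder, of y] by simp
qed

end

text \<open>Rule induction over the span. Generators have the rate \<open>h powr (1/10)\<close>;
  uniform limits are handled by \<open>defect_bound\<close>, whose constant is independent of
  \<open>h\<close>. The accuracy \<open>e\<close> is generalised because combinations invoke the
  hypotheses with a smaller one.\<close>

lemma defect_vanishing:
  fixes V :: "real \<Rightarrow> real^3 \<Rightarrow> real"
  assumes Vm: "\<And>h. h \<in> {0<..1} \<Longrightarrow> V h \<in> borel_measurable borel"
    and VK: "\<And>h x. h \<in> {0<..1} \<Longrightarrow> \<bar>V h x\<bar> \<le> K"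
    and hoelder: "\<And>h x y. h \<in> {0<..1} \<Longrightarrow> \<bar>V h x - V h y\<bar> \<le> K * dist x y powr (1/5)"
    and mu: "(\<mu> \<longlongrightarrow> \<mu>\<^sub>0) (at_right 0)" and s: "K + \<bar>\<mu>\<^sub>0\<bar> + 2 \<le> s"
    and g: "resolvent_span s g" and e: "0 < e"
  shows "\<forall>\<^sub>F h in at_right 0. \<forall>y. \<bar>defect h (V h) (\<mu> h) g y\<bar> \<le> e * (norm y)\<^sup>2"
  using g e
proof (induction arbitrary: e rule: resolvent_span.induct)
  have small: "\<forall>\<^sub>F h in at_right (0::real). h \<in> {0<..1}"
    by (rule eventually_at_rightI[of 0 1]) auto
  {
    case (gen c)
    have "((\<lambda>h. resolvent_error K * h powr (1/10)) \<longlongrightarrow> resolvent_error K * 0) (at_right 0)"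
      by (intro tendsto_mult tendsto_const tendsto_zero_powrI) (auto intro: tendsto_ident_at eventually_mono[OF small])
    then have err: "\<forall>\<^sub>F h in at_right 0. resolvent_error K * h powr (1/10) < e"
      using gen(2) by (auto elim: order_tendstoD(2))
    have "\<forall>\<^sub>F h in at_right 0. dist (\<mu> h) \<mu>\<^sub>0 < 1" using mu by (rule tendstoD) simp
    with small err show ?case
    proof eventually_elim
      case (elim h)
      have "\<bar>\<mu> h - \<mu>\<^sub>0\<bar> < 1" using elim by (simp add: dist_real_def)
      then have cond: "K + 1 \<le> c + \<mu> h" "K - \<mu> h < s" "s < c" using s gen(1) by (auto simp: abs_if split: if_splits)
      have h: "0 < h" "h \<le> 1" using elim by auto
      show ?case
      proof
        fix y
        have "\<bar>defect h (V h) (\<mu> h) (resolvent_fun s c) y\<bar> \<le> resolvent_error K * h powr (1/10) * (norm y)\<^sup>2"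
          by (rule defect_resolvent[OF Vm VK h hoelder cond]) (use elim in auto)
        also have "\<dots> \<le> e * (norm y)\<^sup>2" using elim by (intro mult_right_mono) auto
        finally show "\<bar>defect h (V h) (\<mu> h) (resolvent_fun s c) y\<bar> \<le> e * (norm y)\<^sup>2" .
      qed
    qed
  next
    case (lin f g a b)
    obtain B where B: "f \<in> borel_measurable borel" "\<And>r. \<bar>f r\<bar> \<le> B" using resolvent_span_bounded[OF lin(1)] by blast
    obtain B' where B': "g \<in> borel_measurable borel" "\<And>r. \<bar>g r\<bar> \<le> B'" using resolvent_span_bounded[OF lin(2)] by blast
    define d where "d = e / (\<bar>a\<bar> + \<bar>b\<bar> + 1)"
    have d0: "0 < d" using lin.prems by (simp add: d_def add_nonneg_pos)
    have "(\<bar>a\<bar> + \<bar>b\<bar> + 1) * d = e" unfolding d_def by simp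
    then have de: "\<bar>a\<bar> * d + \<bar>b\<bar> * d \<le> e" using d0 by (simp add: algebra_simps)
    from small lin.IH(1)[OF d0] lin.IH(2)[OF d0] show ?case
    proof eventually_elim
      case (elim h)
      have h: "0 < h" using elim by auto
      show ?case
      proof
        fix y
        have "\<bar>a * defect h (V h) (\<mu> h) f y + b * defect h (V h) (\<mu> h) g y\<bar> \<le> \<bar>a\<bar> * (d * (norm y)\<^sup>2) + \<bar>b\<bar> * (d * (norm y)\<^sup>2)"
          using elim by (intro order_trans[OF abs_triangle_ineq] add_mono) (simp_all add: abs_mult mult_left_mono)
        also have "\<dots> = (\<bar>a\<bar> * d + \<bar>b\<bar> * d) * (norm y)\<^sup>2" by (simp add: algebra_simps)
        also have "\<dots> \<le> e * (norm y)\<^sup>2" by (intro mult_right_mono de) simp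
        finally show "\<bar>defect h (V h) (\<mu> h) (\<lambda>r. a * f r + b * g r) y\<bar> \<le> e * (norm y)\<^sup>2"
          using elim(1) by (subst defect_lin[OF Vm VK h B B']) auto
      qed
    qed
  next
    case (lim g)
    have g: "resolvent_span s g" by (rule resolvent_span.lim) (use lim.IH in blast)
    obtain B' where B': "g \<in> borel_measurable borel" "\<And>r. \<bar>g r\<bar> \<le> B'" using resolvent_span_bounded[OF g] by blast
    \<comment> \<open>Accuracy \<open>e / 4\<close> in the supremum costs \<open>e / 2\<close> in
      the defect by \<open>defect_bound\<close>; the defect of \<open>f\<close> takes the other
      half.\<close>
    obtain f where f: "resolvent_span s f" "\<And>r. \<bar>f r - g r\<bar> \<le> e / 4"
      and ev: "\<forall>\<^sub>F h in at_right 0. \<forall>y. \<bar>defect h (V h) (\<mu> h) f y\<bar> \<le> (e / 2) * (norm y)\<^sup>2"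
    proof -
      have e: "0 < e / 4" "0 < e / 2" using lim.prems by auto
      obtain f where f: "resolvent_span s f" "\<forall>r. \<bar>f r - g r\<bar> \<le> e / 4"
        "\<And>e. 0 < e \<Longrightarrow> \<forall>\<^sub>F h in at_right 0. \<forall>y. \<bar>defect h (V h) (\<mu> h) f y\<bar> \<le> e * (norm y)\<^sup>2"
        using lim.IH e(1) by blast
      show ?thesis by (rule that[OF f(1) _ f(3)[OF e(2)]]) (use f(2) in blast)
    qed
    obtain B where B: "f \<in> borel_measurable borel" "\<And>r. \<bar>f r\<bar> \<le> B" using resolvent_span_bounded[OF f(1)] by blast
    from small ev show ?case
    proof eventually_elim
      case (elim h)
      have h: "0 < h" using elim by auto
      show ?case
      proof
        fix y
        have m: "(\<lambda>r. 1 * f r + (- 1) * g r) \<in> borel_measurable borel" using B(1) B'(1) by measurable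
        have "\<bar>defect h (V h) (\<mu> h) (\<lambda>r. 1 * f r + (- 1) * g r) y\<bar> \<le> 2 * (e / 4) * (norm y)\<^sup>2"
          by (rule defect_bound[OF Vm VK h m]) (use elim f(2) in auto)
        moreover have "defect h (V h) (\<mu> h) (\<lambda>r. 1 * f r + (- 1) * g r) y
          = 1 * defect h (V h) (\<mu> h) f y + (- 1) * defect h (V h) (\<mu> h) g y"
          using elim(1) by (intro defect_lin[OF Vm VK h B B']) auto
        moreover have "\<bar>defect h (V h) (\<mu> h) f y\<bar> \<le> (e / 2) * (norm y)\<^sup>2" using elim by blast
        moreover have "2 * (e / 4) * (norm y)\<^sup>2 = e * (norm y)\<^sup>2 / 2" "(e / 2) * (norm y)\<^sup>2 = e * (norm y)\<^sup>2 / 2" by simp_all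
        ultimately show "\<bar>defect h (V h) (\<mu> h) g y\<bar> \<le> e * (norm y)\<^sup>2" by linarith
      qed
    qed
  }
qed

section \<open>Consequences of the Hoelder bound, and the final assembly\<close>

lemma hoelder_norm_bounds:
  assumes "hoelder_norm \<gamma> V \<le> ennreal K" and K: "0 \<le> K"
  shows "\<bar>V x\<bar> \<le> K" and "\<bar>V x - V y\<bar> \<le> K * dist x y powr \<gamma>"
proof -
  have "ennreal \<bar>V x\<bar> \<le> (SUP x. ennreal \<bar>V x\<bar>)" by (rule SUP_upper) simp
  also have "\<dots> \<le> hoelder_norm \<gamma> V" unfolding hoelder_norm_def by simp
  finally have "ennreal \<bar>V x\<bar> \<le> ennreal K" using assms(1) by simp
  then show "\<bar>V x\<bar> \<le> K" using K by simp
  show "\<bar>V x - V y\<bar> \<le> K * dist x y powr \<gamma>"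
  proof (cases "x = y")
    case False
    have "ennreal (\<bar>V x - V y\<bar> / dist x y powr \<gamma>) \<le> (SUP (x, y)\<in>{(x, y). x \<noteq> y}. ennreal (\<bar>V x - V y\<bar> / dist x y powr \<gamma>))"
      by (rule SUP_upper2[of "(x, y)"]) (use False in auto)
    also have "\<dots> \<le> hoelder_norm \<gamma> V" unfolding hoelder_norm_def by simp
    finally have "ennreal (\<bar>V x - V y\<bar> / dist x y powr \<gamma>) \<le> ennreal K" using assms(1) by simp
    then have "\<bar>V x - V y\<bar> / dist x y powr \<gamma> \<le> K" using K by simp
    then show ?thesis using False by (simp add: pos_divide_le_eq)
  qed simp
qed

lemma hoelder_imp_measurable:
  fixes V :: "'a::euclidean_space \<Rightarrow> real"
  assumes V: "\<And>x y. \<bar>V x - V y\<bar> \<le> K * dist x y powr \<gamma>" and \<gamma>: "0 < \<gamma>"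
  shows "V \<in> borel_measurable borel"
proof (rule borel_measurable_continuous_onI)
  have "isCont V x" for x
    unfolding isCont_def
  proof (rule LIM_zero_cancel, rule Lim_null_comparison)
    have "((\<lambda>y. dist y x powr \<gamma>) \<longlongrightarrow> 0) (at x)"
      by (rule tendsto_zero_powrI[OF _ tendsto_const _ \<gamma>]) (auto intro!: tendsto_eq_intros)
    then show "((\<lambda>y. K * dist y x powr \<gamma>) \<longlongrightarrow> 0) (at x)" by (rule tendsto_mult_right_zero)
    show "\<forall>\<^sub>F y in at x. norm (V y - V x) \<le> K * dist y x powr \<gamma>" using V by simp
  qed
  then show "continuous_on UNIV V" by (simp add: continuous_at_imp_continuous_on)
qed

lemma bounded_on_halfline:
  fixes \<alpha> :: "real \<Rightarrow> real"
  assumes "continuous_on UNIV \<alpha>" "\<And>t. t \<le> 0 \<Longrightarrow> \<alpha> t = 0"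
  shows "\<exists>M. \<forall>r\<le>s. \<bar>\<alpha> r\<bar> \<le> M"
proof -
  have "bounded (\<alpha> ` {0..s})"
    by (intro compact_imp_bounded compact_continuous_image continuous_on_subset[OF assms(1)]) auto
  then obtain M where M: "\<forall>r\<in>{0..s}. \<bar>\<alpha> r\<bar> \<le> M" unfolding bounded_iff by auto
  have "\<bar>\<alpha> r\<bar> \<le> max M 0" if "r \<le> s" for r
    using bspec[OF M, of r] assms(2)[of r] that by (cases "r \<le> 0") auto
  then show ?thesis by blast
qed

theorem proposition3p1:
  fixes \<alpha> :: "real \<Rightarrow> real" and \<mu> :: "real \<Rightarrow> real" and \<mu>\<^sub>0 :: real
    and V :: "real \<Rightarrow> real^3 \<Rightarrow> real"
  assumes "continuous_on UNIV \<alpha>"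
    and "\<forall>t. 0 \<le> \<alpha> t"
    and "\<forall>t\<le>0. \<alpha> t = 0"
    and "(\<mu> \<longlongrightarrow> \<mu>\<^sub>0) (at_right 0)" and "\<mu>\<^sub>0 > 0"
    and "(SUP h\<in>{0<..1}. hoelder_norm (1 / 5) (V h)) < \<infinity>"
  defines "T \<equiv> \<lambda>h. toeplitz h (\<lambda>(q, p). \<alpha> (- \<mu> h - ((norm p)\<^sup>2 / 2 + V h q)))"
    and "A \<equiv> \<lambda>h. op_apply (functional_calculus \<alpha>
                {(u, - \<mu> h *\<^sub>R u - v) | u v. (u, v) \<in> schroedinger h (V h)})"
  shows "(\<forall>h\<in>{0<..1}. bounded_linear (T h) \<and> bounded_linear (A h)) \<and>
         ((\<lambda>h. onorm (\<lambda>u. T h u - A h u)) \<longlongrightarrow> 0) (at_right 0)"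
proof -
  obtain K where K: "(SUP h\<in>{0<..1}. hoelder_norm (1 / 5) (V h)) = ennreal K" "0 \<le> K"
    using assms(6) by (cases "SUP h\<in>{0<..1}. hoelder_norm (1 / 5) (V h)") auto
  have hn: "hoelder_norm (1 / 5) (V h) \<le> ennreal K" if "h \<in> {0<..1}" for h
    unfolding K(1)[symmetric] by (rule SUP_upper[OF that])
  note VK = hoelder_norm_bounds(1)[OF hn K(2)] and hoelder = hoelder_norm_bounds(2)[OF hn K(2)]
  have Vm: "V h \<in> borel_measurable borel" if "h \<in> {0<..1}" for h
    by (rule hoelder_imp_measurable[OF hoelder[OF that]]) simp
  have a0: "\<And>t. t \<le> 0 \<Longrightarrow> \<alpha> t = 0" using assms(3) by blast
  have am [measurable]: "\<alpha> \<in> borel_measurable borel" by (rule borel_measurable_continuous_onI[OF assms(1)])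
  \<comment> \<open>\<alpha> may be unbounded to the right; cut off above the symbol and the
    spectrum it becomes bounded without changing either form.\<close>
  define a where "a s r = (if r \<le> s then \<alpha> r else 0)" for s r
  have am' [measurable]: "a s \<in> borel_measurable borel" for s unfolding a_def[abs_def] by measurable
  have T: "T h = toeplitz h (\<lambda>z. \<alpha> (symbol (V h) (\<mu> h) z))" for h
    unfolding T_def by (rule arg_cong[where f = "toeplitz h"]) (auto simp: symbol_def fun_eq_iff)
  have A: "A h = op_apply (spectral_integral (energy_family h (V h) (\<mu> h)) \<alpha>)" for h
    unfolding A_def functional_calculus_energy ..
  have blT: "bounded_linear (T h)"
    and symT: "inner (T h x) y = inner x (T h y)"
    and blA: "bounded_linear (A h)"
    and symA: "inner (A h x) y = inner x (A h y)"
    and diff: "K - \<mu> h < s \<Longrightarrow> inner x (T h x) - inner x (A h x) = defect h (V h) (\<mu> h) (a s) x"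
    if hh: "h \<in> {0<..1}" for h s x y
  proof -
    have h: "0 < h" using hh by simp
    note [measurable] = measurable_symbol[OF Vm[OF hh] VK[OF hh] h, of "\<mu> h"]
    have sle: "symbol (V h) (\<mu> h) z \<le> K - \<mu> h" for z by (rule symbol_le[OF Vm[OF hh] VK[OF hh] h])
    \<comment> \<open>Boundedness is claimed for every \<open>h\<close>, including those where
      \<open>\<mu> h\<close> is far from its limit, so the half-line here depends on
      \<open>h\<close>; the limit argument uses the fixed \<open>s\<close> below.\<close>
    obtain M where M: "\<And>r. r \<le> K - \<mu> h + 1 \<Longrightarrow> \<bar>\<alpha> r\<bar> \<le> M" using bounded_on_halfline[OF assms(1) a0] by blast
    have fM: "\<bar>\<alpha> (symbol (V h) (\<mu> h) z)\<bar> \<le> M" for z using M sle[of z] by simp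
    have fm: "(\<lambda>z. \<alpha> (symbol (V h) (\<mu> h) z)) \<in> borel_measurable borel" by measurable
    show "bounded_linear (T h)" unfolding T by (rule bounded_linear_toeplitz[OF h fm fM])
    show "inner (T h x) y = inner x (T h y)" unfolding T by (rule toeplitz_symmetric[OF h fm fM])
    note fam = energy_spectral_family[OF Vm[OF hh] VK[OF hh] h, of "\<mu> h"]
    note supp = energy_support[OF Vm[OF hh] VK[OF hh] h, of "\<mu> h"]
    note calc = spectral_family.bounded_on_support_calculus[OF fam am supp[of "K - \<mu> h + 1"] M]
    show "bounded_linear (A h)" unfolding A by (rule calc(1)) auto
    show "inner (A h x) y = inner x (A h y)" unfolding A by (rule calc(2)) auto
    show "inner x (T h x) - inner x (A h x) = defect h (V h) (\<mu> h) (a s) x" if s: "K - \<mu> h < s"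
    proof -
      have "a s (symbol (V h) (\<mu> h) z) = \<alpha> (symbol (V h) (\<mu> h) z)" for z
        using sle[of z] s by (simp add: a_def)
      then have "inner x (T h x) = 1 / (2 * pi * h) ^ 3 * (\<integral>z. a s (symbol (V h) (\<mu> h) z) * (norm (coherent_transform h x z))\<^sup>2 \<partial>lborel)"
        unfolding T toeplitz_inner_self[OF h fm fM] by simp
      moreover have "inner x (A h x) = (\<integral>r. \<alpha> r \<partial>spectral_measure (energy_family h (V h) (\<mu> h)) x)"
        unfolding A by (rule calc(3)) auto
      moreover have "\<dots> = (\<integral>r. a s r \<partial>spectral_measure (energy_family h (V h) (\<mu> h)) x)"
        by (rule spectral_family.integral_mu_cong[OF fam am am'])
          (use spectral_family.mu_AE_le[OF fam supp[OF s], of x] in \<open>auto elim!: eventually_mono simp: a_def\<close>)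
      ultimately show ?thesis by (simp add: defect_def)
    qed
  qed
  define s where "s = K + \<bar>\<mu>\<^sub>0\<bar> + 2"
  have span: "resolvent_span s (a s)"
    unfolding a_def[abs_def] by (rule resolvent_span_cutoff[OF assms(1) a0]) (use K(2) in \<open>auto simp: s_def\<close>)
  have "((\<lambda>h. onorm (\<lambda>u. T h u - A h u)) \<longlongrightarrow> 0) (at_right 0)"
  proof (rule tendstoI)
    fix e :: real assume e: "0 < e"
    then have e2: "0 < e / 2" by simp
    have small: "\<forall>\<^sub>F h in at_right (0::real). h \<in> {0<..1}"
      by (rule eventually_at_rightI[of 0 1]) auto
    have "\<forall>\<^sub>F h in at_right 0. dist (\<mu> h) \<mu>\<^sub>0 < 1" using assms(4) by (rule tendstoD) simp
    moreover have "\<forall>\<^sub>F h in at_right 0. \<forall>y. \<bar>defect h (V h) (\<mu> h) (a s) y\<bar> \<le> e / 2 * (norm y)\<^sup>2"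
      by (rule defect_vanishing[where V = V, OF Vm VK hoelder assms(4) _ span e2]) (simp_all add: s_def)
    moreover note small
    ultimately
    show "\<forall>\<^sub>F h in at_right 0. dist (onorm (\<lambda>u. T h u - A h u)) 0 < e"
    proof eventually_elim
      case (elim h)
      note hh = elim(3)
      have "\<bar>\<mu> h - \<mu>\<^sub>0\<bar> < 1" using elim(1) by (simp add: dist_real_def)
      then have sb: "K - \<mu> h < s" unfolding s_def by (simp add: abs_if split: if_splits)
      have bl: "bounded_linear (\<lambda>u. T h u - A h u)" by (intro bounded_linear_sub blT blA hh)
      have "norm (T h u - A h u) \<le> e / 2 * norm u" for u
      proof (rule symmetric_norm_le[of "\<lambda>u. T h u - A h u"])
        show "linear (\<lambda>u. T h u - A h u)" by (rule bounded_linear.linear[OF bl])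
        show "inner (T h x - A h x) y = inner x (T h y - A h y)" for x y
          by (simp add: inner_diff_left inner_diff_right symT[OF hh] symA[OF hh])
        show "\<bar>inner x (T h x - A h x)\<bar> \<le> e / 2 * (norm x)\<^sup>2" for x
          unfolding inner_diff_right diff[OF hh sb] using elim(2) by blast
      qed
      then have "onorm (\<lambda>u. T h u - A h u) \<le> e / 2" by (rule onorm_bound[rotated]) (use e in simp)
      moreover have "0 \<le> onorm (\<lambda>u. T h u - A h u)" by (rule onorm_pos_le[OF bl])
      ultimately show ?case using e by simp
    qed
  qed
  then show ?thesis using blT blA by blast
qed

end
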